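(* Let $\beta>0$, $h\ge 0$, and let $h_1,h_2,\ldots$ be any sequence of (deterministic) vectors with $h_N\in\mathbb{R}^N$ and $|h_N|=h$ for all $N$. Then $$\left|F_N(\beta,h_N)-\frac1N\sup_{m\in\mathbb{R}^N:\,|m|<1,\ \beta(m)\le\frac{1}{\sqrt2}}H_{TAP}(m)\right|\longrightarrow 0\quad\text{in probability as }N\to\infty .$$
   Context: Let $J_{ij}$, $i,j\ge1$, be iid standard Gaussian random variables on a probability space $(\Omega,\mathcal{A},\mathbb{P})$, and for $\sigma\in\mathbb{R}^N$ let $H_N(\sigma)=\sqrt N\sum_{i,j=1}^N J_{ij}\sigma_i\sigma_j$ (the 2-spin spherical SK Hamiltonian). $|\cdot|$ is the Euclidean norm and $\cdot$ the Euclidean inner product. Let $E$ be the uniform probability measure (and its expectation) on the unit sphere of $\mathbb{R}^N$, and let $$Z_N(\beta,h_N)=E\left[e^{\beta H_N(\sigma)+N h_N\cdot\sigma}\right],\qquad F_N(\beta,h_N)=\frac1N\log Z_N(\beta,h_N).$$ For $m\in\mathbb{R}^N$ with $|m|<1$ the TAP free energy is $$H_{TAP}(m)=\beta H_N(m)+N m\cdot h_N+\frac N2\log(1-|m|^2)+N\frac{\beta^2}{2}(1-|m|^2)^2,$$ and $\beta(m)=\beta(1-|m|^2)$. *)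

theory Defs
  imports "HOL-Probability.Probability"
begin

text \<open>
  The dimension \<open>N\<close> varies inside the statement, so \<open>\<real>\<^sup>N\<close> is the set of functions
  \<open>{1..N} \<rightarrow> \<real>\<close>, extended by \<^const>\<open>undefined\<close>.  It is the carrier of the
  product measure space \<open>\<Pi>\<^sub>M i\<in>{1..N}. lborel\<close>.
\<close>

definition rvec :: "nat \<Rightarrow> (nat \<Rightarrow> real) set" where
  "rvec N = {1..N} \<rightarrow>\<^sub>E UNIV"

definition rnorm :: "nat \<Rightarrow> (nat \<Rightarrow> real) \<Rightarrow> real" where
  "rnorm N x = L2_set x {1..N}"

definition rdot :: "nat \<Rightarrow> (nat \<Rightarrow> real) \<Rightarrow> (nat \<Rightarrow> real) \<Rightarrow> real" where
  "rdot N x y = (\<Sum>i\<in>{1..N}. x i * y i)"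

text \<open>
  The uniform probability measure on the unit sphere of \<open>\<real>\<^sup>N\<close> is normalised surface
  measure: the mass of a set \<open>A\<close> of directions is the relative Lebesgue volume of the
  sector \<open>{x. |x| \<le> 1 \<and> x / |x| \<in> A}\<close> in the unit ball.  It is represented as a
  measure on \<open>\<real>\<^sup>N\<close> concentrated on the sphere.  The value at \<open>x = 0\<close> is irrelevant.
\<close>

definition uniform_sphere :: "nat \<Rightarrow> (nat \<Rightarrow> real) measure" where
  "uniform_sphere N =
     distr (uniform_measure (\<Pi>\<^sub>M i\<in>{1..N}. lborel) {x \<in> rvec N. rnorm N x \<le> 1})
           (\<Pi>\<^sub>M i\<in>{1..N}. borel)
           (\<lambda>x. \<lambda>i\<in>{1..N}. x i / rnorm N x)"

text \<open>In the following, \<open>g\<close> is a realisation of the couplings \<open>(J\<^sub>i\<^sub>j)\<close>.\<close>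

definition hamiltonian :: "(nat \<Rightarrow> nat \<Rightarrow> real) \<Rightarrow> nat \<Rightarrow> (nat \<Rightarrow> real) \<Rightarrow> real" where
  "hamiltonian g N \<sigma> = sqrt (real N) * (\<Sum>i\<in>{1..N}. \<Sum>j\<in>{1..N}. g i j * \<sigma> i * \<sigma> j)"

definition partition_function ::
    "(nat \<Rightarrow> nat \<Rightarrow> real) \<Rightarrow> nat \<Rightarrow> real \<Rightarrow> (nat \<Rightarrow> real) \<Rightarrow> real" where
  "partition_function g N \<beta> h =
     (\<integral>\<sigma>. exp (\<beta> * hamiltonian g N \<sigma> + real N * rdot N h \<sigma>) \<partial>uniform_sphere N)"

definition free_energy ::
    "(nat \<Rightarrow> nat \<Rightarrow> real) \<Rightarrow> nat \<Rightarrow> real \<Rightarrow> (nat \<Rightarrow> real) \<Rightarrow> real" where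
  "free_energy g N \<beta> h = 1 / real N * ln (partition_function g N \<beta> h)"

definition tap_energy ::
    "(nat \<Rightarrow> nat \<Rightarrow> real) \<Rightarrow> nat \<Rightarrow> real \<Rightarrow> (nat \<Rightarrow> real) \<Rightarrow> (nat \<Rightarrow> real) \<Rightarrow> real" where
  "tap_energy g N \<beta> h m =
     \<beta> * hamiltonian g N m + real N * rdot N m h
     + real N / 2 * ln (1 - (rnorm N m)\<^sup>2)
     + real N * (\<beta>\<^sup>2 / 2) * (1 - (rnorm N m)\<^sup>2)\<^sup>2"

definition beta_at :: "nat \<Rightarrow> real \<Rightarrow> (nat \<Rightarrow> real) \<Rightarrow> real" where
  "beta_at N \<beta> m = \<beta> * (1 - (rnorm N m)\<^sup>2)"

definition plefka_region :: "nat \<Rightarrow> real \<Rightarrow> (nat \<Rightarrow> real) set" where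
  "plefka_region N \<beta> = {m \<in> rvec N. rnorm N m < 1 \<and> beta_at N \<beta> m \<le> 1 / sqrt 2}"

text \<open>
  Measurability is part of the notion, since \<^const>\<open>measure\<close> is \<open>0\<close> on sets that are
  not measurable.
\<close>

definition converges_in_probability ::
    "'a measure \<Rightarrow> (nat \<Rightarrow> 'a \<Rightarrow> real) \<Rightarrow> ('a \<Rightarrow> real) \<Rightarrow> bool" where
  "converges_in_probability M X Y \<longleftrightarrow>
     (\<forall>n. X n \<in> borel_measurable M) \<and> Y \<in> borel_measurable M \<and>
     (\<forall>\<epsilon>>0. (\<lambda>n. measure M {\<omega> \<in> space M. \<bar>X n \<omega> - Y \<omega>\<bar> > \<epsilon>}) \<longlonglongrightarrow> 0)"


subsection \<open>Sanity checks\<close>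

lemma rnorm_measurable [measurable]:
  "rnorm N \<in> borel_measurable (\<Pi>\<^sub>M i\<in>{1..N}. lborel)"
  "rnorm N \<in> borel_measurable (\<Pi>\<^sub>M i\<in>{1..N}. borel)"
  unfolding rnorm_def [abs_def] L2_set_def by measurable

lemma normalise_measurable [measurable]:
  "(\<lambda>x. \<lambda>i\<in>{1..N}. x i / rnorm N x) \<in>
     (\<Pi>\<^sub>M i\<in>{1..N}. lborel) \<rightarrow>\<^sub>M (\<Pi>\<^sub>M i\<in>{1..N}. (borel :: real measure))"
  by measurable

lemma normalise_measurable':
  "(\<lambda>x. \<lambda>i\<in>{1..N}. x i / rnorm N x) \<in>
     uniform_measure (\<Pi>\<^sub>M i\<in>{1..N}. lborel) A \<rightarrow>\<^sub>M (\<Pi>\<^sub>M i\<in>{1..N}. (borel :: real measure))"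
  using normalise_measurable [of N]
  by (subst measurable_cong_sets [OF sets_uniform_measure refl])

lemma rvec_eq_space:
  "rvec N = space (\<Pi>\<^sub>M i\<in>{1..N}. (lborel :: real measure))"
  by (simp add: rvec_def space_PiM)

lemma emeasure_unit_ball:
  "emeasure (\<Pi>\<^sub>M i\<in>{1..N}. lborel) {x \<in> rvec N. rnorm N x \<le> 1} =
     ennreal (unit_ball_vol (real N))"
proof -
  have "{x \<in> rvec N. rnorm N x \<le> 1} =
      {f. sqrt (\<Sum>i\<in>{1..N}. (f i)\<^sup>2) \<le> 1} \<inter> space (\<Pi>\<^sub>M i\<in>{1..N}. (lborel :: real measure))"
    by (auto simp: rvec_eq_space rnorm_def L2_set_def)
  then show ?thesis
    using emeasure_cball_aux [of "{1..N}" 1] by simp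
qed

lemma prob_space_uniform_sphere: "prob_space (uniform_sphere N)"
proof -
  have "prob_space (uniform_measure (\<Pi>\<^sub>M i\<in>{1..N}. lborel) {x \<in> rvec N. rnorm N x \<le> 1})"
    by (rule prob_space_uniform_measure; unfold emeasure_unit_ball)
      (simp_all add: unit_ball_vol_pos [THEN less_imp_neq, THEN not_sym])
  then show ?thesis
    unfolding uniform_sphere_def by (rule prob_space.prob_space_distr [OF _ normalise_measurable'])
qed

lemma AE_uniform_sphere:
  assumes "N \<ge> 1"
  shows "AE \<sigma> in uniform_sphere N. rnorm N \<sigma> = 1"
proof -
  interpret product_sigma_finite "\<lambda>_::nat. lborel :: real measure"
    by standard
  let ?L = "\<Pi>\<^sub>M i\<in>{1..N}. (lborel :: real measure)"
  let ?B = "{x \<in> rvec N. rnorm N x \<le> 1}"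
  have B: "?B \<in> sets ?L"
    unfolding rvec_eq_space by measurable
  have "emeasure ?L (\<Pi>\<^sub>E i\<in>{1..N}. {0}) = 0"
    using assms by (subst emeasure_PiM) auto
  then have "AE x in ?L. x \<notin> (\<Pi>\<^sub>E i\<in>{1..N}. {0})"
    by (intro AE_not_in null_setsI sets_PiM_I_finite) simp_all
  then have "AE x in ?L. rnorm N x \<noteq> 0"
  proof (rule AE_mp, intro AE_I2 impI notI)
    fix x assume x: "x \<in> space ?L" "x \<notin> (\<Pi>\<^sub>E i\<in>{1..N}. {0})" and "rnorm N x = 0"
    then have "\<forall>i\<in>{1..N}. x i = 0"
      by (simp add: rnorm_def L2_set_eq_0_iff)
    with x(1) have "x \<in> (\<Pi>\<^sub>E i\<in>{1..N}. {0})"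
      unfolding space_PiM PiE_iff by simp
    with x(2) show False ..
  qed
  then have "AE x in uniform_measure ?L ?B. rnorm N x \<noteq> 0"
    by (intro AE_uniform_measureI B) auto
  then have "AE x in uniform_measure ?L ?B.
      rnorm N (\<lambda>i\<in>{1..N}. x i / rnorm N x) = 1"
  proof (rule AE_mp, intro AE_I2 impI)
    fix x :: "nat \<Rightarrow> real" assume nz: "rnorm N x \<noteq> 0"
    have "(\<Sum>i\<in>{1..N}. (x i / rnorm N x)\<^sup>2) = (\<Sum>i\<in>{1..N}. (x i)\<^sup>2) / (rnorm N x)\<^sup>2"
      by (simp add: power_divide sum_divide_distrib)
    also have "(\<Sum>i\<in>{1..N}. (x i)\<^sup>2) = (rnorm N x)\<^sup>2"
      by (simp add: rnorm_def L2_set_def sum_nonneg)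
    finally show "rnorm N (\<lambda>i\<in>{1..N}. x i / rnorm N x) = 1"
      using nz by (simp add: rnorm_def [of N "restrict _ _"] L2_set_def)
  qed
  moreover have "{x \<in> space (\<Pi>\<^sub>M i\<in>{1..N}. borel). rnorm N x = 1} \<in> sets (\<Pi>\<^sub>M i\<in>{1..N}. borel)"
    by measurable
  ultimately show ?thesis
    unfolding uniform_sphere_def by (subst AE_distr_iff [OF normalise_measurable'])
qed

lemma plefka_region_nonempty:
  assumes "N \<ge> 1" "\<beta> > 0"
  shows "plefka_region N \<beta> \<noteq> {}"
proof -
  define r where "r = sqrt (1 - min (1/2) (1 / (\<beta> * sqrt 2)))"
  define m where "m = (\<lambda>i\<in>{1..N}. if i = 1 then r else 0)"
  have pos: "min (1/2) (1 / (\<beta> * sqrt 2)) > 0"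
    using assms by simp
  have r2: "r\<^sup>2 = 1 - min (1/2) (1 / (\<beta> * sqrt 2))"
    unfolding r_def by (subst real_sqrt_pow2) (auto simp: min_def)
  have "(\<Sum>i\<in>{1..N}. (m i)\<^sup>2) = (\<Sum>i\<in>{1..N}. if i = 1 then r\<^sup>2 else 0)"
    by (rule sum.cong) (auto simp: m_def)
  also have "\<dots> = r\<^sup>2"
    using assms by (subst sum.delta) auto
  finally have norm2: "rnorm N m = \<bar>r\<bar>"
    by (simp add: rnorm_def L2_set_def)
  have "\<beta> * min (1/2) (1 / (\<beta> * sqrt 2)) \<le> \<beta> * (1 / (\<beta> * sqrt 2))"
    using assms by (intro mult_left_mono) auto
  then have "beta_at N \<beta> m \<le> 1 / sqrt 2"
    using assms by (simp add: beta_at_def norm2 r2)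
  moreover have "rnorm N m < 1"
    unfolding norm2 using r2 pos by (subst abs_square_less_1 [symmetric]) linarith
  moreover have "m \<in> rvec N"
    by (auto simp: m_def rvec_def)
  ultimately show ?thesis
    by (auto simp: plefka_region_def)
qed

lemma tap_energy_bdd_above:
  "bdd_above (tap_energy g N \<beta> h ` plefka_region N \<beta>)"
proof (rule bdd_aboveI2)
  fix m assume m: "m \<in> plefka_region N \<beta>"
  have n: "0 \<le> rnorm N m" "rnorm N m < 1"
    using m by (auto simp: plefka_region_def rnorm_def)
  then have n2: "(rnorm N m)\<^sup>2 < 1" "0 \<le> (rnorm N m)\<^sup>2"
    by (simp_all add: abs_square_less_1)
  have mi: "\<bar>m i\<bar> \<le> 1" if "i \<in> {1..N}" for i
  proof -
    have "\<bar>m i\<bar> \<le> L2_set (\<lambda>i. \<bar>m i\<bar>) {1..N}"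
      using that by (intro member_le_L2_set) auto
    also have "\<dots> = rnorm N m"
      by (simp add: rnorm_def L2_set_def)
    finally show ?thesis using n by simp
  qed
  have "\<bar>\<Sum>i\<in>{1..N}. \<Sum>j\<in>{1..N}. g i j * m i * m j\<bar> \<le> (\<Sum>i\<in>{1..N}. \<Sum>j\<in>{1..N}. \<bar>g i j\<bar>)"
  proof (intro order_trans [OF sum_abs] sum_mono)
    fix i j assume "i \<in> {1..N}" "j \<in> {1..N}"
    then have "\<bar>m i\<bar> * \<bar>m j\<bar> \<le> 1"
      using mi by (intro mult_le_one) auto
    then have "\<bar>g i j\<bar> * (\<bar>m i\<bar> * \<bar>m j\<bar>) \<le> \<bar>g i j\<bar> * 1"
      by (intro mult_left_mono) auto
    then show "\<bar>g i j * m i * m j\<bar> \<le> \<bar>g i j\<bar>"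
      by (simp add: abs_mult mult.assoc)
  qed
  then have "\<bar>\<beta>\<bar> * (sqrt N * \<bar>\<Sum>i\<in>{1..N}. \<Sum>j\<in>{1..N}. g i j * m i * m j\<bar>)
      \<le> \<bar>\<beta>\<bar> * (sqrt N * (\<Sum>i\<in>{1..N}. \<Sum>j\<in>{1..N}. \<bar>g i j\<bar>))"
    by (intro mult_left_mono) auto
  then have 1: "\<beta> * hamiltonian g N m \<le> \<bar>\<beta>\<bar> * (sqrt N * (\<Sum>i\<in>{1..N}. \<Sum>j\<in>{1..N}. \<bar>g i j\<bar>))"
    unfolding hamiltonian_def
    by - (rule order_trans [OF abs_ge_self], simp add: abs_mult)
  have "\<bar>rdot N m h\<bar> \<le> (\<Sum>i\<in>{1..N}. \<bar>h i\<bar>)"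
    unfolding rdot_def
  proof (intro order_trans [OF sum_abs] sum_mono)
    fix i assume "i \<in> {1..N}"
    then have "\<bar>m i\<bar> * \<bar>h i\<bar> \<le> 1 * \<bar>h i\<bar>"
      using mi by (intro mult_right_mono) auto
    then show "\<bar>m i * h i\<bar> \<le> \<bar>h i\<bar>"
      by (simp add: abs_mult)
  qed
  then have 2: "real N * rdot N m h \<le> real N * (\<Sum>i\<in>{1..N}. \<bar>h i\<bar>)"
    by (intro mult_left_mono) auto
  have 3: "real N / 2 * ln (1 - (rnorm N m)\<^sup>2) \<le> 0"
    using n2 by (intro mult_nonneg_nonpos) auto
  have "(1 - (rnorm N m)\<^sup>2)\<^sup>2 \<le> 1"
    using n2 by (intro power_le_one) auto
  then have "real N * (\<beta>\<^sup>2 / 2) * (1 - (rnorm N m)\<^sup>2)\<^sup>2 \<le> real N * (\<beta>\<^sup>2 / 2) * 1"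
    by (intro mult_left_mono) auto
  with 1 2 3 show "tap_energy g N \<beta> h m \<le>
      \<bar>\<beta>\<bar> * (sqrt N * (\<Sum>i\<in>{1..N}. \<Sum>j\<in>{1..N}. \<bar>g i j\<bar>))
      + real N * (\<Sum>i\<in>{1..N}. \<bar>h i\<bar>) + real N * (\<beta>\<^sup>2 / 2)"
    unfolding tap_energy_def by linarith
qed

end

theory Submission imports Defs "HOL-Real_Asymp.Real_Asymp" begin

text \<open>
  Write \<open>q = H\<^sub>N / N\<close>, a quadratic form with random coefficients of variance \<open>1 / N\<close>, and
  \<open>f(t)\<close> for the free energy at inverse temperature \<open>t\<close> without field.  The proof separates
  a deterministic comparison, valid for every \<open>q\<close> whose \<open>f(t)\<close> is close to \<open>t\<^sup>2 / 2\<close> on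
  \<open>(0, 1 / sqrt 2]\<close>, from the probabilistic statement that this is the typical behaviour.

  Replace the constraint \<open>|\<sigma>| = 1\<close> by a multiplier \<open>w\<close> larger than the maximum of \<open>q\<close> on the
  sphere.  The weight \<open>exp (- N (w |x|\<^sup>2 - q(x)))\<close> is Gaussian; let \<open>D(w)\<close> be its log-integral
  per dimension and \<open>s(w) = - D'(w)\<close> the mean of \<open>|x|\<^sup>2\<close>.  Up to \<open>1/2 ln \<beta>\<close>, the log-volume
  of the ball and vanishing errors, two bounds hold.  By \<open>sphere_upper\<close>, for every \<open>w\<close>,
  \<open>F \<le> \<beta> w + sup\<^sub>x (h \<bullet> x - \<beta> (w |x|\<^sup>2 - q(x))) + D(w)\<close>.
  By \<open>sphere_lower\<close>, for every \<open>m\<close> with \<open>\<beta> (1 - |m|\<^sup>2) = s(w)\<close>,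
  \<open>F \<ge> \<beta> q(m) + h \<bullet> m + w s(w) + D(w)\<close>, because a Gaussian with mean \<open>m\<close>, rescaled by
  \<open>1 / sqrt \<beta>\<close>, then concentrates on the unit sphere.  The maximiser \<open>m\<close> in the upper bound,
  at the \<open>w\<close> for which it satisfies the condition of the lower bound, makes the two agree; if no
  such \<open>w\<close> exists, adding a multiple of a near-maximiser of \<open>q\<close> to \<open>m\<close> restores the condition
  at small cost (\<open>variational_upper\<close>).  Without field and with \<open>m = 0\<close> the same bounds say
  \<open>w s(w) + D(w) = f(s) + 1/2 ln s\<close> at \<open>s = s(w)\<close>.  Eliminating \<open>w\<close> and \<open>D\<close> gives
  \<open>F = \<beta> q(m) + h \<bullet> m + f(\<beta>(m)) + 1/2 ln (1 - |m|\<^sup>2)\<close>, which is the TAP functional when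
  \<open>f(t) = t\<^sup>2 / 2\<close> at \<open>t = \<beta>(m)\<close>.

  The condition \<open>\<beta>(m) \<le> 1 / sqrt 2\<close> enters as follows.  The infimum over \<open>w\<close> makes
  \<open>f(t) + 1/2 ln t\<close> a concave function with slope \<open>w\<close> at \<open>t = s(w)\<close>, and it equals
  \<open>t\<^sup>2 / 2 + 1/2 ln t\<close> up to \<open>1 / sqrt 2\<close>, where the second derivative of the latter vanishes.
  Since \<open>s\<close> is Lipschitz in \<open>w\<close> away from the maximum of \<open>q\<close>, no such \<open>w\<close> can have \<open>s(w)\<close> at or
  above \<open>1 / sqrt 2\<close> (\<open>overlap_below_critical\<close>).  Conversely strict concavity below
  \<open>1 / sqrt 2\<close> forces \<open>s(w)\<close> to approach that value as \<open>w\<close> approaches the maximum of \<open>q\<close>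
  (\<open>overlap_near_critical\<close>), so every \<open>m\<close> in the open region is covered by the lower bound.

  The estimates on \<open>D\<close> come from two replicas rather than from a diagonalisation of \<open>q\<close>: for
  independent copies \<open>x\<close>, \<open>x'\<close> of the Gaussian vector, \<open>|x|\<^sup>2 - |x'|\<^sup>2\<close> is the inner product of
  \<open>x + x'\<close> and \<open>x - x'\<close>, which are again independent (\<open>gauss_int_replica\<close>).

  For \<open>f(t)\<close>, the first moment of the partition function is \<open>exp (N t\<^sup>2 / 2)\<close>.  For
  \<open>t < 1 / sqrt 2\<close> its second moment exceeds the square of the first by a factor of at most order
  \<open>sqrt N\<close>, so \<open>f(t)\<close> is at least \<open>t\<^sup>2 / 2 - 1 / N\<close> with probability of order \<open>1 / sqrt N\<close> or
  more.  By the Efron-Stein inequality the variance of \<open>f(t)\<close>, truncated to a fixed interval, is of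
  order at most \<open>N\<close> to the power \<open>- 3 / 4\<close>, which is smaller, so \<open>f(t) \<ge> t\<^sup>2 / 2 - \<eta>\<close> with
  probability tending to 1.
\<close>

(* Keeps the index sets {1..N} in the form in which they occur in the definitions. *)
declare One_nat_def [simp del]

section \<open>Quadratic forms on Euclidean space\<close>

abbreviation lebesgue_rn :: "nat \<Rightarrow> (nat \<Rightarrow> real) measure" where
  "lebesgue_rn N \<equiv> \<Pi>\<^sub>M i\<in>{1..N}. lborel"

definition quad :: "nat \<Rightarrow> (nat \<Rightarrow> nat \<Rightarrow> real) \<Rightarrow> (nat \<Rightarrow> real) \<Rightarrow> real" where
  "quad N c x = (\<Sum>i\<in>{1..N}. \<Sum>j\<in>{1..N}. c i j * x i * x j)"

definition bilin :: "nat \<Rightarrow> (nat \<Rightarrow> nat \<Rightarrow> real) \<Rightarrow> (nat \<Rightarrow> real) \<Rightarrow> (nat \<Rightarrow> real) \<Rightarrow> real" where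
  "bilin N c x y = (\<Sum>i\<in>{1..N}. \<Sum>j\<in>{1..N}. c i j * (x i * y j + y i * x j)) / 2"

text \<open>
  The multiplier \<open>w\<close> enforces \<open>|x| = 1\<close>: on the sphere this form is \<open>w\<close> minus the energy, off
  the sphere it confines \<open>x\<close> as soon as \<open>w\<close> exceeds the maximal energy.  Its polar form is
  \<open>confined_bilin\<close>.
\<close>

definition confined :: "nat \<Rightarrow> (nat \<Rightarrow> nat \<Rightarrow> real) \<Rightarrow> real \<Rightarrow> (nat \<Rightarrow> real) \<Rightarrow> real" where
  "confined N c w x = w * rdot N x x - quad N c x"

definition confined_bilin :: "nat \<Rightarrow> (nat \<Rightarrow> nat \<Rightarrow> real) \<Rightarrow> real \<Rightarrow> (nat \<Rightarrow> real) \<Rightarrow> (nat \<Rightarrow> real) \<Rightarrow> real" where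
  "confined_bilin N c w x y = w * rdot N x y - bilin N c x y"

lemma rdot_add_left: "rdot N (\<lambda>i. x i + y i) z = rdot N x z + rdot N y z"
  and rdot_add_right: "rdot N z (\<lambda>i. x i + y i) = rdot N z x + rdot N z y"
  and rdot_scale_left: "rdot N (\<lambda>i. a * x i) z = a * rdot N x z"
  and rdot_scale_right: "rdot N z (\<lambda>i. a * x i) = a * rdot N z x"
  and rdot_commute: "rdot N x z = rdot N z x"
  by (simp_all add: rdot_def algebra_simps sum.distrib sum_distrib_left)

lemma rdot_restrict_left [simp]: "rdot N (restrict x {1..N}) z = rdot N x z"
  and rdot_restrict_right [simp]: "rdot N z (restrict x {1..N}) = rdot N z x"
  by (simp_all add: rdot_def)

lemma rnorm_restrict [simp]: "rnorm N (restrict x {1..N}) = rnorm N x"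
  by (simp add: rnorm_def L2_set_def)

lemma rdot_self: "rdot N x x = (rnorm N x)\<^sup>2"
  by (simp add: rdot_def rnorm_def L2_set_def power2_eq_square sum_nonneg)

lemma rnorm_eq_sqrt: "rnorm N x = sqrt (rdot N x x)"
  by (simp add: rdot_def rnorm_def L2_set_def power2_eq_square)

lemma rdot_self_nonneg [simp]: "0 \<le> rdot N x x"
  by (simp add: rdot_self)

lemma rnorm_nonneg [simp]: "0 \<le> rnorm N x"
  by (simp add: rnorm_def)

lemma rnorm_scale: "rnorm N (\<lambda>i. a * x i) = \<bar>a\<bar> * rnorm N x"
  by (simp add: rnorm_eq_sqrt rdot_scale_left rdot_scale_right real_sqrt_mult)

lemma rdot_le_rnorm: "\<bar>rdot N x y\<bar> \<le> rnorm N x * rnorm N y"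
proof -
  have "\<bar>rdot N x y\<bar> \<le> (\<Sum>i\<in>{1..N}. \<bar>x i\<bar> * \<bar>y i\<bar>)"
    unfolding rdot_def by (rule order_trans[OF sum_abs]) (simp add: abs_mult)
  also have "\<dots> \<le> rnorm N x * rnorm N y"
    unfolding rnorm_def by (rule L2_set_mult_ineq)
  finally show ?thesis .
qed

lemma rnorm_triangle: "rnorm N (\<lambda>i. x i + y i) \<le> rnorm N x + rnorm N y"
  unfolding rnorm_def by (rule L2_set_triangle_ineq)

lemma quad_add: "quad N c (\<lambda>i. x i + y i) = quad N c x + 2 * bilin N c x y + quad N c y"
  by (simp add: quad_def bilin_def algebra_simps sum.distrib)

lemma quad_scale: "quad N c (\<lambda>i. a * x i) = a\<^sup>2 * quad N c x"
  by (simp add: quad_def power2_eq_square sum_distrib_left mult_ac)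

lemma quad_restrict [simp]: "quad N c (restrict x {1..N}) = quad N c x"
  by (simp add: quad_def)

lemma bilin_restrict_left [simp]: "bilin N c (restrict x {1..N}) z = bilin N c x z"
  and bilin_restrict_right [simp]: "bilin N c z (restrict x {1..N}) = bilin N c z x"
  by (simp_all add: bilin_def)

lemma bilin_commute: "bilin N c x y = bilin N c y x"
  by (simp add: bilin_def add.commute)

lemma bilin_self: "bilin N c x x = quad N c x"
proof -
  have "(\<Sum>i\<in>{1..N}. \<Sum>j\<in>{1..N}. c i j * (x i * x j + x i * x j)) = 2 * quad N c x"
    unfolding quad_def sum_distrib_left by (intro sum.cong refl) simp
  then show ?thesis by (simp add: bilin_def)
qed

lemma bilin_add_left: "bilin N c (\<lambda>i. x i + y i) z = bilin N c x z + bilin N c y z"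
  by (simp add: bilin_def algebra_simps sum.distrib add_divide_distrib)

lemma bilin_scale_left: "bilin N c (\<lambda>i. a * x i) z = a * bilin N c x z"
  by (simp add: bilin_def algebra_simps sum_distrib_left)

lemma bilin_scale_right: "bilin N c z (\<lambda>i. a * x i) = a * bilin N c z x"
  by (simp add: bilin_commute[of N c z] bilin_scale_left)

lemma confined_add: "confined N c w (\<lambda>i. x i + y i) = confined N c w x + 2 * confined_bilin N c w x y + confined N c w y"
  by (simp add: confined_def confined_bilin_def quad_add rdot_add_left rdot_add_right rdot_commute[of N y x] algebra_simps)

lemma confined_scale: "confined N c w (\<lambda>i. a * x i) = a\<^sup>2 * confined N c w x"
  by (simp add: confined_def quad_scale rdot_scale_left rdot_scale_right power2_eq_square algebra_simps)

lemma confined_restrict [simp]: "confined N c w (restrict x {1..N}) = confined N c w x"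
  by (simp add: confined_def)

lemma confined_bilin_restrict_left [simp]: "confined_bilin N c w (restrict x {1..N}) z = confined_bilin N c w x z"
  and confined_bilin_restrict_right [simp]: "confined_bilin N c w z (restrict x {1..N}) = confined_bilin N c w z x"
  by (simp_all add: confined_bilin_def)

lemma confined_bilin_self: "confined_bilin N c w x x = confined N c w x"
  by (simp add: confined_bilin_def confined_def bilin_self)

lemma confined_bilin_add_left: "confined_bilin N c w (\<lambda>i. x i + y i) z = confined_bilin N c w x z + confined_bilin N c w y z"
  by (simp add: confined_bilin_def rdot_add_left bilin_add_left algebra_simps)

lemma confined_bilin_scale_left: "confined_bilin N c w (\<lambda>i. a * x i) z = a * confined_bilin N c w x z"
  by (simp add: confined_bilin_def rdot_scale_left bilin_scale_left algebra_simps)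

lemma confined_bilin_scale_right: "confined_bilin N c w z (\<lambda>i. a * x i) = a * confined_bilin N c w z x"
  by (simp add: confined_bilin_def rdot_scale_right bilin_scale_right algebra_simps)

lemma confined_shift: "confined N c w' x = confined N c w x + (w' - w) * rdot N x x"
  by (simp add: confined_def algebra_simps)

lemma rdot_measurable [measurable]:
  assumes "\<And>i. i \<in> {1..N} \<Longrightarrow> (\<lambda>\<omega>. f \<omega> i) \<in> borel_measurable M"
      and "\<And>i. i \<in> {1..N} \<Longrightarrow> (\<lambda>\<omega>. g \<omega> i) \<in> borel_measurable M"
  shows "(\<lambda>\<omega>. rdot N (f \<omega>) (g \<omega>)) \<in> borel_measurable M"
  unfolding rdot_def using assms by measurable

lemma quad_measurable [measurable]:
  assumes "\<And>i. i \<in> {1..N} \<Longrightarrow> (\<lambda>\<omega>. f \<omega> i) \<in> borel_measurable M"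
  shows "(\<lambda>\<omega>. quad N c (f \<omega>)) \<in> borel_measurable M"
  unfolding quad_def using assms by measurable

lemma confined_measurable [measurable]:
  assumes "\<And>i. i \<in> {1..N} \<Longrightarrow> (\<lambda>\<omega>. f \<omega> i) \<in> borel_measurable M"
  shows "(\<lambda>\<omega>. confined N c w (f \<omega>)) \<in> borel_measurable M"
  unfolding confined_def using assms by measurable

lemma rnorm_measurable' [measurable]:
  assumes "\<And>i. i \<in> {1..N} \<Longrightarrow> (\<lambda>\<omega>. f \<omega> i) \<in> borel_measurable M"
  shows "(\<lambda>\<omega>. rnorm N (f \<omega>)) \<in> borel_measurable M"
  unfolding rnorm_eq_sqrt using assms by measurable

section \<open>Lebesgue measure and the uniform measure on the sphere\<close>

lemma affine_measurable [measurable]: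
  "(\<lambda>x. \<lambda>i\<in>{1..N}. t i + a * x i) \<in> lebesgue_rn N \<rightarrow>\<^sub>M lebesgue_rn N"
  by (rule measurable_restrict) measurable

interpretation lebesgue_product: product_sigma_finite "\<lambda>_::nat. lborel :: real measure"
  by standard

lemma lebesgue_rn_sigma_finite: "sigma_finite_measure (lebesgue_rn N)"
  by (rule lebesgue_product.sigma_finite) simp

text \<open>
  The image measure is a product on boxes, so the one-dimensional change of variables in each
  coordinate suffices.
\<close>

lemma lebesgue_rn_affine:
  assumes "a \<noteq> 0"
  shows "density (distr (lebesgue_rn N) (lebesgue_rn N) (\<lambda>x. \<lambda>i\<in>{1..N}. t i + a * x i)) (\<lambda>_. ennreal (\<bar>a\<bar> ^ N)) = lebesgue_rn N"
    (is "?D = _")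
proof (rule lebesgue_product.PiM_eqI)
  fix A :: "nat \<Rightarrow> real set" assume A: "\<And>i. i \<in> {1..N} \<Longrightarrow> A i \<in> sets lborel"
  let ?T = "\<lambda>x. \<lambda>i\<in>{1..N}. t i + a * x i"
  have AS: "Pi\<^sub>E {1..N} A \<in> sets (lebesgue_rn N)" using A by (intro sets_PiM_I_finite) auto
  have "emeasure ?D (Pi\<^sub>E {1..N} A) = ennreal (\<bar>a\<bar>^N) * emeasure (distr (lebesgue_rn N) (lebesgue_rn N) ?T) (Pi\<^sub>E {1..N} A)"
    using AS by (subst emeasure_density) (auto simp: nn_integral_cmult)
  also have "emeasure (distr (lebesgue_rn N) (lebesgue_rn N) ?T) (Pi\<^sub>E {1..N} A) = emeasure (lebesgue_rn N) (?T -` Pi\<^sub>E {1..N} A \<inter> space (lebesgue_rn N))"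
    using AS by (subst emeasure_distr) auto
  also have "?T -` Pi\<^sub>E {1..N} A \<inter> space (lebesgue_rn N) = Pi\<^sub>E {1..N} (\<lambda>i. (\<lambda>y. t i + a * y) -` A i)"
    by (auto simp: space_PiM PiE_iff)
  also have "emeasure (lebesgue_rn N) \<dots> = (\<Prod>i\<in>{1..N}. emeasure lborel ((\<lambda>y. t i + a * y) -` A i))"
  proof (rule lebesgue_product.emeasure_PiM)
    fix i assume "i \<in> {1..N}"
    then have [measurable]: "A i \<in> sets borel" using A by simp
    have "(\<lambda>y. t i + a * y) -` A i \<inter> space lborel \<in> sets lborel" by measurable
    then show "(\<lambda>y. t i + a * y) -` A i \<in> sets lborel" by simp
  qed simp
  also have "ennreal (\<bar>a\<bar>^N) * \<dots> = (\<Prod>i\<in>{1..N}. ennreal \<bar>a\<bar> * emeasure lborel ((\<lambda>y. t i + a * y) -` A i))"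
    by (simp add: prod.distrib ennreal_power)
  also have "\<dots> = (\<Prod>i\<in>{1..N}. emeasure lborel (A i))"
  proof (rule prod.cong[OF refl])
    fix i assume "i \<in> {1..N}"
    then have [measurable]: "A i \<in> sets borel" using A by simp
    have "emeasure lborel (A i) = emeasure (density (distr lborel borel (\<lambda>x. t i + a * x)) (\<lambda>_. ennreal \<bar>a\<bar>)) (A i)"
      using lborel_real_affine[OF assms, of "t i"] by simp
    also have "\<dots> = ennreal \<bar>a\<bar> * emeasure (distr lborel borel (\<lambda>x. t i + a * x)) (A i)"
      by (subst emeasure_density) (auto simp: nn_integral_cmult)
    also have "\<dots> = ennreal \<bar>a\<bar> * emeasure lborel ((\<lambda>y. t i + a * y) -` A i)"
      by (subst emeasure_distr) auto
    finally show "ennreal \<bar>a\<bar> * emeasure lborel ((\<lambda>y. t i + a * y) -` A i) = emeasure lborel (A i)" ..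
  qed
  finally show "emeasure ?D (Pi\<^sub>E {1..N} A) = (\<Prod>i\<in>{1..N}. emeasure lborel (A i))" .
qed simp_all

lemma nn_integral_lebesgue_rn_affine:
  assumes f [measurable]: "f \<in> borel_measurable (lebesgue_rn N)" and a: "a \<noteq> 0"
  shows "(\<integral>\<^sup>+x. f x \<partial>lebesgue_rn N) = ennreal (\<bar>a\<bar> ^ N) * (\<integral>\<^sup>+x. f (\<lambda>i\<in>{1..N}. t i + a * x i) \<partial>lebesgue_rn N)"
proof -
  have "(\<integral>\<^sup>+x. f x \<partial>lebesgue_rn N) = (\<integral>\<^sup>+x. f x \<partial>(density (distr (lebesgue_rn N) (lebesgue_rn N) (\<lambda>x. \<lambda>i\<in>{1..N}. t i + a * x i)) (\<lambda>_. ennreal (\<bar>a\<bar> ^ N))))"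
    by (simp only: lebesgue_rn_affine[OF a])
  also have "\<dots> = ennreal (\<bar>a\<bar> ^ N) * (\<integral>\<^sup>+x. f x \<partial>(distr (lebesgue_rn N) (lebesgue_rn N) (\<lambda>x. \<lambda>i\<in>{1..N}. t i + a * x i)))"
    by (subst nn_integral_density) (use f in \<open>auto simp: nn_integral_cmult\<close>)
  also have "\<dots> = ennreal (\<bar>a\<bar> ^ N) * (\<integral>\<^sup>+x. f (\<lambda>i\<in>{1..N}. t i + a * x i) \<partial>lebesgue_rn N)"
    by (subst nn_integral_distr) auto
  finally show ?thesis .
qed

lemma nn_integral_lebesgue_rn_translate:
  assumes [measurable]: "f \<in> borel_measurable (lebesgue_rn N)"
  shows "(\<integral>\<^sup>+x. f (\<lambda>i\<in>{1..N}. t i + x i) \<partial>lebesgue_rn N) = (\<integral>\<^sup>+x. f x \<partial>lebesgue_rn N)"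
  using nn_integral_lebesgue_rn_affine[OF assms, of 1 t] by simp

lemma nn_integral_lebesgue_rn_reflect:
  assumes [measurable]: "f \<in> borel_measurable (lebesgue_rn N)"
  shows "(\<integral>\<^sup>+x. f (\<lambda>i\<in>{1..N}. - x i) \<partial>lebesgue_rn N) = (\<integral>\<^sup>+x. f x \<partial>lebesgue_rn N)"
  using nn_integral_lebesgue_rn_affine[OF assms, of "-1" "\<lambda>_. 0"] by simp

lemma nn_integral_lebesgue_rn_scale:
  assumes [measurable]: "f \<in> borel_measurable (lebesgue_rn N)" and "a > 0"
  shows "(\<integral>\<^sup>+x. f x \<partial>lebesgue_rn N) = ennreal (a ^ N) * (\<integral>\<^sup>+x. f (\<lambda>i\<in>{1..N}. a * x i) \<partial>lebesgue_rn N)"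
  using nn_integral_lebesgue_rn_affine[OF assms(1), of a "\<lambda>_. 0"] assms(2) by simp

abbreviation ball_vol :: "nat \<Rightarrow> real" where "ball_vol N \<equiv> unit_ball_vol (real N)"

lemma sets_uniform_sphere [measurable_cong, simp]: "sets (uniform_sphere N) = sets (\<Pi>\<^sub>M i\<in>{1..N}. borel)"
  by (simp add: uniform_sphere_def)

lemma sets_lebesgue_rn: "sets (lebesgue_rn N) = sets (\<Pi>\<^sub>M i\<in>{1..N}. borel)"
  by (rule sets_PiM_cong) simp_all

lemma nn_integral_uniform_sphere:
  assumes [measurable]: "G \<in> borel_measurable (\<Pi>\<^sub>M i\<in>{1..N}. borel)"
  shows "ennreal (ball_vol N) * (\<integral>\<^sup>+\<sigma>. G \<sigma> \<partial>uniform_sphere N) =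
    (\<integral>\<^sup>+x. G (\<lambda>i\<in>{1..N}. x i / rnorm N x) * indicator {x. rnorm N x \<le> 1} x \<partial>lebesgue_rn N)"
proof -
  let ?B = "{x \<in> rvec N. rnorm N x \<le> 1}"
  have B: "?B \<in> sets (lebesgue_rn N)"
    unfolding rvec_eq_space by measurable
  have "(\<integral>\<^sup>+\<sigma>. G \<sigma> \<partial>uniform_sphere N) = (\<integral>\<^sup>+x. G (\<lambda>i\<in>{1..N}. x i / rnorm N x) \<partial>(uniform_measure (lebesgue_rn N) ?B))"
    unfolding uniform_sphere_def by (rule nn_integral_distr[OF normalise_measurable']) simp
  also have "\<dots> = (\<integral>\<^sup>+x. G (\<lambda>i\<in>{1..N}. x i / rnorm N x) * indicator ?B x \<partial>lebesgue_rn N) / emeasure (lebesgue_rn N) ?B"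
    by (rule nn_integral_uniform_measure[OF _ B]) measurable
  also have "(\<integral>\<^sup>+x. G (\<lambda>i\<in>{1..N}. x i / rnorm N x) * indicator ?B x \<partial>lebesgue_rn N)
     = (\<integral>\<^sup>+x. G (\<lambda>i\<in>{1..N}. x i / rnorm N x) * indicator {x. rnorm N x \<le> 1} x \<partial>lebesgue_rn N)"
    by (rule nn_integral_cong) (auto simp: indicator_def rvec_eq_space)
  finally have "(\<integral>\<^sup>+\<sigma>. G \<sigma> \<partial>uniform_sphere N) =
    (\<integral>\<^sup>+x. G (\<lambda>i\<in>{1..N}. x i / rnorm N x) * indicator {x. rnorm N x \<le> 1} x \<partial>lebesgue_rn N) / ennreal (ball_vol N)"
    by (simp add: emeasure_unit_ball)
  moreover have "ennreal (ball_vol N) \<noteq> 0" "ennreal (ball_vol N) \<noteq> \<top>"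
    using unit_ball_vol_pos[of "real N", OF of_nat_0_le_iff] by (simp_all add: ennreal_eq_0_iff not_le)
  ultimately show ?thesis
    by (simp add: ennreal_times_divide mult.commute[of "ennreal (ball_vol N)"] ennreal_mult_divide_eq)
qed

text \<open>
  The integrand is homogeneous of degree 0, so balls of different radii differ only by scaling.
  In this form the sphere can be compared with Gaussian measures: a spherical integral is an
  integral over a solid ball or, after subtraction, over a shell.
\<close>

lemma nn_integral_uniform_sphere_radius:
  assumes [measurable]: "G \<in> borel_measurable (\<Pi>\<^sub>M i\<in>{1..N}. borel)" and r: "r > 0"
  shows "(\<integral>\<^sup>+x. G (\<lambda>i\<in>{1..N}. x i / rnorm N x) * indicator {x. rnorm N x \<le> r} x \<partial>lebesgue_rn N) =
    ennreal (r ^ N * ball_vol N) * (\<integral>\<^sup>+\<sigma>. G \<sigma> \<partial>uniform_sphere N)"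
proof -
  have [measurable]: "G \<in> borel_measurable (lebesgue_rn N)"
    using assms(1) by (subst measurable_cong_sets[OF sets_lebesgue_rn refl])
  have "(\<integral>\<^sup>+x. G (\<lambda>i\<in>{1..N}. x i / rnorm N x) * indicator {x. rnorm N x \<le> r} x \<partial>lebesgue_rn N) =
     ennreal (r ^ N) * (\<integral>\<^sup>+x. G (\<lambda>i\<in>{1..N}. (r * x i) / (r * rnorm N x)) * indicator {x. r * rnorm N x \<le> r} x \<partial>lebesgue_rn N)"
    apply (subst nn_integral_lebesgue_rn_scale[OF _ r])
     apply measurable
    apply (intro arg_cong2[where f="(*)"] refl nn_integral_cong)
    using r apply (auto simp: rnorm_scale indicator_def intro!: arg_cong[where f=G])
    done
  also have "\<dots> = ennreal (r ^ N) * (\<integral>\<^sup>+x. G (\<lambda>i\<in>{1..N}. x i / rnorm N x) * indicator {x. rnorm N x \<le> 1} x \<partial>lebesgue_rn N)"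
    using r by simp
  also have "\<dots> = ennreal (r ^ N) * (ennreal (ball_vol N) * (\<integral>\<^sup>+\<sigma>. G \<sigma> \<partial>uniform_sphere N))"
    by (simp add: nn_integral_uniform_sphere)
  finally show ?thesis
    using r by (simp add: ennreal_mult mult_ac)
qed

section \<open>Gaussian integrals of coercive quadratic forms\<close>

definition coercive :: "nat \<Rightarrow> (nat \<Rightarrow> nat \<Rightarrow> real) \<Rightarrow> real \<Rightarrow> real \<Rightarrow> bool" where
  "coercive N c w \<kappa> \<longleftrightarrow> (\<forall>x. \<kappa> * rdot N x x \<le> confined N c w x)"

lemma coerciveD: "coercive N c w \<kappa> \<Longrightarrow> \<kappa> * rdot N x x \<le> confined N c w x"
  by (simp add: coercive_def)

lemma coercive_shift: "coercive N c w \<kappa> \<Longrightarrow> coercive N c (w + t) (\<kappa> + t)"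
  by (simp add: coercive_def confined_def algebra_simps)

lemma coercive_mono: "coercive N c w \<kappa> \<Longrightarrow> \<kappa>' \<le> \<kappa> \<Longrightarrow> coercive N c w \<kappa>'"
  unfolding coercive_def by (meson mult_right_mono order_trans rdot_self_nonneg)

text \<open>
  By coercivity and compactness \<open>confined N c w x - rdot N a x\<close> attains its minimum, and the first
  variation at the minimiser is the equation to be solved.
\<close>

lemma coercive_solve:
  assumes coercive: "coercive N c w \<kappa>" and k: "\<kappa> > 0"
  obtains m where "\<And>x. 2 * confined_bilin N c w m x = rdot N a x"
proof -
  define \<phi> where "\<phi> x = confined N c w x - rdot N a x" for x
  define R where "R = rnorm N a / \<kappa> + 1"
  have R: "R > 0" using k by (simp add: R_def add_nonneg_pos)
  define C where "C = PiE UNIV (\<lambda>i. if i \<in> {1..N} then {-R..R} else {0::real})"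
  have "compactin (product_topology (\<lambda>_. euclidean) UNIV) C"
    unfolding C_def by (subst compactin_PiE) auto
  then have "compact C" by (simp add: euclidean_product_topology)
  moreover have "(\<lambda>_. 0) \<in> C" using R by (auto simp: C_def)
  moreover have "continuous_on C \<phi>"
    unfolding \<phi>_def confined_def rdot_def quad_def
    by (intro continuous_intros continuous_on_product_then_coordinatewise[OF continuous_on_id, unfolded id_def] )
  ultimately obtain m where m: "m \<in> C" "\<And>x. x \<in> C \<Longrightarrow> \<phi> m \<le> \<phi> x"
    using continuous_attains_inf[of C \<phi>] by auto
  have \<phi>0: "\<phi> m \<le> 0" using m(2)[OF \<open>(\<lambda>_. 0) \<in> C\<close>] by (simp add: \<phi>_def confined_def rdot_def quad_def)
  have mmin: "\<phi> m \<le> \<phi> x" for x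
  proof (cases "\<forall>i\<in>{1..N}. \<bar>x i\<bar> \<le> R")
    case True
    have "- R \<le> x i" "x i \<le> R" if "i \<in> {1..N}" for i
      using bspec[OF True that] by linarith+
    then have "\<phi> m \<le> \<phi> (\<lambda>i. if i \<in> {1..N} then x i else 0)"
      by (intro m(2)) (auto simp: C_def)
    also have "\<dots> = \<phi> x"
      by (simp add: \<phi>_def confined_def rdot_def quad_def)
    finally show ?thesis .
  next
    case False
    then obtain i where i: "i \<in> {1..N}" "\<bar>x i\<bar> > R" by auto
    have "\<bar>x i\<bar> \<le> L2_set (\<lambda>i. \<bar>x i\<bar>) {1..N}" using i by (intro member_le_L2_set) auto
    then have rx: "R < rnorm N x" using i by (simp add: rnorm_def L2_set_def)
    then have rp: "rnorm N x > 0" using R by simp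
    have "rnorm N a < \<kappa> * R" using k by (simp add: R_def field_simps)
    then have "rnorm N a < \<kappa> * rnorm N x" using rx k by (smt (verit) mult_left_mono)
    then have "rnorm N a * rnorm N x \<le> \<kappa> * rnorm N x * rnorm N x" using rp by (intro mult_right_mono) auto
    moreover have "rdot N a x \<le> rnorm N a * rnorm N x" using rdot_le_rnorm[of N a x] by simp
    moreover have "\<kappa> * (rnorm N x)\<^sup>2 \<le> confined N c w x" using coerciveD[OF coercive, of x] by (simp add: rdot_self)
    ultimately have "\<phi> x \<ge> 0" by (simp add: \<phi>_def power2_eq_square)
    then show ?thesis using \<phi>0 by simp
  qed
  have "2 * confined_bilin N c w m x = rdot N a x" for x
  proof (rule ccontr)
    define L where "L = 2 * confined_bilin N c w m x - rdot N a x"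
    define Q where "Q = \<bar>confined N c w x\<bar> + 1"
    assume "2 * confined_bilin N c w m x \<noteq> rdot N a x"
    then have L: "L \<noteq> 0" by (simp add: L_def)
    have ge: "0 \<le> t * L + t\<^sup>2 * confined N c w x" for t
      using mmin[of "\<lambda>i. m i + t * x i"]
      by (simp add: \<phi>_def confined_add confined_bilin_scale_right confined_scale rdot_add_right rdot_scale_right L_def algebra_simps)
    have Q: "Q > 0" "confined N c w x < Q" by (auto simp: Q_def)
    have "0 \<le> (- L / Q) * L + (- L / Q)\<^sup>2 * confined N c w x" by (rule ge)
    also have "\<dots> < (- L / Q) * L + (- L / Q)\<^sup>2 * Q"
      using Q L by (intro add_strict_left_mono mult_strict_left_mono) auto
    also have "\<dots> = 0" using Q by (simp add: power2_eq_square field_simps)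
    finally show False by simp
  qed
  then show ?thesis using that by blast
qed

definition gauss_int :: "nat \<Rightarrow> (nat \<Rightarrow> nat \<Rightarrow> real) \<Rightarrow> real \<Rightarrow> ennreal" where
  "gauss_int N c w = (\<integral>\<^sup>+x. ennreal (exp (- (real N * confined N c w x))) \<partial>lebesgue_rn N)"

definition log_gauss :: "nat \<Rightarrow> (nat \<Rightarrow> nat \<Rightarrow> real) \<Rightarrow> real \<Rightarrow> real" where
  "log_gauss N c w = ln (enn2real (gauss_int N c w)) / real N"

lemma nn_integral_gaussian:
  assumes "A > 0"
  shows "(\<integral>\<^sup>+y. ennreal (exp (- (A * y\<^sup>2))) \<partial>lborel) = ennreal (sqrt (pi / A))"
proof -
  define s where "s = 1 / sqrt (2 * A)"
  have s: "s > 0" "s\<^sup>2 = 1 / (2 * A)" using assms by (auto simp: s_def power_divide)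
  interpret prob_space "density lborel (\<lambda>x. ennreal (normal_density 0 s x))"
    by (rule prob_space_normal_density) fact
  have "(\<integral>\<^sup>+y. ennreal (normal_density 0 s y) \<partial>lborel) = 1"
    using emeasure_space_1 by (simp add: emeasure_density)
  moreover have "exp (- (A * y\<^sup>2)) = sqrt (pi / A) * normal_density 0 s y" for y
    using assms by (simp add: normal_density_def s)
  ultimately show ?thesis
    using assms by (simp add: ennreal_mult nn_integral_cmult)
qed

lemma nn_integral_lebesgue_rn_gaussian:
  assumes "A > 0"
  shows "(\<integral>\<^sup>+x. ennreal (exp (- (A * rdot N x x))) \<partial>lebesgue_rn N) = ennreal (sqrt (pi / A) ^ N)"
proof -
  have "(\<integral>\<^sup>+x. ennreal (exp (- (A * rdot N x x))) \<partial>lebesgue_rn N) = (\<integral>\<^sup>+x. (\<Prod>i\<in>{1..N}. ennreal (exp (- (A * (x i)\<^sup>2)))) \<partial>lebesgue_rn N)"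
    by (intro nn_integral_cong)
       (simp add: rdot_def prod_ennreal exp_sum[symmetric] sum_distrib_left power2_eq_square sum_negf)
  also have "\<dots> = (\<Prod>i\<in>{1..N}. \<integral>\<^sup>+y. ennreal (exp (- (A * y\<^sup>2))) \<partial>lborel)"
    by (rule lebesgue_product.product_nn_integral_prod) auto
  also have "\<dots> = ennreal (sqrt (pi / A) ^ N)"
    using assms by (simp add: nn_integral_gaussian ennreal_power)
  finally show ?thesis .
qed

lemma gauss_int_finite:
  assumes "N \<ge> 1" "coercive N c w \<kappa>" "\<kappa> > 0"
  shows "gauss_int N c w < \<infinity>"
proof -
  have "gauss_int N c w \<le> (\<integral>\<^sup>+x. ennreal (exp (- ((N * \<kappa>) * rdot N x x))) \<partial>lebesgue_rn N)"
    unfolding gauss_int_def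
    by (intro nn_integral_mono ennreal_leI) (use assms(1) coerciveD[OF assms(2)] in \<open>simp add: mult.assoc\<close>)
  also have "\<dots> < \<infinity>"
    using assms by (subst nn_integral_lebesgue_rn_gaussian) auto
  finally show ?thesis .
qed

text \<open>
  Lebesgue measure is not the null measure, and the exponential vanishes nowhere.
\<close>

lemma nn_integral_lebesgue_rn_exp_pos:
  assumes [measurable]: "f \<in> borel_measurable (lebesgue_rn N)"
  shows "(\<integral>\<^sup>+x. ennreal (exp (f x)) \<partial>lebesgue_rn N) > 0"
proof (rule ccontr)
  assume "\<not> ?thesis"
  then have "(\<integral>\<^sup>+x. ennreal (exp (f x)) \<partial>lebesgue_rn N) = 0" by (simp add: zero_less_iff_neq_zero)
  then have "AE x in lebesgue_rn N. ennreal (exp (f x)) = 0"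
    by (subst (asm) nn_integral_0_iff_AE) auto
  then have ae: "AE x in lebesgue_rn N. False" by simp
  have B: "{x \<in> rvec N. rnorm N x \<le> 1} \<in> sets (lebesgue_rn N)"
    unfolding rvec_eq_space by measurable
  have "emeasure (lebesgue_rn N) {x \<in> rvec N. rnorm N x \<le> 1} = 0"
    using AE_iff_measurable[of "space (lebesgue_rn N)" "lebesgue_rn N" "\<lambda>_. False"] ae
      emeasure_mono[of "{x \<in> rvec N. rnorm N x \<le> 1}" "space (lebesgue_rn N)" "lebesgue_rn N"] by (auto simp: rvec_eq_space)
  then show False
    using unit_ball_vol_pos[of "real N", OF of_nat_0_le_iff] by (simp add: emeasure_unit_ball ennreal_eq_0_iff)
qed

lemma gauss_int_eq:
  assumes "N \<ge> 1" "coercive N c w \<kappa>" "\<kappa> > 0"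
  shows "gauss_int N c w = ennreal (exp (real N * log_gauss N c w))"
proof -
  have "gauss_int N c w > 0" unfolding gauss_int_def by (rule nn_integral_lebesgue_rn_exp_pos) measurable
  then have "enn2real (gauss_int N c w) > 0"
    using gauss_int_finite[OF assms] by (simp add: enn2real_positive_iff)
  then show ?thesis
    using assms(1) gauss_int_finite[OF assms] by (simp add: log_gauss_def)
qed

text \<open>
  Complete the square: the linear term moves the centre of the Gaussian to \<open>m\<close>.
\<close>

lemma gauss_int_linear:
  assumes m: "\<And>x. 2 * confined_bilin N c w m x = rdot N a x"
  shows "(\<integral>\<^sup>+x. ennreal (exp (real N * (rdot N a x - confined N c w x))) \<partial>lebesgue_rn N)
    = ennreal (exp (real N * (rdot N a m - confined N c w m))) * gauss_int N c w"
proof -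
  have meas: "(\<lambda>x. ennreal (exp (- (real N * confined N c w x)))) \<in> borel_measurable (lebesgue_rn N)" by measurable
  have am: "rdot N a m = 2 * confined N c w m" using m[of m] by (simp add: confined_bilin_self)
  have *: "rdot N a x - confined N c w x = rdot N a m - confined N c w m - confined N c w (\<lambda>i. - m i + x i)" for x
    using m[of x] confined_bilin_scale_left[of N c w "-1" m x] confined_scale[of N c w "-1" m] confined_add[of N c w "\<lambda>i. -1 * m i" x] by (simp add: am)
  have "(\<integral>\<^sup>+x. ennreal (exp (real N * (rdot N a x - confined N c w x))) \<partial>lebesgue_rn N)
    = (\<integral>\<^sup>+x. ennreal (exp (real N * (rdot N a m - confined N c w m))) * ennreal (exp (- (real N * confined N c w (\<lambda>i\<in>{1..N}. - m i + x i)))) \<partial>lebesgue_rn N)"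
  proof (intro nn_integral_cong)
    fix x
    show "ennreal (exp (real N * (rdot N a x - confined N c w x))) = ennreal (exp (real N * (rdot N a m - confined N c w m))) * ennreal (exp (- (real N * confined N c w (\<lambda>i\<in>{1..N}. - m i + x i))))"
      unfolding confined_restrict *[of x] by (simp add: ennreal_mult[symmetric] exp_add[symmetric] right_diff_distrib)
  qed
  also have "\<dots> = ennreal (exp (real N * (rdot N a m - confined N c w m))) * gauss_int N c w"
    unfolding gauss_int_def nn_integral_lebesgue_rn_translate[where f="\<lambda>x. ennreal (exp (- (real N * confined N c w x)))" and t="\<lambda>i. - m i", symmetric, OF meas]
    by (rule nn_integral_cmult) (unfold confined_restrict, measurable)
  finally show ?thesis .
qed

text \<open>
  Every direction has curvature at least \<open>\<kappa>\<close>, so the exponential moments are at most those of the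
  isotropic Gaussian of precision \<open>2 N \<kappa>\<close>.
\<close>

lemma gauss_int_linear_le:
  assumes "N \<ge> 1" "coercive N c w \<kappa>" "\<kappa> > 0"
  shows "(\<integral>\<^sup>+x. ennreal (exp (rdot N a x - real N * confined N c w x)) \<partial>lebesgue_rn N)
    \<le> ennreal (exp (rdot N a a / (4 * real N * \<kappa>))) * gauss_int N c w"
proof -
  let ?a = "\<lambda>i. (1 / real N) * a i"
  obtain m where m: "\<And>x. 2 * confined_bilin N c w m x = rdot N ?a x" using coercive_solve[OF assms(2,3)] by blast
  have N0: "real N > 0" using assms by simp
  have "(\<integral>\<^sup>+x. ennreal (exp (rdot N a x - real N * confined N c w x)) \<partial>lebesgue_rn N)
      = (\<integral>\<^sup>+x. ennreal (exp (real N * (rdot N ?a x - confined N c w x))) \<partial>lebesgue_rn N)"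
    using N0 rdot_scale_left[of N "1 / real N" a] by (intro nn_integral_cong) (simp add: right_diff_distrib)
  also have "\<dots> = ennreal (exp (real N * (rdot N ?a m - confined N c w m))) * gauss_int N c w"
    by (rule gauss_int_linear[OF m])
  also have "\<dots> \<le> ennreal (exp (rdot N a a / (4 * real N * \<kappa>))) * gauss_int N c w"
  proof (intro mult_right_mono ennreal_leI exp_mono)
    have "0 \<le> rdot N (\<lambda>i. a i + (- (2 * real N * \<kappa>)) * m i) (\<lambda>i. a i + (- (2 * real N * \<kappa>)) * m i)" by simp
    also have "\<dots> = rdot N a a - 4 * real N * \<kappa> * rdot N a m + 4 * (real N)\<^sup>2 * \<kappa>\<^sup>2 * rdot N m m"
      unfolding rdot_add_left rdot_add_right rdot_scale_left rdot_scale_right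
      by (simp add: rdot_commute[of N m a] power2_eq_square algebra_simps)
    finally have "4 * real N * \<kappa> * (rdot N a m - real N * (\<kappa> * rdot N m m)) \<le> rdot N a a"
      by (simp add: power2_eq_square algebra_simps)
    then have "rdot N a m - real N * (\<kappa> * rdot N m m) \<le> rdot N a a / (4 * real N * \<kappa>)"
      using N0 assms by (simp add: field_simps)
    moreover have "real N * (\<kappa> * rdot N m m) \<le> real N * confined N c w m" using coerciveD[OF assms(2), of m] N0 by simp
    ultimately have "rdot N a m - real N * confined N c w m \<le> rdot N a a / (4 * real N * \<kappa>)" by linarith
    then show "real N * (rdot N ?a m - confined N c w m) \<le> rdot N a a / (4 * real N * \<kappa>)"
      using N0 rdot_scale_left[of N "1 / real N" a m] by (simp add: right_diff_distrib)
  qed auto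
  finally show ?thesis .
qed

lemma gauss_int_scale:
  assumes "a > 0"
  shows "(\<integral>\<^sup>+x. ennreal (exp (- (real N * (a * confined N c w x)))) \<partial>lebesgue_rn N) = ennreal ((1 / sqrt a) ^ N) * gauss_int N c w"
proof -
  have "(\<integral>\<^sup>+x. ennreal (exp (- (real N * (a * confined N c w x)))) \<partial>lebesgue_rn N)
     = ennreal ((1 / sqrt a) ^ N) * (\<integral>\<^sup>+x. ennreal (exp (- (real N * (a * confined N c w (\<lambda>i\<in>{1..N}. (1 / sqrt a) * x i))))) \<partial>lebesgue_rn N)"
    using assms by (intro nn_integral_lebesgue_rn_scale) auto
  also have "\<dots> = ennreal ((1 / sqrt a) ^ N) * gauss_int N c w"
    using assms unfolding confined_restrict confined_scale by (simp add: gauss_int_def power_divide)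
  finally show ?thesis .
qed

lemma exp_half_N_ln:
  assumes "a > 0" shows "(1 / sqrt a) ^ N = exp (- (real N * (ln a / 2)))"
proof -
  have "1 / sqrt a = exp (- (ln a / 2))"
    using assms by (simp add: exp_minus ln_sqrt[symmetric] inverse_eq_divide)
  then show ?thesis by (simp add: exp_of_nat_mult[symmetric])
qed

text \<open>
  A factor in front of the form is absorbed by rescaling \<open>x\<close>, whose Jacobian contributes
  \<open>- ln a / 2\<close> per dimension.
\<close>

lemma log_gauss_le_of_scaled:
  assumes N: "N \<ge> 1" and p: "coercive N c w \<kappa>" "\<kappa> > 0" and p': "coercive N c w' \<kappa>'" "\<kappa>' > 0" and a: "a > 0"
    and le: "\<And>x. a * confined N c w x \<le> confined N c w' x"
  shows "log_gauss N c w' \<le> log_gauss N c w - ln a / 2"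
proof -
  have "gauss_int N c w' \<le> (\<integral>\<^sup>+x. ennreal (exp (- (real N * (a * confined N c w x)))) \<partial>lebesgue_rn N)"
    unfolding gauss_int_def by (intro nn_integral_mono ennreal_leI) (use le in \<open>simp add: mult_left_mono\<close>)
  also have "\<dots> = ennreal (exp (- (real N * (ln a / 2)))) * ennreal (exp (real N * log_gauss N c w))"
    using gauss_int_scale[OF a, of N c w] gauss_int_eq[OF N p] exp_half_N_ln[OF a, of N] by simp
  finally have "exp (real N * log_gauss N c w') \<le> exp (real N * (log_gauss N c w - ln a / 2))"
    unfolding gauss_int_eq[OF N p'] by (simp add: ennreal_mult[symmetric] exp_add[symmetric] algebra_simps)
  then show ?thesis using N by simp
qed

lemma log_gauss_shift_down:
  assumes N: "N \<ge> 1" and p: "coercive N c w \<kappa>" "\<kappa> > 0" and t: "0 \<le> t" "t \<le> \<kappa> / 2"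
  shows "log_gauss N c (w - t) \<le> log_gauss N c w + t / \<kappa>"
proof -
  let ?a = "1 - t / \<kappa>"
  have a: "?a \<ge> 1 / 2" using p t by (simp add: field_simps)
  have "log_gauss N c (w - t) \<le> log_gauss N c w - ln ?a / 2"
  proof (rule log_gauss_le_of_scaled[OF N p])
    show "coercive N c (w - t) (\<kappa> - t)" using coercive_shift[OF p(1), of "-t"] by simp
    show "0 < \<kappa> - t" using t p by simp
    show "?a > 0" using a by linarith
    fix x
    have "t / \<kappa> * confined N c w x \<ge> t / \<kappa> * (\<kappa> * rdot N x x)" using t p coerciveD[OF p(1)] by (intro mult_left_mono) auto
    then show "?a * confined N c w x \<le> confined N c (w - t) x" using p by (simp add: confined_shift[of N c "w - t" x w] algebra_simps)
  qed
  moreover have "- ln ?a \<le> 2 * (t / \<kappa>)"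
  proof -
    have h: "t / \<kappa> \<le> 1 / 2" "0 \<le> t / \<kappa>" using a t p by auto
    have "- (t/\<kappa>) - 2 * (t/\<kappa>)\<^sup>2 \<le> ln (1 - t/\<kappa>)"
      using h by (intro ln_one_minus_pos_lower_bound) auto
    moreover have "2 * (t/\<kappa>)\<^sup>2 \<le> t / \<kappa>" using h mult_left_mono[of "t/\<kappa>" "1/2" "t/\<kappa>"] by (simp add: power2_eq_square)
    ultimately show ?thesis by linarith
  qed
  ultimately show ?thesis by linarith
qed

lemma log_gauss_shift_up:
  assumes N: "N \<ge> 1" and p: "coercive N c w \<kappa>" "\<kappa> > 0" and t: "0 \<le> t" and L: "\<Lambda> > 0" "\<And>x. confined N c w x \<le> \<Lambda> * rdot N x x"
  shows "log_gauss N c (w + t) \<le> log_gauss N c w - ln (1 + t / \<Lambda>) / 2"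
proof (rule log_gauss_le_of_scaled[OF N p])
  show "coercive N c (w + t) (\<kappa> + t)" by (rule coercive_shift[OF p(1)])
  show "0 < \<kappa> + t" using t p by simp
  show "1 + t / \<Lambda> > 0" using t L by (simp add: add_pos_nonneg)
  fix x
  have "t / \<Lambda> * confined N c w x \<le> t / \<Lambda> * (\<Lambda> * rdot N x x)" using t L by (intro mult_left_mono) auto
  then show "(1 + t / \<Lambda>) * confined N c w x \<le> confined N c (w + t) x" using L unfolding confined_shift[of N c "w + t" x w] by (simp add: algebra_simps)
qed

lemma confined_parallelogram:
  "confined N c w x + confined N c w y = (confined N c w (\<lambda>i. x i + y i) + confined N c w (\<lambda>i. x i + -1 * y i)) / 2"
  unfolding confined_add confined_bilin_scale_right confined_scale by simp

lemma rdot_diff_squares: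
  "rdot N x x - rdot N y y = rdot N (\<lambda>i. x i + y i) (\<lambda>i. x i + -1 * y i)"
  unfolding rdot_add_left rdot_add_right rdot_scale_left rdot_scale_right by (simp add: rdot_commute)

text \<open>
  The rotation \<open>(x, y) \<mapsto> (x + y, x - y)\<close> of a pair of vectors is a translation in \<open>x\<close> at fixed
  \<open>y\<close> followed by an affine substitution in \<open>y\<close> at fixed \<open>x\<close>; hence the Jacobian \<open>2\<^sup>N\<close>.
\<close>

lemma nn_integral_pair_rotate:
  assumes [measurable]: "case_prod E \<in> borel_measurable (lebesgue_rn N \<Otimes>\<^sub>M lebesgue_rn N)"
  shows "ennreal (2 ^ N) * (\<integral>\<^sup>+x. \<integral>\<^sup>+y. E (\<lambda>i\<in>{1..N}. x i + y i) (\<lambda>i\<in>{1..N}. x i + -1 * y i) \<partial>lebesgue_rn N \<partial>lebesgue_rn N)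
     = (\<integral>\<^sup>+x. \<integral>\<^sup>+y. E x y \<partial>lebesgue_rn N \<partial>lebesgue_rn N)"
proof -
  interpret P: pair_sigma_finite "lebesgue_rn N" "lebesgue_rn N"
    by (intro pair_sigma_finite.intro lebesgue_rn_sigma_finite)
  have m1 [measurable]: "(\<lambda>(x, y). \<lambda>i\<in>{1..N}. x i + y i) \<in> lebesgue_rn N \<Otimes>\<^sub>M lebesgue_rn N \<rightarrow>\<^sub>M lebesgue_rn N"
    unfolding case_prod_beta by (rule measurable_restrict) measurable
  have m2 [measurable]: "(\<lambda>(x, y). \<lambda>i\<in>{1..N}. x i + - a * y i) \<in> lebesgue_rn N \<Otimes>\<^sub>M lebesgue_rn N \<rightarrow>\<^sub>M lebesgue_rn N" for a
    unfolding case_prod_beta by (rule measurable_restrict) measurable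
  have E2 [measurable]: "E x \<in> borel_measurable (lebesgue_rn N)" if "x \<in> space (lebesgue_rn N)" for x
    using measurable_Pair2[OF assms that] by simp
  have E1 [measurable]: "(\<lambda>x. E x y) \<in> borel_measurable (lebesgue_rn N)" if "y \<in> space (lebesgue_rn N)" for y
    using measurable_Pair1[OF assms that] by simp
  have mc: "(\<lambda>(x, y). E (f x y) (g x y)) \<in> borel_measurable (lebesgue_rn N \<Otimes>\<^sub>M lebesgue_rn N)"
    if "case_prod f \<in> lebesgue_rn N \<Otimes>\<^sub>M lebesgue_rn N \<rightarrow>\<^sub>M lebesgue_rn N" "case_prod g \<in> lebesgue_rn N \<Otimes>\<^sub>M lebesgue_rn N \<rightarrow>\<^sub>M lebesgue_rn N" for f g
    using measurable_compose[OF measurable_Pair[OF that] assms] by (simp add: case_prod_beta')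
  have mc1: "(\<lambda>x. E (f x) (g x)) \<in> borel_measurable (lebesgue_rn N)"
    if "f \<in> lebesgue_rn N \<rightarrow>\<^sub>M lebesgue_rn N" "g \<in> lebesgue_rn N \<rightarrow>\<^sub>M lebesgue_rn N" for f g
    using measurable_compose[OF measurable_Pair[OF that] assms] by simp
  have mr: "(\<lambda>x. \<lambda>i\<in>{1..N}. t i + a * x i) \<in> lebesgue_rn N \<rightarrow>\<^sub>M lebesgue_rn N" for t a by measurable
  have "(\<integral>\<^sup>+x. \<integral>\<^sup>+y. E (\<lambda>i\<in>{1..N}. x i + y i) (\<lambda>i\<in>{1..N}. x i + -1 * y i) \<partial>lebesgue_rn N \<partial>lebesgue_rn N)
    = (\<integral>\<^sup>+y. \<integral>\<^sup>+x. E (\<lambda>i\<in>{1..N}. x i + y i) (\<lambda>i\<in>{1..N}. x i + -1 * y i) \<partial>lebesgue_rn N \<partial>lebesgue_rn N)"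
    by (rule P.Fubini'[symmetric]) (rule mc, rule m1, rule m2)
  also have "\<dots> = (\<integral>\<^sup>+y. \<integral>\<^sup>+x. E x (\<lambda>i\<in>{1..N}. x i + -2 * y i) \<partial>lebesgue_rn N \<partial>lebesgue_rn N)"
  proof (rule nn_integral_cong)
    fix y assume y: "y \<in> space (lebesgue_rn N)"
    have "(\<integral>\<^sup>+x. E (\<lambda>i\<in>{1..N}. x i + y i) (\<lambda>i\<in>{1..N}. x i + -1 * y i) \<partial>lebesgue_rn N)
      = (\<integral>\<^sup>+x. (\<lambda>x. E (\<lambda>i\<in>{1..N}. x i) (\<lambda>i\<in>{1..N}. -2 * y i + x i)) (\<lambda>i\<in>{1..N}. y i + x i) \<partial>lebesgue_rn N)"
      by (intro nn_integral_cong arg_cong2[where f=E]) auto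
    also have "\<dots> = (\<integral>\<^sup>+x. E (\<lambda>i\<in>{1..N}. x i) (\<lambda>i\<in>{1..N}. -2 * y i + x i) \<partial>lebesgue_rn N)"
      by (rule nn_integral_lebesgue_rn_translate[where f="\<lambda>x. E (\<lambda>i\<in>{1..N}. x i) (\<lambda>i\<in>{1..N}. -2 * y i + x i)"])
         (rule mc1; simp)
    also have "\<dots> = (\<integral>\<^sup>+x. E x (\<lambda>i\<in>{1..N}. x i + -2 * y i) \<partial>lebesgue_rn N)"
      by (intro nn_integral_cong arg_cong2[where f=E]) (auto simp: space_PiM)
    finally show "(\<integral>\<^sup>+x. E (\<lambda>i\<in>{1..N}. x i + y i) (\<lambda>i\<in>{1..N}. x i + -1 * y i) \<partial>lebesgue_rn N) = (\<integral>\<^sup>+x. E x (\<lambda>i\<in>{1..N}. x i + -2 * y i) \<partial>lebesgue_rn N)" .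
  qed
  also have "\<dots> = (\<integral>\<^sup>+x. \<integral>\<^sup>+y. E x (\<lambda>i\<in>{1..N}. x i + -2 * y i) \<partial>lebesgue_rn N \<partial>lebesgue_rn N)"
    by (rule P.Fubini') (rule mc, simp, rule m2)
  finally have 1: "(\<integral>\<^sup>+x. \<integral>\<^sup>+y. E (\<lambda>i\<in>{1..N}. x i + y i) (\<lambda>i\<in>{1..N}. x i + -1 * y i) \<partial>lebesgue_rn N \<partial>lebesgue_rn N) = \<dots>" .
  have 2: "(\<integral>\<^sup>+x. \<integral>\<^sup>+y. E x y \<partial>lebesgue_rn N \<partial>lebesgue_rn N) = (\<integral>\<^sup>+x. ennreal (2 ^ N) * \<integral>\<^sup>+y. E x (\<lambda>i\<in>{1..N}. x i + -2 * y i) \<partial>lebesgue_rn N \<partial>lebesgue_rn N)"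
    by (intro nn_integral_cong) (subst nn_integral_lebesgue_rn_affine[of "E _" _ "-2" _], auto)
  show ?thesis
    unfolding 1 2
    by (rule nn_integral_cmult[symmetric]) (rule sigma_finite_measure.borel_measurable_nn_integral[OF lebesgue_rn_sigma_finite], rule mc, simp, rule m2)
qed

text \<open>
  Take two independent copies \<open>x\<close>, \<open>y\<close> of the Gaussian vector at multiplier \<open>w\<close>.  The product on
  the left tilts their law by \<open>exp (- N \<theta> (|x|\<^sup>2 - |y|\<^sup>2))\<close>.  In the rotated coordinates
  \<open>u = x + y\<close>, \<open>v = x - y\<close>, which are again independent, this tilt is \<open>exp (- N \<theta> u \<bullet> v)\<close>, linear
  in \<open>v\<close>; integrating out \<open>v\<close> costs at most a shift of the multiplier for \<open>u\<close> by
  \<open>\<theta>\<^sup>2 / \<kappa>\<close>.  Dividing by the square of the integral at \<open>w\<close> gives a bound on the second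
  difference of \<open>log_gauss\<close>.
\<close>

lemma gauss_int_replica:
  assumes N: "N \<ge> 1" and p: "coercive N c w \<kappa>" "\<kappa> > 0"
  shows "gauss_int N c (w + \<theta>) * gauss_int N c (w - \<theta>) \<le> gauss_int N c w * gauss_int N c (w - \<theta>\<^sup>2 / \<kappa>)"
proof -
  interpret P: pair_sigma_finite "lebesgue_rn N" "lebesgue_rn N"
    by (intro pair_sigma_finite.intro lebesgue_rn_sigma_finite)
  define E where "E u v = ennreal (exp (- (real N * ((confined N c w u + confined N c w v) / 2)) - real N * \<theta> * rdot N u v))" for u v
  have N0: "real N > 0" using N by simp
  have "gauss_int N c (w + \<theta>) * gauss_int N c (w - \<theta>)
    = (\<integral>\<^sup>+x. ennreal (exp (- (real N * confined N c (w + \<theta>) x))) * gauss_int N c (w - \<theta>) \<partial>lebesgue_rn N)"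
    unfolding gauss_int_def[of N c "w + \<theta>"] by (subst nn_integral_multc) auto
  also have "\<dots> = (\<integral>\<^sup>+x. \<integral>\<^sup>+y. ennreal (exp (- (real N * confined N c (w + \<theta>) x))) * ennreal (exp (- (real N * confined N c (w - \<theta>) y))) \<partial>lebesgue_rn N \<partial>lebesgue_rn N)"
    unfolding gauss_int_def by (subst nn_integral_cmult) auto
  also have "\<dots> = (\<integral>\<^sup>+x. \<integral>\<^sup>+y. E (\<lambda>i\<in>{1..N}. x i + y i) (\<lambda>i\<in>{1..N}. x i + -1 * y i) \<partial>lebesgue_rn N \<partial>lebesgue_rn N)"
  proof (intro nn_integral_cong)
    fix x y
    have "confined N c (w + \<theta>) x + confined N c (w - \<theta>) y = (confined N c w (\<lambda>i. x i + y i) + confined N c w (\<lambda>i. x i + -1 * y i)) / 2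
        + \<theta> * rdot N (\<lambda>i. x i + y i) (\<lambda>i. x i + -1 * y i)"
      unfolding confined_parallelogram[symmetric] rdot_diff_squares[symmetric] unfolding confined_def by (simp add: algebra_simps)
    from arg_cong[OF this, of "(*) (real N)"] have "- (real N * confined N c (w + \<theta>) x) + - (real N * confined N c (w - \<theta>) y) =
       - (real N * ((confined N c w (\<lambda>i. x i + y i) + confined N c w (\<lambda>i. x i + -1 * y i)) / 2)) - real N * \<theta> * rdot N (\<lambda>i. x i + y i) (\<lambda>i. x i + -1 * y i)"
      unfolding distrib_left mult.assoc by linarith
    then show "ennreal (exp (- (real N * confined N c (w + \<theta>) x))) * ennreal (exp (- (real N * confined N c (w - \<theta>) y)))
       = E (\<lambda>i\<in>{1..N}. x i + y i) (\<lambda>i\<in>{1..N}. x i + -1 * y i)"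
      unfolding E_def rdot_restrict_left rdot_restrict_right confined_restrict by (simp add: ennreal_mult[symmetric] exp_add[symmetric])
  qed
  finally have "ennreal (2 ^ N) * (gauss_int N c (w + \<theta>) * gauss_int N c (w - \<theta>)) = (\<integral>\<^sup>+u. \<integral>\<^sup>+v. E u v \<partial>lebesgue_rn N \<partial>lebesgue_rn N)"
    by (simp only:) (rule nn_integral_pair_rotate, unfold E_def, measurable)
  also have "\<dots> \<le> (\<integral>\<^sup>+u. ennreal (sqrt 2 ^ N) * gauss_int N c w * ennreal (exp (- (real N * (confined N c (w - \<theta>\<^sup>2 / \<kappa>) u / 2)))) \<partial>lebesgue_rn N)"
  proof (intro nn_integral_mono)
    fix u :: "nat \<Rightarrow> real"
    let ?a = "\<lambda>i. - (real N * \<theta> * sqrt 2) * u i"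
    have Ev: "(\<integral>\<^sup>+v. E u v \<partial>lebesgue_rn N) = ennreal (sqrt 2 ^ N) * (\<integral>\<^sup>+v. E u (\<lambda>i\<in>{1..N}. sqrt 2 * v i) \<partial>lebesgue_rn N)"
      by (rule nn_integral_lebesgue_rn_scale) (unfold E_def, measurable)
    have "(\<integral>\<^sup>+v. E u (\<lambda>i\<in>{1..N}. sqrt 2 * v i) \<partial>lebesgue_rn N) =
       (\<integral>\<^sup>+v. ennreal (exp (- (real N * (confined N c w u / 2)))) * ennreal (exp (rdot N ?a v - real N * confined N c w v)) \<partial>lebesgue_rn N)"
      unfolding E_def confined_restrict rdot_restrict_right confined_scale rdot_scale_left rdot_scale_right
      by (intro nn_integral_cong) (simp add: ennreal_mult[symmetric] exp_add[symmetric] algebra_simps add_divide_distrib)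
    also have "\<dots> = ennreal (exp (- (real N * (confined N c w u / 2)))) * (\<integral>\<^sup>+v. ennreal (exp (rdot N ?a v - real N * confined N c w v)) \<partial>lebesgue_rn N)"
      by (rule nn_integral_cmult) measurable
    also have "\<dots> \<le> ennreal (exp (- (real N * (confined N c w u / 2)))) * (ennreal (exp (rdot N ?a ?a / (4 * real N * \<kappa>))) * gauss_int N c w)"
      by (intro mult_left_mono gauss_int_linear_le[OF N p]) auto
    also have "\<dots> = ennreal (exp (- (real N * (confined N c (w - \<theta>\<^sup>2 / \<kappa>) u / 2)))) * gauss_int N c w"
    proof -
      have "rdot N ?a ?a / (4 * real N * \<kappa>) = real N * (\<theta>\<^sup>2 / \<kappa> * rdot N u u / 2)"
        unfolding rdot_scale_left rdot_scale_right using N0 p by (simp add: field_simps power2_eq_square)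
      then have "- (real N * (confined N c w u / 2)) + rdot N ?a ?a / (4 * real N * \<kappa>) = - (real N * (confined N c (w - \<theta>\<^sup>2 / \<kappa>) u / 2))"
        by (simp add: confined_def algebra_simps diff_divide_distrib)
      then show ?thesis
        unfolding mult.assoc[symmetric] by (simp only: ennreal_mult[symmetric] exp_add[symmetric] exp_ge_zero)
    qed
    finally have "ennreal (sqrt 2 ^ N) * (\<integral>\<^sup>+v. E u (\<lambda>i\<in>{1..N}. sqrt 2 * v i) \<partial>lebesgue_rn N)
      \<le> ennreal (sqrt 2 ^ N) * (ennreal (exp (- (real N * (confined N c (w - \<theta>\<^sup>2 / \<kappa>) u / 2)))) * gauss_int N c w)"
      by (rule mult_left_mono) simp
    then show "(\<integral>\<^sup>+v. E u v \<partial>lebesgue_rn N) \<le> ennreal (sqrt 2 ^ N) * gauss_int N c w * ennreal (exp (- (real N * (confined N c (w - \<theta>\<^sup>2 / \<kappa>) u / 2))))"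
      unfolding Ev by (simp only: mult_ac)
  qed
  also have "\<dots> = ennreal (sqrt 2 ^ N) * gauss_int N c w * (\<integral>\<^sup>+u. ennreal (exp (- (real N * ((1/2) * confined N c (w - \<theta>\<^sup>2 / \<kappa>) u)))) \<partial>lebesgue_rn N)"
    unfolding times_divide_eq_left mult_1 by (rule nn_integral_cmult) measurable
  also have "\<dots> = ennreal (sqrt 2 ^ N) * gauss_int N c w * (ennreal (sqrt 2 ^ N) * gauss_int N c (w - \<theta>\<^sup>2 / \<kappa>))"
    by (subst gauss_int_scale) (auto simp: real_sqrt_divide)
  also have "\<dots> = ennreal (2 ^ N) * (gauss_int N c w * gauss_int N c (w - \<theta>\<^sup>2 / \<kappa>))"
  proof -
    have "ennreal (2 ^ N) = ennreal (sqrt 2 ^ N) * ennreal (sqrt 2 ^ N)"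
      by (subst ennreal_mult[symmetric]) (auto simp: power_mult_distrib[symmetric])
    then show ?thesis by (simp add: mult_ac)
  qed
  finally show ?thesis
    by (subst (asm) ennreal_mult_le_mult_iff) auto
qed

section \<open>The mean square as a function of the multiplier\<close>

text \<open>
  The replica bound leaves a first difference of \<open>log_gauss\<close> over the distance \<open>\<theta>\<^sup>2 / \<kappa>\<close>, and
  slopes are at most \<open>1 / \<kappa>\<close> at distance of order \<open>\<kappa>\<close> from the maximal energy.
\<close>

lemma log_gauss_second_diff:
  assumes N: "N \<ge> 1" and p: "coercive N c w \<kappa>" "\<kappa> > 0" and t: "\<bar>\<theta>\<bar> \<le> \<kappa> / 2"
  shows "log_gauss N c (w + \<theta>) + log_gauss N c (w - \<theta>) \<le> 2 * log_gauss N c w + \<theta>\<^sup>2 / \<kappa>\<^sup>2"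
proof -
  have N0: "real N > 0" using N by simp
  have "\<theta>\<^sup>2 \<le> (\<kappa>/2)\<^sup>2" using t p by (metis abs_le_square_iff abs_of_nonneg half_gt_zero less_imp_le)
  then have "\<theta>\<^sup>2 / \<kappa> \<le> (\<kappa>/2)\<^sup>2 / \<kappa>" using p by (intro divide_right_mono) auto
  also have "\<dots> = \<kappa> / 4" using p by (simp add: power2_eq_square)
  finally have t2: "\<theta>\<^sup>2 / \<kappa> \<le> \<kappa> / 2" using p by linarith
  have p1: "coercive N c (w + \<theta>) (\<kappa> / 2)" using coercive_mono[OF coercive_shift[OF p(1), of \<theta>]] t by simp
  have p2: "coercive N c (w - \<theta>) (\<kappa> / 2)" using coercive_mono[OF coercive_shift[OF p(1), of "- \<theta>"]] t by simp
  have p3: "coercive N c (w - \<theta>\<^sup>2 / \<kappa>) (\<kappa> / 2)" using coercive_mono[OF coercive_shift[OF p(1), of "- (\<theta>\<^sup>2 / \<kappa>)"]] t2 by simp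
  have k2: "\<kappa> / 2 > 0" using p by simp
  have "ennreal (exp (real N * (log_gauss N c (w + \<theta>) + log_gauss N c (w - \<theta>)))) \<le> ennreal (exp (real N * (log_gauss N c w + log_gauss N c (w - \<theta>\<^sup>2 / \<kappa>))))"
    using gauss_int_replica[OF N p, of \<theta>]
    unfolding gauss_int_eq[OF N p1 k2] gauss_int_eq[OF N p2 k2] gauss_int_eq[OF N p3 k2] gauss_int_eq[OF N p]
    by (simp add: ennreal_mult[symmetric] exp_add[symmetric] distrib_left)
  then have "log_gauss N c (w + \<theta>) + log_gauss N c (w - \<theta>) \<le> log_gauss N c w + log_gauss N c (w - \<theta>\<^sup>2 / \<kappa>)"
    using N0 by simp
  also have "log_gauss N c (w - \<theta>\<^sup>2 / \<kappa>) \<le> log_gauss N c w + \<theta>\<^sup>2 / \<kappa> / \<kappa>"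
    using p t2 by (intro log_gauss_shift_down[OF N p]) auto
  finally show ?thesis by (simp add: power2_eq_square)
qed

text \<open>
  The expectation of \<open>|x|\<^sup>2\<close> under the Gaussian weight.  It is minus the derivative of
  \<open>log_gauss\<close> in \<open>w\<close>, and enters below through the inequality \<open>log_gauss_jensen\<close>.
\<close>

definition mean_sq :: "nat \<Rightarrow> (nat \<Rightarrow> nat \<Rightarrow> real) \<Rightarrow> real \<Rightarrow> real" where
  "mean_sq N c w = (\<integral>x. rdot N x x * exp (- (real N * confined N c w x)) \<partial>lebesgue_rn N) / (\<integral>x. exp (- (real N * confined N c w x)) \<partial>lebesgue_rn N)"

lemma gauss_int_integrable:
  assumes "N \<ge> 1" "coercive N c w \<kappa>" "\<kappa> > 0"
  shows "integrable (lebesgue_rn N) (\<lambda>x. exp (- (real N * confined N c w x)))"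
    and "(\<integral>x. exp (- (real N * confined N c w x)) \<partial>lebesgue_rn N) = exp (real N * log_gauss N c w)"
proof -
  show i: "integrable (lebesgue_rn N) (\<lambda>x. exp (- (real N * confined N c w x)))"
    using gauss_int_finite[OF assms] unfolding gauss_int_def by (intro integrableI_nonneg) auto
  have "ennreal (\<integral>x. exp (- (real N * confined N c w x)) \<partial>lebesgue_rn N) = gauss_int N c w"
    unfolding gauss_int_def by (rule nn_integral_eq_integral[symmetric, OF i]) simp
  then show "(\<integral>x. exp (- (real N * confined N c w x)) \<partial>lebesgue_rn N) = exp (real N * log_gauss N c w)"
    unfolding gauss_int_eq[OF assms] by (subst (asm) ennreal_inj) auto
qed

lemma sq_gauss_int_integrable:
  assumes "N \<ge> 1" "coercive N c w \<kappa>" "\<kappa> > 0"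
  shows "integrable (lebesgue_rn N) (\<lambda>x. rdot N x x * exp (- (real N * confined N c w x)))"
proof -
  define A where "A = real N * \<kappa> / 2"
  have A: "A > 0" using assms by (simp add: A_def)
  have p: "coercive N c (w - \<kappa> / 2) (\<kappa> / 2)" using coercive_shift[OF assms(2), of "- (\<kappa> / 2)"] by simp
  have "integrable (lebesgue_rn N) (\<lambda>x. (1 / A) * exp (- (real N * confined N c (w - \<kappa> / 2) x)))"
    using gauss_int_integrable(1)[OF assms(1) p] assms(3) by (intro integrable_mult_right) auto
  then show ?thesis
  proof (rule Bochner_Integration.integrable_bound)
    show "AE x in lebesgue_rn N. norm (rdot N x x * exp (- (real N * confined N c w x))) \<le> norm ((1 / A) * exp (- (real N * confined N c (w - \<kappa> / 2) x)))"
    proof (rule AE_I2)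
      fix x
      have "A * rdot N x x \<le> exp (A * rdot N x x)" using exp_ge_add_one_self[of "A * rdot N x x"] by linarith
      then have "rdot N x x \<le> (1 / A) * exp (A * rdot N x x)" using A by (simp add: field_simps)
      then have "rdot N x x * exp (- (real N * confined N c w x)) \<le> (1 / A) * exp (A * rdot N x x) * exp (- (real N * confined N c w x))"
        by (rule mult_right_mono) simp
      also have "\<dots> = (1 / A) * exp (- (real N * confined N c (w - \<kappa> / 2) x))"
        unfolding mult.assoc exp_add[symmetric] by (simp add: confined_shift[of N c "w - \<kappa> / 2" x w] A_def algebra_simps)
      finally show "norm (rdot N x x * exp (- (real N * confined N c w x))) \<le> norm ((1 / A) * exp (- (real N * confined N c (w - \<kappa> / 2) x)))"
        using A by simp
    qed
  qed simp
qed

lemma mean_sq_nonneg: "mean_sq N c w \<ge> 0"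
  unfolding mean_sq_def by (intro divide_nonneg_nonneg Bochner_Integration.integral_nonneg mult_nonneg_nonneg) auto

text \<open>
  Bounding the tilt \<open>exp (- N (w' - w) (|x|\<^sup>2 - s))\<close> below by its tangent shows that
  \<open>- mean_sq\<close> is a subgradient of the convex function \<open>log_gauss\<close>.
\<close>

lemma log_gauss_jensen:
  assumes N: "N \<ge> 1" and p: "coercive N c w \<kappa>" "\<kappa> > 0" and p': "coercive N c w' \<kappa>'" "\<kappa>' > 0"
  shows "log_gauss N c w - (w' - w) * mean_sq N c w \<le> log_gauss N c w'"
proof -
  let ?s = "mean_sq N c w" and ?e = "\<lambda>x. exp (- (real N * confined N c w x))"
  define T where "T = real N * (w' - w)"
  have eq: "(\<integral>x. rdot N x x * ?e x \<partial>lebesgue_rn N) = ?s * exp (real N * log_gauss N c w)"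
    unfolding mean_sq_def gauss_int_integrable(2)[OF N p] by simp
  have i1: "integrable (lebesgue_rn N) (\<lambda>x. exp (- T * ?s) * ((1 + T * ?s) * ?e x))"
    using gauss_int_integrable(1)[OF N p] by (intro integrable_mult_right) auto
  have i2: "integrable (lebesgue_rn N) (\<lambda>x. exp (- T * ?s) * (T * (rdot N x x * ?e x)))"
    using sq_gauss_int_integrable[OF N p] by (intro integrable_mult_right) auto
  have "exp (- T * ?s) * exp (real N * log_gauss N c w) =
     exp (- T * ?s) * ((1 + T * ?s) * exp (real N * log_gauss N c w)) - exp (- T * ?s) * (T * (?s * exp (real N * log_gauss N c w)))"
    by (simp add: algebra_simps)
  also have "\<dots> = (\<integral>x. exp (- T * ?s) * ((1 + T * ?s) * ?e x) - exp (- T * ?s) * (T * (rdot N x x * ?e x)) \<partial>lebesgue_rn N)"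
    by (subst Bochner_Integration.integral_diff[OF i1 i2])
       (simp add: eq gauss_int_integrable(2)[OF N p])
  also have "\<dots> \<le> (\<integral>x. exp (- (real N * confined N c w' x)) \<partial>lebesgue_rn N)"
  proof (rule integral_mono)
    fix x
    have "exp (- T * ?s) * ((1 + T * ?s) * ?e x) - exp (- T * ?s) * (T * (rdot N x x * ?e x))
      = (exp (- T * ?s) * (1 + (T * ?s - T * rdot N x x))) * ?e x"
      by (simp add: algebra_simps)
    also have "\<dots> \<le> (exp (- T * ?s) * exp (T * ?s - T * rdot N x x)) * ?e x"
      by (intro mult_right_mono mult_left_mono exp_ge_add_one_self) auto
    also have "\<dots> = exp (- (real N * confined N c w' x))"
      unfolding exp_add[symmetric] by (simp add: confined_shift[of N c w' x w] T_def algebra_simps)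
    finally show "exp (- T * ?s) * ((1 + T * ?s) * ?e x) - exp (- T * ?s) * (T * (rdot N x x * ?e x)) \<le> exp (- (real N * confined N c w' x))" .
  qed (use i1 i2 gauss_int_integrable(1)[OF N p'] in auto)
  also have "\<dots> = exp (real N * log_gauss N c w')" by (rule gauss_int_integrable(2)[OF N p'])
  finally have "exp (real N * (log_gauss N c w - (w' - w) * ?s)) \<le> exp (real N * log_gauss N c w')"
    by (simp add: exp_add[symmetric] T_def algebra_simps)
  then show ?thesis using N by simp
qed

lemma mean_sq_le:
  assumes N: "N \<ge> 1" and p: "coercive N c w \<kappa>" "\<kappa> > 0"
  shows "mean_sq N c w \<le> 1 / \<kappa>"
proof -
  have p': "coercive N c (w - \<kappa> / 2) (\<kappa> / 2)" using coercive_shift[OF p(1), of "- (\<kappa> / 2)"] by simp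
  have "log_gauss N c w + (\<kappa> / 2) * mean_sq N c w \<le> log_gauss N c (w - \<kappa> / 2)" using log_gauss_jensen[OF N p p'] p by simp
  also have "\<dots> \<le> log_gauss N c w + (\<kappa> / 2) / \<kappa>" using p by (intro log_gauss_shift_down[OF N p]) auto
  finally show ?thesis using p by (simp add: field_simps)
qed

text \<open>
  The slope of \<open>log_gauss\<close> at \<open>w\<close> dominates its average slope on \<open>[w, w + \<Lambda>]\<close>, and moving the
  multiplier by \<open>\<Lambda>\<close> at least doubles the form.
\<close>

lemma mean_sq_ge:
  assumes N: "N \<ge> 1" and p: "coercive N c w \<kappa>" "\<kappa> > 0" and L: "\<Lambda> > 0" "\<And>x. confined N c w x \<le> \<Lambda> * rdot N x x"
  shows "ln 2 / (2 * \<Lambda>) \<le> mean_sq N c w"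
proof -
  have "log_gauss N c w - \<Lambda> * mean_sq N c w \<le> log_gauss N c (w + \<Lambda>)"
    using log_gauss_jensen[OF N p coercive_shift[OF p(1), of \<Lambda>]] p L by simp
  also have "\<dots> \<le> log_gauss N c w - ln (1 + \<Lambda> / \<Lambda>) / 2"
    using L by (intro log_gauss_shift_up[OF N p]) auto
  finally show ?thesis using L by (simp add: field_simps)
qed

text \<open>
  A function whose second differences are of order \<open>\<theta>\<^sup>2\<close> stays below its tangent line plus a
  parabola: the subgradient inequality at \<open>w - \<theta>\<close> controls one of the two outer terms.
\<close>

lemma log_gauss_upper_quadratic:
  assumes N: "N \<ge> 1" and p: "coercive N c w \<kappa>" "\<kappa> > 0" and t: "\<bar>\<theta>\<bar> \<le> \<kappa> / 2"
  shows "log_gauss N c (w + \<theta>) \<le> log_gauss N c w - \<theta> * mean_sq N c w + \<theta>\<^sup>2 / \<kappa>\<^sup>2"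
proof -
  have p2: "coercive N c (w - \<theta>) (\<kappa> / 2)" using coercive_mono[OF coercive_shift[OF p(1), of "- \<theta>"]] t by simp
  have "log_gauss N c w + \<theta> * mean_sq N c w \<le> log_gauss N c (w - \<theta>)" using log_gauss_jensen[OF N p p2] p by simp
  then show ?thesis using log_gauss_second_diff[OF N p t] by linarith
qed

lemma mean_sq_antimono:
  assumes N: "N \<ge> 1" and p: "coercive N c w \<kappa>" "\<kappa> > 0" and w: "w \<le> w'"
  shows "mean_sq N c w' \<le> mean_sq N c w"
proof (cases "w = w'")
  case False
  have p': "coercive N c w' \<kappa>" using coercive_mono[OF coercive_shift[OF p(1), of "w' - w"]] w by simp
  have "log_gauss N c w - (w' - w) * mean_sq N c w \<le> log_gauss N c w'" "log_gauss N c w' - (w - w') * mean_sq N c w' \<le> log_gauss N c w"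
    by (rule log_gauss_jensen[OF N p p' p(2)] log_gauss_jensen[OF N p' p(2) p])+
  then have "(w' - w) * mean_sq N c w' \<le> (w' - w) * mean_sq N c w" by (simp add: algebra_simps)
  then show ?thesis using w False by simp
qed simp

text \<open>
  At the point \<open>w + 2 \<theta>\<close> the tangent line drawn at \<open>w + \<theta>\<close> lies below the parabola drawn at \<open>w\<close>;
  comparing the two bounds the change of slope.
\<close>

lemma mean_sq_lipschitz:
  assumes N: "N \<ge> 1" and p: "coercive N c w \<kappa>" "\<kappa> > 0" and t: "0 \<le> \<theta>" "\<theta> \<le> \<kappa> / 4"
  shows "mean_sq N c w - mean_sq N c (w + \<theta>) \<le> 4 * \<theta> / \<kappa>\<^sup>2"
proof (cases "\<theta> = 0")
  case False
  have p1: "coercive N c (w + \<theta>) (\<kappa> + \<theta>)" "coercive N c (w + 2 * \<theta>) (\<kappa> + 2 * \<theta>)" by (rule coercive_shift[OF p(1)])+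
  have k: "\<kappa> + \<theta> > 0" "\<kappa> + 2 * \<theta> > 0" using p t by auto
  have 1: "log_gauss N c (w + 2 * \<theta>) \<le> log_gauss N c w - (2 * \<theta>) * mean_sq N c w + (2 * \<theta>)\<^sup>2 / \<kappa>\<^sup>2"
    using t p by (intro log_gauss_upper_quadratic[OF N p]) auto
  have 2: "log_gauss N c (w + \<theta>) - \<theta> * mean_sq N c (w + \<theta>) \<le> log_gauss N c (w + 2 * \<theta>)"
    using log_gauss_jensen[OF N p1(1) k(1) p1(2) k(2)] by simp
  have 3: "log_gauss N c w - \<theta> * mean_sq N c w \<le> log_gauss N c (w + \<theta>)"
    using log_gauss_jensen[OF N p p1(1) k(1)] by simp
  have "\<theta> * (mean_sq N c w - mean_sq N c (w + \<theta>)) \<le> \<theta> * (4 * \<theta> / \<kappa>\<^sup>2)"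
    using 1 2 3 by (simp add: algebra_simps power2_eq_square)
  moreover have "0 < \<theta>" using t False by simp
  ultimately show ?thesis by (rule mult_left_le_imp_le)
qed simp

lemma mean_sq_continuous_on:
  assumes N: "N \<ge> 1" and p: "coercive N c w \<kappa>" "\<kappa> > 0"
  shows "continuous_on {w..} (mean_sq N c)"
proof (rule continuous_onI)
  fix x e :: real assume x: "x \<in> {w..}" and e: "e > 0"
  define d where "d = min (\<kappa> / 4) (e * \<kappa>\<^sup>2 / 8)"
  have d: "d > 0" using p e by (simp add: d_def)
  have coercive: "coercive N c y \<kappa>" if "y \<ge> w" for y using coercive_mono[OF coercive_shift[OF p(1), of "y - w"]] that by simp
  have main: "dist (mean_sq N c y) (mean_sq N c z) \<le> e" if "w \<le> y" "y \<le> z" "z - y < d" for y z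
  proof -
    have "mean_sq N c y - mean_sq N c (y + (z - y)) \<le> 4 * (z - y) / \<kappa>\<^sup>2"
      using that by (intro mean_sq_lipschitz[OF N coercive p(2)]) (auto simp: d_def)
    moreover have "z - y < e * \<kappa>\<^sup>2 / 8" "0 < e * \<kappa>\<^sup>2" using that e p by (auto simp: d_def)
    then have "4 * (z - y) \<le> 4 * (e * \<kappa>\<^sup>2 / 8)" "4 * (e * \<kappa>\<^sup>2 / 8) \<le> e * \<kappa>\<^sup>2" by simp_all
    then have "4 * (z - y) \<le> e * \<kappa>\<^sup>2" by (rule order_trans)
    then have "4 * (z - y) / \<kappa>\<^sup>2 \<le> e" using p by (simp add: field_simps)
    ultimately show ?thesis using mean_sq_antimono[OF N coercive p(2), of y z] that by (simp add: dist_real_def)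
  qed
  show "\<exists>d>0. \<forall>x'\<in>{w..}. dist x' x < d \<longrightarrow> dist (mean_sq N c x') (mean_sq N c x) \<le> e"
  proof (intro exI[of _ d] conjI ballI impI d)
    fix y assume "y \<in> {w..}" "dist y x < d"
    then show "dist (mean_sq N c y) (mean_sq N c x) \<le> e"
      using main[of y x] main[of x y] x by (cases "y \<le> x") (auto simp: dist_real_def abs_if split: if_splits)
  qed
qed

section \<open>Concentration of a Gaussian vector\<close>

text \<open>
  Chernoff's bound, with the exponential moments of \<open>|x|\<^sup>2\<close> read off from
  \<open>log_gauss_upper_quadratic\<close>.  The sign \<open>\<sigma>\<close> selects the upper or the lower tail.
\<close>

lemma gauss_int_upper_tail:
  assumes N: "N \<ge> 1" and p: "coercive N c w \<kappa>" "\<kappa> > 0" and e: "0 < \<epsilon>" "\<epsilon> \<le> 1 / \<kappa>" and sg: "\<sigma> = 1 \<or> \<sigma> = (-1::real)"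
  shows "(\<integral>\<^sup>+x. ennreal (exp (- (real N * confined N c w x))) * indicator {x. \<sigma> * (rdot N x x - mean_sq N c w) \<ge> \<epsilon>} x \<partial>lebesgue_rn N)
     \<le> ennreal (exp (- (real N * (\<epsilon>\<^sup>2 * \<kappa>\<^sup>2 / 4)))) * gauss_int N c w"
proof -
  define \<theta> where "\<theta> = \<epsilon> * \<kappa>\<^sup>2 / 2"
  have "\<epsilon> * \<kappa> \<le> 1" using e p by (simp add: field_simps)
  then have th: "0 < \<theta>" "\<theta> \<le> \<kappa> / 2" using e p mult_right_mono[of "\<epsilon> * \<kappa>" 1 \<kappa>] by (auto simp: \<theta>_def power2_eq_square)
  let ?w = "w + - \<sigma> * \<theta>"
  have p': "coercive N c ?w (\<kappa> / 2)" using coercive_mono[OF coercive_shift[OF p(1), of "- \<sigma> * \<theta>"], of "\<kappa>/2"] th sg by auto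
  have N0: "real N > 0" using N by simp
  have "(\<integral>\<^sup>+x. ennreal (exp (- (real N * confined N c w x))) * indicator {x. \<sigma> * (rdot N x x - mean_sq N c w) \<ge> \<epsilon>} x \<partial>lebesgue_rn N)
     \<le> (\<integral>\<^sup>+x. ennreal (exp (- (real N * \<theta> * (\<sigma> * mean_sq N c w + \<epsilon>)))) * ennreal (exp (- (real N * confined N c ?w x))) \<partial>lebesgue_rn N)"
  proof (intro nn_integral_mono)
    fix x
    show "ennreal (exp (- (real N * confined N c w x))) * indicator {x. \<sigma> * (rdot N x x - mean_sq N c w) \<ge> \<epsilon>} x
      \<le> ennreal (exp (- (real N * \<theta> * (\<sigma> * mean_sq N c w + \<epsilon>)))) * ennreal (exp (- (real N * confined N c ?w x)))"
    proof (cases "\<sigma> * (rdot N x x - mean_sq N c w) \<ge> \<epsilon>")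
      case True
      then have "0 \<le> (real N * \<theta>) * (\<sigma> * rdot N x x - \<sigma> * mean_sq N c w - \<epsilon>)"
        using N0 th by (intro mult_nonneg_nonneg) (auto simp: algebra_simps)
      then have "- (real N * confined N c w x) \<le> - (real N * \<theta> * (\<sigma> * mean_sq N c w + \<epsilon>)) + - (real N * confined N c ?w x)"
        unfolding confined_shift[of N c ?w x w] by (simp add: algebra_simps)
      then show ?thesis using True by (simp add: ennreal_mult[symmetric] exp_add[symmetric])
    qed simp
  qed
  also have "\<dots> = ennreal (exp (- (real N * \<theta> * (\<sigma> * mean_sq N c w + \<epsilon>)))) * gauss_int N c ?w"
    unfolding gauss_int_def by (rule nn_integral_cmult) measurable
  also have "\<dots> = ennreal (exp (real N * (log_gauss N c ?w - \<theta> * (\<sigma> * mean_sq N c w + \<epsilon>))))"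
    using p by (subst gauss_int_eq[OF N p']) (auto simp: ennreal_mult[symmetric] exp_add[symmetric] algebra_simps)
  also have "\<dots> \<le> ennreal (exp (real N * (log_gauss N c w - \<epsilon>\<^sup>2 * \<kappa>\<^sup>2 / 4)))"
  proof -
    have s2: "\<sigma>\<^sup>2 = 1" using sg by auto
    have "log_gauss N c ?w \<le> log_gauss N c w - (- \<sigma> * \<theta>) * mean_sq N c w + (- \<sigma> * \<theta>)\<^sup>2 / \<kappa>\<^sup>2"
      using sg th by (intro log_gauss_upper_quadratic[OF N p]) auto
    moreover have "(- \<sigma> * \<theta>)\<^sup>2 / \<kappa>\<^sup>2 - \<theta> * \<epsilon> = - (\<epsilon>\<^sup>2 * \<kappa>\<^sup>2 / 4)"
      using p by (simp add: power_mult_distrib s2 \<theta>_def field_simps power2_eq_square s2[unfolded power2_eq_square])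
    ultimately have "log_gauss N c ?w - \<theta> * (\<sigma> * mean_sq N c w + \<epsilon>) \<le> log_gauss N c w - \<epsilon>\<^sup>2 * \<kappa>\<^sup>2 / 4"
      by (simp add: algebra_simps)
    then show ?thesis using N0 by (intro ennreal_leI exp_mono) (simp add: mult_left_mono)
  qed
  also have "\<dots> = ennreal (exp (- (real N * (\<epsilon>\<^sup>2 * \<kappa>\<^sup>2 / 4)))) * gauss_int N c w"
    by (subst gauss_int_eq[OF N p]) (auto simp: ennreal_mult[symmetric] exp_add[symmetric] algebra_simps)
  finally show ?thesis .
qed

lemma gauss_int_linear_tail:
  assumes N: "N \<ge> 1" and p: "coercive N c w \<kappa>" "\<kappa> > 0" and e: "0 < \<epsilon>" and m: "rdot N m m \<le> 1"
  shows "(\<integral>\<^sup>+x. ennreal (exp (- (real N * confined N c w x))) * indicator {x. rdot N m x \<ge> \<epsilon>} x \<partial>lebesgue_rn N)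
     \<le> ennreal (exp (- (real N * (\<kappa> * \<epsilon>\<^sup>2)))) * gauss_int N c w"
proof -
  define T where "T = 2 * real N * \<kappa> * \<epsilon>"
  have T: "T > 0" using N p e by (simp add: T_def)
  let ?a = "\<lambda>i. T * m i"
  have "(\<integral>\<^sup>+x. ennreal (exp (- (real N * confined N c w x))) * indicator {x. rdot N m x \<ge> \<epsilon>} x \<partial>lebesgue_rn N)
    \<le> (\<integral>\<^sup>+x. ennreal (exp (- (T * \<epsilon>))) * ennreal (exp (rdot N ?a x - real N * confined N c w x)) \<partial>lebesgue_rn N)"
  proof (intro nn_integral_mono)
    fix x
    show "ennreal (exp (- (real N * confined N c w x))) * indicator {x. rdot N m x \<ge> \<epsilon>} x
      \<le> ennreal (exp (- (T * \<epsilon>))) * ennreal (exp (rdot N ?a x - real N * confined N c w x))"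
    proof (cases "rdot N m x \<ge> \<epsilon>")
      case True
      then have "T * \<epsilon> \<le> T * rdot N m x" using T by simp
      then show ?thesis using True
        unfolding rdot_scale_left by (simp add: ennreal_mult[symmetric] exp_add[symmetric])
    qed simp
  qed
  also have "\<dots> = ennreal (exp (- (T * \<epsilon>))) * (\<integral>\<^sup>+x. ennreal (exp (rdot N ?a x - real N * confined N c w x)) \<partial>lebesgue_rn N)"
    by (rule nn_integral_cmult) measurable
  also have "\<dots> \<le> ennreal (exp (- (T * \<epsilon>))) * (ennreal (exp (rdot N ?a ?a / (4 * real N * \<kappa>))) * gauss_int N c w)"
    by (intro mult_left_mono gauss_int_linear_le[OF N p]) auto
  also have "\<dots> = ennreal (exp (- (T * \<epsilon>) + rdot N ?a ?a / (4 * real N * \<kappa>))) * gauss_int N c w"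
    unfolding mult.assoc[symmetric] by (simp only: ennreal_mult[symmetric] exp_add[symmetric] exp_ge_zero)
  also have "\<dots> \<le> ennreal (exp (- (real N * (\<kappa> * \<epsilon>\<^sup>2)))) * gauss_int N c w"
  proof (intro mult_right_mono ennreal_leI exp_mono)
    have "rdot N ?a ?a / (4 * real N * \<kappa>) = (real N * \<kappa> * \<epsilon>\<^sup>2) * rdot N m m"
      unfolding rdot_scale_left rdot_scale_right T_def using N p by (simp add: field_simps power2_eq_square)
    also have "\<dots> \<le> (real N * \<kappa> * \<epsilon>\<^sup>2) * 1"
      using m N p by (intro mult_left_mono) auto
    finally have "rdot N ?a ?a / (4 * real N * \<kappa>) \<le> real N * (\<kappa> * \<epsilon>\<^sup>2)" by (simp only: mult.assoc mult_1_right)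
    moreover have "T * \<epsilon> = 2 * (real N * (\<kappa> * \<epsilon>\<^sup>2))" by (simp add: T_def power2_eq_square)
    ultimately show "- (T * \<epsilon>) + rdot N ?a ?a / (4 * real N * \<kappa>) \<le> - (real N * (\<kappa> * \<epsilon>\<^sup>2))"
      by linarith
  qed auto
  finally show ?thesis .
qed

definition conc_region :: "nat \<Rightarrow> real \<Rightarrow> (nat \<Rightarrow> real) \<Rightarrow> real \<Rightarrow> (nat \<Rightarrow> real) set" where
  "conc_region N s m \<epsilon> = {x. \<bar>rdot N x x - s\<bar> < \<epsilon> \<and> \<bar>rdot N m x\<bar> < \<epsilon>}"

lemma gauss_int_concentration:
  assumes N: "N \<ge> 1" and p: "coercive N c w \<kappa>" "\<kappa> > 0" and e: "0 < \<epsilon>" "\<epsilon> \<le> 1 / \<kappa>" and m: "rdot N m m \<le> 1"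
    and small: "2 * exp (- (real N * (\<epsilon>\<^sup>2 * \<kappa>\<^sup>2 / 4))) + 2 * exp (- (real N * (\<kappa> * \<epsilon>\<^sup>2))) \<le> 1 / 2"
  shows "ennreal (1/2) * gauss_int N c w \<le> (\<integral>\<^sup>+x. ennreal (exp (- (real N * confined N c w x))) * indicator (conc_region N (mean_sq N c w) m \<epsilon>) x \<partial>lebesgue_rn N)"
    (is "_ \<le> ?R")
proof -
  let ?f = "\<lambda>x. ennreal (exp (- (real N * confined N c w x)))"
  let ?A = "\<lambda>\<sigma>. {x. \<sigma> * (rdot N x x - mean_sq N c w) \<ge> \<epsilon>}" and ?B = "\<lambda>m. {x. rdot N m x \<ge> \<epsilon>}"
  let ?m = "\<lambda>i. -1 * m i"
  let ?e1 = "exp (- (real N * (\<epsilon>\<^sup>2 * \<kappa>\<^sup>2 / 4)))" and ?e2 = "exp (- (real N * (\<kappa> * \<epsilon>\<^sup>2)))"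
  have hh: "ennreal (1/2) + ennreal (1/2) = 1" by (subst ennreal_plus[symmetric]) auto
  have "rdot N ?m ?m \<le> 1" using m unfolding rdot_scale_left rdot_scale_right by simp
  note B = gauss_int_linear_tail[OF N p e(1) m] gauss_int_linear_tail[OF N p e(1) this]
  note A = gauss_int_upper_tail[OF N p e, of 1] gauss_int_upper_tail[OF N p e, of "-1"]
  have "gauss_int N c w \<le> (\<integral>\<^sup>+x. (?f x * indicator (conc_region N (mean_sq N c w) m \<epsilon>) x + (?f x * indicator (?A 1) x + ?f x * indicator (?A (-1)) x))
      + (?f x * indicator (?B m) x + ?f x * indicator (?B ?m) x) \<partial>lebesgue_rn N)"
    unfolding gauss_int_def
  proof (intro nn_integral_mono)
    fix x
    consider "x \<in> conc_region N (mean_sq N c w) m \<epsilon>" | "x \<in> ?A 1" | "x \<in> ?A (-1)" | "x \<in> ?B m" | "x \<in> ?B ?m"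
      unfolding rdot_scale_left conc_region_def by (fastforce simp: abs_less_iff not_less)
    then show "?f x \<le> (?f x * indicator (conc_region N (mean_sq N c w) m \<epsilon>) x + (?f x * indicator (?A 1) x + ?f x * indicator (?A (-1)) x))
      + (?f x * indicator (?B m) x + ?f x * indicator (?B ?m) x)"
      by cases (simp_all add: add_increasing add_increasing2)
  qed
  also have "\<dots> = (?R + ((\<integral>\<^sup>+x. ?f x * indicator (?A 1) x \<partial>lebesgue_rn N) + (\<integral>\<^sup>+x. ?f x * indicator (?A (-1)) x \<partial>lebesgue_rn N)))
      + ((\<integral>\<^sup>+x. ?f x * indicator (?B m) x \<partial>lebesgue_rn N) + (\<integral>\<^sup>+x. ?f x * indicator (?B ?m) x \<partial>lebesgue_rn N))"
    unfolding conc_region_def by (subst nn_integral_add; (measurable)?)+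
  also have "\<dots> \<le> (?R + (ennreal ?e1 * gauss_int N c w + ennreal ?e1 * gauss_int N c w)) + (ennreal ?e2 * gauss_int N c w + ennreal ?e2 * gauss_int N c w)"
    by (intro add_mono order_refl A B) auto
  also have "\<dots> = ?R + ennreal (2 * ?e1 + 2 * ?e2) * gauss_int N c w"
    by (simp add: distrib_right[symmetric] add.assoc ennreal_plus[symmetric] del: ennreal_plus)
  also have "\<dots> \<le> ?R + ennreal (1/2) * gauss_int N c w"
    using small by (intro add_mono mult_right_mono ennreal_leI) auto
  finally have "ennreal (1/2) * gauss_int N c w + ennreal (1/2) * gauss_int N c w \<le> ?R + ennreal (1/2) * gauss_int N c w"
    by (simp only: distrib_right[symmetric] hh mult_1)
  moreover have "ennreal (1/2) * gauss_int N c w < \<top>"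
    by (metis ennreal_mult_less_top ennreal_less_top infinity_ennreal_def gauss_int_finite[OF N p])
  ultimately show ?thesis
    unfolding add.commute[of ?R] ennreal_add_left_cancel_le by auto
qed

section \<open>Gaussian bounds for the spherical free energy\<close>

text \<open>
  The couplings of \<open>H\<^sub>N / N\<close>.
\<close>

definition scaled :: "(nat \<Rightarrow> nat \<Rightarrow> real) \<Rightarrow> nat \<Rightarrow> nat \<Rightarrow> nat \<Rightarrow> real" where
  "scaled g N i j = g i j / sqrt (real N)"

definition log_vol :: "nat \<Rightarrow> real" where
  "log_vol N = ln (ball_vol N) / real N"

lemma ball_vol_eq: "N \<ge> 1 \<Longrightarrow> ball_vol N = exp (real N * log_vol N)"
  using unit_ball_vol_pos[of "real N", OF of_nat_0_le_iff] by (simp add: log_vol_def)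

lemma hamiltonian_eq:
  assumes "N \<ge> 1"
  shows "hamiltonian g N x = real N * quad N (scaled g N) x"
proof -
  have "quad N (scaled g N) x = (\<Sum>i\<in>{1..N}. \<Sum>j\<in>{1..N}. g i j * x i * x j) / sqrt (real N)"
    by (simp add: quad_def scaled_def sum_divide_distrib)
  moreover have "real N = sqrt (real N) * sqrt (real N)" by simp
  ultimately show ?thesis using assms unfolding hamiltonian_def by (metis (no_types, lifting) mult.assoc nonzero_mult_div_cancel_left of_nat_0_less_iff less_le_trans less_numeral_extra(1) nonzero_eq_divide_eq real_sqrt_gt_0_iff times_divide_eq_right less_irrefl)
qed

lemma quad_le_sum:
  "\<bar>quad N c x\<bar> \<le> (\<Sum>i\<in>{1..N}. \<Sum>j\<in>{1..N}. \<bar>c i j\<bar>) * rdot N x x"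
proof -
  have xi: "\<bar>x i\<bar> \<le> rnorm N x" if "i \<in> {1..N}" for i
  proof -
    have "\<bar>x i\<bar> \<le> L2_set (\<lambda>i. \<bar>x i\<bar>) {1..N}" using that by (intro member_le_L2_set) auto
    then show ?thesis by (simp add: rnorm_def L2_set_def)
  qed
  have "\<bar>quad N c x\<bar> \<le> (\<Sum>i\<in>{1..N}. \<Sum>j\<in>{1..N}. \<bar>c i j\<bar> * rdot N x x)"
    unfolding quad_def
  proof (intro order_trans [OF sum_abs] sum_mono)
    fix i j assume ij: "i \<in> {1..N}" "j \<in> {1..N}"
    have "\<bar>x i\<bar> * \<bar>x j\<bar> \<le> rnorm N x * rnorm N x" using ij by (intro mult_mono xi) auto
    then have "\<bar>c i j\<bar> * (\<bar>x i\<bar> * \<bar>x j\<bar>) \<le> \<bar>c i j\<bar> * rdot N x x"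
      by (intro mult_left_mono) (auto simp: rdot_self power2_eq_square)
    then show "\<bar>c i j * x i * x j\<bar> \<le> \<bar>c i j\<bar> * rdot N x x" by (simp add: abs_mult mult.assoc)
  qed
  then show ?thesis by (simp add: sum_distrib_right)
qed

lemma AE_uniform_sphere_rdot: "N \<ge> 1 \<Longrightarrow> AE \<sigma> in uniform_sphere N. rdot N \<sigma> \<sigma> = 1"
  using AE_uniform_sphere[of N] by (auto simp: rdot_self)

text \<open>
  An exponent that is bounded on the unit sphere gives an integrable weight with integral between
  \<open>exp (- B)\<close> and \<open>exp B\<close>, since the measure lives on the sphere.
\<close>

lemma sphere_exp_integrable:
  assumes N: "N \<ge> 1" and [measurable]: "f \<in> borel_measurable (uniform_sphere N)"
    and B: "\<And>\<sigma>. rdot N \<sigma> \<sigma> = 1 \<Longrightarrow> \<bar>f \<sigma>\<bar> \<le> B"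
  shows "integrable (uniform_sphere N) (\<lambda>\<sigma>. exp (f \<sigma>))"
    and "(\<integral>\<sigma>. exp (f \<sigma>) \<partial>uniform_sphere N) \<ge> exp (- B)"
    and "(\<integral>\<sigma>. exp (f \<sigma>) \<partial>uniform_sphere N) \<le> exp B"
    and "ennreal (\<integral>\<sigma>. exp (f \<sigma>) \<partial>uniform_sphere N) = (\<integral>\<^sup>+\<sigma>. ennreal (exp (f \<sigma>)) \<partial>uniform_sphere N)"
proof -
  interpret U: prob_space "uniform_sphere N" by (rule prob_space_uniform_sphere)
  have ae: "AE \<sigma> in uniform_sphere N. \<bar>f \<sigma>\<bar> \<le> B"
    using AE_uniform_sphere_rdot[OF N] by eventually_elim (rule B)
  show i: "integrable (uniform_sphere N) (\<lambda>\<sigma>. exp (f \<sigma>))"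
  proof (rule U.integrable_const_bound[of _ "exp B"])
    show "AE x in uniform_sphere N. norm (exp (f x)) \<le> exp B" using ae by eventually_elim auto
  qed measurable
  have "(\<integral>\<sigma>. exp (- B) \<partial>uniform_sphere N) \<le> (\<integral>\<sigma>. exp (f \<sigma>) \<partial>uniform_sphere N)"
    by (rule integral_mono_AE[OF _ i]) (use ae in \<open>auto elim!: eventually_mono\<close>)
  then show "(\<integral>\<sigma>. exp (f \<sigma>) \<partial>uniform_sphere N) \<ge> exp (- B)" by (simp add: U.prob_space)
  have "(\<integral>\<sigma>. exp (f \<sigma>) \<partial>uniform_sphere N) \<le> (\<integral>\<sigma>. exp B \<partial>uniform_sphere N)"
    by (rule integral_mono_AE[OF i]) (use ae in \<open>auto elim!: eventually_mono\<close>)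
  then show "(\<integral>\<sigma>. exp (f \<sigma>) \<partial>uniform_sphere N) \<le> exp B" by (simp add: U.prob_space)
  show "ennreal (\<integral>\<sigma>. exp (f \<sigma>) \<partial>uniform_sphere N) = (\<integral>\<^sup>+\<sigma>. ennreal (exp (f \<sigma>)) \<partial>uniform_sphere N)"
    by (rule nn_integral_eq_integral[symmetric, OF i]) simp
qed

text \<open>
  The exponent of the Gibbs weight, defined on all of \<open>\<real>\<^sup>N\<close>.
\<close>

definition exponent :: "(nat \<Rightarrow> nat \<Rightarrow> real) \<Rightarrow> nat \<Rightarrow> real \<Rightarrow> (nat \<Rightarrow> real) \<Rightarrow> (nat \<Rightarrow> real) \<Rightarrow> real" where
  "exponent g N \<beta> h x = real N * (\<beta> * quad N (scaled g N) x + rdot N h x)"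

lemma exponent_measurable [measurable]:
  "exponent g N \<beta> h \<in> borel_measurable (\<Pi>\<^sub>M i\<in>{1..N}. borel)"
  "exponent g N \<beta> h \<in> borel_measurable (lebesgue_rn N)"
  "exponent g N \<beta> h \<in> borel_measurable (uniform_sphere N)"
proof -
  show "exponent g N \<beta> h \<in> borel_measurable (\<Pi>\<^sub>M i\<in>{1..N}. borel)" "exponent g N \<beta> h \<in> borel_measurable (lebesgue_rn N)"
    unfolding exponent_def[abs_def] by measurable
  then show "exponent g N \<beta> h \<in> borel_measurable (uniform_sphere N)"
    by (subst measurable_cong_sets[OF sets_uniform_sphere refl])
qed

lemma exponent_bound:
  assumes K: "\<And>x. \<bar>quad N (scaled g N) x\<bar> \<le> K * rdot N x x" and s: "rdot N \<sigma> \<sigma> = 1"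
  shows "\<bar>exponent g N \<beta> h \<sigma>\<bar> \<le> real N * (\<bar>\<beta>\<bar> * K + rnorm N h)"
proof -
  have "rnorm N \<sigma> = 1" using s by (simp add: rnorm_eq_sqrt)
  then have "\<bar>rdot N h \<sigma>\<bar> \<le> rnorm N h" using rdot_le_rnorm[of N h \<sigma>] by simp
  moreover have "\<bar>\<beta> * quad N (scaled g N) \<sigma>\<bar> \<le> \<bar>\<beta>\<bar> * K" using K[of \<sigma>] s by (simp add: abs_mult mult_left_mono)
  ultimately show ?thesis unfolding exponent_def abs_mult[of "real N"] by (intro mult_mono) auto
qed

lemma partition_function_exponent:
  assumes "N \<ge> 1"
  shows "partition_function g N \<beta> h = (\<integral>\<sigma>. exp (exponent g N \<beta> h \<sigma>) \<partial>uniform_sphere N)"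
  unfolding partition_function_def exponent_def hamiltonian_eq[OF assms] by (simp add: algebra_simps)

lemma
  assumes N: "N \<ge> 1"
  shows partition_function_pos: "partition_function g N \<beta> h > 0"
    and partition_function_eq: "partition_function g N \<beta> h = exp (real N * free_energy g N \<beta> h)"
    and partition_function_nn: "ennreal (partition_function g N \<beta> h) = (\<integral>\<^sup>+\<sigma>. ennreal (exp (exponent g N \<beta> h \<sigma>)) \<partial>uniform_sphere N)"
proof -
  note * = sphere_exp_integrable[OF N exponent_measurable(3)[of g N \<beta> h] exponent_bound[OF quad_le_sum], folded partition_function_exponent[OF N]]
  show p: "partition_function g N \<beta> h > 0" using *(2) exp_gt_zero less_le_trans by blast
  show "partition_function g N \<beta> h = exp (real N * free_energy g N \<beta> h)"
    using p N by (simp add: free_energy_def)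
  show "ennreal (partition_function g N \<beta> h) = (\<integral>\<^sup>+\<sigma>. ennreal (exp (exponent g N \<beta> h \<sigma>)) \<partial>uniform_sphere N)"
    using *(4) by simp
qed

lemma free_energy_ge:
  assumes N: "N \<ge> 1" and K: "\<And>x. \<bar>quad N (scaled g N) x\<bar> \<le> K * rdot N x x"
  shows "- (\<bar>\<beta>\<bar> * K + rnorm N h) \<le> free_energy g N \<beta> h"
proof -
  have "exp (- (real N * (\<bar>\<beta>\<bar> * K + rnorm N h))) \<le> exp (real N * free_energy g N \<beta> h)"
    unfolding partition_function_eq[OF N, symmetric] partition_function_exponent[OF N]
    by (rule sphere_exp_integrable(2)[OF N exponent_measurable(3) exponent_bound[OF K]])
  then have "real N * - (\<bar>\<beta>\<bar> * K + rnorm N h) \<le> real N * free_energy g N \<beta> h" by (simp only: exp_le_cancel_iff mult_minus_right)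
  then show ?thesis using N by (subst (asm) mult_le_cancel_left_pos) auto
qed

lemma free_energy_lipschitz:
  assumes N: "N \<ge> 1" and K: "\<And>x. \<bar>quad N (scaled g N) x\<bar> \<le> K * rdot N x x"
  shows "free_energy g N \<beta> h \<le> free_energy g N \<beta>' h + K * \<bar>\<beta> - \<beta>'\<bar>"
proof -
  have "ennreal (partition_function g N \<beta> h) \<le> (\<integral>\<^sup>+\<sigma>. ennreal (exp (real N * (K * \<bar>\<beta> - \<beta>'\<bar>))) * ennreal (exp (exponent g N \<beta>' h \<sigma>)) \<partial>uniform_sphere N)"
    unfolding partition_function_nn[OF N]
  proof (rule nn_integral_mono_AE)
    show "AE \<sigma> in uniform_sphere N. ennreal (exp (exponent g N \<beta> h \<sigma>)) \<le> ennreal (exp (real N * (K * \<bar>\<beta> - \<beta>'\<bar>))) * ennreal (exp (exponent g N \<beta>' h \<sigma>))"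
      using AE_uniform_sphere_rdot[OF N]
    proof eventually_elim
      fix \<sigma> assume s: "rdot N \<sigma> \<sigma> = 1"
      have "(\<beta> - \<beta>') * quad N (scaled g N) \<sigma> \<le> \<bar>\<beta> - \<beta>'\<bar> * \<bar>quad N (scaled g N) \<sigma>\<bar>" by (metis abs_ge_self abs_mult)
      also have "\<dots> \<le> \<bar>\<beta> - \<beta>'\<bar> * K" using K[of \<sigma>] s by (intro mult_left_mono) auto
      finally have "\<beta> * quad N (scaled g N) \<sigma> + rdot N h \<sigma> \<le> K * \<bar>\<beta> - \<beta>'\<bar> + (\<beta>' * quad N (scaled g N) \<sigma> + rdot N h \<sigma>)" by (simp add: algebra_simps)
      then have "exponent g N \<beta> h \<sigma> \<le> real N * (K * \<bar>\<beta> - \<beta>'\<bar>) + exponent g N \<beta>' h \<sigma>"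
        unfolding exponent_def distrib_left[symmetric] by (intro mult_left_mono) auto
      then show "ennreal (exp (exponent g N \<beta> h \<sigma>)) \<le> ennreal (exp (real N * (K * \<bar>\<beta> - \<beta>'\<bar>))) * ennreal (exp (exponent g N \<beta>' h \<sigma>))"
        by (simp add: ennreal_mult[symmetric] exp_add[symmetric])
    qed
  qed
  also have "\<dots> = ennreal (exp (real N * (K * \<bar>\<beta> - \<beta>'\<bar>))) * ennreal (partition_function g N \<beta>' h)"
    unfolding partition_function_nn[OF N] by (rule nn_integral_cmult) measurable
  finally have "exp (real N * free_energy g N \<beta> h) \<le> exp (real N * (K * \<bar>\<beta> - \<beta>'\<bar>) + real N * free_energy g N \<beta>' h)"
    unfolding partition_function_eq[OF N] by (simp add: ennreal_mult[symmetric] exp_add)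
  then have "real N * free_energy g N \<beta> h \<le> real N * (free_energy g N \<beta>' h + K * \<bar>\<beta> - \<beta>'\<bar>)" by (simp add: distrib_left)
  then show ?thesis using N by (subst (asm) mult_le_cancel_left_pos) auto
qed

lemma free_energy_0: "free_energy g N 0 (\<lambda>_. 0) = 0"
proof -
  interpret U: prob_space "uniform_sphere N" by (rule prob_space_uniform_sphere)
  show ?thesis by (simp add: free_energy_def partition_function_def rdot_def U.prob_space)
qed

text \<open>
  On the shell where \<open>|x|\<close> lies between \<open>exp (- 1 / N)\<close> and 1 the confined form at \<open>x\<close> is at most
  its value at \<open>x / |x|\<close>, so the spherical weight is bounded by \<open>exp (N \<beta> w)\<close> times the Gaussian
  weight at \<open>x\<close>, up to \<open>exp |h|\<close> from the field.  The shell contains the fraction \<open>1 - 1 / e\<close> of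
  the ball, whence an error of order \<open>1 / N\<close> only.  The Gaussian integral with field is evaluated at
  its centre \<open>m\<close>.
\<close>

lemma sphere_upper:
  assumes N: "N \<ge> 1" and p: "coercive N (scaled g N) w \<kappa>" "\<kappa> > 0" and b: "\<beta> > 0"
    and m: "\<And>x. 2 * (\<beta> * confined_bilin N (scaled g N) w m x) = rdot N h x"
  shows "free_energy g N \<beta> h + ln \<beta> / 2 + log_vol N
    \<le> \<beta> * w + rdot N h m - \<beta> * confined N (scaled g N) w m + log_gauss N (scaled g N) w + (rnorm N h + 1) / real N"
proof -
  let ?c = "scaled g N"
  have N0: "real N > 0" using N by simp
  define G where "G \<sigma> = ennreal (exp (exponent g N \<beta> h \<sigma>))" for \<sigma>
  define I where "I = (\<integral>\<^sup>+\<sigma>. G \<sigma> \<partial>uniform_sphere N)"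
  have Gm [measurable]: "G \<in> borel_measurable (\<Pi>\<^sub>M i\<in>{1..N}. borel)" unfolding G_def[abs_def] by measurable
  have I: "I = ennreal (exp (real N * free_energy g N \<beta> h))"
    unfolding I_def G_def partition_function_nn[OF N, symmetric] partition_function_eq[OF N] ..
  \<comment> \<open>The ball of this radius has the fraction \<open>1 / e\<close> of the volume of the unit ball.\<close>
  define r where "r = exp (- (1 / real N))"
  have r: "r > 0" "r \<le> 1" "1 - 1 / real N \<le> r" "r ^ N = exp (- 1)"
    using N0 exp_ge_add_one_self[of "- (1 / real N)"] by (auto simp: r_def exp_of_nat_mult[symmetric])
  let ?g = "\<lambda>x. G (\<lambda>i\<in>{1..N}. x i / rnorm N x)"
  let ?Ann = "{x. r < rnorm N x \<and> rnorm N x \<le> 1}"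
  have gm [measurable]: "?g \<in> borel_measurable (lebesgue_rn N)"
    by (rule measurable_compose[OF normalise_measurable Gm])
  have "ennreal (ball_vol N) * I = (\<integral>\<^sup>+x. ?g x * indicator {x. rnorm N x \<le> 1} x \<partial>lebesgue_rn N)"
    unfolding I_def by (rule nn_integral_uniform_sphere) measurable
  also have "\<dots> = (\<integral>\<^sup>+x. ?g x * indicator {x. rnorm N x \<le> r} x + ?g x * indicator ?Ann x \<partial>lebesgue_rn N)"
    using r by (intro nn_integral_cong) (auto simp: indicator_def)
  also have "\<dots> = ennreal (r ^ N * ball_vol N) * I + (\<integral>\<^sup>+x. ?g x * indicator ?Ann x \<partial>lebesgue_rn N)"
    unfolding I_def nn_integral_uniform_sphere_radius[OF Gm r(1), symmetric]
    by (rule nn_integral_add) measurable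
  finally have split: "ennreal (ball_vol N) * I = ennreal (r ^ N * ball_vol N) * I + (\<integral>\<^sup>+x. ?g x * indicator ?Ann x \<partial>lebesgue_rn N)" .
  have "(\<integral>\<^sup>+x. ?g x * indicator ?Ann x \<partial>lebesgue_rn N) \<le>
     (\<integral>\<^sup>+x. ennreal (exp (real N * (\<beta> * w) + rnorm N h)) * ennreal (exp (real N * (rdot N h x - \<beta> * confined N ?c w x))) \<partial>lebesgue_rn N)"
  proof (intro nn_integral_mono)
    fix x
    show "?g x * indicator ?Ann x \<le> ennreal (exp (real N * (\<beta> * w) + rnorm N h)) * ennreal (exp (real N * (rdot N h x - \<beta> * confined N ?c w x)))"
    proof (cases "x \<in> ?Ann")
      case True
      define \<rho> where "\<rho> = rnorm N x"
      let ?s = "\<lambda>i. (1 / \<rho>) * x i"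
      have rho: "r < \<rho>" "\<rho> \<le> 1" "\<rho> > 0" using True r by (auto simp: \<rho>_def)
      have xx: "rdot N x x = \<rho>\<^sup>2" by (simp add: rdot_self \<rho>_def)
      have ss: "rdot N ?s ?s = 1" unfolding rdot_scale_left rdot_scale_right xx using rho by (simp add: power2_eq_square)
      have "confined N ?c w x \<ge> 0" using coerciveD[OF p(1), of x] p(2) by (meson less_imp_le mult_nonneg_nonneg order_trans rdot_self_nonneg)
      moreover have "1 \<le> (1 / \<rho>)\<^sup>2" using rho by (simp add: power_divide power_le_one)
      ultimately have "confined N ?c w x \<le> confined N ?c w ?s" unfolding confined_scale by (metis mult_right_mono mult_1)
      then have t: "quad N ?c ?s \<le> w - confined N ?c w x" using ss unfolding confined_def[of N ?c w ?s] by simp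
      have hx: "\<bar>rdot N h x\<bar> \<le> rnorm N h * \<rho>" unfolding \<rho>_def by (rule rdot_le_rnorm)
      have "rdot N h ?s - rdot N h x = rdot N h x * ((1 - \<rho>) / \<rho>)" unfolding rdot_scale_right using rho by (simp add: field_simps)
      also have "\<dots> \<le> (rnorm N h * \<rho>) * ((1 - \<rho>) / \<rho>)" using rho hx by (intro mult_right_mono) auto
      also have "\<dots> = rnorm N h * (1 - \<rho>)" using rho by simp
      also have "\<dots> \<le> rnorm N h * (1 / real N)" using rho r by (intro mult_left_mono) auto
      finally have "real N * (rdot N h ?s - rdot N h x) \<le> real N * (rnorm N h * (1 / real N))" using N0 by (intro mult_left_mono) auto
      then have l: "real N * rdot N h ?s \<le> real N * rdot N h x + rnorm N h" using N0 by (simp add: right_diff_distrib)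
      have "real N * (\<beta> * quad N ?c ?s) \<le> real N * (\<beta> * (w - confined N ?c w x))" using t b N0 by simp
      then have "exponent g N \<beta> h ?s \<le> (real N * (\<beta> * w) + rnorm N h) + real N * (rdot N h x - \<beta> * confined N ?c w x)"
        using l unfolding exponent_def by (simp add: algebra_simps)
      moreover have "?g x = ennreal (exp (exponent g N \<beta> h ?s))"
      proof -
        have "(\<lambda>i\<in>{1..N}. x i / rnorm N x) = restrict ?s {1..N}" by (simp add: \<rho>_def)
        then show ?thesis by (simp only: G_def exponent_def quad_restrict rdot_restrict_right)
      qed
      ultimately show ?thesis using True by (simp add: ennreal_mult[symmetric] exp_add[symmetric])
    qed simp
  qed
  also have "\<dots> = ennreal (exp (real N * (\<beta> * w) + rnorm N h)) * (\<integral>\<^sup>+x. ennreal (exp (real N * (rdot N h x - \<beta> * confined N ?c w x))) \<partial>lebesgue_rn N)"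
    by (rule nn_integral_cmult) measurable
  finally have Ann: "(\<integral>\<^sup>+x. ?g x * indicator ?Ann x \<partial>lebesgue_rn N) \<le> \<dots>" .
  have lin: "(\<integral>\<^sup>+x. ennreal (exp (real N * (rdot N h x - \<beta> * confined N ?c w x))) \<partial>lebesgue_rn N)
     = ennreal (exp (real N * (rdot N h m - \<beta> * confined N ?c w m))) * ennreal (exp (real N * (log_gauss N ?c w - ln \<beta> / 2)))"
  proof -
    let ?c' = "\<lambda>i j. \<beta> * ?c i j"
    have q': "quad N ?c' x = \<beta> * quad N ?c x" and b': "bilin N ?c' x y = \<beta> * bilin N ?c x y" for x y
      by (simp_all add: quad_def bilin_def sum_distrib_left mult_ac)
    have tq': "confined N ?c' (\<beta> * w) x = \<beta> * confined N ?c w x" and tb': "confined_bilin N ?c' (\<beta> * w) x y = \<beta> * confined_bilin N ?c w x y" for x y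
      by (simp_all add: confined_def confined_bilin_def q' b' algebra_simps)
    have "gauss_int N ?c' (\<beta> * w) = ennreal (exp (real N * (log_gauss N ?c w - ln \<beta> / 2)))"
      unfolding gauss_int_def[of N ?c'] tq' gauss_int_scale[OF b] exp_half_N_ln[OF b] gauss_int_eq[OF N p]
      by (simp add: ennreal_mult[symmetric] exp_add[symmetric] algebra_simps)
    then show ?thesis using gauss_int_linear[of N ?c' "\<beta> * w" m h] m unfolding tq' tb' by simp
  qed
  have "ennreal (ball_vol N) * I \<le> ennreal (exp (- 1) * ball_vol N) * I +
     ennreal (exp (real N * (\<beta> * w) + rnorm N h)) * (ennreal (exp (real N * (rdot N h m - \<beta> * confined N ?c w m))) * ennreal (exp (real N * (log_gauss N ?c w - ln \<beta> / 2))))"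
    unfolding split r(4) lin[symmetric] by (rule add_left_mono[OF Ann])
  then have "exp (real N * log_vol N) * exp (real N * free_energy g N \<beta> h) \<le> exp (- 1) * exp (real N * log_vol N) * exp (real N * free_energy g N \<beta> h) +
     exp (real N * (\<beta> * w) + rnorm N h) * (exp (real N * (rdot N h m - \<beta> * confined N ?c w m)) * exp (real N * (log_gauss N ?c w - ln \<beta> / 2)))"
    unfolding I ball_vol_eq[OF N] by (simp add: ennreal_mult[symmetric] ennreal_plus[symmetric] del: ennreal_plus)
  moreover have "2 * exp (- 1 :: real) \<le> 1" using exp_ge_add_one_self[of "1::real"] by (simp add: exp_minus field_simps)
  then have "2 * exp (- 1) * (exp (real N * log_vol N) * exp (real N * free_energy g N \<beta> h)) \<le> 1 * (exp (real N * log_vol N) * exp (real N * free_energy g N \<beta> h))"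
    by (intro mult_right_mono) auto
  ultimately have "exp (- 1) * (exp (real N * log_vol N) * exp (real N * free_energy g N \<beta> h)) \<le>
     exp (real N * (\<beta> * w) + rnorm N h) * (exp (real N * (rdot N h m - \<beta> * confined N ?c w m)) * exp (real N * (log_gauss N ?c w - ln \<beta> / 2)))"
    by linarith
  then have "real N * (free_energy g N \<beta> h + ln \<beta> / 2 + log_vol N)
    \<le> real N * (\<beta> * w + rdot N h m - \<beta> * confined N (scaled g N) w m + log_gauss N (scaled g N) w) + (rnorm N h + 1)"
    unfolding exp_add[symmetric] by (simp add: algebra_simps)
  also have "\<dots> = real N * (\<beta> * w + rdot N h m - \<beta> * confined N (scaled g N) w m + log_gauss N (scaled g N) w + (rnorm N h + 1) / real N)"
  proof -
    have "real N * ((rnorm N h + 1) / real N) = rnorm N h + 1" using N0 by simp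
    then show ?thesis by (simp only: distrib_left)
  qed
  finally show ?thesis using N0 by (subst (asm) mult_le_cancel_left_pos) auto
qed

text \<open>
  Put \<open>x = m + y / sqrt \<beta>\<close> with \<open>y\<close> distributed according to the Gaussian weight at \<open>w\<close>.  The
  condition on \<open>m\<close> says that \<open>|x|\<^sup>2\<close> has mean 1, and by \<open>gauss_int_concentration\<close> at least half of
  the Gaussian mass lies in a thin shell around the unit sphere, where the spherical weight at
  \<open>x / |x|\<close> and the weight at \<open>x\<close> are comparable.  In the exponent the terms quadratic in \<open>y\<close>
  reduce to \<open>w |y|\<^sup>2\<close>, which is nearly \<open>w s(w)\<close>; the terms linear in \<open>y\<close> can be dropped because
  the region is symmetric under \<open>y \<mapsto> - y\<close>.
\<close>

lemma sphere_lower: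
  assumes N: "N \<ge> 1" and K: "\<And>x. \<bar>quad N (scaled g N) x\<bar> \<le> K * rdot N x x"
    and p: "coercive N (scaled g N) w \<kappa>" "\<kappa> > 0" and b: "\<beta> > 0"
    and m: "\<beta> * (1 - rdot N m m) = mean_sq N (scaled g N) w"
    and e: "0 < \<epsilon>" "\<epsilon> \<le> 1 / 2" and d: "0 < \<delta>" "\<delta> \<le> 1 / \<kappa>" "2 * \<delta> / sqrt \<beta> + \<delta> / \<beta> \<le> \<epsilon>"
    and small: "2 * exp (- (real N * (\<delta>\<^sup>2 * \<kappa>\<^sup>2 / 4))) + 2 * exp (- (real N * (\<kappa> * \<delta>\<^sup>2))) \<le> 1 / 2"
  shows "\<beta> * quad N (scaled g N) m + rdot N h m + w * mean_sq N (scaled g N) w + log_gauss N (scaled g N) w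
     - \<bar>w\<bar> * \<delta> - (\<beta> * K + rnorm N h + 1) * \<epsilon> - 1 / real N \<le> free_energy g N \<beta> h + ln \<beta> / 2 + log_vol N"
proof -
  let ?c = "scaled g N" and ?s = "mean_sq N (scaled g N) w"
  have N0: "real N > 0" using N by simp
  have mm: "rdot N m m \<le> 1"
    using m mean_sq_nonneg[of N ?c w] b by (metis diff_ge_0_iff_ge zero_le_mult_iff less_le_not_le)
  define G where "G \<sigma> = ennreal (exp (exponent g N \<beta> h \<sigma>))" for \<sigma>
  define I where "I = (\<integral>\<^sup>+\<sigma>. G \<sigma> \<partial>uniform_sphere N)"
  have Gm [measurable]: "G \<in> borel_measurable (\<Pi>\<^sub>M i\<in>{1..N}. borel)" unfolding G_def[abs_def] by measurable
  have I: "I = ennreal (exp (real N * free_energy g N \<beta> h))"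
    unfolding I_def G_def partition_function_nn[OF N, symmetric] partition_function_eq[OF N] ..
  let ?g = "\<lambda>x. G (\<lambda>i\<in>{1..N}. x i / rnorm N x)"
  have gm [measurable]: "?g \<in> borel_measurable (lebesgue_rn N)"
    by (rule measurable_compose[OF normalise_measurable Gm])
  let ?Ann = "{x. \<bar>rdot N x x - 1\<bar> \<le> \<epsilon>}"
  let ?C1 = "exp (- (real N * ((\<beta> * K + rnorm N h) * \<epsilon>)))"
  define f where "f x = ennreal (exp (exponent g N \<beta> h x)) * indicator ?Ann x" for x
  have fm [measurable]: "f \<in> borel_measurable (lebesgue_rn N)" unfolding f_def[abs_def] by measurable
  have K0: "K \<ge> 0"
  proof -
    have "rdot N (\<lambda>i. if i = 1 then 1 else 0) (\<lambda>i. if i = 1 then 1 else 0) = 1"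
      using N by (simp add: rdot_def if_distrib[of "\<lambda>x. x * _"] cong: if_cong)
    then show ?thesis using K[of "\<lambda>i. if i = 1 then 1 else 0"] by auto
  qed
  have s1: "sqrt (1 + \<epsilon>) > 0" using e by simp
  have ub: "ennreal ?C1 * (\<integral>\<^sup>+x. f x \<partial>lebesgue_rn N) \<le> ennreal (sqrt (1 + \<epsilon>) ^ N * ball_vol N) * I"
  proof -
    have "ennreal ?C1 * (\<integral>\<^sup>+x. f x \<partial>lebesgue_rn N) = (\<integral>\<^sup>+x. ennreal ?C1 * f x \<partial>lebesgue_rn N)"
      by (rule nn_integral_cmult[symmetric]) measurable
    also have "\<dots> \<le> (\<integral>\<^sup>+x. ?g x * indicator {x. rnorm N x \<le> sqrt (1 + \<epsilon>)} x \<partial>lebesgue_rn N)"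
    proof (intro nn_integral_mono)
      fix x
      show "ennreal ?C1 * f x \<le> ?g x * indicator {x. rnorm N x \<le> sqrt (1 + \<epsilon>)} x"
      proof (cases "x \<in> ?Ann")
        case True
        define \<rho> where "\<rho> = rnorm N x"
        let ?z = "\<lambda>i. (1 / \<rho>) * x i"
        have xx: "rdot N x x = \<rho>\<^sup>2" by (simp add: rdot_self \<rho>_def)
        have r2: "\<bar>\<rho>\<^sup>2 - 1\<bar> \<le> \<epsilon>" using True by (simp add: xx)
        then have "\<rho>\<^sup>2 \<ge> 1/2" using e by linarith
        then have rho0: "\<rho> > 0" by (metis \<rho>_def less_eq_real_def not_one_le_zero power_zero_numeral rnorm_nonneg half_gt_zero_iff linorder_not_le zero_less_one)
        have "\<bar>\<rho> - 1\<bar> * 1 \<le> \<bar>\<rho> - 1\<bar> * (\<rho> + 1)" using rho0 by (intro mult_left_mono) auto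
        also have "\<dots> = \<bar>(\<rho> - 1) * (\<rho> + 1)\<bar>" using rho0 by (simp add: abs_mult)
        also have "\<dots> = \<bar>\<rho>\<^sup>2 - 1\<bar>" by (simp add: power2_eq_square algebra_simps)
        finally have "\<bar>\<rho> - 1\<bar> \<le> \<bar>\<rho>\<^sup>2 - 1\<bar>" by (simp only: mult_1_right)
        then have r1: "\<bar>\<rho> - 1\<bar> \<le> \<epsilon>" using r2 by (rule order_trans)
        have "\<bar>quad N ?c x - quad N ?c ?z\<bar> = \<bar>quad N ?c x\<bar> * \<bar>1 - (1 / \<rho>)\<^sup>2\<bar>"
          unfolding quad_scale abs_mult[symmetric] by (simp add: algebra_simps)
        also have "\<dots> \<le> (K * \<rho>\<^sup>2) * \<bar>1 - (1 / \<rho>)\<^sup>2\<bar>" using K[of x] by (intro mult_right_mono) (auto simp: xx)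
        also have "\<dots> = K * \<bar>\<rho>\<^sup>2 * (1 - (1 / \<rho>)\<^sup>2)\<bar>" by (simp add: abs_mult)
        also have "\<dots> = K * \<bar>\<rho>\<^sup>2 - 1\<bar>" using rho0 by (simp add: right_diff_distrib power_divide)
        finally have "\<bar>quad N ?c x - quad N ?c ?z\<bar> \<le> K * \<epsilon>" using r2 K0 by (meson mult_left_mono order_trans)
        then have q: "\<beta> * quad N ?c x \<le> \<beta> * quad N ?c ?z + \<beta> * (K * \<epsilon>)"
          using b by (subst distrib_left[symmetric]) (intro mult_left_mono, auto)
        have "rdot N h x - rdot N h ?z = rdot N h x * ((\<rho> - 1) / \<rho>)"
          unfolding rdot_scale_right using rho0 by (simp add: field_simps)
        also have "\<dots> \<le> \<bar>rdot N h x\<bar> * \<bar>(\<rho> - 1) / \<rho>\<bar>" by (metis abs_ge_self abs_mult)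
        also have "\<dots> \<le> (rnorm N h * \<rho>) * \<bar>(\<rho> - 1) / \<rho>\<bar>" using rdot_le_rnorm[of N h x] by (intro mult_right_mono) (auto simp: \<rho>_def)
        also have "\<dots> = rnorm N h * \<bar>\<rho> - 1\<bar>" using rho0 by (simp add: abs_divide)
        also have "\<dots> \<le> rnorm N h * \<epsilon>" using r1 by (intro mult_left_mono) auto
        finally have "\<beta> * quad N ?c x + rdot N h x \<le> (\<beta> * K + rnorm N h) * \<epsilon> + (\<beta> * quad N ?c ?z + rdot N h ?z)"
          using q by (simp add: algebra_simps)
        then have "- (real N * ((\<beta> * K + rnorm N h) * \<epsilon>)) + exponent g N \<beta> h x \<le> exponent g N \<beta> h ?z"
          unfolding exponent_def using N0 by (metis (no_types, lifting) add_le_cancel_left distrib_left minus_add_cancel mult_left_mono of_nat_0_le_iff)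
        moreover have "?g x = ennreal (exp (exponent g N \<beta> h ?z))"
      proof -
        have "(\<lambda>i\<in>{1..N}. x i / rnorm N x) = restrict ?z {1..N}" by (simp add: \<rho>_def)
        then show ?thesis by (simp only: G_def exponent_def quad_restrict rdot_restrict_right)
      qed
        moreover have "rnorm N x \<le> sqrt (1 + \<epsilon>)" using r2 unfolding \<rho>_def[symmetric] by (intro real_le_rsqrt) auto
        ultimately show ?thesis using True by (simp add: f_def ennreal_mult[symmetric] exp_add[symmetric])
      qed (simp add: f_def)
    qed
    also have "\<dots> = ennreal (sqrt (1 + \<epsilon>) ^ N * ball_vol N) * I"
      unfolding I_def by (rule nn_integral_uniform_sphere_radius[OF Gm s1])
    finally show ?thesis .
  qed
  define lin where "lin x = real N * (2 * sqrt \<beta> * bilin N ?c m x + rdot N h x / sqrt \<beta>)" for x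
  define R0 where "R0 = conc_region N ?s m \<delta>"
  define u where "u x = ennreal (exp (- (real N * confined N ?c w x))) * indicator R0 x" for x
  have R0m [measurable]: "R0 \<inter> space (lebesgue_rn N) \<in> sets (lebesgue_rn N)"
  proof -
    have "R0 \<inter> space (lebesgue_rn N) = {x \<in> space (lebesgue_rn N). \<bar>rdot N x x - ?s\<bar> < \<delta> \<and> \<bar>rdot N m x\<bar> < \<delta>}"
      by (auto simp: R0_def conc_region_def)
    then show ?thesis by simp
  qed
  have um [measurable]: "u \<in> borel_measurable (lebesgue_rn N)"
    unfolding u_def[abs_def] R0_def conc_region_def by measurable
  have linm [measurable]: "lin \<in> borel_measurable (lebesgue_rn N)" unfolding lin_def[abs_def] bilin_def by measurable
  define C2 where "C2 = exp (real N * (\<beta> * quad N ?c m + rdot N h m + w * ?s - \<bar>w\<bar> * \<delta>))"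
  have sb: "1 / sqrt \<beta> > 0" using b by simp
  have conc: "ennreal (1/2) * gauss_int N ?c w \<le> (\<integral>\<^sup>+x. u x \<partial>lebesgue_rn N)"
    unfolding u_def R0_def by (rule gauss_int_concentration[OF N p d(1,2) mm small])
  have sym: "(\<integral>\<^sup>+x. u x \<partial>lebesgue_rn N) \<le> (\<integral>\<^sup>+x. u x * ennreal (exp (lin x)) \<partial>lebesgue_rn N)"
  proof -
    have urefl: "u (\<lambda>i\<in>{1..N}. - x i) = u x" for x
      using confined_scale[of N ?c w "-1" x] rdot_scale_left[of N "-1" x] rdot_scale_right[of N _ "-1" x]
      by (simp add: u_def R0_def conc_region_def indicator_def)
    have lrefl: "lin (\<lambda>i\<in>{1..N}. - x i) = - lin x" for x
      using bilin_scale_right[of N ?c m "-1" x] rdot_scale_right[of N h "-1" x] by (simp add: lin_def algebra_simps)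
    have "2 * (\<integral>\<^sup>+x. u x \<partial>lebesgue_rn N) = (\<integral>\<^sup>+x. 2 * u x \<partial>lebesgue_rn N)" by (rule nn_integral_cmult[symmetric]) measurable
    also have "\<dots> \<le> (\<integral>\<^sup>+x. u x * ennreal (exp (lin x)) + u x * ennreal (exp (- lin x)) \<partial>lebesgue_rn N)"
    proof (intro nn_integral_mono)
      fix x
      have "1 + lin x \<le> exp (lin x)" "1 + (- lin x) \<le> exp (- lin x)" by (rule exp_ge_add_one_self)+
      then have "2 \<le> exp (lin x) + exp (- lin x)" by linarith
      then have "ennreal 2 \<le> ennreal (exp (lin x)) + ennreal (exp (- lin x))" by (simp add: ennreal_plus[symmetric] del: ennreal_plus ennreal_numeral)
      then have "u x * 2 \<le> u x * (ennreal (exp (lin x)) + ennreal (exp (- lin x)))" by (intro mult_left_mono) auto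
      then show "2 * u x \<le> u x * ennreal (exp (lin x)) + u x * ennreal (exp (- lin x))" by (simp add: distrib_left mult.commute)
    qed
    also have "\<dots> = (\<integral>\<^sup>+x. u x * ennreal (exp (lin x)) \<partial>lebesgue_rn N) + (\<integral>\<^sup>+x. u x * ennreal (exp (- lin x)) \<partial>lebesgue_rn N)"
      by (rule nn_integral_add) measurable
    finally have "2 * (\<integral>\<^sup>+x. u x \<partial>lebesgue_rn N) \<le> (\<integral>\<^sup>+x. u x * ennreal (exp (lin x)) \<partial>lebesgue_rn N) + (\<integral>\<^sup>+x. u x * ennreal (exp (- lin x)) \<partial>lebesgue_rn N)" .
    moreover have "(\<integral>\<^sup>+x. u x * ennreal (exp (- lin x)) \<partial>lebesgue_rn N) = (\<integral>\<^sup>+x. u x * ennreal (exp (lin x)) \<partial>lebesgue_rn N)"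
      using nn_integral_lebesgue_rn_reflect[of "\<lambda>x. u x * ennreal (exp (lin x))" N] unfolding urefl lrefl by simp
    ultimately have "2 * (\<integral>\<^sup>+x. u x \<partial>lebesgue_rn N) \<le> 2 * (\<integral>\<^sup>+x. u x * ennreal (exp (lin x)) \<partial>lebesgue_rn N)" by (simp add: mult_2)
    then show ?thesis by (subst (asm) ennreal_mult_le_mult_iff) auto
  qed
  have lb: "ennreal ((1 / sqrt \<beta>) ^ N * C2) * (ennreal (1/2) * gauss_int N ?c w) \<le> (\<integral>\<^sup>+x. f x \<partial>lebesgue_rn N)"
  proof -
    have "ennreal C2 * (ennreal (1/2) * gauss_int N ?c w) \<le> ennreal C2 * (\<integral>\<^sup>+x. u x * ennreal (exp (lin x)) \<partial>lebesgue_rn N)"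
      using conc sym by (intro mult_left_mono) auto
    also have "\<dots> = (\<integral>\<^sup>+x. ennreal C2 * (u x * ennreal (exp (lin x))) \<partial>lebesgue_rn N)"
      by (rule nn_integral_cmult[symmetric]) measurable
    also have "\<dots> \<le> (\<integral>\<^sup>+x. f (\<lambda>i\<in>{1..N}. m i + (1 / sqrt \<beta>) * x i) \<partial>lebesgue_rn N)"
    proof (intro nn_integral_mono)
      fix x
      show "ennreal C2 * (u x * ennreal (exp (lin x))) \<le> f (\<lambda>i\<in>{1..N}. m i + (1 / sqrt \<beta>) * x i)"
      proof (cases "x \<in> R0")
        case True
        let ?y = "\<lambda>i. m i + (1 / sqrt \<beta>) * x i"
        have x: "\<bar>rdot N x x - ?s\<bar> < \<delta>" "\<bar>rdot N m x\<bar> < \<delta>" using True by (auto simp: R0_def conc_region_def)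
        have sb2: "sqrt \<beta> * sqrt \<beta> = \<beta>" using b by simp
        have yy: "rdot N ?y ?y = rdot N m m + 2 * rdot N m x / sqrt \<beta> + rdot N x x / \<beta>"
          unfolding rdot_add_left rdot_add_right rdot_scale_left rdot_scale_right using b by (simp add: rdot_commute[of N x m] sb2)
        have "rdot N ?y ?y - 1 = 2 * rdot N m x / sqrt \<beta> + (rdot N x x - ?s) / \<beta>"
          unfolding yy m[symmetric] using b by (simp add: field_simps)
        then have "\<bar>rdot N ?y ?y - 1\<bar> \<le> \<bar>2 * rdot N m x / sqrt \<beta>\<bar> + \<bar>(rdot N x x - ?s) / \<beta>\<bar>" by (simp only: abs_triangle_ineq)
        also have "\<dots> \<le> 2 * \<delta> / sqrt \<beta> + \<delta> / \<beta>" using x b by (intro add_mono) (auto simp: abs_mult divide_right_mono)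
        finally have yA: "\<bar>rdot N ?y ?y - 1\<bar> \<le> \<epsilon>" using d by linarith
        have qy: "\<beta> * quad N ?c ?y = \<beta> * quad N ?c m + 2 * sqrt \<beta> * bilin N ?c m x + (w * rdot N x x - confined N ?c w x)"
        proof -
          have "\<beta> * (1 / sqrt \<beta>)\<^sup>2 = 1" "\<beta> * (1 / sqrt \<beta>) = sqrt \<beta>" using b sb2 by (auto simp: power_divide real_div_sqrt)
          moreover have "\<beta> * quad N ?c ?y = \<beta> * quad N ?c m + 2 * (\<beta> * (1 / sqrt \<beta>)) * bilin N ?c m x + (\<beta> * (1 / sqrt \<beta>)\<^sup>2) * quad N ?c x"
            unfolding quad_add quad_scale bilin_scale_right by (simp add: algebra_simps)
          ultimately show ?thesis by (simp add: confined_def)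
        qed
        have "\<bar>w * (rdot N x x - ?s)\<bar> \<le> \<bar>w\<bar> * \<delta>" unfolding abs_mult using x by (intro mult_left_mono) auto
        then have "w * ?s - \<bar>w\<bar> * \<delta> \<le> w * rdot N x x" by (simp add: algebra_simps abs_le_iff)
        then have "real N * (\<beta> * quad N ?c m + rdot N h m + w * ?s - \<bar>w\<bar> * \<delta>) \<le> real N * (\<beta> * quad N ?c m + rdot N h m + w * rdot N x x)"
          using N0 by (intro mult_left_mono) auto
        also have "\<dots> = exponent g N \<beta> h ?y + real N * confined N ?c w x - lin x"
          unfolding exponent_def qy rdot_add_right rdot_scale_right lin_def by (simp add: algebra_simps)
        finally have "C2 * (exp (- (real N * confined N ?c w x)) * exp (lin x)) \<le> exp (exponent g N \<beta> h ?y)"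
          unfolding C2_def exp_add[symmetric] by simp
        moreover have "f (restrict ?y {1..N}) = ennreal (exp (exponent g N \<beta> h ?y))"
          using yA unfolding f_def exponent_def by (simp add: rdot_restrict_left rdot_restrict_right del: times_divide_eq_left mult_1)
        ultimately show ?thesis using True by (simp add: u_def ennreal_mult[symmetric] C2_def)
      qed (simp add: u_def)
    qed
    finally have "ennreal ((1 / sqrt \<beta>) ^ N) * (ennreal C2 * (ennreal (1/2) * gauss_int N ?c w)) \<le> ennreal ((1 / sqrt \<beta>) ^ N) * (\<integral>\<^sup>+x. f (\<lambda>i\<in>{1..N}. m i + (1 / sqrt \<beta>) * x i) \<partial>lebesgue_rn N)"
      by (intro mult_left_mono) auto
    also have "\<dots> = (\<integral>\<^sup>+x. f x \<partial>lebesgue_rn N)"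
      using nn_integral_lebesgue_rn_affine[OF fm, of "1 / sqrt \<beta>" m] sb by simp
    finally show ?thesis using b by (simp add: ennreal_mult mult.assoc C2_def)
  qed
  have "ennreal (?C1 * ((1 / sqrt \<beta>) ^ N * C2 * (1/2 * exp (real N * log_gauss N ?c w)))) = ennreal ?C1 * (ennreal ((1 / sqrt \<beta>) ^ N * C2) * (ennreal (1/2) * gauss_int N ?c w))"
  proof -
    have "0 \<le> (1 / sqrt \<beta>) ^ N * C2" "(0::real) \<le> 1/2" using b by (auto simp: C2_def)
    then show ?thesis
      unfolding gauss_int_eq[OF N p] by (simp only: ennreal_mult[symmetric] exp_ge_zero mult_nonneg_nonneg)
  qed
  also have "\<dots> \<le> ennreal ?C1 * (\<integral>\<^sup>+x. f x \<partial>lebesgue_rn N)" by (intro mult_left_mono lb) auto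
  also have "\<dots> \<le> ennreal (sqrt (1 + \<epsilon>) ^ N * ball_vol N) * I" by (rule ub)
  also have "\<dots> = ennreal (sqrt (1 + \<epsilon>) ^ N * exp (real N * log_vol N) * exp (real N * free_energy g N \<beta> h))"
    unfolding I ball_vol_eq[OF N] using e by (simp add: ennreal_mult)
  finally have le: "?C1 * ((1 / sqrt \<beta>) ^ N * C2 * (1/2 * exp (real N * log_gauss N ?c w))) \<le> sqrt (1 + \<epsilon>) ^ N * exp (real N * log_vol N) * exp (real N * free_energy g N \<beta> h)"
    using e by (subst (asm) ennreal_le_iff) auto
  have "sqrt (1 + \<epsilon>) \<le> exp \<epsilon>"
  proof -
    have "sqrt (1 + \<epsilon>) \<le> 1 + \<epsilon>" using e by (intro real_le_lsqrt) (auto simp: power2_eq_square algebra_simps)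
    also have "\<dots> \<le> exp \<epsilon>" by (rule exp_ge_add_one_self)
    finally show ?thesis .
  qed
  then have sq: "sqrt (1 + \<epsilon>) ^ N \<le> exp (real N * \<epsilon>)"
    unfolding exp_of_nat_mult using e by (intro power_mono) auto
  have half: "exp (- 1) \<le> (1/2 :: real)" using exp_ge_add_one_self[of "1::real"] by (simp add: exp_minus field_simps)
  have "?C1 * (exp (- (real N * (ln \<beta> / 2))) * C2 * (exp (- 1) * exp (real N * log_gauss N ?c w))) \<le> ?C1 * ((1 / sqrt \<beta>) ^ N * C2 * (1/2 * exp (real N * log_gauss N ?c w)))"
    unfolding exp_half_N_ln[OF b] using half by (intro mult_left_mono mult_right_mono) (auto simp: C2_def)
  also have "\<dots> \<le> exp (real N * \<epsilon>) * exp (real N * log_vol N) * exp (real N * free_energy g N \<beta> h)"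
    using le sq by (smt (verit) exp_gt_zero mult_right_mono)
  finally have "real N * (\<beta> * quad N ?c m + rdot N h m + w * ?s + log_gauss N ?c w - \<bar>w\<bar> * \<delta> - (\<beta> * K + rnorm N h + 1) * \<epsilon>) - 1
     \<le> real N * (free_energy g N \<beta> h + ln \<beta> / 2 + log_vol N)"
    unfolding C2_def exp_add[symmetric] by (simp add: algebra_simps)
  moreover have "real N * (1 / real N) = 1" using N0 by simp
  ultimately have "real N * (\<beta> * quad N ?c m + rdot N h m + w * ?s + log_gauss N ?c w - \<bar>w\<bar> * \<delta> - (\<beta> * K + rnorm N h + 1) * \<epsilon> - 1 / real N)
     \<le> real N * (free_energy g N \<beta> h + ln \<beta> / 2 + log_vol N)" by (simp add: right_diff_distrib)
  then show ?thesis using N0 by (subst (asm) mult_le_cancel_left_pos) auto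
qed

section \<open>Mean square and critical temperature\<close>

definition max_quad :: "nat \<Rightarrow> (nat \<Rightarrow> nat \<Rightarrow> real) \<Rightarrow> real" where
  "max_quad N c = (SUP x\<in>{x. rdot N x x = 1}. quad N c x)"

definition quad_bounded :: "nat \<Rightarrow> (nat \<Rightarrow> nat \<Rightarrow> real) \<Rightarrow> real \<Rightarrow> bool" where
  "quad_bounded N c K \<longleftrightarrow> (\<forall>x. \<bar>quad N c x\<bar> \<le> K * rdot N x x)"

lemma quad_boundedD: "quad_bounded N c K \<Longrightarrow> \<bar>quad N c x\<bar> \<le> K * rdot N x x"
  by (simp add: quad_bounded_def)

lemma unit_vector_exists:
  assumes "N \<ge> 1" obtains e where "rdot N e e = 1"
proof
  show "rdot N (\<lambda>i. if i = 1 then 1 else 0) (\<lambda>i. if i = 1 then 1 else 0) = 1"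
    using assms by (simp add: rdot_def if_distrib[of "\<lambda>x. x * _"] cong: if_cong)
qed

text \<open>
  The direction of the zero vector is an arbitrary unit vector.
\<close>

lemma unit_direction:
  assumes "N \<ge> 1" obtains e where "rdot N e e = 1" "\<And>i. i \<in> {1..N} \<Longrightarrow> x i = rnorm N x * e i"
proof (cases "rnorm N x = 0")
  case True
  then have "\<forall>i\<in>{1..N}. x i = 0" by (simp add: rnorm_def L2_set_eq_0_iff)
  then show ?thesis using unit_vector_exists[OF assms] that True by (metis mult_zero_left)
next
  case False
  show ?thesis
  proof
    show "rdot N (\<lambda>i. (1 / rnorm N x) * x i) (\<lambda>i. (1 / rnorm N x) * x i) = 1"
      unfolding rdot_scale_left rdot_scale_right using False by (simp add: rdot_self power2_eq_square)
    show "x i = rnorm N x * (1 / rnorm N x * x i)" for i using False by simp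
  qed
qed

lemma quad_cong: "(\<And>i. i \<in> {1..N} \<Longrightarrow> x i = y i) \<Longrightarrow> quad N c x = quad N c y"
  unfolding quad_def by (intro sum.cong refl) simp

lemma rdot_cong: "(\<And>i. i \<in> {1..N} \<Longrightarrow> x i = y i) \<Longrightarrow> rdot N z x = rdot N z y"
  unfolding rdot_def by (intro sum.cong refl) simp

lemma quad_bounded_nonneg: "N \<ge> 1 \<Longrightarrow> quad_bounded N c K \<Longrightarrow> K \<ge> 0"
  using unit_vector_exists[of N] quad_boundedD by (metis abs_ge_zero mult.right_neutral order_trans)

lemma
  assumes N: "N \<ge> 1" and K: "quad_bounded N c K"
  shows quad_le_max_quad: "quad N c x \<le> max_quad N c * rdot N x x"
    and max_quad_abs_le: "\<bar>max_quad N c\<bar> \<le> K"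
    and max_quad_approx: "\<epsilon> > 0 \<Longrightarrow> \<exists>e. rdot N e e = 1 \<and> max_quad N c - \<epsilon> < quad N c e"
proof -
  let ?S = "{x. rdot N x x = 1}"
  have b: "quad N c x \<le> K" "- K \<le> quad N c x" if "x \<in> ?S" for x using quad_boundedD[OF K, of x] that by auto
  have bdd: "bdd_above (quad N c ` ?S)" using b by (intro bdd_aboveI2) auto
  have ne: "?S \<noteq> {}" using unit_vector_exists[OF N] by blast
  obtain e where e: "rdot N e e = 1" "\<And>i. i \<in> {1..N} \<Longrightarrow> x i = rnorm N x * e i" using unit_direction[OF N, of x] by blast
  have "quad N c x = (rnorm N x)\<^sup>2 * quad N c e" using quad_cong[of N x "\<lambda>i. rnorm N x * e i" c] e(2) by (simp add: quad_scale)
  also have "\<dots> \<le> (rnorm N x)\<^sup>2 * max_quad N c" unfolding max_quad_def using e by (intro mult_left_mono cSUP_upper bdd) auto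
  finally show "quad N c x \<le> max_quad N c * rdot N x x" by (simp add: rdot_self mult.commute)
  have "max_quad N c \<le> K" unfolding max_quad_def by (rule cSUP_least[OF ne]) (rule b)
  moreover have "- K \<le> quad N c e" "quad N c e \<le> max_quad N c" unfolding max_quad_def using b(2) e(1) by (auto intro!: cSUP_upper bdd)
  ultimately show "\<bar>max_quad N c\<bar> \<le> K" by simp
  show "\<exists>e. rdot N e e = 1 \<and> max_quad N c - \<epsilon> < quad N c e" if "\<epsilon> > 0"
    using less_cSUP_iff[OF ne bdd, of "max_quad N c - \<epsilon>"] that unfolding max_quad_def by auto
qed

lemma coercive_max_quad: "N \<ge> 1 \<Longrightarrow> quad_bounded N c K \<Longrightarrow> coercive N c w (w - max_quad N c)"
  unfolding coercive_def confined_def using quad_le_max_quad[of N c K] by (simp add: algebra_simps)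

lemma coercive_quad_bounded: "quad_bounded N c K \<Longrightarrow> coercive N c w (w - K)"
  unfolding coercive_def confined_def using quad_boundedD[of N c K] by (simp add: algebra_simps abs_le_iff)

lemma confined_le_quad_bounded: "quad_bounded N c K \<Longrightarrow> confined N c w x \<le> (\<bar>w\<bar> + K) * rdot N x x"
  unfolding confined_def using quad_boundedD[of N c K x] mult_right_mono[OF abs_ge_self[of w], of "rdot N x x"]
  by (simp add: algebra_simps abs_le_iff)

abbreviation free0 :: "(nat \<Rightarrow> nat \<Rightarrow> real) \<Rightarrow> nat \<Rightarrow> real \<Rightarrow> real" where
  "free0 g N t \<equiv> free_energy g N t (\<lambda>_. 0)"

lemma rdot_zero [simp]: "rdot N (\<lambda>_. 0) x = 0" "rdot N x (\<lambda>_. 0) = 0"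
  by (simp_all add: rdot_def)

lemma rnorm_zero [simp]: "rnorm N (\<lambda>_. 0) = 0"
  by (simp add: rnorm_eq_sqrt)

lemma quad_zero [simp]: "quad N c (\<lambda>_. 0) = 0"
  by (simp add: quad_def)

lemma bilin_zero [simp]: "bilin N c (\<lambda>_. 0) x = 0"
  by (simp add: bilin_def)

lemma free0_upper:
  assumes N: "N \<ge> 1" and p: "coercive N (scaled g N) w \<kappa>" "\<kappa> > 0" and t: "t > 0"
  shows "free0 g N t + ln t / 2 + log_vol N \<le> t * w + log_gauss N (scaled g N) w + 1 / real N"
  using sphere_upper[OF N p t, of "\<lambda>_. 0" "\<lambda>_. 0"] by (simp add: confined_bilin_def confined_def)

text \<open>
  The widths of the shell and of the concentration region are chosen in terms of the bounds on
  \<open>q\<close>, \<open>w\<close>, \<open>\<beta>\<close> and \<open>h\<close>, so one threshold for \<open>N\<close> serves all of them.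
\<close>

lemma sphere_lower_uniform:
  assumes k: "\<kappa> > 0" and K: "K \<ge> 0" and H: "H \<ge> 0" and b: "b > 0" and W: "W \<ge> 0" and B: "B \<ge> 0" and e: "\<epsilon> > 0"
  shows "\<forall>\<^sub>F N in sequentially. \<forall>g w \<beta> h m. quad_bounded N (scaled g N) K \<longrightarrow> coercive N (scaled g N) w \<kappa> \<longrightarrow> \<bar>w\<bar> \<le> W \<longrightarrow> b \<le> \<beta> \<longrightarrow> \<beta> \<le> B \<longrightarrow>
     rnorm N h \<le> H \<longrightarrow> \<beta> * (1 - rdot N m m) = mean_sq N (scaled g N) w \<longrightarrow>
     \<beta> * quad N (scaled g N) m + rdot N h m + w * mean_sq N (scaled g N) w + log_gauss N (scaled g N) w - \<epsilon> \<le> free_energy g N \<beta> h + ln \<beta> / 2 + log_vol N"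
proof -
  define e' where "e' = min (1/2) (\<epsilon> / (4 * (B * K + H + 1)))"
  define \<delta> where "\<delta> = min (1 / \<kappa>) (min (\<epsilon> / (4 * (W + 1))) (e' / (2 / sqrt b + 1 / b)))"
  have C: "B * K + H + 1 > 0" using K H B by (simp add: add_nonneg_pos)
  have e'0: "0 < e'" using e C by (auto simp: e'_def)
  have e': "0 < e'" "e' \<le> 1/2" by (rule e'0) (unfold e'_def, rule min.cobounded1)
  have bb: "2 / sqrt b + 1 / b > 0" using b by (simp add: add_pos_pos)
  have d: "0 < \<delta>" "\<delta> \<le> 1 / \<kappa>" using k e W e' bb by (auto simp: \<delta>_def)
  have Ce: "(B * K + H + 1) * e' \<le> \<epsilon> / 4"
  proof -
    have "(B * K + H + 1) * e' \<le> (B * K + H + 1) * (\<epsilon> / (4 * (B * K + H + 1)))" using C by (intro mult_left_mono) (auto simp: e'_def)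
    also have "\<dots> = \<epsilon> / 4" using C by (simp add: field_simps)
    finally show ?thesis .
  qed
  have Wd: "W * \<delta> \<le> \<epsilon> / 4"
  proof -
    have "W * \<delta> \<le> (W + 1) * \<delta>" using d by (simp add: mult_right_mono)
    also have "\<dots> \<le> (W + 1) * (\<epsilon> / (4 * (W + 1)))" using W by (intro mult_left_mono) (auto simp: \<delta>_def)
    also have "\<dots> = \<epsilon> / 4" using W by (simp add: field_simps)
    finally show ?thesis .
  qed
  have db: "2 * \<delta> / sqrt \<beta> + \<delta> / \<beta> \<le> e'" if "b \<le> \<beta>" for \<beta>
  proof -
    have "2 * \<delta> / sqrt \<beta> + \<delta> / \<beta> \<le> 2 * \<delta> / sqrt b + \<delta> / b"
      using that b d by (intro add_mono divide_left_mono) auto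
    also have "\<dots> = \<delta> * (2 / sqrt b + 1 / b)" by (simp add: algebra_simps)
    also have "\<dots> \<le> (e' / (2 / sqrt b + 1 / b)) * (2 / sqrt b + 1 / b)" using bb by (intro mult_right_mono) (auto simp: \<delta>_def)
    finally show ?thesis using bb by simp
  qed
  have lim: "(\<lambda>N. exp (- (real N * A))) \<longlonglongrightarrow> 0" if "A > 0" for A
    using that by real_asymp
  have "(\<lambda>N. 2 * exp (- (real N * (\<delta>\<^sup>2 * \<kappa>\<^sup>2 / 4))) + 2 * exp (- (real N * (\<kappa> * \<delta>\<^sup>2)))) \<longlonglongrightarrow> 2 * 0 + 2 * 0"
    using d k by (intro tendsto_intros lim) auto
  then have ev1: "\<forall>\<^sub>F N in sequentially. 2 * exp (- (real N * (\<delta>\<^sup>2 * \<kappa>\<^sup>2 / 4))) + 2 * exp (- (real N * (\<kappa> * \<delta>\<^sup>2))) < 1 / 2"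
    by (rule order_tendstoD) simp
  have "(\<lambda>N. 1 / real N) \<longlonglongrightarrow> 0" by (rule lim_1_over_n)
  then have ev2: "\<forall>\<^sub>F N in sequentially. 1 / real N < \<epsilon> / 4" by (rule order_tendstoD) (use e in simp)
  show ?thesis
    using ev1 ev2 eventually_ge_at_top[of 1]
  proof eventually_elim
    case (elim N)
    show ?case
    proof (intro allI impI)
      fix g w \<beta> h m
      assume a: "quad_bounded N (scaled g N) K" "coercive N (scaled g N) w \<kappa>" "\<bar>w\<bar> \<le> W" "b \<le> \<beta>" "\<beta> \<le> B" "rnorm N h \<le> H" "\<beta> * (1 - rdot N m m) = mean_sq N (scaled g N) w"
      have "\<beta> * quad N (scaled g N) m + rdot N h m + w * mean_sq N (scaled g N) w + log_gauss N (scaled g N) w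
        - \<bar>w\<bar> * \<delta> - (\<beta> * K + rnorm N h + 1) * e' - 1 / real N \<le> free_energy g N \<beta> h + ln \<beta> / 2 + log_vol N"
        using a b elim by (intro sphere_lower[OF _ quad_boundedD[OF a(1)] a(2) k _ a(7) e' d db]) auto
      moreover have "\<bar>w\<bar> * \<delta> \<le> W * \<delta>" using a d by (intro mult_right_mono) auto
      moreover have "\<beta> * K \<le> B * K" using a K by (intro mult_right_mono) auto
      then have "(\<beta> * K + rnorm N h + 1) * e' \<le> (B * K + H + 1) * e'" using a e' by (intro mult_right_mono) auto
      ultimately show "\<beta> * quad N (scaled g N) m + rdot N h m + w * mean_sq N (scaled g N) w + log_gauss N (scaled g N) w - \<epsilon> \<le> free_energy g N \<beta> h + ln \<beta> / 2 + log_vol N"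
        using Ce Wd elim e by linarith
    qed
  qed
qed

lemma mean_sq_pos:
  assumes "N \<ge> 1" "quad_bounded N c K" "coercive N c w \<kappa>" "\<kappa> > 0" "\<bar>w\<bar> \<le> W" "W > 0"
  shows "ln 2 / (2 * (W + K)) \<le> mean_sq N c w" "0 < mean_sq N c w"
proof -
  have K: "K \<ge> 0" by (rule quad_bounded_nonneg) fact+
  have "confined N c w x \<le> (W + K) * rdot N x x" for x
    using confined_le_quad_bounded[OF assms(2), of w x] assms(5) mult_right_mono[of "\<bar>w\<bar> + K" "W + K" "rdot N x x"] by simp
  then show "ln 2 / (2 * (W + K)) \<le> mean_sq N c w" using assms K by (intro mean_sq_ge[OF assms(1,3,4)]) auto
  moreover have "0 < ln 2 / (2 * (W + K))" using assms K by (simp add: add_pos_nonneg)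
  ultimately show "0 < mean_sq N c w" by linarith
qed

lemma free0_lower_uniform:
  assumes k: "\<kappa> > 0" and K: "K \<ge> 0" and W: "W > 0" and e: "\<epsilon> > 0"
  shows "\<forall>\<^sub>F N in sequentially. \<forall>g w. quad_bounded N (scaled g N) K \<longrightarrow> coercive N (scaled g N) w \<kappa> \<longrightarrow> \<bar>w\<bar> \<le> W \<longrightarrow>
     w * mean_sq N (scaled g N) w + log_gauss N (scaled g N) w - \<epsilon> \<le> free0 g N (mean_sq N (scaled g N) w) + ln (mean_sq N (scaled g N) w) / 2 + log_vol N"
proof -
  define b where "b = ln 2 / (2 * (W + K))"
  have b: "b > 0" using W K by (simp add: b_def add_pos_nonneg)
  have kk: "0 \<le> 1 / \<kappa>" using k by simp
  show ?thesis
    using sphere_lower_uniform[OF k K order_refl b less_imp_le[OF W] kk e] eventually_ge_at_top[of 1]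
  proof (eventually_elim)
    case (elim N)
    show ?case
    proof (intro allI impI)
      fix g w assume a: "quad_bounded N (scaled g N) K" "coercive N (scaled g N) w \<kappa>" "\<bar>w\<bar> \<le> W"
      have "b \<le> mean_sq N (scaled g N) w" unfolding b_def by (rule mean_sq_pos[OF elim(2) a(1,2) k a(3) W])
      moreover have "mean_sq N (scaled g N) w \<le> 1 / \<kappa>" by (rule mean_sq_le[OF elim(2) a(2) k])
      moreover have "0 \<le> 1 / \<kappa>" using k by simp
      ultimately show "w * mean_sq N (scaled g N) w + log_gauss N (scaled g N) w - \<epsilon> \<le> free0 g N (mean_sq N (scaled g N) w) + ln (mean_sq N (scaled g N) w) / 2 + log_vol N"
        using elim(1)[rule_format, of g w "mean_sq N (scaled g N) w" "\<lambda>_. 0" "\<lambda>_. 0"] a by simp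
    qed
  qed
qed

text \<open>
  By \<open>free0_upper\<close> the function \<open>f(t) + 1/2 ln t\<close> lies below the line of slope \<open>w\<close>, and at
  \<open>t = s(w)\<close> it nearly touches it.
\<close>

lemma supergradient:
  assumes N: "N \<ge> 1" and p: "coercive N (scaled g N) w \<kappa>" "\<kappa> > 0" and t: "t > 0" and Ne: "1 / real N \<le> \<epsilon>"
    and low: "w * s + log_gauss N (scaled g N) w - \<epsilon> \<le> free0 g N s + ln s / 2 + log_vol N"
  shows "free0 g N t + ln t / 2 \<le> free0 g N s + ln s / 2 + (t - s) * w + 2 * \<epsilon>"
  using free0_upper[OF N p t] low Ne by (simp add: algebra_simps)

text \<open>
  The mean square is continuous in the multiplier and at most \<open>1 / (w - K)\<close>, so it takes every value
  between \<open>s(w)\<close> and 0, at a multiplier bounded in terms of the value.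
\<close>

lemma mean_sq_IVT:
  assumes N: "N \<ge> 1" and K: "quad_bounded N c K" and p: "coercive N c w \<kappa>" "\<kappa> > 0" and t: "0 < t" "t \<le> mean_sq N c w"
  obtains w' where "w \<le> w'" "w' \<le> max w (K + 1 / t)" "mean_sq N c w' = t" "coercive N c w' \<kappa>"
proof -
  define u where "u = max w (K + 1 / t)"
  have "coercive N c u (u - K)" by (rule coercive_quad_bounded[OF K])
  then have "coercive N c u (1 / t)" by (rule coercive_mono) (simp add: u_def)
  then have "mean_sq N c u \<le> 1 / (1 / t)" using t by (intro mean_sq_le[OF N]) auto
  then have "mean_sq N c u \<le> t" by simp
  moreover have "continuous_on {w..u} (mean_sq N c)" by (rule continuous_on_subset[OF mean_sq_continuous_on[OF N p]]) auto
  ultimately obtain w' where w': "w \<le> w'" "w' \<le> u" "mean_sq N c w' = t"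
    using IVT2'[of "mean_sq N c" u t w] t by (auto simp: u_def)
  moreover have "coercive N c w' \<kappa>" using coercive_mono[OF coercive_shift[OF p(1), of "w' - w"]] w' by simp
  ultimately show ?thesis using that by (auto simp: u_def)
qed

text \<open>
  The critical inverse temperature of the model without field.
\<close>

definition beta_crit :: real where "beta_crit = 1 / sqrt 2"

lemma beta_crit: "0.7 < beta_crit" "beta_crit < 0.71" "beta_crit * beta_crit = 1 / 2" "0 < beta_crit"
proof -
  show s: "beta_crit * beta_crit = 1 / 2" "0 < beta_crit" by (auto simp: beta_crit_def)
  have eq: "beta_crit = sqrt (1/2)" by (simp add: beta_crit_def real_sqrt_divide)
  show "0.7 < beta_crit" unfolding eq by (rule real_less_rsqrt) (simp add: power2_eq_square)
  show "beta_crit < 0.71" unfolding eq by (rule real_less_lsqrt) (simp_all add: power2_eq_square)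
qed

text \<open>
  The two properties of the couplings on which the deterministic part rests.
\<close>

definition typical :: "(nat \<Rightarrow> nat \<Rightarrow> real) \<Rightarrow> nat \<Rightarrow> real \<Rightarrow> real \<Rightarrow> bool" where
  "typical g N K \<eta> \<longleftrightarrow> quad_bounded N (scaled g N) K \<and> (\<forall>t. 0 < t \<and> t \<le> beta_crit \<longrightarrow> \<bar>free0 g N t - t\<^sup>2 / 2\<bar> \<le> \<eta>)"

text \<open>
  The annealed free energy \<open>t\<^sup>2 / 2\<close> plus the contribution \<open>1/2 ln t\<close> of the radial direction.  Its
  second derivative \<open>1 - 1 / (2 t\<^sup>2)\<close> vanishes at \<open>beta_crit\<close>.
\<close>

definition annealed :: "real \<Rightarrow> real" where "annealed t = t\<^sup>2 / 2 + ln t / 2"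

text \<open>
  At the inflection point \<open>beta_crit\<close> the slopes over neighbouring intervals differ only to second
  order in \<open>\<delta>\<close>.
\<close>

lemma annealed_inflection:
  assumes d: "0 < \<delta>" "\<delta> \<le> 1 / 100"
  shows "annealed (beta_crit - 2 * \<delta>) - annealed (beta_crit - 3 * \<delta>) - annealed beta_crit + annealed (beta_crit - \<delta>) \<le> 17 * \<delta> ^ 3"
proof -
  let ?p = "(beta_crit - 3 * \<delta>) * beta_crit"
  have pos: "beta_crit - 3 * \<delta> > 0" using beta_crit d by linarith
  have "\<delta> * beta_crit \<le> (1/100) * 0.71" using d beta_crit by (intro mult_mono) auto
  then have sd: "\<delta> * beta_crit \<le> 0.0071" by simp
  have p: "?p = 1 / 2 - 3 * (\<delta> * beta_crit)" using beta_crit(3) by (simp add: algebra_simps)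
  have p0: "?p \<ge> 0.47"
  proof -
    define Z where "Z = \<delta> * beta_crit"
    show ?thesis using sd unfolding p Z_def[symmetric] by simp
  qed
  have "ln (beta_crit - 2 * \<delta>) + ln (beta_crit - \<delta>) - ln (beta_crit - 3 * \<delta>) - ln beta_crit = ln ((beta_crit - 2 * \<delta>) * (beta_crit - \<delta>) / ?p)"
    using pos beta_crit d by (simp add: ln_div ln_mult)
  also have "(beta_crit - 2 * \<delta>) * (beta_crit - \<delta>) / ?p = 1 + 2 * \<delta>\<^sup>2 / ?p"
    using pos beta_crit(4) by (simp add: field_simps power2_eq_square)
  also have "ln (1 + 2 * \<delta>\<^sup>2 / ?p) \<le> 2 * \<delta>\<^sup>2 / ?p" using p0 by (intro ln_add_one_self_le_self) auto
  finally have l: "ln (beta_crit - 2 * \<delta>) + ln (beta_crit - \<delta>) - ln (beta_crit - 3 * \<delta>) - ln beta_crit \<le> 2 * (\<delta>\<^sup>2 / ?p)" by simp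
  have gen: "x / y - 2 * x = x * (1 - 2 * y) / y" if "y \<noteq> 0" for x y :: real using that by (simp add: field_simps)
  have "\<delta>\<^sup>2 / ?p - 2 * \<delta>\<^sup>2 = \<delta>\<^sup>2 * (1 - 2 * ?p) / ?p" using p0 by (intro gen) auto
  also have "\<dots> = \<delta>\<^sup>2 * (6 * (\<delta> * beta_crit)) / ?p" unfolding p by simp
  also have "\<dots> = 6 * beta_crit * \<delta> ^ 3 / ?p" by (simp add: power2_eq_square power3_eq_cube)
  also have "\<dots> \<le> 17 * \<delta> ^ 3"
  proof -
    have "6 * beta_crit \<le> 17 * ?p" using p0 beta_crit by linarith
    then have "6 * beta_crit * \<delta> ^ 3 \<le> 17 * ?p * \<delta> ^ 3" using d by (intro mult_right_mono) auto
    moreover have "x / y \<le> 17 * z" if "x \<le> 17 * y * z" "y > 0" for x y z :: real using that by (simp add: pos_divide_le_eq mult_ac)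
    ultimately show ?thesis using p0 by force
  qed
  finally have 1: "\<delta>\<^sup>2 / ?p - 2 * \<delta>\<^sup>2 \<le> 17 * \<delta> ^ 3" .
  have "(beta_crit - 2 * \<delta>)\<^sup>2 / 2 - (beta_crit - 3 * \<delta>)\<^sup>2 / 2 - beta_crit\<^sup>2 / 2 + (beta_crit - \<delta>)\<^sup>2 / 2 = - 2 * \<delta>\<^sup>2"
    by (simp add: power2_eq_square field_simps)
  then show ?thesis using l 1 unfolding annealed_def by argo
qed

text \<open>
  The second derivative at distance \<open>\<delta>\<close> below \<open>beta_crit\<close> is negative of order \<open>\<delta>\<close>, so the
  second difference is of order \<open>\<delta>\<^sup>3\<close>.
\<close>

lemma annealed_strict_concave:
  assumes d: "0 < \<delta>" "\<delta> \<le> 1 / 4"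
  shows "annealed (beta_crit - \<delta>) + annealed beta_crit - 2 * annealed (beta_crit - \<delta> / 2) \<le> - (\<delta> ^ 3 / 4)"
proof -
  let ?p = "(beta_crit - \<delta> / 2)\<^sup>2"
  have pos: "beta_crit - \<delta> > 0" "beta_crit - \<delta> / 2 > 0" using beta_crit d by linarith+
  have p0: "?p > 0" using pos by simp
  define P Z Y where "P = ?p" and "Z = \<delta> * beta_crit" and "Y = \<delta> * \<delta>"
  have "\<delta> * 0.7 \<le> Z" unfolding Z_def using d beta_crit by (intro mult_left_mono) auto
  moreover have "Y \<le> \<delta> * (1/4)" unfolding Y_def using d by (intro mult_left_mono) auto
  moreover have "P = 1 / 2 - Z + Y / 4" unfolding P_def Z_def Y_def using beta_crit(3) by (simp add: power2_eq_square algebra_simps)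
  ultimately have "P \<le> (1 - \<delta>) / 2" using d by simp
  then have p1: "?p \<le> (1 - \<delta>) / 2" by (simp add: P_def)
  have x0: "(\<delta>\<^sup>2 / 4) / ?p < 1"
  proof -
    have "(\<delta>/2)\<^sup>2 < ?p" using pos d beta_crit by (intro power_strict_mono) auto
    then show ?thesis using p0 by (simp add: power_divide)
  qed
  have "ln (beta_crit - \<delta>) + ln beta_crit - 2 * ln (beta_crit - \<delta> / 2) = ln ((beta_crit - \<delta>) * beta_crit / ?p)"
    using pos beta_crit by (simp add: ln_div ln_mult ln_realpow)
  also have "(beta_crit - \<delta>) * beta_crit / ?p = 1 + - ((\<delta>\<^sup>2 / 4) / ?p)"
  proof -
    have "(beta_crit - \<delta>) * beta_crit = ?p - \<delta>\<^sup>2 / 4" by (simp add: power2_eq_square algebra_simps)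
    then show ?thesis using p0 by (simp add: diff_divide_distrib)
  qed
  also have "ln (1 + - ((\<delta>\<^sup>2 / 4) / ?p)) \<le> - ((\<delta>\<^sup>2 / 4) / ?p)" using x0 by (intro ln_add_one_self_le_self2) auto
  also have "\<dots> \<le> - ((\<delta>\<^sup>2 / 2) * (1 + \<delta>))"
  proof -
    have "(\<delta>\<^sup>2 / 2) * (1 + \<delta>) * ?p \<le> (\<delta>\<^sup>2 / 2) * (1 + \<delta>) * ((1 - \<delta>) / 2)" using p1 d by (intro mult_left_mono) auto
    also have "\<dots> = (\<delta>\<^sup>2 / 4) * (1 - \<delta>\<^sup>2)" by (simp add: power2_eq_square field_simps)
    also have "\<dots> \<le> \<delta>\<^sup>2 / 4" by (simp add: mult_left_le)
    finally show ?thesis using p0 by (simp add: pos_le_divide_eq mult_ac)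
  qed
  finally have 1: "ln (beta_crit - \<delta>) + ln beta_crit - 2 * ln (beta_crit - \<delta> / 2) \<le> - ((\<delta>\<^sup>2 / 2) * (1 + \<delta>))" .
  have 2: "(beta_crit - \<delta>)\<^sup>2 / 2 + beta_crit\<^sup>2 / 2 - (beta_crit - \<delta> / 2)\<^sup>2 = \<delta>\<^sup>2 / 4"
    by (simp add: power2_eq_square field_simps)
  have 3: "(\<delta>\<^sup>2 / 2) * (1 + \<delta>) = \<delta>\<^sup>2 / 2 + \<delta> ^ 3 / 2" by (simp add: power2_eq_square power3_eq_cube field_simps)
  show ?thesis using 1 2 unfolding annealed_def 3 by argo
qed

lemma typical_mono: "typical g N K \<eta> \<Longrightarrow> \<eta> \<le> \<eta>' \<Longrightarrow> typical g N K \<eta>'"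
  by (force simp: typical_def)

lemma typical_annealed: "typical g N K \<eta> \<Longrightarrow> 0 < t \<Longrightarrow> t \<le> beta_crit \<Longrightarrow> \<bar>free0 g N t + ln t / 2 - annealed t\<bar> \<le> \<eta>"
  by (simp add: typical_def annealed_def)

text \<open>
  Suppose \<open>s(w)\<close> were within \<open>\<delta>\<close> of \<open>beta_crit\<close>, or above it.  Raising the multiplier one meets
  \<open>w1\<close>, \<open>w2\<close> with mean squares \<open>beta_crit - \<delta>\<close> and \<open>beta_crit - 2 \<delta>\<close>.  Multipliers are slopes of
  \<open>f(t) + 1/2 ln t\<close>, which is close to \<open>annealed\<close>, so \<open>w2 - w1\<close> is of order \<open>\<delta>\<^sup>2\<close> by
  \<open>annealed_inflection\<close>; but \<open>mean_sq_lipschitz\<close> forces \<open>w2 - w1\<close> to be at least of order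
  \<open>\<kappa>\<^sup>2 \<delta>\<close>.
\<close>

lemma overlap_below_critical:
  assumes k: "0 < \<kappa>" "\<kappa> \<le> 1" and K: "K \<ge> 0" and W: "W > 0"
  obtains \<delta> \<eta> where "\<delta> > 0" "\<eta> > 0"
    "\<forall>\<^sub>F N in sequentially. \<forall>g w. typical g N K \<eta> \<longrightarrow> coercive N (scaled g N) w \<kappa> \<longrightarrow> \<bar>w\<bar> \<le> W \<longrightarrow> mean_sq N (scaled g N) w \<le> beta_crit - \<delta>"
proof -
  \<comment> \<open>With \<open>136 = 8 * 17\<close> the third-order term \<open>17 \<delta>\<^sup>3\<close> uses half of the room \<open>\<kappa>\<^sup>2 \<delta>\<^sup>2 / 4\<close>.\<close>
  define \<delta> where "\<delta> = \<kappa>\<^sup>2 / 136"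
  define \<eta> where "\<eta> = \<delta>\<^sup>2 * \<kappa>\<^sup>2 / 128"
  have k2: "0 < \<kappa>\<^sup>2" "\<kappa>\<^sup>2 \<le> 1" using k by (auto intro: power_le_one)
  have d: "0 < \<delta>" "\<delta> \<le> 1 / 100" using k2 by (auto simp: \<delta>_def)
  have eta: "\<eta> > 0" using d k by (simp add: \<eta>_def)
  define W' where "W' = W + K + 10"
  have W': "W' > 0" using W K by (simp add: W'_def)
  have "\<forall>\<^sub>F N in sequentially. \<forall>g w. typical g N K \<eta> \<longrightarrow> coercive N (scaled g N) w \<kappa> \<longrightarrow> \<bar>w\<bar> \<le> W \<longrightarrow> mean_sq N (scaled g N) w \<le> beta_crit - \<delta>"
    using free0_lower_uniform[OF k(1) K W' eta] eventually_ge_at_top[of 1] order_tendstoD(2)[OF lim_1_over_n[where 'a=real] eta]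
  proof eventually_elim
    case (elim N)
    note N = elim(2)
    show ?case
    proof (intro allI impI, rule ccontr)
      fix g w assume g: "typical g N K \<eta>" and p: "coercive N (scaled g N) w \<kappa>" and w: "\<bar>w\<bar> \<le> W" and "\<not> mean_sq N (scaled g N) w \<le> beta_crit - \<delta>"
      then have big: "beta_crit - \<delta> \<le> mean_sq N (scaled g N) w" by simp
      have qb: "quad_bounded N (scaled g N) K" using g by (simp add: typical_def)
      have inv: "1 / t \<le> 2" if "t \<ge> 1/2" for t :: real using that by (simp add: field_simps)
      obtain w1 where w1: "w \<le> w1" "w1 \<le> max w (K + 1 / (beta_crit - \<delta>))" "mean_sq N (scaled g N) w1 = beta_crit - \<delta>" "coercive N (scaled g N) w1 \<kappa>"
        using mean_sq_IVT[OF N qb p k(1) _ big] beta_crit d by auto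
      have w1b: "\<bar>w1\<bar> \<le> W + K + 2" using w1 w K W inv[of "beta_crit - \<delta>"] beta_crit d by (auto simp: abs_le_iff le_max_iff_disj)
      have "beta_crit - 2 * \<delta> \<le> mean_sq N (scaled g N) w1" using w1 d by simp
      then obtain w2 where w2: "w1 \<le> w2" "w2 \<le> max w1 (K + 1 / (beta_crit - 2 * \<delta>))" "mean_sq N (scaled g N) w2 = beta_crit - 2 * \<delta>" "coercive N (scaled g N) w2 \<kappa>"
        using mean_sq_IVT[OF N qb w1(4) k(1), of "beta_crit - 2 * \<delta>"] beta_crit d by auto
      have w2b: "\<bar>w2\<bar> \<le> W + K + 4" using w2 w1b K W inv[of "beta_crit - 2 * \<delta>"] beta_crit d by (auto simp: abs_le_iff le_max_iff_disj)
      have Ne: "1 / real N \<le> \<eta>" using elim(3) by simp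
      have l1: "free0 g N beta_crit + ln beta_crit / 2 \<le> free0 g N (beta_crit - \<delta>) + ln (beta_crit - \<delta>) / 2 + (beta_crit - (beta_crit - \<delta>)) * w1 + 2 * \<eta>"
        using elim(1)[rule_format, OF qb w1(4)] w1b beta_crit by (intro supergradient[OF N w1(4) k(1) _ Ne]) (auto simp: W'_def w1(3))
      have l2: "free0 g N (beta_crit - 3 * \<delta>) + ln (beta_crit - 3 * \<delta>) / 2 \<le> free0 g N (beta_crit - 2 * \<delta>) + ln (beta_crit - 2 * \<delta>) / 2 + ((beta_crit - 3 * \<delta>) - (beta_crit - 2 * \<delta>)) * w2 + 2 * \<eta>"
        using elim(1)[rule_format, OF qb w2(4)] w2b beta_crit d by (intro supergradient[OF N w2(4) k(1) _ Ne]) (auto simp: W'_def w2(3))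
      have "\<delta> * (w2 - w1) \<le> (annealed (beta_crit - 2 * \<delta>) - annealed (beta_crit - 3 * \<delta>) - annealed beta_crit + annealed (beta_crit - \<delta>)) + 8 * \<eta>"
        using l1 l2 typical_annealed[OF g, of beta_crit] typical_annealed[OF g, of "beta_crit - \<delta>"] typical_annealed[OF g, of "beta_crit - 2 * \<delta>"] typical_annealed[OF g, of "beta_crit - 3 * \<delta>"] beta_crit d
        by (simp add: algebra_simps abs_le_iff)
      also have "\<dots> \<le> 17 * \<delta> ^ 3 + 8 * \<eta>" using annealed_inflection[OF d] by simp
      also have "\<dots> = \<delta> * (17 * \<delta>\<^sup>2 + \<delta> * \<kappa>\<^sup>2 / 16)" by (simp add: \<eta>_def power2_eq_square power3_eq_cube algebra_simps)
      finally have up: "w2 - w1 \<le> 17 * \<delta>\<^sup>2 + \<delta> * \<kappa>\<^sup>2 / 16" using d by simp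
      have "17 * \<delta>\<^sup>2 = \<delta> * \<kappa>\<^sup>2 / 8" by (simp add: \<delta>_def power2_eq_square)
      then have up': "w2 - w1 \<le> \<delta> * \<kappa>\<^sup>2 * (3 / 16)" using up by simp
      have dk: "0 < \<delta> * \<kappa>\<^sup>2" "\<delta> * \<kappa>\<^sup>2 \<le> \<kappa>" using d k k2 mult_mono[of \<delta> \<kappa> "\<kappa>\<^sup>2" 1] mult_left_mono[of \<kappa> 1 \<kappa>] by (auto simp: \<delta>_def power2_eq_square)
      have "w2 - w1 \<le> \<kappa> / 4" using up' dk by linarith
      then have "mean_sq N (scaled g N) w1 - mean_sq N (scaled g N) (w1 + (w2 - w1)) \<le> 4 * (w2 - w1) / \<kappa>\<^sup>2"
        using w2 by (intro mean_sq_lipschitz[OF N w1(4) k(1)]) auto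
      then have "\<delta> \<le> 4 * (w2 - w1) / \<kappa>\<^sup>2" using w1 w2 by simp
      then have "\<delta> * \<kappa>\<^sup>2 \<le> 4 * (w2 - w1)" using k2 by (simp add: pos_le_divide_eq)
      moreover have False if "X \<le> 4 * Y" "Y \<le> X * (3 / 16)" "0 < X" for X Y :: real using that by simp
      ultimately show False using up' dk by blast
    qed
  qed
  then show ?thesis using that d eta by blast
qed

text \<open>
  Let \<open>s\<close> be the mean square at distance \<open>\<kappa>\<close> above the maximal energy.  For larger \<open>t\<close>, adding to
  the Gaussian of mean square \<open>s\<close> a mean along a direction of nearly maximal energy shows that
  \<open>f(t) + 1/2 ln t\<close> grows with slope at least the maximal energy, up to \<open>\<kappa>\<close>; the supergradient
  inequality bounds the slope above by the maximal energy plus \<open>\<kappa>\<close>.  So the function is nearly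
  affine beyond \<open>s\<close>, which \<open>annealed_strict_concave\<close> excludes on an interval of length \<open>\<delta>\<close> below
  \<open>beta_crit\<close>.
\<close>

lemma overlap_near_critical:
  assumes d: "0 < \<delta>" "\<delta> \<le> 1 / 4" and K: "K \<ge> 0"
  obtains \<kappa> \<eta> where "0 < \<kappa>" "\<kappa> \<le> 1" "\<eta> > 0"
    "\<forall>\<^sub>F N in sequentially. \<forall>g. typical g N K \<eta> \<longrightarrow> beta_crit - \<delta> \<le> mean_sq N (scaled g N) (max_quad N (scaled g N) + \<kappa>)"
proof -
  define \<eta> where "\<eta> = \<delta> ^ 3 / 256"
  \<comment> \<open>Both errors are small against the second difference \<open>\<delta>\<^sup>3 / 4\<close>.\<close>
  define \<kappa> where "\<kappa> = \<delta> ^ 3 / 64"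
  have d3: "0 < \<delta> ^ 3" "\<delta> ^ 3 \<le> 1" using d by (auto intro: power_le_one)
  have k: "0 < \<kappa>" "\<kappa> \<le> 1" and eta: "\<eta> > 0" using d3 by (auto simp: \<kappa>_def \<eta>_def)
  define W where "W = K + 1"
  have W: "W > 0" using K by (simp add: W_def)
  have quarter: "0 < (1 / 4 :: real)" by simp
  have "\<forall>\<^sub>F N in sequentially. \<forall>g. typical g N K \<eta> \<longrightarrow> beta_crit - \<delta> \<le> mean_sq N (scaled g N) (max_quad N (scaled g N) + \<kappa>)"
    using free0_lower_uniform[OF k(1) K W eta] sphere_lower_uniform[OF k(1) K order_refl quarter less_imp_le[OF W] zero_le_one eta]
      eventually_ge_at_top[of 1] order_tendstoD(2)[OF lim_1_over_n[where 'a=real] eta]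
  proof eventually_elim
    case (elim N)
    note N = elim(3)
    have Ne: "1 / real N \<le> \<eta>" using elim(4) by simp
    show ?case
    proof (intro allI impI, rule ccontr)
      fix g assume g: "typical g N K \<eta>"
      let ?c = "scaled g N"
      define w where "w = max_quad N ?c + \<kappa>"
      define s where "s = mean_sq N ?c w"
      assume "\<not> beta_crit - \<delta> \<le> mean_sq N ?c (max_quad N ?c + \<kappa>)"
      then have small: "s < beta_crit - \<delta>" by (simp add: s_def w_def)
      have qb: "quad_bounded N ?c K" using g by (simp add: typical_def)
      have p: "coercive N ?c w \<kappa>" using coercive_max_quad[OF N qb, of w] by (simp add: w_def)
      have w: "\<bar>w\<bar> \<le> W" using max_quad_abs_le[OF N qb] k by (auto simp: w_def W_def)
      have s0: "0 < s" unfolding s_def by (rule mean_sq_pos(2)[OF N qb p k(1) w W])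
      obtain e where e: "rdot N e e = 1" "max_quad N ?c - \<kappa> < quad N ?c e" using max_quad_approx[OF N qb k(1)] by blast
      have up: "free0 g N t + ln t / 2 \<le> free0 g N s + ln s / 2 + (t - s) * w + 2 * \<eta>" if "t > 0" for t
        using elim(1)[rule_format, OF qb p w] that by (intro supergradient[OF N p k(1) _ Ne]) (auto simp: s_def)
      have lo: "free0 g N s + ln s / 2 + (t - s) * (w - 2 * \<kappa>) - 2 * \<eta> \<le> free0 g N t + ln t / 2" if t: "beta_crit - \<delta> \<le> t" "t \<le> beta_crit" for t
      proof -
        have t0: "t > 0" "s \<le> t" "1/4 \<le> t" "t \<le> 1" using t small s0 beta_crit d by auto
        define m where "m = (\<lambda>i. sqrt (1 - s / t) * e i)"
        have st: "1 - s / t \<ge> 0" using t0 by simp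
        have mm: "rdot N m m = 1 - s / t" unfolding m_def rdot_scale_left rdot_scale_right using st e by simp
        have qm: "quad N ?c m = (1 - s / t) * quad N ?c e" unfolding m_def quad_scale using st by simp
        have "t * quad N ?c m + w * s + log_gauss N ?c w - \<eta> \<le> free0 g N t + ln t / 2 + log_vol N"
          using elim(2)[rule_format, of g w t "\<lambda>_. 0" m] qb p w t0 mm by (simp add: s_def)
        moreover have "t * quad N ?c m = (t - s) * quad N ?c e" unfolding qm using t0 by (simp add: field_simps)
        moreover have "(t - s) * (w - 2 * \<kappa>) \<le> (t - s) * quad N ?c e" using t0 e by (intro mult_left_mono) (auto simp: w_def)
        moreover have "free0 g N s + ln s / 2 + log_vol N \<le> s * w + log_gauss N ?c w + 1 / real N" by (rule free0_upper[OF N p k(1) s0])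
        ultimately show ?thesis using Ne by (simp add: algebra_simps)
      qed
      have t1: "beta_crit - \<delta> / 2 > 0" using beta_crit d by simp
      have "- (2 * \<kappa>) * ((beta_crit - \<delta> - s) + (beta_crit - s)) - 8 * \<eta> \<le>
        (free0 g N (beta_crit - \<delta>) + ln (beta_crit - \<delta>) / 2) + (free0 g N beta_crit + ln beta_crit / 2) - 2 * (free0 g N (beta_crit - \<delta> / 2) + ln (beta_crit - \<delta> / 2) / 2)"
        using lo[of "beta_crit - \<delta>"] lo[of beta_crit] up[OF t1] d by (simp add: algebra_simps)
      also have "\<dots> \<le> annealed (beta_crit - \<delta>) + annealed beta_crit - 2 * annealed (beta_crit - \<delta> / 2) + 4 * \<eta>"
        using typical_annealed[OF g, of beta_crit] typical_annealed[OF g, of "beta_crit - \<delta>"] typical_annealed[OF g, of "beta_crit - \<delta> / 2"] beta_crit d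
        by (simp add: abs_le_iff)
      also have "\<dots> \<le> - (\<delta> ^ 3 / 4) + 4 * \<eta>" using annealed_strict_concave[OF d] by simp
      finally have "\<delta> ^ 3 / 4 \<le> (2 * \<kappa>) * ((beta_crit - \<delta> - s) + (beta_crit - s)) + 12 * \<eta>" by simp
      also have "\<dots> \<le> (2 * \<kappa>) * 2 + 12 * \<eta>" using k beta_crit s0 d by (intro add_right_mono mult_left_mono) auto
      also have "\<dots> = \<delta> ^ 3 * (1/16 + 12 / 256)" by (simp add: \<kappa>_def \<eta>_def)
      finally show False using d3 by simp
    qed
  qed
  then show ?thesis using that k eta by blast
qed

section \<open>The TAP functional for typical couplings\<close>

text \<open>
  The TAP energy per dimension, with the Hamiltonian written through the scaled couplings.
\<close>

definition tap_density :: "(nat \<Rightarrow> nat \<Rightarrow> real) \<Rightarrow> nat \<Rightarrow> real \<Rightarrow> (nat \<Rightarrow> real) \<Rightarrow> (nat \<Rightarrow> real) \<Rightarrow> real" where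
  "tap_density g N \<beta> h m = \<beta> * quad N (scaled g N) m + rdot N h m + ln (1 - rdot N m m) / 2 + \<beta>\<^sup>2 / 2 * (1 - rdot N m m)\<^sup>2"

lemma tap_energy_tap_density: "N \<ge> 1 \<Longrightarrow> tap_energy g N \<beta> h m = real N * tap_density g N \<beta> h m"
  unfolding tap_energy_def tap_density_def by (simp add: hamiltonian_eq rdot_self[symmetric] rdot_commute[of N m h] algebra_simps)

text \<open>
  In terms of \<open>s = \<beta>(m)\<close> the last two terms of the TAP functional are \<open>annealed s - ln \<beta> / 2\<close>.
\<close>

lemma tap_density_overlap:
  assumes "\<beta> > 0" "s > 0" "\<beta> * (1 - rdot N m m) = s"
  shows "tap_density g N \<beta> h m = \<beta> * quad N (scaled g N) m + rdot N h m + annealed s - ln \<beta> / 2"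
proof -
  have e: "1 - rdot N m m = s / \<beta>" using assms by (simp add: field_simps)
  show ?thesis unfolding tap_density_def e annealed_def using assms by (simp add: ln_div power_divide diff_divide_distrib)
qed

lemma rnorm_diff_le: "\<bar>rnorm N x - rnorm N y\<bar> \<le> rnorm N (\<lambda>i. x i + -1 * y i)"
proof -
  have "rnorm N x \<le> rnorm N (\<lambda>i. x i + -1 * y i) + rnorm N y"
    using rnorm_triangle[of N "\<lambda>i. x i + -1 * y i" y] by simp
  moreover have "rnorm N y \<le> rnorm N (\<lambda>i. -1 * (x i + -1 * y i)) + rnorm N x"
    using rnorm_triangle[of N "\<lambda>i. -1 * (x i + -1 * y i)" x] by simp
  ultimately show ?thesis unfolding rnorm_scale by simp
qed

text \<open>
  The maximiser of \<open>h \<bullet> x - \<beta> (w |x|\<^sup>2 - q(x))\<close>, characterised by its Euler equation.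
\<close>

definition stationary :: "nat \<Rightarrow> (nat \<Rightarrow> nat \<Rightarrow> real) \<Rightarrow> real \<Rightarrow> (nat \<Rightarrow> real) \<Rightarrow> real \<Rightarrow> (nat \<Rightarrow> real)" where
  "stationary N c \<beta> h w = (SOME m. \<forall>x. 2 * (\<beta> * confined_bilin N c w m x) = rdot N h x)"

lemma stationary:
  assumes "coercive N c w \<kappa>" "\<kappa> > 0" "\<beta> > 0"
  shows "2 * (\<beta> * confined_bilin N c w (stationary N c \<beta> h w) x) = rdot N h x"
proof -
  obtain m where m: "\<And>x. 2 * confined_bilin N c w m x = rdot N (\<lambda>i. (1 / \<beta>) * h i) x" using coercive_solve[OF assms(1,2)] by blast
  have "\<forall>x. 2 * (\<beta> * confined_bilin N c w m x) = rdot N h x"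
    using m assms(3) unfolding rdot_scale_left by (simp add: field_simps)
  then have "\<forall>x. 2 * (\<beta> * confined_bilin N c w (stationary N c \<beta> h w) x) = rdot N h x" unfolding stationary_def by (rule someI[where P="\<lambda>m. \<forall>x. 2 * (\<beta> * confined_bilin N c w m x) = rdot N h x"])
  then show ?thesis by blast
qed

lemma stationary_norm:
  assumes p: "coercive N c w \<kappa>" "\<kappa> > 0" "\<beta> > 0"
  shows "rnorm N (stationary N c \<beta> h w) \<le> rnorm N h / (2 * \<beta> * \<kappa>)"
proof -
  let ?m = "stationary N c \<beta> h w"
  have "2 * (\<beta> * (\<kappa> * (rnorm N ?m)\<^sup>2)) \<le> 2 * (\<beta> * confined N c w ?m)"
    using coerciveD[OF p(1), of ?m] p by (simp add: rdot_self)
  also have "\<dots> = rdot N h ?m" using stationary[OF p, of h ?m] by (simp add: confined_bilin_self)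
  also have "\<dots> \<le> rnorm N h * rnorm N ?m" using rdot_le_rnorm[of N h ?m] by simp
  finally have "(2 * \<beta> * \<kappa> * rnorm N ?m) * rnorm N ?m \<le> rnorm N h * rnorm N ?m" by (simp add: power2_eq_square mult_ac)
  then have "2 * \<beta> * \<kappa> * rnorm N ?m \<le> rnorm N h" if "rnorm N ?m > 0" using that by (simp add: mult_le_cancel_right)
  then have "2 * \<beta> * \<kappa> * rnorm N ?m \<le> rnorm N h" using rnorm_nonneg[of N ?m] by (cases "rnorm N ?m = 0") auto
  then show ?thesis using p by (simp add: pos_le_divide_eq mult_ac)
qed

text \<open>
  Subtract the Euler equations at \<open>w\<close> and \<open>w'\<close>, test with the difference of the solutions and use
  coercivity.
\<close>

lemma stationary_lipschitz:
  assumes p: "coercive N c w \<kappa>" "coercive N c w' \<kappa>" "\<kappa> > 0" "\<beta> > 0"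
  shows "\<bar>rnorm N (stationary N c \<beta> h w) - rnorm N (stationary N c \<beta> h w')\<bar> \<le> rnorm N h / (2 * \<beta> * \<kappa>\<^sup>2) * \<bar>w - w'\<bar>"
proof -
  let ?m = "stationary N c \<beta> h w" and ?m' = "stationary N c \<beta> h w'"
  define d where "d = (\<lambda>i. ?m i + -1 * ?m' i)"
  have "\<beta> * confined_bilin N c w ?m d = \<beta> * confined_bilin N c w' ?m' d"
    using stationary[OF p(1,3,4), of h d] stationary[OF p(2,3,4), of h d] by linarith
  then have e1: "confined_bilin N c w ?m d = confined_bilin N c w' ?m' d" using p by simp
  have "confined N c w d = confined_bilin N c w ?m d - confined_bilin N c w ?m' d"
    unfolding confined_bilin_self[symmetric] by (subst d_def) (unfold confined_bilin_add_left confined_bilin_scale_left, simp)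
  also have "\<dots> = (w' - w) * rdot N ?m' d" unfolding e1 by (simp add: confined_bilin_def algebra_simps)
  also have "\<dots> \<le> \<bar>w' - w\<bar> * \<bar>rdot N ?m' d\<bar>" by (metis abs_ge_self abs_mult)
  also have "\<dots> \<le> \<bar>w' - w\<bar> * (rnorm N ?m' * rnorm N d)" by (intro mult_left_mono rdot_le_rnorm) auto
  finally have "\<kappa> * (rnorm N d)\<^sup>2 \<le> \<bar>w' - w\<bar> * (rnorm N ?m' * rnorm N d)"
    using coerciveD[OF p(1), of d] by (simp add: rdot_self)
  then have "(\<kappa> * rnorm N d) * rnorm N d \<le> (\<bar>w' - w\<bar> * rnorm N ?m') * rnorm N d" by (simp add: power2_eq_square mult_ac)
  then have "\<kappa> * rnorm N d \<le> \<bar>w' - w\<bar> * rnorm N ?m'" if "rnorm N d > 0" using that by (simp add: mult_le_cancel_right)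
  then have "\<kappa> * rnorm N d \<le> \<bar>w' - w\<bar> * rnorm N ?m'" using rnorm_nonneg[of N d] by (cases "rnorm N d = 0") auto
  also have "\<dots> \<le> \<bar>w' - w\<bar> * (rnorm N h / (2 * \<beta> * \<kappa>))" by (intro mult_left_mono stationary_norm[OF p(2-4)]) auto
  finally have "rnorm N d \<le> \<bar>w' - w\<bar> * (rnorm N h / (2 * \<beta> * \<kappa>)) / \<kappa>" using p by (simp add: pos_le_divide_eq mult_ac)
  also have "\<dots> = rnorm N h / (2 * \<beta> * \<kappa>\<^sup>2) * \<bar>w - w'\<bar>" by (simp add: power2_eq_square abs_minus_commute mult_ac)
  finally show ?thesis using rnorm_diff_le[of N ?m ?m'] unfolding d_def by linarith
qed

lemma stationary_continuous:
  assumes "coercive N c u \<kappa>" "\<kappa> > 0" "\<beta> > 0"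
  shows "continuous_on {u..} (\<lambda>w. rnorm N (stationary N c \<beta> h w))"
proof (rule continuous_onI)
  fix x e :: real assume x: "x \<in> {u..}" and e: "e > 0"
  define C where "C = rnorm N h / (2 * \<beta> * \<kappa>\<^sup>2)"
  have C: "C \<ge> 0" using assms by (simp add: C_def)
  have coercive: "coercive N c y \<kappa>" if "y \<ge> u" for y using coercive_mono[OF coercive_shift[OF assms(1), of "y - u"]] that by simp
  show "\<exists>d>0. \<forall>x'\<in>{u..}. dist x' x < d \<longrightarrow> dist (rnorm N (stationary N c \<beta> h x')) (rnorm N (stationary N c \<beta> h x)) \<le> e"
  proof (intro exI[of _ "e / (C + 1)"] conjI ballI impI)
    show "e / (C + 1) > 0" using e C by simp
    fix y assume y: "y \<in> {u..}" "dist y x < e / (C + 1)"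
    have "\<bar>rnorm N (stationary N c \<beta> h y) - rnorm N (stationary N c \<beta> h x)\<bar> \<le> C * \<bar>y - x\<bar>"
      unfolding C_def using x y by (intro stationary_lipschitz[OF coercive coercive assms(2,3)]) auto
    also have "\<dots> \<le> (C + 1) * \<bar>y - x\<bar>" by (intro mult_right_mono) auto
    also have "\<dots> \<le> (C + 1) * (e / (C + 1))" using y C by (intro mult_left_mono) (auto simp: dist_real_def)
    finally show "dist (rnorm N (stationary N c \<beta> h y)) (rnorm N (stationary N c \<beta> h x)) \<le> e" using C by (simp add: dist_real_def)
  qed
qed

text \<open>
  Let \<open>m\<close> be the stationary point at multiplier \<open>w\<close> and follow \<open>\<Phi>(w) = \<beta> |m|\<^sup>2 + s(w)\<close>, which is
  continuous and below \<open>\<beta>\<close> for large \<open>w\<close>.  If \<open>\<Phi>\<close> is at least \<open>\<beta>\<close> at the lowest admissible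
  multiplier, some \<open>w\<close> gives \<open>\<Phi>(w) = \<beta>\<close>, and \<open>sphere_upper\<close> at this \<open>w\<close> is the claim.
  Otherwise stay at the lowest multiplier and move \<open>m\<close> along a direction of nearly maximal energy
  until \<open>\<beta> |m|\<^sup>2 + s = \<beta>\<close>.  In that direction the confined form is at most \<open>2 \<kappa>\<close> and the
  displacement is at most 2, hence the loss \<open>8 \<beta> \<kappa>\<close>.
\<close>

lemma variational_upper:
  assumes N: "N \<ge> 1" and K: "quad_bounded N (scaled g N) K" and b: "\<beta> > 0" and k: "\<kappa> > 0"
    and R: "\<kappa> \<le> R" "rnorm N h / \<beta> \<le> R" "2 / \<beta> \<le> R"
  obtains w m where "max_quad N (scaled g N) + \<kappa> \<le> w" "w \<le> max_quad N (scaled g N) + R" "\<beta> * (1 - rdot N m m) = mean_sq N (scaled g N) w"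
    "free_energy g N \<beta> h + ln \<beta> / 2 + log_vol N
      \<le> \<beta> * quad N (scaled g N) m + rdot N h m + w * mean_sq N (scaled g N) w + log_gauss N (scaled g N) w + 8 * \<beta> * \<kappa> + (rnorm N h + 1) / real N"
proof -
  let ?c = "scaled g N"
  define u where "u = max_quad N ?c + \<kappa>"
  have p: "coercive N ?c w \<kappa>" if "w \<ge> u" for w
    using coercive_mono[OF coercive_max_quad[OF N K, of w], of \<kappa>] that by (simp add: u_def)
  define \<mu> where "\<mu> w = stationary N ?c \<beta> h w" for w
  define \<Phi> where "\<Phi> w = \<beta> * (rnorm N (\<mu> w))\<^sup>2 + mean_sq N ?c w" for w
  have R0: "R > 0" using k R by simp
  have pu: "coercive N ?c u \<kappa>" by (rule p) simp
  have UB: "free_energy g N \<beta> h + ln \<beta> / 2 + log_vol N \<le> \<beta> * w + rdot N h (\<mu> w) - \<beta> * confined N ?c w (\<mu> w) + log_gauss N ?c w + (rnorm N h + 1) / real N"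
    if "w \<ge> u" for w
    unfolding \<mu>_def by (rule sphere_upper[OF N p[OF that] k b stationary[OF p[OF that] k b]])
  have cont: "continuous_on {u..} \<Phi>"
    unfolding \<Phi>_def[abs_def] \<mu>_def by (intro continuous_intros stationary_continuous[OF pu k b] mean_sq_continuous_on[OF N pu k])
  have end1: "\<Phi> (max_quad N ?c + R) \<le> \<beta>"
  proof -
    have pR: "coercive N ?c (max_quad N ?c + R) R" using coercive_max_quad[OF N K, of "max_quad N ?c + R"] by simp
    have "rnorm N (\<mu> (max_quad N ?c + R)) \<le> rnorm N h / (2 * \<beta> * R)" unfolding \<mu>_def by (rule stationary_norm[OF pR R0 b])
    also have "\<dots> \<le> 1 / 2" using R(2) R0 b by (simp add: field_simps)
    finally have "(rnorm N (\<mu> (max_quad N ?c + R)))\<^sup>2 \<le> (1/2)\<^sup>2" by (intro power_mono) auto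
    then have "\<beta> * (rnorm N (\<mu> (max_quad N ?c + R)))\<^sup>2 \<le> \<beta> * (1/2)" using b by (intro mult_left_mono) (auto simp: power2_eq_square)
    moreover have "mean_sq N ?c (max_quad N ?c + R) \<le> 1 / R" by (rule mean_sq_le[OF N pR R0])
    moreover have "1 / R \<le> \<beta> / 2" using R(3) R0 b by (simp add: field_simps)
    ultimately show ?thesis unfolding \<Phi>_def by simp
  qed
  show ?thesis
  proof (cases "\<beta> \<le> \<Phi> u")
    case True
    obtain w where w: "u \<le> w" "w \<le> max_quad N ?c + R" "\<Phi> w = \<beta>"
      using IVT2'[of \<Phi> "max_quad N ?c + R" \<beta> u] True end1 R continuous_on_subset[OF cont] by (auto simp: u_def)
    have bs: "\<beta> * (1 - rdot N (\<mu> w) (\<mu> w)) = mean_sq N ?c w" using w(3) by (simp add: \<Phi>_def rdot_self algebra_simps)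
    show ?thesis
    proof (rule that[OF _ w(2) bs])
      show "max_quad N (scaled g N) + \<kappa> \<le> w" using w by (simp add: u_def)
      have "\<beta> * w + rdot N h (\<mu> w) - \<beta> * confined N ?c w (\<mu> w) = \<beta> * quad N ?c (\<mu> w) + rdot N h (\<mu> w) + w * mean_sq N ?c w"
        unfolding bs[symmetric] confined_def by (simp add: algebra_simps)
      moreover have "0 \<le> 8 * \<beta> * \<kappa>" using b k by simp
      ultimately show "free_energy g N \<beta> h + ln \<beta> / 2 + log_vol N
        \<le> \<beta> * quad N ?c (\<mu> w) + rdot N h (\<mu> w) + w * mean_sq N ?c w + log_gauss N ?c w + 8 * \<beta> * \<kappa> + (rnorm N h + 1) / real N"
        using UB[OF w(1)] by linarith
    qed
  next
    case False
    let ?m = "\<mu> u"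
    obtain e where e: "rdot N e e = 1" "max_quad N ?c - \<kappa> < quad N ?c e" using max_quad_approx[OF N K k] by blast
    have e1: "rnorm N e = 1" using e by (simp add: rnorm_eq_sqrt)
    define T where "T = 1 - mean_sq N ?c u / \<beta>"
    define G where "G t = rdot N ?m ?m + 2 * t * rdot N ?m e + t\<^sup>2" for t
    have mT: "rdot N ?m ?m \<le> T" using False b by (simp add: \<Phi>_def T_def rdot_self field_simps)
    have T1: "T \<le> 1" using mean_sq_nonneg[of N ?c u] b by (simp add: T_def)
    have mm: "rdot N ?m ?m \<le> 1" using mT T1 by simp
    then have m1: "rnorm N ?m \<le> 1" by (simp add: rnorm_eq_sqrt)
    have G2: "T \<le> G 2"
    proof -
      have "\<bar>rdot N ?m e\<bar> \<le> rnorm N ?m" using rdot_le_rnorm[of N ?m e] e1 by simp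
      moreover have "0 \<le> (1 - rnorm N ?m) * (3 - rnorm N ?m)" using m1 by (intro mult_nonneg_nonneg) auto
      then have "0 \<le> 3 - 4 * rnorm N ?m + (rnorm N ?m)\<^sup>2" by (simp add: algebra_simps power2_eq_square)
      ultimately show ?thesis using T1 unfolding G_def rdot_self by (simp add: abs_le_iff)
    qed
    have "continuous_on {0..2} G" unfolding G_def[abs_def] by (intro continuous_intros)
    then obtain t where t: "0 \<le> t" "t \<le> 2" "G t = T"
      using IVT'[of G 0 T 2] mT G2 by (auto simp: G_def)
    define m where "m = (\<lambda>i. ?m i + t * e i)"
    have mmT: "rdot N m m = T"
      unfolding t(3)[symmetric] G_def m_def rdot_add_left rdot_add_right rdot_scale_left rdot_scale_right e(1)
      by (simp add: rdot_commute[of N e] power2_eq_square)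
    have bs: "\<beta> * (1 - rdot N m m) = mean_sq N ?c u" unfolding mmT T_def using b by simp
    have st: "2 * (\<beta> * confined_bilin N ?c u ?m e) = rdot N h e" unfolding \<mu>_def by (rule stationary[OF pu k b])
    have "rdot N h m - \<beta> * confined N ?c u m = rdot N h ?m - \<beta> * confined N ?c u ?m - \<beta> * (t\<^sup>2 * confined N ?c u e)"
      unfolding m_def rdot_add_right rdot_scale_right confined_add confined_scale confined_bilin_scale_right st[symmetric] by (simp add: algebra_simps)
    moreover have "\<beta> * (t\<^sup>2 * confined N ?c u e) \<le> \<beta> * (4 * (2 * \<kappa>))"
    proof (intro mult_left_mono mult_mono)
      show "t\<^sup>2 \<le> 4" using t power_mono[of t 2 2] by simp
      show "confined N ?c u e \<le> 2 * \<kappa>" using e by (simp add: confined_def u_def)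
      show "0 \<le> confined N ?c u e" using coerciveD[OF pu, of e] e k by simp
    qed (use b in auto)
    moreover have "\<beta> * u + rdot N h m - \<beta> * confined N ?c u m = \<beta> * quad N ?c m + rdot N h m + u * mean_sq N ?c u"
      unfolding bs[symmetric] confined_def by (simp add: algebra_simps)
    ultimately have "free_energy g N \<beta> h + ln \<beta> / 2 + log_vol N
        \<le> \<beta> * quad N ?c m + rdot N h m + u * mean_sq N ?c u + log_gauss N ?c u + 8 * \<beta> * \<kappa> + (rnorm N h + 1) / real N"
      using UB[OF order_refl] by (simp add: algebra_simps)
    then show ?thesis using that[of u m] bs R by (simp add: u_def)
  qed
qed

text \<open>
  The point \<open>m\<close> is the one from \<open>variational_upper\<close>; \<open>overlap_below_critical\<close> places it in the
  Plefka region, and \<open>free0_lower_uniform\<close> with typicality turns \<open>w s(w) + D(w)\<close> into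
  \<open>annealed s\<close>.
\<close>

lemma free_energy_le_tap:
  assumes b: "\<beta> > 0" and H: "H \<ge> 0" and K: "K \<ge> 0" and e: "\<epsilon> > 0"
  obtains \<eta> where "\<eta> > 0"
    "\<forall>\<^sub>F N in sequentially. \<forall>g h. typical g N K \<eta> \<longrightarrow> rnorm N h = H \<longrightarrow>
       (\<exists>m. rdot N m m < 1 \<and> \<beta> * (1 - rdot N m m) \<le> beta_crit \<and> free_energy g N \<beta> h \<le> tap_density g N \<beta> h m + \<epsilon>)"
proof -
  define \<kappa> where "\<kappa> = min 1 (\<epsilon> / (32 * \<beta>))"
  have k: "0 < \<kappa>" "\<kappa> \<le> 1" using b e by (auto simp: \<kappa>_def)
  have bk: "8 * \<beta> * \<kappa> \<le> \<epsilon> / 4"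
  proof -
    have "8 * \<beta> * \<kappa> \<le> 8 * \<beta> * (\<epsilon> / (32 * \<beta>))" using b by (intro mult_left_mono) (auto simp: \<kappa>_def)
    then show ?thesis using b by simp
  qed
  define R where "R = 1 + H / \<beta> + 2 / \<beta>"
  have R: "1 \<le> R" "\<kappa> \<le> R" "H / \<beta> \<le> R" "2 / \<beta> \<le> R"
  proof -
    have "0 \<le> H / \<beta>" "0 \<le> 2 / \<beta>" using b H by auto
    then show "1 \<le> R" "\<kappa> \<le> R" "H / \<beta> \<le> R" "2 / \<beta> \<le> R" using k unfolding R_def by linarith+
  qed
  define W where "W = K + R"
  have W: "W > 0" using K R by (simp add: W_def)
  obtain \<delta> \<eta>1 where g1: "\<delta> > 0" "\<eta>1 > 0" and
    ev1: "\<forall>\<^sub>F N in sequentially. \<forall>g w. typical g N K \<eta>1 \<longrightarrow> coercive N (scaled g N) w \<kappa> \<longrightarrow> \<bar>w\<bar> \<le> W \<longrightarrow> mean_sq N (scaled g N) w \<le> beta_crit - \<delta>"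
    by (rule overlap_below_critical[OF k K W])
  define \<eta> where "\<eta> = min \<eta>1 (\<epsilon> / 4)"
  have eta: "\<eta> > 0" "\<eta> \<le> \<eta>1" "\<eta> \<le> \<epsilon> / 4" using g1 e by (auto simp: \<eta>_def)
  have e4: "\<epsilon> / 4 > 0" using e by simp
  have "(\<lambda>N. (H + 1) * (1 / real N)) \<longlonglongrightarrow> (H + 1) * 0" by (intro tendsto_intros lim_1_over_n)
  then have ev3: "\<forall>\<^sub>F N in sequentially. (H + 1) * (1 / real N) < \<epsilon> / 4" by (rule order_tendstoD) (use e in simp)
  have "\<forall>\<^sub>F N in sequentially. \<forall>g h. typical g N K \<eta> \<longrightarrow> rnorm N h = H \<longrightarrow>
       (\<exists>m. rdot N m m < 1 \<and> \<beta> * (1 - rdot N m m) \<le> beta_crit \<and> free_energy g N \<beta> h \<le> tap_density g N \<beta> h m + \<epsilon>)"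
    using ev1 free0_lower_uniform[OF k(1) K W e4] ev3 eventually_ge_at_top[of 1]
  proof eventually_elim
    case (elim N)
    note N = elim(4)
    show ?case
    proof (intro allI impI)
      fix g h assume g: "typical g N K \<eta>" and h: "rnorm N h = H"
      let ?c = "scaled g N"
      have qb: "quad_bounded N ?c K" using g by (simp add: typical_def)
      have g': "typical g N K \<eta>1" using typical_mono[OF g eta(2)] .
      obtain w m where w: "max_quad N ?c + \<kappa> \<le> w" "w \<le> max_quad N ?c + R" and bs: "\<beta> * (1 - rdot N m m) = mean_sq N ?c w" and
        F: "free_energy g N \<beta> h + ln \<beta> / 2 + log_vol N \<le> \<beta> * quad N ?c m + rdot N h m + w * mean_sq N ?c w + log_gauss N ?c w + 8 * \<beta> * \<kappa> + (rnorm N h + 1) / real N"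
        using variational_upper[OF N qb b k(1) R(2), of h] R h by auto
      have p: "coercive N ?c w \<kappa>" using coercive_mono[OF coercive_max_quad[OF N qb, of w], of \<kappa>] w by simp
      have wW: "\<bar>w\<bar> \<le> W" using w max_quad_abs_le[OF N qb] k R by (auto simp: W_def abs_le_iff)
      define s where "s = mean_sq N ?c w"
      have s0: "0 < s" unfolding s_def by (rule mean_sq_pos(2)[OF N qb p k(1) wW W])
      have s1: "s \<le> beta_crit - \<delta>" using elim(1)[rule_format, OF g' p wW] by (simp add: s_def)
      have lo: "w * s + log_gauss N ?c w - \<epsilon> / 4 \<le> free0 g N s + ln s / 2 + log_vol N"
        using elim(2)[rule_format, OF qb p wW] by (simp add: s_def)
      have "free0 g N s + ln s / 2 \<le> annealed s + \<epsilon> / 4" using typical_annealed[OF g, of s] s0 s1 g1 eta by (simp add: abs_le_iff)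
      moreover have "(rnorm N h + 1) / real N < \<epsilon> / 4" using elim(3) h by simp
      ultimately have "free_energy g N \<beta> h \<le> \<beta> * quad N ?c m + rdot N h m + annealed s - ln \<beta> / 2 + \<epsilon>"
        using F lo bk unfolding s_def[symmetric] by linarith
      then have "free_energy g N \<beta> h \<le> tap_density g N \<beta> h m + \<epsilon>" using tap_density_overlap[OF b s0] bs by (simp add: s_def)
      moreover have "rdot N m m < 1" using bs s0 b by (metis diff_gt_0_iff_gt s_def zero_less_mult_pos)
      ultimately show "\<exists>m. rdot N m m < 1 \<and> \<beta> * (1 - rdot N m m) \<le> beta_crit \<and> free_energy g N \<beta> h \<le> tap_density g N \<beta> h m + \<epsilon>"
        using bs s1 g1 by (intro exI[of _ m]) (simp add: s_def)
    qed
  qed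
  then show ?thesis using that eta by blast
qed

text \<open>
  Moving \<open>m\<close> radially outwards lowers \<open>\<beta>(m)\<close> from \<open>s\<close> to \<open>s'\<close> and changes the TAP functional
  little.  The field term is only 1/2-Hoelder continuous at \<open>m = 0\<close>, hence the square root.
\<close>

lemma tap_density_move_inward:
  assumes N: "N \<ge> 1" and qb: "quad_bounded N (scaled g N) K" and b: "\<beta> > 0" and s: "0 < s'" "s' \<le> s" "s - s' \<le> \<delta>" "s \<le> beta_crit" "s \<le> \<beta>"
    and far: "s' < s \<Longrightarrow> beta_crit - 1 / 4 \<le> s'" and m: "\<beta> * (1 - rdot N m m) = s"
  obtains m' where "\<beta> * (1 - rdot N m' m') = s'"
    "tap_density g N \<beta> h m \<le> tap_density g N \<beta> h m' + (K + 2) * \<delta> + rnorm N h * sqrt (\<delta> / \<beta>)"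
proof -
  let ?c = "scaled g N"
  have K0: "K \<ge> 0" by (rule quad_bounded_nonneg[OF N qb])
  obtain e where e: "rdot N e e = 1" "\<And>i. i \<in> {1..N} \<Longrightarrow> m i = rnorm N m * e i" by (rule unit_direction[OF N, of m]) blast
  define r where "r = rnorm N m"
  define r' where "r' = sqrt (1 - s' / \<beta>)"
  define m' where "m' = (\<lambda>i. r' * e i)"
  have r2: "r\<^sup>2 = 1 - s / \<beta>" using m b by (simp add: r_def rdot_self[symmetric] field_simps)
  have "s' / \<beta> \<le> 1" using s b by simp
  then have r'2: "r'\<^sup>2 = 1 - s' / \<beta>" by (simp add: r'_def)
  have r0: "0 \<le> r" "0 \<le> r'" using \<open>s' / \<beta> \<le> 1\<close> by (auto simp: r_def r'_def)
  have diff: "r'\<^sup>2 - r\<^sup>2 = (s - s') / \<beta>" unfolding r2 r'2 by (simp add: diff_divide_distrib)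
  then have "r\<^sup>2 \<le> r'\<^sup>2" using s b by (metis diff_ge_0_iff_ge divide_nonneg_pos)
  then have rr: "r \<le> r'" using r0 by (simp add: power2_le_iff_abs_le)
  have m's: "\<beta> * (1 - rdot N m' m') = s'"
    unfolding m'_def rdot_scale_left rdot_scale_right e(1) using r'2 b by (simp add: power2_eq_square[symmetric])
  have qm: "quad N ?c m = r\<^sup>2 * quad N ?c e" using quad_cong[of N m "\<lambda>i. r * e i" ?c] e(2) by (simp add: r_def quad_scale)
  have hm: "rdot N h m = r * rdot N h e" using rdot_cong[of N m "\<lambda>i. r * e i" h] e(2) by (simp add: r_def rdot_scale_right)
  have qm': "quad N ?c m' = r'\<^sup>2 * quad N ?c e" and hm': "rdot N h m' = r' * rdot N h e" by (simp_all add: m'_def quad_scale rdot_scale_right)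
  have "\<beta> * quad N ?c m - \<beta> * quad N ?c m' = - (\<beta> * (r'\<^sup>2 - r\<^sup>2)) * quad N ?c e" unfolding qm qm' by (simp add: algebra_simps)
  also have "\<beta> * (r'\<^sup>2 - r\<^sup>2) = s - s'" unfolding diff using b by simp
  also have "- (s - s') * quad N ?c e = (s - s') * (- quad N ?c e)" by (simp add: algebra_simps)
  also have "\<dots> \<le> (s - s') * K" using s quad_boundedD[OF qb, of e] e by (intro mult_left_mono) (auto simp: abs_le_iff)
  also have "\<dots> \<le> \<delta> * K" using s K0 by (intro mult_right_mono) auto
  finally have 1: "\<beta> * quad N ?c m \<le> \<beta> * quad N ?c m' + K * \<delta>" by (simp add: mult.commute)
  have "(r' - r)\<^sup>2 \<le> r'\<^sup>2 - r\<^sup>2"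
  proof -
    have "r * r \<le> r * r'" using r0 rr by (intro mult_left_mono) auto
    then show ?thesis by (simp add: power2_eq_square algebra_simps)
  qed
  also have "\<dots> \<le> \<delta> / \<beta>" unfolding diff using s b by (intro divide_right_mono) auto
  finally have "r' - r \<le> sqrt (\<delta> / \<beta>)" by (rule real_le_rsqrt)
  moreover have "- rdot N h e \<le> rnorm N h" using rdot_le_rnorm[of N h e] e by (simp add: rnorm_eq_sqrt abs_le_iff)
  then have "(r' - r) * (- rdot N h e) \<le> (r' - r) * rnorm N h" using rr by (intro mult_left_mono) auto
  moreover have "(r' - r) * rnorm N h \<le> sqrt (\<delta> / \<beta>) * rnorm N h" using calculation(1) by (intro mult_right_mono) auto
  ultimately have 2: "rdot N h m \<le> rdot N h m' + rnorm N h * sqrt (\<delta> / \<beta>)" unfolding hm hm' by (simp add: algebra_simps)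
  have 3: "annealed s \<le> annealed s' + 2 * \<delta>"
  proof (cases "s' < s")
    case True
    have s'h: "s' \<ge> 0.45" using far[OF True] beta_crit(1) by simp
    have "1 + (s - s') / s' = s / s'" using s by (simp add: field_simps)
    then have "ln s - ln s' = ln (1 + (s - s') / s')" using s by (simp add: ln_div)
    also have "\<dots> \<le> (s - s') / s'" using s by (intro ln_add_one_self_le_self) auto
    also have "\<dots> \<le> \<delta> / 0.45" using s s'h by (intro frac_le) auto
    finally have l: "ln s \<le> ln s' + \<delta> / 0.45" by simp
    have "s\<^sup>2 - s'\<^sup>2 = (s - s') * (s + s')" by (simp add: power2_eq_square algebra_simps)
    also have "\<dots> \<le> \<delta> * 1.42" using s beta_crit by (intro mult_mono) auto
    finally show ?thesis using l s True unfolding annealed_def by simp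
  next
    case False
    then show ?thesis using s by (simp add: annealed_def)
  qed
  have "tap_density g N \<beta> h m \<le> tap_density g N \<beta> h m' + (K + 2) * \<delta> + rnorm N h * sqrt (\<delta> / \<beta>)"
    using 1 2 3 s unfolding tap_density_overlap[OF b less_le_trans[OF s(1,2)] m] tap_density_overlap[OF b s(1) m's] by (simp add: algebra_simps)
  with m's show ?thesis by (rule that)
qed

text \<open>
  Near \<open>|m| = 1\<close> the logarithm makes the TAP functional smaller than the trivial lower bound on the
  free energy.  Elsewhere move \<open>\<beta>(m)\<close> slightly below \<open>beta_crit\<close>; then \<open>overlap_near_critical\<close>
  supplies a multiplier with this mean square at a fixed distance from the maximal energy, and
  \<open>sphere_lower_uniform\<close> applies.
\<close>

lemma tap_le_free_energy:
  assumes b: "\<beta> > 0" and H: "H \<ge> 0" and K: "K \<ge> 0" and e: "\<epsilon> > 0"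
  obtains \<eta> where "\<eta> > 0"
    "\<forall>\<^sub>F N in sequentially. \<forall>g h m. typical g N K \<eta> \<longrightarrow> rnorm N h = H \<longrightarrow> rdot N m m < 1 \<longrightarrow> \<beta> * (1 - rdot N m m) \<le> beta_crit \<longrightarrow>
       tap_density g N \<beta> h m \<le> free_energy g N \<beta> h + \<epsilon>"
proof -
  \<comment> \<open>Below this value of \<open>1 - |m|\<^sup>2\<close> the logarithm outweighs all other terms.\<close>
  define r0 where "r0 = exp (- (2 * (2 * (\<beta> * K + H) + \<beta>\<^sup>2 / 2)))"
  define \<delta> where "\<delta> = min (1/4) (min (\<epsilon> / (8 * (K + 2))) (\<beta> * (\<epsilon> / (8 * (H + 1)))\<^sup>2))"
  have d0: "0 < \<delta>" using e K b H by (auto simp: \<delta>_def)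
  have d: "0 < \<delta>" "\<delta> \<le> 1/4" by (rule d0) (unfold \<delta>_def, rule min.cobounded1)
  have dK: "(K + 2) * \<delta> \<le> \<epsilon> / 8"
  proof -
    have "(K + 2) * \<delta> \<le> (K + 2) * (\<epsilon> / (8 * (K + 2)))" using K by (intro mult_left_mono) (auto simp: \<delta>_def)
    also have "\<dots> = \<epsilon> / 8" using K by (simp add: field_simps)
    finally show ?thesis .
  qed
  have dH: "H * sqrt (\<delta> / \<beta>) \<le> \<epsilon> / 8"
  proof -
    have "\<delta> \<le> \<beta> * (\<epsilon> / (8 * (H + 1)))\<^sup>2" by (simp add: \<delta>_def)
    then have "\<delta> / \<beta> \<le> (\<epsilon> / (8 * (H + 1)))\<^sup>2" using b by (simp add: pos_divide_le_eq mult.commute)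
    then have "sqrt (\<delta> / \<beta>) \<le> \<epsilon> / (8 * (H + 1))" using e H by (intro real_le_lsqrt) auto
    then have "H * sqrt (\<delta> / \<beta>) \<le> (H + 1) * (\<epsilon> / (8 * (H + 1)))" using H d b by (intro mult_mono) auto
    also have "\<dots> = \<epsilon> / 8" using H by (simp add: field_simps)
    finally show ?thesis .
  qed
  obtain \<kappa> \<eta>1 where k: "0 < \<kappa>" "\<kappa> \<le> 1" and e1: "\<eta>1 > 0" and
    ev1: "\<forall>\<^sub>F N in sequentially. \<forall>g. typical g N K \<eta>1 \<longrightarrow> beta_crit - \<delta> \<le> mean_sq N (scaled g N) (max_quad N (scaled g N) + \<kappa>)"
    by (rule overlap_near_critical[OF d K])
  define \<eta> where "\<eta> = min \<eta>1 (\<epsilon> / 8)"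
  have eta: "\<eta> > 0" "\<eta> \<le> \<eta>1" "\<eta> \<le> \<epsilon> / 8" using e1 e by (auto simp: \<eta>_def)
  define smin where "smin = min (\<beta> * r0) (1/4)"
  have smin: "smin > 0" using b by (simp add: smin_def r0_def)
  define W where "W = K + 1 + 1 / smin"
  have W: "W \<ge> 0" using K smin by (simp add: W_def)
  have e8: "\<epsilon> / 8 > 0" using e by simp
  have "\<forall>\<^sub>F N in sequentially. \<forall>g h m. typical g N K \<eta> \<longrightarrow> rnorm N h = H \<longrightarrow> rdot N m m < 1 \<longrightarrow> \<beta> * (1 - rdot N m m) \<le> beta_crit \<longrightarrow>
       tap_density g N \<beta> h m \<le> free_energy g N \<beta> h + \<epsilon>"
    using ev1 sphere_lower_uniform[OF k(1) K H b W less_imp_le[OF b] e8] eventually_ge_at_top[of 1] order_tendstoD(2)[OF lim_1_over_n[where 'a=real] e8]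
  proof eventually_elim
    case (elim N)
    note N = elim(3)
    show ?case
    proof (intro allI impI)
      fix g h m assume g: "typical g N K \<eta>" and h: "rnorm N h = H" and m: "rdot N m m < 1" "\<beta> * (1 - rdot N m m) \<le> beta_crit"
      let ?c = "scaled g N"
      have qb: "quad_bounded N ?c K" using g by (simp add: typical_def)
      have g': "typical g N K \<eta>1" using typical_mono[OF g eta(2)] .
      define s where "s = \<beta> * (1 - rdot N m m)"
      have s0: "0 < s" "s \<le> beta_crit" "s \<le> \<beta>" using m b by (auto simp: s_def)
      show "tap_density g N \<beta> h m \<le> free_energy g N \<beta> h + \<epsilon>"
      proof (cases "1 - rdot N m m \<le> r0")
        case True
        have "\<bar>quad N ?c m\<bar> \<le> K * rdot N m m" by (rule quad_boundedD[OF qb])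
        also have "\<dots> \<le> K * 1" using m K by (intro mult_left_mono) auto
        finally have "\<beta> * quad N ?c m \<le> \<beta> * K" using b by (intro mult_left_mono) auto
        moreover have "rnorm N m \<le> 1" using m by (simp add: rnorm_eq_sqrt)
        then have "rnorm N h * rnorm N m \<le> H" using h H mult_left_mono[of "rnorm N m" 1 H] by simp
        then have "rdot N h m \<le> H" using rdot_le_rnorm[of N h m] by simp
        moreover have "ln (1 - rdot N m m) \<le> ln r0" using True m by (subst ln_le_cancel_iff) (auto simp: r0_def)
        then have "ln (1 - rdot N m m) \<le> - (2 * (2 * (\<beta> * K + H) + \<beta>\<^sup>2 / 2))" by (simp add: r0_def)
        moreover have "(1 - rdot N m m)\<^sup>2 \<le> 1" using m by (intro power_le_one) auto
        then have "\<beta>\<^sup>2 / 2 * (1 - rdot N m m)\<^sup>2 \<le> \<beta>\<^sup>2 / 2 * 1" by (intro mult_left_mono) auto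
        ultimately have "tap_density g N \<beta> h m \<le> - (\<beta> * K + H)" unfolding tap_density_def by (simp add: algebra_simps)
        moreover have "- (\<bar>\<beta>\<bar> * K + rnorm N h) \<le> free_energy g N \<beta> h" by (rule free_energy_ge[OF N quad_boundedD[OF qb]])
        ultimately show ?thesis using h b e by simp
      next
        case False
        then have sr: "\<beta> * r0 \<le> s" using b by (simp add: s_def)
        define s' where "s' = min s (beta_crit - \<delta>)"
        have s': "0 < s'" "s' \<le> s" "s - s' \<le> \<delta>" "s' \<le> beta_crit - \<delta>" "s' < s \<Longrightarrow> beta_crit - 1 / 4 \<le> s'" "smin \<le> s'" "s' \<le> beta_crit"
          using s0 d beta_crit sr by (auto simp: s'_def smin_def min_def)
        obtain m' where m': "\<beta> * (1 - rdot N m' m') = s'" and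
          move: "tap_density g N \<beta> h m \<le> tap_density g N \<beta> h m' + (K + 2) * \<delta> + rnorm N h * sqrt (\<delta> / \<beta>)"
          using tap_density_move_inward[OF N qb b s'(1,2,3) s0(2,3) s'(5) s_def[symmetric], of h] by blast
        define u where "u = max_quad N ?c + \<kappa>"
        have pu: "coercive N ?c u \<kappa>" using coercive_max_quad[OF N qb, of u] by (simp add: u_def)
        have "s' \<le> mean_sq N ?c u" using elim(1)[rule_format, OF g'] s' by (simp add: u_def)
        then obtain w where w: "u \<le> w" "w \<le> max u (K + 1 / s')" "mean_sq N ?c w = s'" "coercive N ?c w \<kappa>"
          using mean_sq_IVT[OF N qb pu k(1) s'(1)] by blast
        define B where "B = 1 / smin"
        have "1 / s' \<le> B" unfolding B_def using s' smin by (intro divide_left_mono) auto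
        moreover have "0 \<le> B" using smin by (simp add: B_def)
        moreover have "- K \<le> max_quad N ?c" "max_quad N ?c \<le> K" using max_quad_abs_le[OF N qb] by (auto simp: abs_le_iff)
        ultimately have "- (K + 1 + B) \<le> w" "w \<le> K + 1 + B" using w(1,2) k K unfolding u_def by linarith+
        then have wW: "\<bar>w\<bar> \<le> W" by (simp add: W_def B_def abs_le_iff)
        have "\<beta> * quad N ?c m' + rdot N h m' + w * s' + log_gauss N ?c w - \<epsilon> / 8 \<le> free_energy g N \<beta> h + ln \<beta> / 2 + log_vol N"
          using elim(2)[rule_format, OF qb w(4) wW order_refl order_refl, of h m'] h m' w(3) by simp
        moreover have "free0 g N s' + ln s' / 2 + log_vol N \<le> s' * w + log_gauss N ?c w + 1 / real N" by (rule free0_upper[OF N w(4) k(1) s'(1)])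
        moreover have "annealed s' - \<epsilon> / 8 \<le> free0 g N s' + ln s' / 2" using typical_annealed[OF g s'(1,7)] eta by (simp add: abs_le_iff)
        moreover have "tap_density g N \<beta> h m' = \<beta> * quad N ?c m' + rdot N h m' + annealed s' - ln \<beta> / 2" by (rule tap_density_overlap[OF b s'(1) m'])
        ultimately show ?thesis using move dK dH h elim(4) e by (simp add: mult.commute)
      qed
    qed
  qed
  then show ?thesis using that eta by blast
qed

lemma free_energy_tap_typical:
  assumes b: "\<beta> > 0" and H: "H \<ge> 0" and K: "K \<ge> 0" and e: "\<epsilon> > 0"
  obtains \<eta> where "\<eta> > 0"
    "\<forall>\<^sub>F N in sequentially. \<forall>g h. typical g N K \<eta> \<longrightarrow> rnorm N h = H \<longrightarrow>
       \<bar>free_energy g N \<beta> h - 1 / real N * (SUP m\<in>plefka_region N \<beta>. tap_energy g N \<beta> h m)\<bar> \<le> \<epsilon>"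
proof -
  obtain \<eta>1 where e1: "\<eta>1 > 0" and ev1: "\<forall>\<^sub>F N in sequentially. \<forall>g h. typical g N K \<eta>1 \<longrightarrow> rnorm N h = H \<longrightarrow>
       (\<exists>m. rdot N m m < 1 \<and> \<beta> * (1 - rdot N m m) \<le> beta_crit \<and> free_energy g N \<beta> h \<le> tap_density g N \<beta> h m + \<epsilon>)"
    by (rule free_energy_le_tap[OF b H K e])
  obtain \<eta>2 where e2: "\<eta>2 > 0" and ev2: "\<forall>\<^sub>F N in sequentially. \<forall>g h m. typical g N K \<eta>2 \<longrightarrow> rnorm N h = H \<longrightarrow> rdot N m m < 1 \<longrightarrow> \<beta> * (1 - rdot N m m) \<le> beta_crit \<longrightarrow>
       tap_density g N \<beta> h m \<le> free_energy g N \<beta> h + \<epsilon>"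
    by (rule tap_le_free_energy[OF b H K e])
  define \<eta> where "\<eta> = min \<eta>1 \<eta>2"
  have "\<forall>\<^sub>F N in sequentially. \<forall>g h. typical g N K \<eta> \<longrightarrow> rnorm N h = H \<longrightarrow>
       \<bar>free_energy g N \<beta> h - 1 / real N * (SUP m\<in>plefka_region N \<beta>. tap_energy g N \<beta> h m)\<bar> \<le> \<epsilon>"
    using ev1 ev2 eventually_ge_at_top[of 1]
  proof eventually_elim
    case (elim N)
    note N = elim(3)
    have N0: "real N > 0" using N by simp
    show ?case
    proof (intro allI impI)
      fix g h assume g: "typical g N K \<eta>" and h: "rnorm N h = H"
      have g1: "typical g N K \<eta>1" "typical g N K \<eta>2" using g by (auto simp: typical_def \<eta>_def)
      let ?S = "SUP m\<in>plefka_region N \<beta>. tap_energy g N \<beta> h m"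
      have reg: "m \<in> plefka_region N \<beta> \<longleftrightarrow> m \<in> rvec N \<and> rdot N m m < 1 \<and> \<beta> * (1 - rdot N m m) \<le> beta_crit" for m
        by (auto simp: plefka_region_def beta_at_def rdot_self beta_crit_def abs_square_less_1 power_less_one_iff)
      obtain m where m: "rdot N m m < 1" "\<beta> * (1 - rdot N m m) \<le> beta_crit" "free_energy g N \<beta> h \<le> tap_density g N \<beta> h m + \<epsilon>"
        using elim(1)[rule_format, OF g1(1) h] by blast
      have "restrict m {1..N} \<in> plefka_region N \<beta>" unfolding reg using m by (simp add: rvec_def)
      then have "tap_energy g N \<beta> h (restrict m {1..N}) \<le> ?S" by (rule cSUP_upper) (rule tap_energy_bdd_above)
      then have "real N * tap_density g N \<beta> h m \<le> ?S" unfolding tap_energy_tap_density[OF N] by (simp add: tap_density_def)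
      then have "tap_density g N \<beta> h m \<le> 1 / real N * ?S" using N0 by (simp add: pos_le_divide_eq mult.commute)
      then have up: "free_energy g N \<beta> h - 1 / real N * ?S \<le> \<epsilon>" using m by linarith
      have "?S \<le> real N * (free_energy g N \<beta> h + \<epsilon>)"
      proof (rule cSUP_least)
        show "plefka_region N \<beta> \<noteq> {}" by (rule plefka_region_nonempty[OF N b])
        fix m assume "m \<in> plefka_region N \<beta>"
        then have "tap_density g N \<beta> h m \<le> free_energy g N \<beta> h + \<epsilon>" unfolding reg using elim(2)[rule_format, OF g1(2) h] by blast
        then show "tap_energy g N \<beta> h m \<le> real N * (free_energy g N \<beta> h + \<epsilon>)"
          unfolding tap_energy_tap_density[OF N] using N0 by (intro mult_left_mono) auto
      qed
      then have "1 / real N * ?S \<le> free_energy g N \<beta> h + \<epsilon>" using N0 by (simp add: pos_divide_le_eq mult.commute)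
      then show "\<bar>free_energy g N \<beta> h - 1 / real N * ?S\<bar> \<le> \<epsilon>" using up by (simp add: abs_le_iff)
    qed
  qed
  then show ?thesis using that[of \<eta>] e1 e2 by (simp add: \<eta>_def)
qed

section \<open>The maximal energy and the overlap of two replicas\<close>

lemma bilin_polar: "4 * bilin N c x z = quad N c (\<lambda>i. x i + z i) - quad N c (\<lambda>i. x i + -1 * z i)"
  unfolding quad_add bilin_scale_right quad_scale by simp

text \<open>
  Let \<open>k\<close> be the maximum of \<open>|q|\<close> on the sphere, nearly attained at \<open>e\<close>.  On the ball of radius
  \<open>1/16\<close> around \<open>(15/16) e\<close> the form keeps its sign and at least half of \<open>k\<close>, so this ball alone
  contributes \<open>16\<^sup>-\<^sup>N exp (N k / 2)\<close> to the partition function at inverse temperature 1 or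
  \<open>- 1\<close>.
\<close>

lemma quad_bounded_of_free_energy:
  assumes N: "N \<ge> 1" and f1: "free0 g N 1 \<le> 1" and f2: "free0 g N (-1) \<le> 1"
  shows "quad_bounded N (scaled g N) 10"
proof -
  let ?c = "scaled g N"
  let ?S = "{x. rdot N x x = 1}"
  define k where "k = (SUP x\<in>?S. \<bar>quad N ?c x\<bar>)"
  have bdd: "bdd_above ((\<lambda>x. \<bar>quad N ?c x\<bar>) ` ?S)"
  proof (rule bdd_aboveI2)
    fix x assume "x \<in> ?S"
    then show "\<bar>quad N ?c x\<bar> \<le> (\<Sum>i\<in>{1..N}. \<Sum>j\<in>{1..N}. \<bar>?c i j\<bar>)" using quad_le_sum[of N ?c x] by simp
  qed
  have ne: "?S \<noteq> {}" using unit_vector_exists[OF N] by blast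
  have kb: "\<bar>quad N ?c x\<bar> \<le> k * rdot N x x" for x
  proof -
    obtain e where e: "rdot N e e = 1" "\<And>i. i \<in> {1..N} \<Longrightarrow> x i = rnorm N x * e i" using unit_direction[OF N, of x] by blast
    have "\<bar>quad N ?c x\<bar> = (rnorm N x)\<^sup>2 * \<bar>quad N ?c e\<bar>" using quad_cong[of N x "\<lambda>i. rnorm N x * e i" ?c] e(2) by (simp add: quad_scale abs_mult)
    also have "\<dots> \<le> (rnorm N x)\<^sup>2 * k" unfolding k_def using e by (intro mult_left_mono cSUP_upper bdd) auto
    finally show ?thesis by (simp add: rdot_self mult.commute)
  qed
  have "k \<le> 10"
  proof (rule ccontr)
    assume "\<not> k \<le> 10"
    then have k: "k > 10" by simp
    then have "0.9 * k < k" by simp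
    then obtain e where e: "rdot N e e = 1" "0.9 * k < \<bar>quad N ?c e\<bar>"
      unfolding k_def using less_cSUP_iff[OF ne bdd] by auto
    define t :: real where "t = (if quad N ?c e \<ge> 0 then 1 else -1)"
    have t: "t = 1 \<or> t = -1" "0.9 * k < t * quad N ?c e" using e by (auto simp: t_def)
    have ft: "free0 g N t \<le> 1" using t f1 f2 by auto
    define h0 :: "nat \<Rightarrow> real" where "h0 = (\<lambda>_. 0)"
    define G where "G \<sigma> = ennreal (exp (exponent g N t h0 \<sigma>))" for \<sigma>
    define I where "I = (\<integral>\<^sup>+\<sigma>. G \<sigma> \<partial>uniform_sphere N)"
    have Gm [measurable]: "G \<in> borel_measurable (\<Pi>\<^sub>M i\<in>{1..N}. borel)" unfolding G_def[abs_def] by measurable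
    have I: "I = ennreal (exp (real N * free0 g N t))"
      unfolding I_def G_def partition_function_nn[OF N, symmetric] partition_function_eq[OF N] h0_def ..
    let ?f = "\<lambda>x. G (\<lambda>i\<in>{1..N}. x i / rnorm N x) * indicator {x. rnorm N x \<le> 1} x"
    let ?T = "\<lambda>z. \<lambda>i\<in>{1..N}. (15/16) * e i + (1/16) * z i"
    have fm [measurable]: "?f \<in> borel_measurable (lebesgue_rn N)"
      by (intro borel_measurable_times_ennreal measurable_compose[OF normalise_measurable Gm]) measurable
    have Bset: "{x \<in> rvec N. rnorm N x \<le> 1} \<in> sets (lebesgue_rn N)" unfolding rvec_eq_space by measurable
    have "ennreal ((1/16) ^ N) * (ennreal (exp (real N * (k / 2))) * ennreal (ball_vol N))
      = ennreal ((1/16) ^ N) * (\<integral>\<^sup>+z. ennreal (exp (real N * (k / 2))) * indicator {x \<in> rvec N. rnorm N x \<le> 1} z \<partial>lebesgue_rn N)"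
      using Bset by (subst nn_integral_cmult_indicator) (auto simp: emeasure_unit_ball)
    also have "\<dots> \<le> ennreal ((1/16) ^ N) * (\<integral>\<^sup>+z. ?f (?T z) \<partial>lebesgue_rn N)"
    proof (intro mult_left_mono nn_integral_mono)
      fix z
      show "ennreal (exp (real N * (k / 2))) * indicator {x \<in> rvec N. rnorm N x \<le> 1} z \<le> ?f (?T z)"
      proof (cases "rnorm N z \<le> 1")
        case True
        let ?y = "\<lambda>i. (15/16) * e i + (1/16) * z i"
        have zz: "rdot N z z \<le> 1" using True by (simp add: rdot_self power_le_one)
        have e1: "rnorm N e = 1" using e by (simp add: rnorm_eq_sqrt)
        have "rnorm N ?y \<le> rnorm N (\<lambda>i. (15/16) * e i) + rnorm N (\<lambda>i. (1/16) * z i)" by (rule rnorm_triangle)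
        also have "\<dots> \<le> 1" unfolding rnorm_scale using e1 True by simp
        finally have y1: "rnorm N ?y \<le> 1" .
        have "\<bar>4 * bilin N ?c e z\<bar> \<le> \<bar>quad N ?c (\<lambda>i. e i + z i)\<bar> + \<bar>quad N ?c (\<lambda>i. e i + -1 * z i)\<bar>"
          unfolding bilin_polar by (rule abs_triangle_ineq4)
        also have "\<dots> \<le> k * rdot N (\<lambda>i. e i + z i) (\<lambda>i. e i + z i) + k * rdot N (\<lambda>i. e i + -1 * z i) (\<lambda>i. e i + -1 * z i)"
          by (intro add_mono kb)
        also have "\<dots> = k * (2 * rdot N e e + 2 * rdot N z z)"
          unfolding rdot_add_left rdot_add_right rdot_scale_left rdot_scale_right by (simp add: algebra_simps)
        also have "\<dots> \<le> k * 4" using zz e k by (intro mult_left_mono) auto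
        finally have bb: "\<bar>bilin N ?c e z\<bar> \<le> k" by simp
        have zb: "\<bar>quad N ?c z\<bar> \<le> k"
        proof -
          have "k * rdot N z z \<le> k * 1" using zz k by (intro mult_left_mono) auto
          then show ?thesis using kb[of z] by linarith
        qed
        have "quad N ?c ?y = (225/256) * quad N ?c e + (30/256) * bilin N ?c e z + (1/256) * quad N ?c z"
          unfolding quad_add quad_scale bilin_scale_left bilin_scale_right by (simp add: power2_eq_square)
        then have "t * quad N ?c ?y = (225/256) * (t * quad N ?c e) + (30/256) * (t * bilin N ?c e z) + (1/256) * (t * quad N ?c z)"
          by (simp add: algebra_simps)
        moreover have "t * bilin N ?c e z \<ge> - k" "t * quad N ?c z \<ge> - k" using bb zb t by (auto simp: abs_le_iff)
        ultimately have confined: "t * quad N ?c ?y \<ge> k / 2" using t(2) k by simp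
        define \<rho> where "\<rho> = rnorm N ?y"
        have rho0: "\<rho> > 0"
        proof (rule ccontr)
          assume "\<not> \<rho> > 0"
          then have "rnorm N ?y = 0" using rnorm_nonneg[of N ?y] unfolding \<rho>_def by linarith
          then have "rdot N ?y ?y = 0" unfolding rdot_self by (simp only: zero_power2)
          then have "quad N ?c ?y = 0" using kb[of ?y] by simp
          then show False using confined k by simp
        qed
        let ?s = "\<lambda>i. (1 / \<rho>) * ?y i"
        have "1 \<le> (1 / \<rho>)\<^sup>2" using rho0 y1 by (simp add: \<rho>_def power_divide power_le_one)
        then have "1 * (t * quad N ?c ?y) \<le> (1 / \<rho>)\<^sup>2 * (t * quad N ?c ?y)" using confined k by (intro mult_right_mono) auto
        also have "\<dots> = t * quad N ?c ?s" unfolding quad_scale by simp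
        finally have "k / 2 \<le> t * quad N ?c ?s" using confined by simp
        then have "real N * (k / 2) \<le> exponent g N t h0 ?s" unfolding exponent_def h0_def by (intro mult_left_mono) auto
        moreover have "(\<lambda>i\<in>{1..N}. (?T z) i / rnorm N (?T z)) = restrict ?s {1..N}"
          unfolding rnorm_restrict \<rho>_def[symmetric] by auto
        then have "G (\<lambda>i\<in>{1..N}. (?T z) i / rnorm N (?T z)) = ennreal (exp (exponent g N t h0 ?s))"
          by (simp only: G_def exponent_def quad_restrict rdot_restrict_right)
        moreover have "rnorm N (?T z) \<le> 1" using y1 by simp
        ultimately show ?thesis by (auto simp: indicator_def)
      qed simp
    qed auto
    also have "\<dots> = (\<integral>\<^sup>+x. ?f x \<partial>lebesgue_rn N)"
      using nn_integral_lebesgue_rn_affine[OF fm, of "1/16" "\<lambda>i. (15/16) * e i"] by simp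
    also have "\<dots> = ennreal (ball_vol N) * I" unfolding I_def by (rule nn_integral_uniform_sphere[symmetric]) measurable
    finally have "exp (- (real N * ln 16)) * (exp (real N * (k / 2)) * ball_vol N) \<le> ball_vol N * exp (real N * free0 g N t)"
    proof -
      have "(1/16 :: real) ^ N = exp (- (real N * ln 16))"
        by (simp add: exp_minus exp_of_nat_mult power_divide inverse_eq_divide)
      moreover assume "ennreal ((1/16) ^ N) * (ennreal (exp (real N * (k / 2))) * ennreal (ball_vol N)) \<le> ennreal (ball_vol N) * I"
      ultimately show ?thesis unfolding I by (simp add: ennreal_mult[symmetric])
    qed
    then have "ball_vol N * exp (- (real N * ln 16) + real N * (k / 2)) \<le> ball_vol N * exp (real N * free0 g N t)"
      by (simp only: exp_add mult_ac)
    then have "exp (- (real N * ln 16) + real N * (k / 2)) \<le> exp (real N * free0 g N t)"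
      by (simp only: mult_le_cancel_left_pos[OF unit_ball_vol_pos[of "real N", OF of_nat_0_le_iff]])
    then have "real N * (k / 2 - ln 16) \<le> real N * free0 g N t" unfolding exp_le_cancel_iff by (simp add: algebra_simps)
    then have "k / 2 - ln 16 \<le> free0 g N t" using N by (subst (asm) mult_le_cancel_left_pos) auto
    moreover have "ln (16::real) = 4 * ln 2" using ln_realpow[of "2::real" 4] by simp
    moreover have "ln (2::real) < 1" by (rule ln_2_less_1)
    ultimately show False using ft k by simp
  qed
  then show ?thesis unfolding quad_bounded_def using kb by (meson mult_right_mono order_trans rdot_self_nonneg)
qed

definition std_gauss :: "real measure" where "std_gauss = density lborel (\<lambda>x. ennreal (std_normal_density x))"

lemma prob_space_std_gauss: "prob_space std_gauss"
  unfolding std_gauss_def by (rule prob_space_normal_density) simp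

lemma sets_std_gauss [measurable_cong, simp]: "sets std_gauss = sets borel"
  by (simp add: std_gauss_def)

lemma space_std_gauss [simp]: "space std_gauss = UNIV"
  by (simp add: std_gauss_def)

lemma std_gauss_mgf: "(\<integral>\<^sup>+y. ennreal (exp (c * y)) \<partial>std_gauss) = ennreal (exp (c\<^sup>2 / 2))"
proof -
  interpret prob_space "density lborel (\<lambda>x. ennreal (normal_density c 1 x))"
    by (rule prob_space_normal_density) simp
  have one: "(\<integral>\<^sup>+y. ennreal (normal_density c 1 y) \<partial>lborel) = 1"
    using emeasure_space_1 by (simp add: emeasure_density)
  have "(\<integral>\<^sup>+y. ennreal (exp (c * y)) \<partial>std_gauss) = (\<integral>\<^sup>+y. ennreal (std_normal_density y) * ennreal (exp (c * y)) \<partial>lborel)"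
    unfolding std_gauss_def by (rule nn_integral_density) auto
  also have "\<dots> = (\<integral>\<^sup>+y. ennreal (exp (c\<^sup>2 / 2)) * ennreal (normal_density c 1 y) \<partial>lborel)"
  proof (rule nn_integral_cong)
    fix y :: real
    have "- y\<^sup>2 / 2 + c * y = c\<^sup>2 / 2 + - (y - c)\<^sup>2 / 2" by (simp add: power2_eq_square field_simps)
    then have "exp (- y\<^sup>2 / 2) * exp (c * y) = exp (c\<^sup>2 / 2) * exp (- (y - c)\<^sup>2 / 2)" by (simp only: exp_add[symmetric])
    then show "ennreal (std_normal_density y) * ennreal (exp (c * y)) = ennreal (exp (c\<^sup>2 / 2)) * ennreal (normal_density c 1 y)"
      unfolding normal_density_def by (simp add: ennreal_mult[symmetric])
  qed
  also have "\<dots> = ennreal (exp (c\<^sup>2 / 2))" by (subst nn_integral_cmult) (auto simp: one)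
  finally show ?thesis .
qed

text \<open>
  Stirling's upper bound with the exact power of \<open>N\<close>, by induction in steps of 1 from the arguments
  \<open>1/2\<close> and \<open>1\<close>.  The power determines the factor \<open>sqrt N\<close> in \<open>partition_function_second_moment\<close>,
  which has to be beaten by the variance in \<open>free_energy_lower_tail\<close>.
\<close>

lemma Gamma_half_upper:
  obtains C :: real where "C > 0" "\<And>N. N \<ge> 1 \<Longrightarrow> Gamma (real N / 2 + 1) \<le> C * sqrt (real N) * exp (real N / 2 * ln (real N / 2) - real N / 2)"
proof -
  define L where "L x = ln (Gamma (x + 1)) + x - x * ln x - ln x / 2" for x :: real
  have step: "L (x + 1) \<le> L x" if x: "x > 0" for x
  proof -
    have "Gamma (x + 1 + 1) = (x + 1) * Gamma (x + 1)" using x by (intro Gamma_plus1) (auto simp: nonpos_Ints_def)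
    moreover have "Gamma (x + 1) \<noteq> 0" using Gamma_real_pos[of "x + 1"] x by linarith
    ultimately have "ln (Gamma (x + 1 + 1)) = ln (x + 1) + ln (Gamma (x + 1))" using x by (simp add: ln_mult)
    then have eq: "L (x + 1) - L x = 1 - (x + 1 / 2) * (ln (x + 1) - ln x)" by (simp add: L_def field_simps)
    have "2 * ((x + 1) - x) / (x + (x + 1)) \<le> ln (x + 1) - ln x" using x by (intro ln_inverse_approx_ge) auto
    then have "(x + 1 / 2) * (2 * ((x + 1) - x) / (x + (x + 1))) \<le> (x + 1 / 2) * (ln (x + 1) - ln x)" using x by (intro mult_left_mono) auto
    moreover have "(x + 1 / 2) * (2 * ((x + 1) - x) / (x + (x + 1))) = 1" using x by (simp add: field_simps)
    ultimately show ?thesis using eq by linarith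
  qed
  define M where "M = max (L (1/2)) (L 1)"
  have bound: "L (real n / 2) \<le> M" if "n \<ge> 1" for n
    using that
  proof (induction n rule: less_induct)
    case (less n)
    consider "n = 1" | "n = 2" | "n \<ge> 3" using less.prems by linarith
    then show ?case
    proof cases
      case 3
      have "L (real (n - 2) / 2 + 1) \<le> L (real (n - 2) / 2)" using 3 by (intro step) auto
      also have "\<dots> \<le> M" using 3 by (intro less.IH) auto
      also have "real (n - 2) / 2 + 1 = real n / 2" using 3 by (simp add: of_nat_diff field_simps)
      finally show ?thesis .
    qed (auto simp: M_def)
  qed
  show ?thesis
  proof (rule that)
    show "exp M > 0" by simp
    fix N :: nat assume N: "N \<ge> 1"
    have x: "real N / 2 > 0" using N by simp
    have "ln (Gamma (real N / 2 + 1)) \<le> M + real N / 2 * ln (real N / 2) - real N / 2 + ln (real N / 2) / 2"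
      using bound[OF N] unfolding L_def by linarith
    then have "exp (ln (Gamma (real N / 2 + 1))) \<le> exp (M + (real N / 2 * ln (real N / 2) - real N / 2) + ln (real N / 2) / 2)"
      unfolding exp_le_cancel_iff by linarith
    also have "\<dots> = exp M * exp (real N / 2 * ln (real N / 2) - real N / 2) * sqrt (real N / 2)"
      using x by (simp only: exp_add ln_sqrt[symmetric]) simp
    also have "\<dots> \<le> exp M * exp (real N / 2 * ln (real N / 2) - real N / 2) * sqrt (real N)"
      by (intro mult_left_mono) auto
    finally show "Gamma (real N / 2 + 1) \<le> exp M * sqrt (real N) * exp (real N / 2 * ln (real N / 2) - real N / 2)"
      using Gamma_real_pos[of "real N / 2 + 1"] by (simp add: mult_ac)
  qed
qed

text \<open>
  Apply \<open>sphere_upper\<close> to \<open>q = 0\<close> with field \<open>a / N\<close>; the multiplier \<open>1/2\<close> is optimal for \<open>a = 0\<close>.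
\<close>

lemma sphere_mgf:
  obtains C :: real where "C > 0" "\<And>N a. N \<ge> 1 \<Longrightarrow>
     (\<integral>\<^sup>+\<sigma>. ennreal (exp (rdot N a \<sigma>)) \<partial>uniform_sphere N) \<le> ennreal (C * sqrt (real N) * exp (rdot N a a / (2 * real N) + rnorm N a / real N))"
proof -
  obtain C where C: "C > 0" "\<And>N. N \<ge> 1 \<Longrightarrow> Gamma (real N / 2 + 1) \<le> C * sqrt (real N) * exp (real N / 2 * ln (real N / 2) - real N / 2)"
    using Gamma_half_upper by blast
  show ?thesis
  proof (rule that)
    show "C * exp 1 > 0" using C by simp
    fix N :: nat and a :: "nat \<Rightarrow> real" assume N: "N \<ge> 1"
    have N0: "real N > 0" using N by simp
    let ?g = "\<lambda>_ _. 0 :: real"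
    let ?h = "\<lambda>i. (1 / real N) * a i"
    have c0: "scaled ?g N = (\<lambda>_ _. 0)" by (simp add: scaled_def fun_eq_iff)
    have q0: "quad N (scaled ?g N) x = 0" "bilin N (scaled ?g N) x y = 0" for x y by (simp_all add: c0 quad_def bilin_def)
    have tq0: "confined N (scaled ?g N) (1/2) x = rdot N x x / 2" for x by (simp add: confined_def q0)
    have p: "coercive N (scaled ?g N) (1/2) (1/2)" by (simp add: coercive_def tq0)
    have enh: "exponent ?g N 1 ?h \<sigma> = rdot N a \<sigma>" for \<sigma> unfolding exponent_def q0 rdot_scale_left using N0 by simp
    have log_gauss: "log_gauss N (scaled ?g N) (1/2) = ln (2 * pi / real N) / 2"
    proof -
      have "gauss_int N (scaled ?g N) (1/2) = (\<integral>\<^sup>+x. ennreal (exp (- ((real N / 2) * rdot N x x))) \<partial>lebesgue_rn N)"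
        unfolding gauss_int_def tq0 by simp
      also have "\<dots> = ennreal (sqrt (pi / (real N / 2)) ^ N)" using N0 by (intro nn_integral_lebesgue_rn_gaussian) simp
      finally have "enn2real (gauss_int N (scaled ?g N) (1/2)) = sqrt (2 * pi / real N) ^ N" using N0 by (simp add: mult.commute)
      then show ?thesis unfolding log_gauss_def using N0 by (simp add: ln_realpow ln_sqrt)
    qed
    have "free_energy ?g N 1 ?h + ln 1 / 2 + log_vol N
      \<le> 1 * (1/2) + rdot N ?h ?h - 1 * confined N (scaled ?g N) (1/2) ?h + log_gauss N (scaled ?g N) (1/2) + (rnorm N ?h + 1) / real N"
      by (rule sphere_upper[OF N p]) (auto simp: confined_bilin_def q0 simp del: times_divide_eq_left)
    then have "real N * free_energy ?g N 1 ?h \<le> real N * (1/2 + rdot N ?h ?h / 2 + ln (2 * pi / real N) / 2 - log_vol N + (rnorm N ?h + 1) / real N)"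
      unfolding tq0 log_gauss using N0 by (intro mult_left_mono) auto
    also have "\<dots> = real N / 2 + real N * (rdot N ?h ?h / 2) + real N / 2 * ln (2 * pi / real N) - real N * log_vol N + (rnorm N ?h + 1)"
    proof -
      have "real N * ((rnorm N ?h + 1) / real N) = rnorm N ?h + 1" using N0 by simp
      then show ?thesis by (simp only: distrib_left right_diff_distrib times_divide_eq_right mult_1_right)
    qed
    also have "real N * (rdot N ?h ?h / 2) = rdot N a a / (2 * real N)"
      unfolding rdot_scale_left rdot_scale_right using N0 by (simp add: field_simps)
    also have "rnorm N ?h = rnorm N a / real N" unfolding rnorm_scale using N0 by simp
    also have "real N * log_vol N = real N / 2 * ln pi - ln (Gamma (real N / 2 + 1))"
    proof -
      have "Gamma (real N / 2 + 1) \<noteq> 0" using Gamma_real_pos[of "real N / 2 + 1"] N0 by linarith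
      then show ?thesis using N0 by (simp add: log_vol_def unit_ball_vol_def ln_div ln_powr)
    qed
    also have "ln (2 * pi / real N) = ln pi - ln (real N / 2)" using N0 by (simp add: ln_div ln_mult)
    finally have "real N * free_energy ?g N 1 ?h \<le> (rdot N a a / (2 * real N) + rnorm N a / real N) + 1
       + (real N / 2 - real N / 2 * ln (real N / 2)) + ln (Gamma (real N / 2 + 1))"
      by (simp add: algebra_simps)
    then have "exp (real N * free_energy ?g N 1 ?h) \<le> exp (rdot N a a / (2 * real N) + rnorm N a / real N) * exp 1
       * exp (real N / 2 - real N / 2 * ln (real N / 2)) * exp (ln (Gamma (real N / 2 + 1)))"
      by (simp only: exp_add[symmetric] exp_le_cancel_iff)
    also have "exp (ln (Gamma (real N / 2 + 1))) = Gamma (real N / 2 + 1)"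
      using N0 by (intro exp_ln Gamma_real_pos) simp
    finally have "exp (real N * free_energy ?g N 1 ?h) \<le> exp (rdot N a a / (2 * real N) + rnorm N a / real N) * exp 1
       * exp (real N / 2 - real N / 2 * ln (real N / 2)) * Gamma (real N / 2 + 1)" .
    also have "\<dots> \<le> exp (rdot N a a / (2 * real N) + rnorm N a / real N) * exp 1
       * exp (real N / 2 - real N / 2 * ln (real N / 2)) * (C * sqrt (real N) * exp (real N / 2 * ln (real N / 2) - real N / 2))"
      by (intro mult_left_mono C(2) N) auto
    also have "\<dots> = (C * exp 1) * sqrt (real N) * exp (rdot N a a / (2 * real N) + rnorm N a / real N) * (exp (real N / 2 - real N / 2 * ln (real N / 2)) * exp (real N / 2 * ln (real N / 2) - real N / 2))"
      by (simp only: mult_ac)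
    also have "\<dots> = (C * exp 1) * sqrt (real N) * exp (rdot N a a / (2 * real N) + rnorm N a / real N)"
      unfolding exp_add[symmetric] by simp
    finally have "partition_function ?g N 1 ?h \<le> (C * exp 1) * sqrt (real N) * exp (rdot N a a / (2 * real N) + rnorm N a / real N)"
      unfolding partition_function_eq[OF N] .
    then show "(\<integral>\<^sup>+\<sigma>. ennreal (exp (rdot N a \<sigma>)) \<partial>uniform_sphere N) \<le> ennreal ((C * exp 1) * sqrt (real N) * exp (rdot N a a / (2 * real N) + rnorm N a / real N))"
      using partition_function_nn[OF N, of ?g 1 ?h] unfolding enh by (metis ennreal_leI)
  qed
qed

text \<open>
  Linearise the square with an auxiliary standard Gaussian \<open>y\<close>
  (Hubbard-Stratonovich), integrate over the sphere by \<open>sphere_mgf\<close>, and note that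
  \<open>exp (t\<^sup>2 y\<^sup>2)\<close> is integrable against the Gaussian density precisely for \<open>t < beta_crit\<close>.
\<close>

lemma overlap_mgf:
  assumes t: "0 < t" "t < beta_crit"
  obtains C :: real where "C > 0" "\<And>N e. N \<ge> 1 \<Longrightarrow> rdot N e e = 1 \<Longrightarrow>
     (\<integral>\<^sup>+\<sigma>. ennreal (exp (real N * t\<^sup>2 * (rdot N e \<sigma>)\<^sup>2)) \<partial>uniform_sphere N) \<le> ennreal (C * sqrt (real N))"
proof -
  obtain C where C: "C > 0" "\<And>N a. N \<ge> 1 \<Longrightarrow>
     (\<integral>\<^sup>+\<sigma>. ennreal (exp (rdot N a \<sigma>)) \<partial>uniform_sphere N) \<le> ennreal (C * sqrt (real N) * exp (rdot N a a / (2 * real N) + rnorm N a / real N))"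
    by (rule sphere_mgf) blast
  have "t\<^sup>2 < beta_crit\<^sup>2" using t by (intro power_strict_mono) auto
  then have t2: "t\<^sup>2 < 1 / 2" using beta_crit(3) by (simp add: power2_eq_square)
  define \<alpha> where "\<alpha> = (1 / 2 - t\<^sup>2) / 2"
  have al: "\<alpha> > 0" using t2 by (simp add: \<alpha>_def)
  define D where "D = exp (1 / (4 * \<alpha>)) * sqrt (pi / \<alpha>)"
  have D: "D > 0" using al by (simp add: D_def)
  have gint: "(\<integral>\<^sup>+y. ennreal (exp (t\<^sup>2 * y\<^sup>2 + \<bar>y\<bar>)) \<partial>std_gauss) \<le> ennreal D"
  proof -
    have "(\<integral>\<^sup>+y. ennreal (exp (t\<^sup>2 * y\<^sup>2 + \<bar>y\<bar>)) \<partial>std_gauss) = (\<integral>\<^sup>+y. ennreal (std_normal_density y) * ennreal (exp (t\<^sup>2 * y\<^sup>2 + \<bar>y\<bar>)) \<partial>lborel)"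
      unfolding std_gauss_def by (rule nn_integral_density) auto
    also have "\<dots> \<le> (\<integral>\<^sup>+y. ennreal (exp (1 / (4 * \<alpha>))) * ennreal (exp (- (\<alpha> * y\<^sup>2))) \<partial>lborel)"
    proof (intro nn_integral_mono)
      fix y :: real
      have "0 \<le> (2 * \<alpha> * \<bar>y\<bar> - 1)\<^sup>2" by simp
      then have "4 * \<alpha> * \<bar>y\<bar> \<le> 4 * \<alpha> * (\<alpha> * y\<^sup>2) + 1" by (simp add: power2_eq_square algebra_simps abs_mult[symmetric])
      then have "\<bar>y\<bar> \<le> (4 * \<alpha> * (\<alpha> * y\<^sup>2) + 1) / (4 * \<alpha>)" using al by (simp add: pos_le_divide_eq mult.commute)
      also have "\<dots> = \<alpha> * y\<^sup>2 + 1 / (4 * \<alpha>)" using al by (simp add: add_divide_distrib)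
      finally have "- y\<^sup>2 / 2 + (t\<^sup>2 * y\<^sup>2 + \<bar>y\<bar>) \<le> - y\<^sup>2 / 2 + t\<^sup>2 * y\<^sup>2 + \<alpha> * y\<^sup>2 + 1 / (4 * \<alpha>)" by simp
      also have "\<dots> = 1 / (4 * \<alpha>) + - (\<alpha> * y\<^sup>2)" by (simp add: \<alpha>_def field_simps)
      finally have le1: "exp (- y\<^sup>2 / 2) * exp (t\<^sup>2 * y\<^sup>2 + \<bar>y\<bar>) \<le> exp (1 / (4 * \<alpha>)) * exp (- (\<alpha> * y\<^sup>2))" by (simp only: exp_add[symmetric] exp_le_cancel_iff)
      have "std_normal_density y \<le> exp (- y\<^sup>2 / 2)"
      proof -
        have "1 \<le> sqrt (2 * pi)" using pi_ge_two by simp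
        then have "1 / sqrt (2 * pi) * exp (- y\<^sup>2 / 2) \<le> 1 * exp (- y\<^sup>2 / 2)" by (intro mult_right_mono) (auto simp: divide_le_eq)
        then show ?thesis by (simp add: std_normal_density_def)
      qed
      then have "std_normal_density y * exp (t\<^sup>2 * y\<^sup>2 + \<bar>y\<bar>) \<le> exp (- y\<^sup>2 / 2) * exp (t\<^sup>2 * y\<^sup>2 + \<bar>y\<bar>)" by (intro mult_right_mono) auto
      from order_trans[OF this le1] show "ennreal (std_normal_density y) * ennreal (exp (t\<^sup>2 * y\<^sup>2 + \<bar>y\<bar>)) \<le> ennreal (exp (1 / (4 * \<alpha>))) * ennreal (exp (- (\<alpha> * y\<^sup>2)))"
        by (simp add: ennreal_mult[symmetric])
    qed
    also have "\<dots> = ennreal (exp (1 / (4 * \<alpha>))) * ennreal (sqrt (pi / \<alpha>))"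
      by (subst nn_integral_cmult) (auto simp: nn_integral_gaussian[OF al])
    also have "\<dots> = ennreal D" using al by (simp add: D_def ennreal_mult)
    finally show ?thesis .
  qed
  show ?thesis
  proof (rule that)
    show "C * D > 0" using C D by simp
    fix N :: nat and e :: "nat \<Rightarrow> real" assume N: "N \<ge> 1" and e: "rdot N e e = 1"
    have N0: "real N > 0" using N by simp
    have e1: "rnorm N e = 1" using e by (simp add: rnorm_eq_sqrt)
    interpret G: prob_space std_gauss by (rule prob_space_std_gauss)
    interpret U: prob_space "uniform_sphere N" by (rule prob_space_uniform_sphere)
    interpret P: pair_sigma_finite std_gauss "uniform_sphere N" ..
    define A where "A = sqrt (2 * real N) * t"
    have A0: "A \<ge> 0" using t by (simp add: A_def)
    have A2: "A\<^sup>2 = 2 * real N * t\<^sup>2" by (simp add: A_def power_mult_distrib)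
    have "(\<integral>\<^sup>+\<sigma>. ennreal (exp (real N * t\<^sup>2 * (rdot N e \<sigma>)\<^sup>2)) \<partial>uniform_sphere N) = (\<integral>\<^sup>+\<sigma>. \<integral>\<^sup>+y. ennreal (exp ((A * rdot N e \<sigma>) * y)) \<partial>std_gauss \<partial>uniform_sphere N)"
      unfolding std_gauss_mgf power_mult_distrib A2 by (simp add: mult.assoc)
    also have "\<dots> = (\<integral>\<^sup>+y. \<integral>\<^sup>+\<sigma>. ennreal (exp ((A * rdot N e \<sigma>) * y)) \<partial>uniform_sphere N \<partial>std_gauss)"
      by (rule P.Fubini') (unfold rdot_def, measurable)
    also have "\<dots> \<le> (\<integral>\<^sup>+y. ennreal (C * sqrt (real N)) * ennreal (exp (t\<^sup>2 * y\<^sup>2 + \<bar>y\<bar>)) \<partial>std_gauss)"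
    proof (intro nn_integral_mono)
      fix y :: real
      let ?a = "\<lambda>i. (A * y) * e i"
      have "(\<integral>\<^sup>+\<sigma>. ennreal (exp ((A * rdot N e \<sigma>) * y)) \<partial>uniform_sphere N) = (\<integral>\<^sup>+\<sigma>. ennreal (exp (rdot N ?a \<sigma>)) \<partial>uniform_sphere N)"
        unfolding rdot_scale_left by (simp add: mult_ac)
      also have "\<dots> \<le> ennreal (C * sqrt (real N) * exp (rdot N ?a ?a / (2 * real N) + rnorm N ?a / real N))" by (rule C(2)[OF N])
      also have "\<dots> \<le> ennreal (C * sqrt (real N) * exp (t\<^sup>2 * y\<^sup>2 + \<bar>y\<bar>))"
      proof (intro ennreal_leI mult_left_mono exp_mono add_mono)
        have "rdot N ?a ?a = A\<^sup>2 * y\<^sup>2" unfolding rdot_scale_left rdot_scale_right e by (simp add: power2_eq_square)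
        then show "rdot N ?a ?a / (2 * real N) \<le> t\<^sup>2 * y\<^sup>2" using N0 by (simp add: A2)
        have "A\<^sup>2 \<le> (real N)\<^sup>2"
        proof -
          have "2 * real N * t\<^sup>2 \<le> 2 * real N * (1 / 2)" using t2 N0 by (intro mult_left_mono) auto
          also have "\<dots> \<le> (real N)\<^sup>2" using N by (simp add: power2_eq_square)
          finally show ?thesis by (simp add: A2)
        qed
        then have "A \<le> real N" by (rule power2_le_imp_le) simp
        then have "A * \<bar>y\<bar> \<le> real N * \<bar>y\<bar>" by (intro mult_right_mono) auto
        then show "rnorm N ?a / real N \<le> \<bar>y\<bar>" unfolding rnorm_scale e1 using A0 N0 by (simp add: abs_mult pos_divide_le_eq mult.commute)
      qed (use C in auto)
      finally show "(\<integral>\<^sup>+\<sigma>. ennreal (exp ((A * rdot N e \<sigma>) * y)) \<partial>uniform_sphere N) \<le> ennreal (C * sqrt (real N)) * ennreal (exp (t\<^sup>2 * y\<^sup>2 + \<bar>y\<bar>))"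
        using C by (simp add: ennreal_mult)
    qed
    also have "\<dots> = ennreal (C * sqrt (real N)) * (\<integral>\<^sup>+y. ennreal (exp (t\<^sup>2 * y\<^sup>2 + \<bar>y\<bar>)) \<partial>std_gauss)"
      by (rule nn_integral_cmult) measurable
    also have "\<dots> \<le> ennreal (C * sqrt (real N)) * ennreal D" by (intro mult_left_mono gint) auto
    also have "\<dots> = ennreal (C * D * sqrt (real N))" using C D by (simp add: ennreal_mult[symmetric] mult_ac)
    finally show "(\<integral>\<^sup>+\<sigma>. ennreal (exp (real N * t\<^sup>2 * (rdot N e \<sigma>)\<^sup>2)) \<partial>uniform_sphere N) \<le> ennreal (C * D * sqrt (real N))" .
  qed
qed

section \<open>Moments of the partition function\<close>

text \<open>
  The couplings that enter \<open>H\<^sub>N\<close>, as the index set of a product measure.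
\<close>

abbreviation index_pairs :: "nat \<Rightarrow> (nat \<times> nat) set" where "index_pairs N \<equiv> {1..N} \<times> {1..N}"

definition coupling_law :: "nat \<Rightarrow> (nat \<times> nat \<Rightarrow> real) measure" where
  "coupling_law N = (\<Pi>\<^sub>M p\<in>index_pairs N. std_gauss)"

definition couplings :: "(nat \<times> nat \<Rightarrow> real) \<Rightarrow> nat \<Rightarrow> nat \<Rightarrow> real" where
  "couplings x i j = x (i, j)"

lemma std_gauss_sigma_finite: "sigma_finite_measure std_gauss"
  using prob_space_std_gauss by (rule prob_space_imp_sigma_finite)

interpretation gauss_product: product_sigma_finite "\<lambda>_::nat \<times> nat. std_gauss"
  by (rule product_sigma_finite.intro) (rule std_gauss_sigma_finite)

lemma prob_space_coupling_law: "prob_space (coupling_law N)"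
  unfolding coupling_law_def by (intro prob_space_PiM prob_space_std_gauss)

lemma coupling_law_component [measurable]: "p \<in> index_pairs N \<Longrightarrow> (\<lambda>x. x p) \<in> borel_measurable (coupling_law N)"
proof -
  assume "p \<in> index_pairs N"
  then have "(\<lambda>x. x p) \<in> coupling_law N \<rightarrow>\<^sub>M std_gauss" unfolding coupling_law_def by measurable
  then show ?thesis by (simp cong: measurable_cong_sets)
qed

lemma coupling_law_component' [measurable]: "i \<in> {1..N} \<Longrightarrow> j \<in> {1..N} \<Longrightarrow> (\<lambda>x. x (i, j)) \<in> borel_measurable (coupling_law N)"
  by (rule coupling_law_component) simp

lemma coupling_law_mgf: "(\<integral>\<^sup>+x. ennreal (exp (\<Sum>p\<in>index_pairs N. c p * x p)) \<partial>coupling_law N) = ennreal (exp ((\<Sum>p\<in>index_pairs N. (c p)\<^sup>2) / 2))"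
proof -
  have m: "(\<lambda>y. ennreal (exp (c p * y))) \<in> borel_measurable std_gauss" for p
    by (subst measurable_cong_sets[OF sets_std_gauss refl]) measurable
  have "(\<integral>\<^sup>+x. ennreal (exp (\<Sum>p\<in>index_pairs N. c p * x p)) \<partial>coupling_law N) = (\<integral>\<^sup>+x. (\<Prod>p\<in>index_pairs N. ennreal (exp (c p * x p))) \<partial>coupling_law N)"
    by (simp add: exp_sum prod_ennreal)
  also have "\<dots> = (\<Prod>p\<in>index_pairs N. \<integral>\<^sup>+y. ennreal (exp (c p * y)) \<partial>std_gauss)"
    unfolding coupling_law_def by (rule gauss_product.product_nn_integral_prod) (simp, rule m)
  also have "\<dots> = ennreal (exp ((\<Sum>p\<in>index_pairs N. (c p)\<^sup>2) / 2))"
    unfolding std_gauss_mgf by (simp add: prod_ennreal exp_sum sum_divide_distrib)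
  finally show ?thesis .
qed

definition coupling_coeff :: "nat \<Rightarrow> real \<Rightarrow> (nat \<Rightarrow> real) \<Rightarrow> nat \<times> nat \<Rightarrow> real" where
  "coupling_coeff N t \<sigma> p = sqrt (real N) * t * (\<sigma> (fst p) * \<sigma> (snd p))"

lemma exponent_couplings:
  assumes "N \<ge> 1"
  shows "exponent (couplings x) N t h \<sigma> = (\<Sum>p\<in>index_pairs N. coupling_coeff N t \<sigma> p * x p) + real N * rdot N h \<sigma>"
proof -
  have "real N * (t * quad N (scaled (couplings x) N) \<sigma>) = t * hamiltonian (couplings x) N \<sigma>" by (simp add: hamiltonian_eq[OF assms])
  also have "\<dots> = (\<Sum>i\<in>{1..N}. \<Sum>j\<in>{1..N}. coupling_coeff N t \<sigma> (i, j) * x (i, j))"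
    by (simp add: hamiltonian_def coupling_coeff_def couplings_def sum_distrib_left mult_ac)
  also have "\<dots> = (\<Sum>p\<in>index_pairs N. coupling_coeff N t \<sigma> p * x p)" by (simp add: sum.cartesian_product)
  finally show ?thesis by (simp add: exponent_def distrib_left)
qed

lemma sum_index_pairs_prod: "(\<Sum>p\<in>index_pairs N. a (fst p) * b (snd p)) = (\<Sum>i\<in>{1..N}. a i) * (\<Sum>j\<in>{1..N}. b j :: real)"
  by (simp add: sum_product sum.cartesian_product case_prod_beta)

text \<open>
  The covariance of the energies of \<open>\<sigma>\<close> and \<open>\<tau>\<close> depends on their overlap alone.
\<close>

lemma sum_coupling_coeff_mult: "(\<Sum>p\<in>index_pairs N. coupling_coeff N t \<sigma> p * coupling_coeff N t \<tau> p) = real N * t\<^sup>2 * (rdot N \<sigma> \<tau>)\<^sup>2"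
proof -
  have "(\<Sum>p\<in>index_pairs N. coupling_coeff N t \<sigma> p * coupling_coeff N t \<tau> p) = real N * t\<^sup>2 * (\<Sum>p\<in>index_pairs N. (\<sigma> (fst p) * \<tau> (fst p)) * (\<sigma> (snd p) * \<tau> (snd p)))"
    unfolding sum_distrib_left coupling_coeff_def by (intro sum.cong refl) (simp add: power2_eq_square algebra_simps)
  then show ?thesis by (simp add: sum_index_pairs_prod[where a="\<lambda>i. \<sigma> i * \<tau> i" and b="\<lambda>i. \<sigma> i * \<tau> i"] rdot_def power2_eq_square)
qed

lemma sphere_component [measurable]: "i \<in> {1..N} \<Longrightarrow> (\<lambda>\<sigma>. \<sigma> i) \<in> borel_measurable (uniform_sphere N)"
  by (subst measurable_cong_sets[OF sets_uniform_sphere refl]) measurable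

lemma coupling_coeff_measurable [measurable]: "p \<in> index_pairs N \<Longrightarrow> (\<lambda>\<sigma>. coupling_coeff N t \<sigma> p) \<in> borel_measurable (uniform_sphere N)"
  unfolding coupling_coeff_def by (cases p) auto

lemma exponent_couplings_measurable [measurable]:
  assumes "N \<ge> 1"
  shows "(\<lambda>(x, \<sigma>). exponent (couplings x) N t h \<sigma>) \<in> borel_measurable (coupling_law N \<Otimes>\<^sub>M uniform_sphere N)"
  unfolding exponent_couplings[OF assms] case_prod_beta
proof (intro borel_measurable_add borel_measurable_sum borel_measurable_times borel_measurable_const)
  fix p assume p: "p \<in> index_pairs N"
  show "(\<lambda>z. coupling_coeff N t (snd z) p) \<in> borel_measurable (coupling_law N \<Otimes>\<^sub>M uniform_sphere N)"
    by (rule measurable_compose[OF measurable_snd coupling_coeff_measurable[OF p]])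
  show "(\<lambda>z. fst z p) \<in> borel_measurable (coupling_law N \<Otimes>\<^sub>M uniform_sphere N)"
    by (rule measurable_compose[OF measurable_fst coupling_law_component[OF p]])
next
  show "(\<lambda>z. rdot N h (snd z)) \<in> borel_measurable (coupling_law N \<Otimes>\<^sub>M uniform_sphere N)"
  proof (rule rdot_measurable)
    show "(\<lambda>z. snd z i) \<in> borel_measurable (coupling_law N \<Otimes>\<^sub>M uniform_sphere N)" if "i \<in> {1..N}" for i
      by (rule measurable_compose[OF measurable_snd sphere_component[OF that]])
  qed simp
qed

lemma sphere_sigma_finite: "sigma_finite_measure (uniform_sphere N)"
  using prob_space_uniform_sphere by (rule prob_space_imp_sigma_finite)

lemma partition_function_measurable [measurable]:
  assumes N: "N \<ge> 1"
  shows "(\<lambda>x. partition_function (couplings x) N t h) \<in> borel_measurable (coupling_law N)"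
proof -
  have "partition_function (couplings x) N t h = enn2real (\<integral>\<^sup>+\<sigma>. ennreal (exp (exponent (couplings x) N t h \<sigma>)) \<partial>uniform_sphere N)" for x
    unfolding partition_function_nn[OF N, symmetric] using partition_function_pos[OF N, of "couplings x" t h] by simp
  moreover have "(\<lambda>x. \<integral>\<^sup>+\<sigma>. ennreal (exp (exponent (couplings x) N t h \<sigma>)) \<partial>uniform_sphere N) \<in> borel_measurable (coupling_law N)"
  proof (rule sigma_finite_measure.borel_measurable_nn_integral[OF sphere_sigma_finite])
    show "(\<lambda>(x, \<sigma>). ennreal (exp (exponent (couplings x) N t h \<sigma>))) \<in> borel_measurable (coupling_law N \<Otimes>\<^sub>M uniform_sphere N)"
      using measurable_compose[OF exponent_couplings_measurable[OF N, of t h], of "\<lambda>y. ennreal (exp y)" borel] by (simp add: case_prod_beta')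
  qed
  ultimately show ?thesis by simp
qed

lemma free_energy_measurable [measurable]:
  "N \<ge> 1 \<Longrightarrow> (\<lambda>x. free_energy (couplings x) N t h) \<in> borel_measurable (coupling_law N)"
  unfolding free_energy_def by measurable

lemma partition_function_first_moment:
  assumes N: "N \<ge> 1"
  shows "(\<integral>\<^sup>+x. ennreal (partition_function (couplings x) N t (\<lambda>_. 0)) \<partial>coupling_law N) = ennreal (exp (real N * (t\<^sup>2 / 2)))"
proof -
  interpret G: prob_space "coupling_law N" by (rule prob_space_coupling_law)
  interpret U: prob_space "uniform_sphere N" by (rule prob_space_uniform_sphere)
  interpret P: pair_sigma_finite "coupling_law N" "uniform_sphere N" ..
  have "(\<integral>\<^sup>+x. ennreal (partition_function (couplings x) N t (\<lambda>_. 0)) \<partial>coupling_law N)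
    = (\<integral>\<^sup>+x. \<integral>\<^sup>+\<sigma>. ennreal (exp (exponent (couplings x) N t (\<lambda>_. 0) \<sigma>)) \<partial>uniform_sphere N \<partial>coupling_law N)"
    unfolding partition_function_nn[OF N] ..
  also have "\<dots> = (\<integral>\<^sup>+\<sigma>. \<integral>\<^sup>+x. ennreal (exp (exponent (couplings x) N t (\<lambda>_. 0) \<sigma>)) \<partial>coupling_law N \<partial>uniform_sphere N)"
    by (rule P.Fubini'[symmetric])
       (use measurable_compose[OF exponent_couplings_measurable[OF N, of t "\<lambda>_. 0"], of "\<lambda>y. ennreal (exp y)" borel] in \<open>simp add: case_prod_beta'\<close>)
  also have "\<dots> = (\<integral>\<^sup>+\<sigma>. ennreal (exp (real N * (t\<^sup>2 / 2))) \<partial>uniform_sphere N)"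
  proof (rule nn_integral_cong_AE)
    show "AE \<sigma> in uniform_sphere N. (\<integral>\<^sup>+x. ennreal (exp (exponent (couplings x) N t (\<lambda>_. 0) \<sigma>)) \<partial>coupling_law N) = ennreal (exp (real N * (t\<^sup>2 / 2)))"
      using AE_uniform_sphere_rdot[OF N]
    proof eventually_elim
      fix \<sigma> assume s: "rdot N \<sigma> \<sigma> = 1"
      show "(\<integral>\<^sup>+x. ennreal (exp (exponent (couplings x) N t (\<lambda>_. 0) \<sigma>)) \<partial>coupling_law N) = ennreal (exp (real N * (t\<^sup>2 / 2)))"
        using sum_coupling_coeff_mult[of N t \<sigma> \<sigma>] s unfolding exponent_couplings[OF N] by (simp add: coupling_law_mgf power2_eq_square)
    qed
  qed
  also have "\<dots> = ennreal (exp (real N * (t\<^sup>2 / 2)))" by (simp add: U.emeasure_space_1)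
  finally show ?thesis .
qed

text \<open>
  Markov's inequality for the partition function.
\<close>

lemma free_energy_upper_tail:
  assumes N: "N \<ge> 1"
  shows "measure (coupling_law N) {x \<in> space (coupling_law N). free0 (couplings x) N t > t\<^sup>2 / 2 + \<eta>} \<le> exp (- (real N * \<eta>))"
proof -
  interpret G: prob_space "coupling_law N" by (rule prob_space_coupling_law)
  have N0: "real N > 0" using N by simp
  let ?c = "exp (- (real N * (t\<^sup>2 / 2 + \<eta>)))"
  have [measurable]: "(\<lambda>x. partition_function (couplings x) N t (\<lambda>_. 0)) \<in> borel_measurable (coupling_law N)" "(\<lambda>x. free0 (couplings x) N t) \<in> borel_measurable (coupling_law N)"
    using N by measurable
  have "emeasure (coupling_law N) {x \<in> space (coupling_law N). free0 (couplings x) N t > t\<^sup>2 / 2 + \<eta>}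
    \<le> emeasure (coupling_law N) {x \<in> space (coupling_law N). 1 \<le> ennreal ?c * ennreal (partition_function (couplings x) N t (\<lambda>_. 0))}"
  proof (rule emeasure_mono, safe)
    fix x assume "free0 (couplings x) N t > t\<^sup>2 / 2 + \<eta>"
    then have "real N * (t\<^sup>2 / 2 + \<eta>) \<le> real N * free0 (couplings x) N t" using N0 by simp
    then have "0 \<le> - (real N * (t\<^sup>2 / 2 + \<eta>)) + real N * free0 (couplings x) N t" by simp
    then show "1 \<le> ennreal ?c * ennreal (partition_function (couplings x) N t (\<lambda>_. 0))"
      unfolding partition_function_eq[OF N] by (simp only: ennreal_mult[symmetric] exp_ge_zero exp_add[symmetric]) (simp add: ennreal_ge_1)
  qed measurable
  also have "\<dots> \<le> ennreal ?c * (\<integral>\<^sup>+x. ennreal (partition_function (couplings x) N t (\<lambda>_. 0)) * indicator (space (coupling_law N)) x \<partial>coupling_law N)"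
    by (rule nn_integral_Markov_inequality) auto
  also have "\<dots> = ennreal ?c * ennreal (exp (real N * (t\<^sup>2 / 2)))"
    unfolding partition_function_first_moment[OF N, symmetric] by (intro arg_cong2[where f="(*)"] refl nn_integral_cong) simp
  also have "\<dots> = ennreal (exp (- (real N * \<eta>)))"
    by (simp add: ennreal_mult[symmetric] exp_add[symmetric] distrib_left)
  finally show ?thesis by (simp add: G.emeasure_eq_measure)
qed

text \<open>
  Two replicas at overlap \<open>R\<close> have joint exponential moment \<open>exp (N t\<^sup>2 (1 + R\<^sup>2))\<close>; the overlap is
  averaged by \<open>overlap_mgf\<close>.
\<close>

lemma partition_function_second_moment:
  assumes t: "0 < t" "t < beta_crit"
  obtains C :: real where "C > 0" "\<And>N. N \<ge> 1 \<Longrightarrow>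
    (\<integral>\<^sup>+x. ennreal ((partition_function (couplings x) N t (\<lambda>_. 0))\<^sup>2) \<partial>coupling_law N) \<le> ennreal (exp (real N * t\<^sup>2) * (C * sqrt (real N)))"
proof -
  obtain C where C: "C > 0" "\<And>N e. N \<ge> 1 \<Longrightarrow> rdot N e e = 1 \<Longrightarrow>
     (\<integral>\<^sup>+\<sigma>. ennreal (exp (real N * t\<^sup>2 * (rdot N e \<sigma>)\<^sup>2)) \<partial>uniform_sphere N) \<le> ennreal (C * sqrt (real N))"
    using overlap_mgf[OF t] by blast
  show ?thesis
  proof (rule that[OF C(1)])
    fix N :: nat assume N: "N \<ge> 1"
    interpret G: prob_space "coupling_law N" by (rule prob_space_coupling_law)
    interpret U: prob_space "uniform_sphere N" by (rule prob_space_uniform_sphere)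
    interpret P: pair_sigma_finite "coupling_law N" "uniform_sphere N" ..
    define F where "F x \<sigma> = ennreal (exp (exponent (couplings x) N t (\<lambda>_. 0) \<sigma>))" for x \<sigma>
    define Z where "Z x = ennreal (partition_function (couplings x) N t (\<lambda>_. 0))" for x
    have Fm: "(\<lambda>(x, \<sigma>). F x \<sigma>) \<in> borel_measurable (coupling_law N \<Otimes>\<^sub>M uniform_sphere N)"
      using measurable_compose[OF exponent_couplings_measurable[OF N, of t "\<lambda>_. 0"], of "\<lambda>y. ennreal (exp y)" borel] by (simp add: case_prod_beta' F_def)
    have F1 [measurable]: "F x \<in> borel_measurable (uniform_sphere N)" for x unfolding F_def[abs_def] by measurable
    have F2: "(\<lambda>x. F x \<sigma>) \<in> borel_measurable (coupling_law N)" if "\<sigma> \<in> space (uniform_sphere N)" for \<sigma>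
      using measurable_Pair1[OF Fm that] by simp
    have Zm: "Z \<in> borel_measurable (coupling_law N)" unfolding Z_def[abs_def] using N by measurable
    have Zi: "Z x = (\<integral>\<^sup>+\<sigma>. F x \<sigma> \<partial>uniform_sphere N)" for x unfolding Z_def F_def partition_function_nn[OF N] ..
    have FF: "(\<integral>\<^sup>+x. F x \<sigma> * F x \<tau> \<partial>coupling_law N) = ennreal (exp (real N * t\<^sup>2)) * ennreal (exp (real N * t\<^sup>2 * (rdot N \<sigma> \<tau>)\<^sup>2))"
      if s: "rdot N \<sigma> \<sigma> = 1" "rdot N \<tau> \<tau> = 1" for \<sigma> \<tau>
    proof -
      have "(\<integral>\<^sup>+x. F x \<sigma> * F x \<tau> \<partial>coupling_law N) = (\<integral>\<^sup>+x. ennreal (exp (\<Sum>p\<in>index_pairs N. (coupling_coeff N t \<sigma> p + coupling_coeff N t \<tau> p) * x p)) \<partial>coupling_law N)"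
        unfolding F_def exponent_couplings[OF N] by (intro nn_integral_cong) (simp add: ennreal_mult[symmetric] exp_add[symmetric] sum.distrib distrib_right)
      also have "\<dots> = ennreal (exp ((\<Sum>p\<in>index_pairs N. (coupling_coeff N t \<sigma> p + coupling_coeff N t \<tau> p)\<^sup>2) / 2))" by (rule coupling_law_mgf)
      also have "(\<Sum>p\<in>index_pairs N. (coupling_coeff N t \<sigma> p + coupling_coeff N t \<tau> p)\<^sup>2) = (\<Sum>p\<in>index_pairs N. coupling_coeff N t \<sigma> p * coupling_coeff N t \<sigma> p) + 2 * (\<Sum>p\<in>index_pairs N. coupling_coeff N t \<sigma> p * coupling_coeff N t \<tau> p) + (\<Sum>p\<in>index_pairs N. coupling_coeff N t \<tau> p * coupling_coeff N t \<tau> p)"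
        by (simp add: power2_eq_square algebra_simps sum.distrib sum_distrib_left)
      also have "\<dots> = 2 * (real N * t\<^sup>2 + real N * t\<^sup>2 * (rdot N \<sigma> \<tau>)\<^sup>2)" unfolding sum_coupling_coeff_mult s by simp
      finally show ?thesis by (simp add: ennreal_mult[symmetric] exp_add[symmetric])
    qed
    have inner: "(\<integral>\<^sup>+x. F x \<sigma> * Z x \<partial>coupling_law N) \<le> ennreal (exp (real N * t\<^sup>2) * (C * sqrt (real N)))"
      if s: "rdot N \<sigma> \<sigma> = 1" and sp: "\<sigma> \<in> space (uniform_sphere N)" for \<sigma>
    proof -
      have "(\<integral>\<^sup>+x. F x \<sigma> * Z x \<partial>coupling_law N) = (\<integral>\<^sup>+x. \<integral>\<^sup>+\<tau>. F x \<sigma> * F x \<tau> \<partial>uniform_sphere N \<partial>coupling_law N)"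
        unfolding Zi by (intro nn_integral_cong nn_integral_cmult[symmetric]) measurable
      also have "\<dots> = (\<integral>\<^sup>+\<tau>. \<integral>\<^sup>+x. F x \<sigma> * F x \<tau> \<partial>coupling_law N \<partial>uniform_sphere N)"
      proof (rule P.Fubini'[symmetric])
        show "(\<lambda>(x, \<tau>). F x \<sigma> * F x \<tau>) \<in> borel_measurable (coupling_law N \<Otimes>\<^sub>M uniform_sphere N)"
          using borel_measurable_times_ennreal[OF measurable_compose[OF measurable_fst F2[OF sp]] Fm] by (simp add: case_prod_beta')
      qed
      also have "\<dots> = (\<integral>\<^sup>+\<tau>. ennreal (exp (real N * t\<^sup>2)) * ennreal (exp (real N * t\<^sup>2 * (rdot N \<sigma> \<tau>)\<^sup>2)) \<partial>uniform_sphere N)"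
      proof (rule nn_integral_cong_AE)
        show "AE \<tau> in uniform_sphere N. (\<integral>\<^sup>+x. F x \<sigma> * F x \<tau> \<partial>coupling_law N) = ennreal (exp (real N * t\<^sup>2)) * ennreal (exp (real N * t\<^sup>2 * (rdot N \<sigma> \<tau>)\<^sup>2))"
          using AE_uniform_sphere_rdot[OF N] by eventually_elim (rule FF[OF s])
      qed
      also have "\<dots> = ennreal (exp (real N * t\<^sup>2)) * (\<integral>\<^sup>+\<tau>. ennreal (exp (real N * t\<^sup>2 * (rdot N \<sigma> \<tau>)\<^sup>2)) \<partial>uniform_sphere N)"
        by (rule nn_integral_cmult) measurable
      also have "\<dots> \<le> ennreal (exp (real N * t\<^sup>2)) * ennreal (C * sqrt (real N))"
        by (intro mult_left_mono C(2)[OF N s]) auto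
      finally show ?thesis using C by (simp add: ennreal_mult)
    qed
    have "(\<integral>\<^sup>+x. ennreal ((partition_function (couplings x) N t (\<lambda>_. 0))\<^sup>2) \<partial>coupling_law N) = (\<integral>\<^sup>+x. Z x * Z x \<partial>coupling_law N)"
      unfolding Z_def using partition_function_pos[OF N] by (intro nn_integral_cong) (simp add: power2_eq_square ennreal_mult less_imp_le)
    also have "\<dots> = (\<integral>\<^sup>+x. (\<integral>\<^sup>+\<sigma>. F x \<sigma> \<partial>uniform_sphere N) * Z x \<partial>coupling_law N)" unfolding Zi[symmetric] ..
    also have "\<dots> = (\<integral>\<^sup>+x. \<integral>\<^sup>+\<sigma>. F x \<sigma> * Z x \<partial>uniform_sphere N \<partial>coupling_law N)"
      by (intro nn_integral_cong nn_integral_multc[symmetric]) measurable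
    also have "\<dots> = (\<integral>\<^sup>+\<sigma>. \<integral>\<^sup>+x. F x \<sigma> * Z x \<partial>coupling_law N \<partial>uniform_sphere N)"
    proof (rule P.Fubini'[symmetric])
      show "(\<lambda>(x, \<sigma>). F x \<sigma> * Z x) \<in> borel_measurable (coupling_law N \<Otimes>\<^sub>M uniform_sphere N)"
        using borel_measurable_times_ennreal[OF Fm measurable_compose[OF measurable_fst Zm]] by (simp add: case_prod_beta')
    qed
    also have "\<dots> \<le> (\<integral>\<^sup>+\<sigma>. ennreal (exp (real N * t\<^sup>2) * (C * sqrt (real N))) \<partial>uniform_sphere N)"
    proof (rule nn_integral_mono_AE)
      show "AE \<sigma> in uniform_sphere N. (\<integral>\<^sup>+x. F x \<sigma> * Z x \<partial>coupling_law N) \<le> ennreal (exp (real N * t\<^sup>2) * (C * sqrt (real N)))"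
        using AE_uniform_sphere_rdot[OF N] AE_space by eventually_elim (rule inner)
    qed
    also have "\<dots> = ennreal (exp (real N * t\<^sup>2) * (C * sqrt (real N)))" by (simp add: U.emeasure_space_1)
    finally show "(\<integral>\<^sup>+x. ennreal ((partition_function (couplings x) N t (\<lambda>_. 0))\<^sup>2) \<partial>coupling_law N) \<le> ennreal (exp (real N * t\<^sup>2) * (C * sqrt (real N)))" .
  qed
qed

text \<open>
  Split \<open>Z\<close> at half of its mean and bound the large part by \<open>Z \<le> \<alpha> Z\<^sup>2 / 2 + 1 / (2 \<alpha>)\<close> with the
  best \<open>\<alpha>\<close>.
\<close>

lemma (in prob_space) paley_zygmund_half:
  fixes Z :: "'a \<Rightarrow> real"
  assumes i1: "integrable M Z" and i2: "integrable M (\<lambda>x. (Z x)\<^sup>2)"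
    and mu: "expectation Z = \<mu>" "\<mu> > 0" and S: "expectation (\<lambda>x. (Z x)\<^sup>2) \<le> S" "S > 0"
  shows "\<mu>\<^sup>2 / (4 * S) \<le> prob {x \<in> space M. Z x > \<mu> / 2}"
proof -
  let ?A = "{x \<in> space M. Z x > \<mu> / 2}"
  have [measurable]: "Z \<in> borel_measurable M" using i1 by auto
  have A: "?A \<in> events" by measurable
  define \<alpha> where "\<alpha> = \<mu> / (2 * S)"
  have al: "\<alpha> > 0" using mu S by (simp add: \<alpha>_def)
  have iA: "integrable M (\<lambda>x. indicator ?A x :: real)" using A by (simp add: emeasure_eq_measure)
  have "\<mu> \<le> expectation (\<lambda>x. \<mu> / 2 + (\<alpha> / 2 * (Z x)\<^sup>2 + 1 / (2 * \<alpha>) * indicator ?A x))"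
    unfolding mu(1)[symmetric]
  proof (rule integral_mono[OF i1])
    show "integrable M (\<lambda>x. expectation Z / 2 + (\<alpha> / 2 * (Z x)\<^sup>2 + 1 / (2 * \<alpha>) * indicator {x \<in> space M. expectation Z / 2 < Z x} x))"
      using i2 iA unfolding mu(1) by (intro Bochner_Integration.integrable_add integrable_mult_right) auto
    fix x assume x: "x \<in> space M"
    show "Z x \<le> expectation Z / 2 + (\<alpha> / 2 * (Z x)\<^sup>2 + 1 / (2 * \<alpha>) * indicator {x \<in> space M. expectation Z / 2 < Z x} x)"
    proof (cases "x \<in> ?A")
      case True
      have "0 \<le> (\<alpha> * Z x - 1)\<^sup>2" by simp
      then have "Z x * (2 * \<alpha>) \<le> \<alpha>\<^sup>2 * (Z x)\<^sup>2 + 1" by (simp add: power2_eq_square algebra_simps)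
      then have "Z x \<le> (\<alpha>\<^sup>2 * (Z x)\<^sup>2 + 1) / (2 * \<alpha>)" using al by (simp add: pos_le_divide_eq)
      also have "\<dots> = \<alpha> / 2 * (Z x)\<^sup>2 + 1 / (2 * \<alpha>)" using al by (simp add: field_simps power2_eq_square)
      finally show ?thesis using True mu by simp
    next
      case False
      then have "Z x \<le> \<mu> / 2" using x by simp
      moreover have "0 \<le> \<alpha> / 2 * (Z x)\<^sup>2" using al by simp
      ultimately show ?thesis using False unfolding mu(1) by simp
    qed
  qed
  also have "\<dots> = \<mu> / 2 + (\<alpha> / 2 * expectation (\<lambda>x. (Z x)\<^sup>2) + 1 / (2 * \<alpha>) * prob ?A)"
    using i2 iA by (simp add: prob_space A)
  also have "\<dots> \<le> \<mu> / 2 + (\<alpha> / 2 * S + 1 / (2 * \<alpha>) * prob ?A)"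
    using al S by (intro add_left_mono add_right_mono mult_left_mono) auto
  also have "\<dots> = \<mu> / 2 + \<mu> / 4 + S / \<mu> * prob ?A" using mu S by (simp add: \<alpha>_def field_simps)
  finally have "\<mu> / 4 \<le> S / \<mu> * prob ?A" by argo
  then have "\<mu> / 4 * (\<mu> / S) \<le> S / \<mu> * prob ?A * (\<mu> / S)" using mu S by (intro mult_right_mono) auto
  then show ?thesis using mu S by (simp add: power2_eq_square field_simps)
qed

lemma free_energy_large_probability:
  assumes t: "0 < t" "t < beta_crit"
  obtains c :: real where "c > 0" "\<And>N. N \<ge> 1 \<Longrightarrow>
    c / sqrt (real N) \<le> measure (coupling_law N) {x \<in> space (coupling_law N). free0 (couplings x) N t > t\<^sup>2 / 2 - 1 / real N}"
proof -
  obtain C where C: "C > 0" "\<And>N. N \<ge> 1 \<Longrightarrow>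
    (\<integral>\<^sup>+x. ennreal ((partition_function (couplings x) N t (\<lambda>_. 0))\<^sup>2) \<partial>coupling_law N) \<le> ennreal (exp (real N * t\<^sup>2) * (C * sqrt (real N)))"
    using partition_function_second_moment[OF t] by blast
  show ?thesis
  proof (rule that)
    show "1 / (4 * C) > 0" using C by simp
    fix N :: nat assume N: "N \<ge> 1"
    have N0: "real N > 0" using N by simp
    interpret G: prob_space "coupling_law N" by (rule prob_space_coupling_law)
    let ?Z = "\<lambda>x. partition_function (couplings x) N t (\<lambda>_. 0)"
    have Zm [measurable]: "?Z \<in> borel_measurable (coupling_law N)" "(\<lambda>x. free0 (couplings x) N t) \<in> borel_measurable (coupling_law N)" using N by measurable
    have Z0: "?Z x \<ge> 0" for x using partition_function_pos[OF N, of "couplings x" t "\<lambda>_. 0"] by simp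
    let ?\<mu> = "exp (real N * (t\<^sup>2 / 2))" and ?S = "exp (real N * t\<^sup>2) * (C * sqrt (real N))"
    have i1: "integrable (coupling_law N) ?Z" using partition_function_first_moment[OF N, of t] Z0 by (intro integrableI_nonneg) auto
    have i2: "integrable (coupling_law N) (\<lambda>x. (?Z x)\<^sup>2)"
      using C(2)[OF N] by (intro integrableI_nonneg) (auto simp: le_less_trans[OF _ ennreal_less_top])
    have e1: "G.expectation ?Z = ?\<mu>" using partition_function_first_moment[OF N, of t] Z0 by (subst integral_eq_nn_integral) auto
    have e2: "G.expectation (\<lambda>x. (?Z x)\<^sup>2) \<le> ?S"
    proof -
      have "ennreal (G.expectation (\<lambda>x. (?Z x)\<^sup>2)) = (\<integral>\<^sup>+x. ennreal ((?Z x)\<^sup>2) \<partial>coupling_law N)"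
        by (rule nn_integral_eq_integral[symmetric, OF i2]) simp
      then have "ennreal (G.expectation (\<lambda>x. (?Z x)\<^sup>2)) \<le> ennreal ?S" using C(2)[OF N] by simp
      then show ?thesis using C by (subst (asm) ennreal_le_iff) auto
    qed
    have S0: "?S > 0" using C N0 by simp
    have "?\<mu>\<^sup>2 / (4 * ?S) \<le> G.prob {x \<in> space (coupling_law N). ?Z x > ?\<mu> / 2}"
      by (rule G.paley_zygmund_half[OF i1 i2 e1 _ e2 S0]) simp
    also have "?\<mu>\<^sup>2 / (4 * ?S) = 1 / (4 * C) / sqrt (real N)"
    proof -
      have "?\<mu>\<^sup>2 = exp (real N * t\<^sup>2)" by (simp add: power2_eq_square exp_add[symmetric])
      then show ?thesis by simp
    qed
    also have "G.prob {x \<in> space (coupling_law N). ?Z x > ?\<mu> / 2} \<le> G.prob {x \<in> space (coupling_law N). free0 (couplings x) N t > t\<^sup>2 / 2 - 1 / real N}"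
    proof (rule G.finite_measure_mono, safe)
      fix x assume "?\<mu> / 2 < ?Z x"
      moreover have "exp (- 1) \<le> (1/2 :: real)" using exp_ge_add_one_self[of "1::real"] by (simp add: exp_minus field_simps)
      then have "?\<mu> * exp (- 1) \<le> ?\<mu> * (1/2)" by (intro mult_left_mono) auto
      ultimately have "exp (real N * (t\<^sup>2 / 2) + - 1) < exp (real N * free0 (couplings x) N t)"
        unfolding partition_function_eq[OF N] exp_add by linarith
      then have "real N * (t\<^sup>2 / 2) - 1 < real N * free0 (couplings x) N t" by simp
      moreover have "real N * (t\<^sup>2 / 2 - 1 / real N) = real N * (t\<^sup>2 / 2) - 1" using N0 by (simp add: right_diff_distrib)
      ultimately have "real N * (t\<^sup>2 / 2 - 1 / real N) < real N * free0 (couplings x) N t" by simp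
      then show "t\<^sup>2 / 2 - 1 / real N < free0 (couplings x) N t" using N0 by (subst (asm) mult_less_cancel_left_pos) auto
    qed measurable
    finally show "1 / (4 * C) / sqrt (real N) \<le> measure (coupling_law N) {x \<in> space (coupling_law N). free0 (couplings x) N t > t\<^sup>2 / 2 - 1 / real N}" .
  qed
qed

section \<open>The Efron-Stein inequality\<close>

text \<open>
  The square of the positive part.  For convex functions only one sign of an increment is controlled
  by the gradient at the current point, which is why the Efron-Stein inequality is stated with it.
\<close>

definition pos_sq :: "real \<Rightarrow> real" where "pos_sq a = (max 0 a)\<^sup>2"

lemma pos_sq_nonneg [simp]: "0 \<le> pos_sq a" by (simp add: pos_sq_def)

lemma pos_sq_measurable [measurable]: "pos_sq \<in> borel_measurable borel" unfolding pos_sq_def[abs_def] by measurable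

lemma pos_sq_split: "a\<^sup>2 = pos_sq a + pos_sq (- a)" by (simp add: pos_sq_def max_def)

lemma (in prob_space) bounded_integrable:
  fixes u :: "'a \<Rightarrow> real"
  assumes "u \<in> borel_measurable M" "\<And>x. x \<in> space M \<Longrightarrow> \<bar>u x\<bar> \<le> B"
  shows "integrable M u"
  by (rule integrable_const_bound[of _ B]) (use assms in auto)

lemma (in prob_space) square_expectation_le:
  fixes u :: "'a \<Rightarrow> real"
  assumes "u \<in> borel_measurable M" "\<And>x. x \<in> space M \<Longrightarrow> \<bar>u x\<bar> \<le> B"
  shows "(expectation u)\<^sup>2 \<le> expectation (\<lambda>x. (u x)\<^sup>2)"
proof -
  have i: "integrable M u" by (rule bounded_integrable) fact+
  have i2: "integrable M (\<lambda>x. (u x)\<^sup>2)"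
  proof (rule bounded_integrable)
    show "(\<lambda>x. (u x)\<^sup>2) \<in> borel_measurable M" using assms(1) by measurable
    show "\<bar>(u x)\<^sup>2\<bar> \<le> B\<^sup>2" if "x \<in> space M" for x using power_mono[OF assms(2)[OF that], of 2] by simp
  qed
  have "0 \<le> variance u" by (rule variance_positive)
  then show ?thesis using variance_eq[OF i i2] by simp
qed

text \<open>
  The variance is half of the mean squared difference of two independent copies, and by symmetry both
  signs of the difference contribute equally.
\<close>

lemma (in prob_space) variance_pair:
  fixes u :: "'a \<Rightarrow> real"
  assumes u [measurable]: "u \<in> borel_measurable M" and B: "\<And>x. x \<in> space M \<Longrightarrow> \<bar>u x\<bar> \<le> B"
  shows "ennreal (expectation (\<lambda>x. (u x)\<^sup>2) - (expectation u)\<^sup>2) = (\<integral>\<^sup>+y. \<integral>\<^sup>+z. ennreal (pos_sq (u y - u z)) \<partial>M \<partial>M)"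
proof -
  interpret P: pair_prob_space M M ..
  have i: "integrable M u" by (rule bounded_integrable) fact+
  have i2: "integrable M (\<lambda>x. (u x)\<^sup>2)"
  proof (rule bounded_integrable)
    show "(\<lambda>x. (u x)\<^sup>2) \<in> borel_measurable M" using assms(1) by measurable
    show "\<bar>(u x)\<^sup>2\<bar> \<le> B\<^sup>2" if "x \<in> space M" for x using power_mono[OF B[OF that], of 2] by simp
  qed
  let ?a = "expectation (\<lambda>x. (u x)\<^sup>2)" and ?m = "expectation u"
  have V: "0 \<le> ?a - ?m\<^sup>2" using square_expectation_le[OF assms] by simp
  define T where "T = (\<integral>\<^sup>+y. \<integral>\<^sup>+z. ennreal (pos_sq (u y - u z)) \<partial>M \<partial>M)"
  have inner: "(\<integral>\<^sup>+z. ennreal ((u y - u z)\<^sup>2) \<partial>M) = ennreal ((u y)\<^sup>2 - 2 * u y * ?m + ?a)" for y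
  proof -
    have eq: "(u y - u z)\<^sup>2 = ((u y)\<^sup>2 - 2 * u y * u z) + (u z)\<^sup>2" for z by (simp add: power2_diff algebra_simps)
    have ii: "integrable M (\<lambda>z. (u y - u z)\<^sup>2)" unfolding eq using i i2 by (intro Bochner_Integration.integrable_add Bochner_Integration.integrable_diff integrable_mult_right) auto
    have "(\<integral>\<^sup>+z. ennreal ((u y - u z)\<^sup>2) \<partial>M) = ennreal (expectation (\<lambda>z. (u y - u z)\<^sup>2))"
      by (rule nn_integral_eq_integral[OF ii]) simp
    also have "expectation (\<lambda>z. (u y - u z)\<^sup>2) = (u y)\<^sup>2 - 2 * u y * ?m + ?a"
      unfolding eq using i i2 by (simp add: prob_space)
    finally show ?thesis .
  qed
  have nn: "0 \<le> (u y)\<^sup>2 - 2 * u y * ?m + ?a" for y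
  proof -
    have "0 \<le> (u y - ?m)\<^sup>2" by simp
    then show ?thesis using V by (simp add: power2_diff)
  qed
  have "(\<integral>\<^sup>+y. \<integral>\<^sup>+z. ennreal ((u y - u z)\<^sup>2) \<partial>M \<partial>M) = (\<integral>\<^sup>+y. ennreal ((u y)\<^sup>2 - 2 * u y * ?m + ?a) \<partial>M)"
    unfolding inner ..
  also have "\<dots> = ennreal (expectation (\<lambda>y. ((u y)\<^sup>2 - 2 * u y * ?m) + ?a))"
    using i i2 nn by (intro nn_integral_eq_integral Bochner_Integration.integrable_add Bochner_Integration.integrable_diff) auto
  also have "expectation (\<lambda>y. ((u y)\<^sup>2 - 2 * u y * ?m) + ?a) = 2 * (?a - ?m\<^sup>2)"
    using i i2 by (simp add: prob_space power2_eq_square)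
  finally have full: "(\<integral>\<^sup>+y. \<integral>\<^sup>+z. ennreal ((u y - u z)\<^sup>2) \<partial>M \<partial>M) = ennreal (2 * (?a - ?m\<^sup>2))" .
  have "(\<integral>\<^sup>+y. \<integral>\<^sup>+z. ennreal ((u y - u z)\<^sup>2) \<partial>M \<partial>M) = (\<integral>\<^sup>+y. (\<integral>\<^sup>+z. ennreal (pos_sq (u y - u z)) \<partial>M) + (\<integral>\<^sup>+z. ennreal (pos_sq (u z - u y)) \<partial>M) \<partial>M)"
  proof (rule nn_integral_cong)
    fix y
    have "ennreal ((u y - u z)\<^sup>2) = ennreal (pos_sq (u y - u z)) + ennreal (pos_sq (u z - u y))" for z
      using pos_sq_split[of "u y - u z"] by (simp add: ennreal_plus[symmetric] del: ennreal_plus)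
    then show "(\<integral>\<^sup>+z. ennreal ((u y - u z)\<^sup>2) \<partial>M) = (\<integral>\<^sup>+z. ennreal (pos_sq (u y - u z)) \<partial>M) + (\<integral>\<^sup>+z. ennreal (pos_sq (u z - u y)) \<partial>M)"
      by (simp add: nn_integral_add)
  qed
  also have "\<dots> = T + (\<integral>\<^sup>+y. \<integral>\<^sup>+z. ennreal (pos_sq (u z - u y)) \<partial>M \<partial>M)"
    unfolding T_def by (rule nn_integral_add) measurable
  also have "(\<integral>\<^sup>+y. \<integral>\<^sup>+z. ennreal (pos_sq (u z - u y)) \<partial>M \<partial>M) = T"
    unfolding T_def by (rule P.Fubini') measurable
  finally have 1: "ennreal (2 * (?a - ?m\<^sup>2)) = T + T" unfolding full .
  have 2: "ennreal (2 * (?a - ?m\<^sup>2)) = 2 * ennreal (?a - ?m\<^sup>2)" by (subst ennreal_mult) (use V in auto)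
  have "2 * T = 2 * ennreal (?a - ?m\<^sup>2)" unfolding mult_2[of T] by (rule trans[OF 1[symmetric] 2])
  then show ?thesis unfolding T_def[symmetric] by (subst (asm) ennreal_mult_cancel_left) auto
qed

lemma (in prob_space) pos_sq_expectation_le:
  fixes u :: "'a \<Rightarrow> real"
  assumes u [measurable]: "u \<in> borel_measurable M" and B: "\<And>x. x \<in> space M \<Longrightarrow> \<bar>u x\<bar> \<le> B"
  shows "ennreal (pos_sq (expectation u)) \<le> (\<integral>\<^sup>+x. ennreal (pos_sq (u x)) \<partial>M)"
proof -
  let ?v = "\<lambda>x. max 0 (u x)"
  have v: "?v \<in> borel_measurable M" "\<And>x. x \<in> space M \<Longrightarrow> \<bar>?v x\<bar> \<le> B" using B by (auto simp: abs_le_iff max_def) force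
  have i: "integrable M u" by (rule bounded_integrable[OF u B])
  have iv: "integrable M ?v" by (rule bounded_integrable[OF v])
  have i2: "integrable M (\<lambda>x. (?v x)\<^sup>2)"
  proof (rule bounded_integrable)
    show "(\<lambda>x. (?v x)\<^sup>2) \<in> borel_measurable M" by measurable
    show "\<bar>(?v x)\<^sup>2\<bar> \<le> B\<^sup>2" if "x \<in> space M" for x using power_mono[OF v(2)[OF that], of 2] by simp
  qed
  have "expectation u \<le> expectation ?v" by (rule integral_mono[OF i iv]) simp
  moreover have "0 \<le> expectation ?v" by (rule Bochner_Integration.integral_nonneg) simp
  ultimately have "pos_sq (expectation u) \<le> (expectation ?v)\<^sup>2" unfolding pos_sq_def by (intro power_mono) auto
  also have "\<dots> \<le> expectation (\<lambda>x. (?v x)\<^sup>2)" by (rule square_expectation_le[OF v])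
  finally have "ennreal (pos_sq (expectation u)) \<le> ennreal (expectation (\<lambda>x. (?v x)\<^sup>2))" by (rule ennreal_leI)
  also have "\<dots> = (\<integral>\<^sup>+x. ennreal (pos_sq (u x)) \<partial>M)" unfolding pos_sq_def by (rule nn_integral_eq_integral[symmetric, OF i2]) simp
  finally show ?thesis .
qed

lemma resample_measurable:
  fixes \<mu> :: "'b measure" and f :: "('i \<Rightarrow> 'b) \<Rightarrow> real"
  assumes mu: "prob_space \<mu>" and f: "f \<in> borel_measurable (\<Pi>\<^sub>M i\<in>I. \<mu>)" and j: "j \<in> I"
  shows "(\<lambda>x. \<integral>\<^sup>+z. ennreal (pos_sq (f x - f (x(j := z)))) \<partial>\<mu>) \<in> borel_measurable (\<Pi>\<^sub>M i\<in>I. \<mu>)"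
proof -
  interpret m: prob_space \<mu> by (rule mu)
  let ?Q = "\<Pi>\<^sub>M i\<in>I. \<mu>"
  show ?thesis
  proof (rule m.borel_measurable_nn_integral)
    have u: "(\<lambda>(x, z). x(j := z)) \<in> ?Q \<Otimes>\<^sub>M \<mu> \<rightarrow>\<^sub>M ?Q"
      using measurable_fun_upd[of I I j fst "?Q \<Otimes>\<^sub>M \<mu>" "\<lambda>_. \<mu>" snd] j by (simp add: case_prod_beta' insert_absorb)
    have "(\<lambda>(x, z). f (x(j := z))) \<in> borel_measurable (?Q \<Otimes>\<^sub>M \<mu>)" using measurable_compose[OF u f] by (simp add: case_prod_beta')
    moreover have "(\<lambda>(x, z). f x) \<in> borel_measurable (?Q \<Otimes>\<^sub>M \<mu>)" using measurable_compose[OF measurable_fst f] by (simp add: case_prod_beta')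
    ultimately show "(\<lambda>(x, z). ennreal (pos_sq (f x - f (x(j := z))))) \<in> borel_measurable (?Q \<Otimes>\<^sub>M \<mu>)" unfolding case_prod_beta' by measurable
  qed
qed

text \<open>
  Induction over the coordinates.  Conditioning on all coordinates but \<open>i\<close> splits the variance into
  the mean of the conditional variance, which is the \<open>i\<close>-th summand by \<open>variance_pair\<close>, and the
  variance of the conditional mean \<open>g\<close>.  The induction hypothesis applies to \<open>g\<close>, and averaging
  over coordinate \<open>i\<close> only decreases the squared positive parts of its increments.
\<close>

lemma efron_stein:
  fixes \<mu> :: "'b measure" and f :: "('i \<Rightarrow> 'b) \<Rightarrow> real"
  assumes mu: "prob_space \<mu>" and fin: "finite I"
    and f: "f \<in> borel_measurable (\<Pi>\<^sub>M i\<in>I. \<mu>)" and B: "\<And>x. x \<in> space (\<Pi>\<^sub>M i\<in>I. \<mu>) \<Longrightarrow> \<bar>f x\<bar> \<le> B"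
  shows "ennreal ((\<integral>x. (f x)\<^sup>2 \<partial>(\<Pi>\<^sub>M i\<in>I. \<mu>)) - (\<integral>x. f x \<partial>(\<Pi>\<^sub>M i\<in>I. \<mu>))\<^sup>2)
    \<le> (\<Sum>i\<in>I. \<integral>\<^sup>+x. \<integral>\<^sup>+z. ennreal (pos_sq (f x - f (x(i := z)))) \<partial>\<mu> \<partial>(\<Pi>\<^sub>M i\<in>I. \<mu>))"
  using fin f B
proof (induction I arbitrary: f rule: finite_induct)
  case empty
  interpret P: prob_space "\<Pi>\<^sub>M i\<in>({}::'i set). \<mu>" by (intro prob_space_PiM mu)
  have sp: "space (\<Pi>\<^sub>M i\<in>({}::'i set). \<mu>) = {\<lambda>_. undefined}" by (simp add: space_PiM)
  have "(\<integral>x. f x \<partial>(\<Pi>\<^sub>M i\<in>({}::'i set). \<mu>)) = (\<integral>x. f (\<lambda>_. undefined) \<partial>(\<Pi>\<^sub>M i\<in>({}::'i set). \<mu>))"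
    by (rule Bochner_Integration.integral_cong[OF refl]) (auto simp: sp)
  moreover have "(\<integral>x. (f x)\<^sup>2 \<partial>(\<Pi>\<^sub>M i\<in>({}::'i set). \<mu>)) = (\<integral>x. (f (\<lambda>_. undefined))\<^sup>2 \<partial>(\<Pi>\<^sub>M i\<in>({}::'i set). \<mu>))"
    by (rule Bochner_Integration.integral_cong[OF refl]) (auto simp: sp)
  ultimately show ?case by (simp add: P.prob_space)
next
  case (insert i I)
  interpret m: prob_space \<mu> by (rule mu)
  interpret PI: product_sigma_finite "\<lambda>_::'i. \<mu>" by (rule product_sigma_finite.intro) (rule m.sigma_finite_measure_axioms)
  let ?P = "\<Pi>\<^sub>M j\<in>I. \<mu>" and ?Q = "\<Pi>\<^sub>M j\<in>insert i I. \<mu>"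
  interpret P: prob_space ?P by (intro prob_space_PiM mu)
  interpret Q: prob_space ?Q by (intro prob_space_PiM mu)
  interpret PM: pair_sigma_finite ?P \<mu> ..
  interpret MM: pair_sigma_finite \<mu> \<mu> ..
  have f [measurable]: "f \<in> borel_measurable ?Q" by fact
  have B: "\<bar>f x\<bar> \<le> B" if "x \<in> space ?Q" for x using insert.prems(2) that by simp
  have upd: "(\<lambda>(x, y). x(i := y)) \<in> ?P \<Otimes>\<^sub>M \<mu> \<rightarrow>\<^sub>M ?Q"
    using measurable_add_dim[of i I "\<lambda>_. \<mu>"] by simp
  have fu: "(\<lambda>(x, y). f (x(i := y))) \<in> borel_measurable (?P \<Otimes>\<^sub>M \<mu>)"
    using measurable_compose[OF upd f] by (simp add: case_prod_beta')
  have fy [measurable]: "(\<lambda>y. f (x(i := y))) \<in> borel_measurable \<mu>" if "x \<in> space ?P" for x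
    using measurable_Pair2[OF fu that] by simp
  have sp: "x(i := y) \<in> space ?Q" if "x \<in> space ?P" "y \<in> space \<mu>" for x y
    using that by (auto simp: space_PiM PiE_iff extensional_def)
  have By: "\<bar>f (x(i := y))\<bar> \<le> B" if "x \<in> space ?P" "y \<in> space \<mu>" for x y by (rule B[OF sp[OF that]])
  have if1: "integrable ?Q f" by (rule Q.bounded_integrable[OF f B])
  have if2: "integrable ?Q (\<lambda>x. (f x)\<^sup>2)"
  proof (rule Q.bounded_integrable)
    show "(\<lambda>x. (f x)\<^sup>2) \<in> borel_measurable ?Q" by measurable
    show "\<bar>(f x)\<^sup>2\<bar> \<le> B\<^sup>2" if "x \<in> space ?Q" for x using power_mono[OF B[OF that], of 2] by simp
  qed
  define g where "g x = (\<integral>y. f (x(i := y)) \<partial>\<mu>)" for x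
  define g2 where "g2 x = (\<integral>y. (f (x(i := y)))\<^sup>2 \<partial>\<mu>)" for x
  have gm [measurable]: "g \<in> borel_measurable ?P"
    unfolding g_def[abs_def] by (rule m.borel_measurable_lebesgue_integral[OF fu])
  have g2m [measurable]: "g2 \<in> borel_measurable ?P"
  proof -
    have "(\<lambda>(x, y). (f (x(i := y)))\<^sup>2) \<in> borel_measurable (?P \<Otimes>\<^sub>M \<mu>)"
      using borel_measurable_power[OF fu, of 2] by (simp add: case_prod_beta')
    then show ?thesis unfolding g2_def[abs_def] by (rule m.borel_measurable_lebesgue_integral)
  qed
  have gB: "\<bar>g x\<bar> \<le> B" if x: "x \<in> space ?P" for x
  proof -
    have i: "integrable \<mu> (\<lambda>y. f (x(i := y)))" by (rule m.bounded_integrable[OF fy[OF x] By[OF x]])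
    have "g x \<le> (\<integral>y. B \<partial>\<mu>)" unfolding g_def by (rule integral_mono[OF i]) (use By[OF x] in \<open>auto simp: abs_le_iff\<close>)
    moreover have "(\<integral>y. - B \<partial>\<mu>) \<le> g x" unfolding g_def
      by (rule integral_mono[OF _ i]) (use By[OF x] in \<open>auto simp: abs_le_iff minus_le_iff\<close>)
    ultimately show ?thesis by (simp add: m.prob_space abs_le_iff)
  qed
  have g2B: "\<bar>g2 x\<bar> \<le> B\<^sup>2" if x: "x \<in> space ?P" for x
  proof -
    have b: "(f (x(i := y)))\<^sup>2 \<le> B\<^sup>2" if "y \<in> space \<mu>" for y using power_mono[OF By[OF x that], of 2] by simp
    have i: "integrable \<mu> (\<lambda>y. (f (x(i := y)))\<^sup>2)"
    proof (rule m.bounded_integrable)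
      show "(\<lambda>y. (f (x(i := y)))\<^sup>2) \<in> borel_measurable \<mu>" using fy[OF x] by measurable
    qed (use b in auto)
    have "g2 x \<le> (\<integral>y. B\<^sup>2 \<partial>\<mu>)" unfolding g2_def by (rule integral_mono[OF i]) (use b in auto)
    moreover have "0 \<le> g2 x" unfolding g2_def by (rule Bochner_Integration.integral_nonneg) simp
    ultimately show ?thesis by (simp add: m.prob_space)
  qed
  have gsq: "\<bar>(g x)\<^sup>2\<bar> \<le> B\<^sup>2" if "x \<in> space ?P" for x using power_mono[OF gB[OF that], of 2] by simp
  have ig: "integrable ?P (\<lambda>x. (g x)\<^sup>2)" by (rule P.bounded_integrable[OF _ gsq]) measurable
  have ig2: "integrable ?P g2" by (rule P.bounded_integrable[OF g2m g2B])
  have E1: "(\<integral>x. f x \<partial>?Q) = (\<integral>x. g x \<partial>?P)"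
    unfolding g_def by (rule PI.product_integral_insert[OF insert.hyps(1,2) if1])
  have E2: "(\<integral>x. (f x)\<^sup>2 \<partial>?Q) = (\<integral>x. g2 x \<partial>?P)"
    unfolding g2_def by (rule PI.product_integral_insert[OF insert.hyps(1,2) if2])
  have vy: "ennreal (g2 x - (g x)\<^sup>2) = (\<integral>\<^sup>+y. \<integral>\<^sup>+z. ennreal (pos_sq (f (x(i := y)) - f (x(i := z)))) \<partial>\<mu> \<partial>\<mu>)" if x: "x \<in> space ?P" for x
    unfolding g_def g2_def by (rule m.variance_pair[OF fy[OF x] By[OF x]])
  have vy0: "0 \<le> g2 x - (g x)\<^sup>2" if x: "x \<in> space ?P" for x
    unfolding g_def g2_def using m.square_expectation_le[OF fy[OF x] By[OF x]] by simp
  note meas = resample_measurable[OF mu f]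
  have D: "(\<integral>\<^sup>+x. \<integral>\<^sup>+z. ennreal (pos_sq (f x - f (x(j := z)))) \<partial>\<mu> \<partial>?Q) = (\<integral>\<^sup>+x. \<integral>\<^sup>+y. \<integral>\<^sup>+z. ennreal (pos_sq (f (x(i := y)) - f ((x(i := y))(j := z)))) \<partial>\<mu> \<partial>\<mu> \<partial>?P)"
    if j: "j \<in> insert i I" for j
    by (rule PI.product_nn_integral_insert[OF insert.hyps(1,2) meas[OF j]])
  have "ennreal ((\<integral>x. (f x)\<^sup>2 \<partial>?Q) - (\<integral>x. f x \<partial>?Q)\<^sup>2) = ennreal ((\<integral>x. g2 x - (g x)\<^sup>2 \<partial>?P) + ((\<integral>x. (g x)\<^sup>2 \<partial>?P) - (\<integral>x. g x \<partial>?P)\<^sup>2))"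
    unfolding E1 E2 by (simp add: Bochner_Integration.integral_diff[OF ig2 ig])
  also have "\<dots> = ennreal (\<integral>x. g2 x - (g x)\<^sup>2 \<partial>?P) + ennreal ((\<integral>x. (g x)\<^sup>2 \<partial>?P) - (\<integral>x. g x \<partial>?P)\<^sup>2)"
  proof (rule ennreal_plus)
    show "0 \<le> (\<integral>x. g2 x - (g x)\<^sup>2 \<partial>?P)" by (rule Bochner_Integration.integral_nonneg_AE) (use vy0 in auto)
    show "0 \<le> (\<integral>x. (g x)\<^sup>2 \<partial>?P) - (\<integral>x. g x \<partial>?P)\<^sup>2" using P.square_expectation_le[OF gm gB] by simp
  qed
  also have "\<dots> \<le> (\<integral>\<^sup>+x. \<integral>\<^sup>+z. ennreal (pos_sq (f x - f (x(i := z)))) \<partial>\<mu> \<partial>?Q) + (\<Sum>j\<in>I. \<integral>\<^sup>+x. \<integral>\<^sup>+z. ennreal (pos_sq (f x - f (x(j := z)))) \<partial>\<mu> \<partial>?Q)"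
  proof (rule add_mono)
    have "ennreal (\<integral>x. g2 x - (g x)\<^sup>2 \<partial>?P) = (\<integral>\<^sup>+x. ennreal (g2 x - (g x)\<^sup>2) \<partial>?P)"
      by (rule nn_integral_eq_integral[symmetric]) (use ig ig2 vy0 in auto)
    also have "\<dots> = (\<integral>\<^sup>+x. \<integral>\<^sup>+y. \<integral>\<^sup>+z. ennreal (pos_sq (f (x(i := y)) - f (x(i := z)))) \<partial>\<mu> \<partial>\<mu> \<partial>?P)"
      by (rule nn_integral_cong) (rule vy)
    also have "\<dots> = (\<integral>\<^sup>+x. \<integral>\<^sup>+z. ennreal (pos_sq (f x - f (x(i := z)))) \<partial>\<mu> \<partial>?Q)"
      by (subst D) simp_all
    finally show "ennreal (\<integral>x. g2 x - (g x)\<^sup>2 \<partial>?P) \<le> (\<integral>\<^sup>+x. \<integral>\<^sup>+z. ennreal (pos_sq (f x - f (x(i := z)))) \<partial>\<mu> \<partial>?Q)" by simp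
    have "ennreal ((\<integral>x. (g x)\<^sup>2 \<partial>?P) - (\<integral>x. g x \<partial>?P)\<^sup>2) \<le> (\<Sum>j\<in>I. \<integral>\<^sup>+x. \<integral>\<^sup>+z. ennreal (pos_sq (g x - g (x(j := z)))) \<partial>\<mu> \<partial>?P)"
      by (rule insert.IH[OF gm gB])
    also have "\<dots> \<le> (\<Sum>j\<in>I. \<integral>\<^sup>+x. \<integral>\<^sup>+z. ennreal (pos_sq (f x - f (x(j := z)))) \<partial>\<mu> \<partial>?Q)"
    proof (rule sum_mono)
      fix j assume j: "j \<in> I"
      then have ji: "j \<noteq> i" using insert.hyps by auto
      have "(\<integral>\<^sup>+x. \<integral>\<^sup>+z. ennreal (pos_sq (g x - g (x(j := z)))) \<partial>\<mu> \<partial>?P)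
        \<le> (\<integral>\<^sup>+x. \<integral>\<^sup>+z. \<integral>\<^sup>+y. ennreal (pos_sq (f (x(i := y)) - f ((x(i := y))(j := z)))) \<partial>\<mu> \<partial>\<mu> \<partial>?P)"
      proof (intro nn_integral_mono)
        fix x z assume x: "x \<in> space ?P" and z: "z \<in> space \<mu>"
        have xz: "x(j := z) \<in> space ?P" using x z j by (auto simp: space_PiM PiE_iff extensional_def)
        have i1: "integrable \<mu> (\<lambda>y. f (x(i := y)))" by (rule m.bounded_integrable[OF fy[OF x] By[OF x]])
        have i2: "integrable \<mu> (\<lambda>y. f ((x(j := z))(i := y)))" by (rule m.bounded_integrable[OF fy[OF xz] By[OF xz]])
        have "g x - g (x(j := z)) = (\<integral>y. f (x(i := y)) - f ((x(j := z))(i := y)) \<partial>\<mu>)"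
          unfolding g_def by (rule Bochner_Integration.integral_diff[symmetric, OF i1 i2])
        also have "ennreal (pos_sq \<dots>) \<le> (\<integral>\<^sup>+y. ennreal (pos_sq (f (x(i := y)) - f ((x(j := z))(i := y)))) \<partial>\<mu>)"
        proof (rule m.pos_sq_expectation_le)
          show "(\<lambda>y. f (x(i := y)) - f ((x(j := z))(i := y))) \<in> borel_measurable \<mu>" using fy[OF x] fy[OF xz] by measurable
          show "\<bar>f (x(i := y)) - f ((x(j := z))(i := y))\<bar> \<le> B + B" if y: "y \<in> space \<mu>" for y
            using By[OF x y] By[OF xz y] by linarith
        qed
        finally show "ennreal (pos_sq (g x - g (x(j := z)))) \<le> (\<integral>\<^sup>+y. ennreal (pos_sq (f (x(i := y)) - f ((x(i := y))(j := z)))) \<partial>\<mu>)"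
          unfolding fun_upd_twist[OF ji] .
      qed
      also have "\<dots> = (\<integral>\<^sup>+x. \<integral>\<^sup>+y. \<integral>\<^sup>+z. ennreal (pos_sq (f (x(i := y)) - f ((x(i := y))(j := z)))) \<partial>\<mu> \<partial>\<mu> \<partial>?P)"
      proof (rule nn_integral_cong)
        fix x assume x: "x \<in> space ?P"
        have u: "(\<lambda>(y, z). x(j := z)) \<in> \<mu> \<Otimes>\<^sub>M \<mu> \<rightarrow>\<^sub>M ?P"
          using measurable_fun_upd[of I I j "\<lambda>_. x" "\<mu> \<Otimes>\<^sub>M \<mu>" "\<lambda>_. \<mu>" snd] j x by (simp add: case_prod_beta' insert_absorb)
        have "(\<lambda>(y, z). f ((x(j := z))(i := y))) \<in> borel_measurable (\<mu> \<Otimes>\<^sub>M \<mu>)"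
          using measurable_compose[OF measurable_Pair[OF u measurable_fst] fu] by (simp add: case_prod_beta')
        moreover have "(\<lambda>(y, z). f (x(i := y))) \<in> borel_measurable (\<mu> \<Otimes>\<^sub>M \<mu>)"
          using measurable_compose[OF measurable_fst fy[OF x]] by (simp add: case_prod_beta')
        ultimately have "(\<lambda>(y, z). ennreal (pos_sq (f (x(i := y)) - f ((x(j := z))(i := y))))) \<in> borel_measurable (\<mu> \<Otimes>\<^sub>M \<mu>)"
          unfolding case_prod_beta' by measurable
        then have "(\<lambda>(y, z). ennreal (pos_sq (f (x(i := y)) - f ((x(i := y))(j := z))))) \<in> borel_measurable (\<mu> \<Otimes>\<^sub>M \<mu>)"
          unfolding fun_upd_twist[OF ji] .
        then show "(\<integral>\<^sup>+z. \<integral>\<^sup>+y. ennreal (pos_sq (f (x(i := y)) - f ((x(i := y))(j := z)))) \<partial>\<mu> \<partial>\<mu>) = (\<integral>\<^sup>+y. \<integral>\<^sup>+z. ennreal (pos_sq (f (x(i := y)) - f ((x(i := y))(j := z)))) \<partial>\<mu> \<partial>\<mu>)"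
          by (rule MM.Fubini')
      qed
      also have "\<dots> = (\<integral>\<^sup>+x. \<integral>\<^sup>+z. ennreal (pos_sq (f x - f (x(j := z)))) \<partial>\<mu> \<partial>?Q)"
        by (rule D[symmetric]) (use j in simp)
      finally show "(\<integral>\<^sup>+x. \<integral>\<^sup>+z. ennreal (pos_sq (g x - g (x(j := z)))) \<partial>\<mu> \<partial>?P) \<le> (\<integral>\<^sup>+x. \<integral>\<^sup>+z. ennreal (pos_sq (f x - f (x(j := z)))) \<partial>\<mu> \<partial>?Q)" .
    qed
    finally show "ennreal ((\<integral>x. (g x)\<^sup>2 \<partial>?P) - (\<integral>x. g x \<partial>?P)\<^sup>2) \<le> (\<Sum>j\<in>I. \<integral>\<^sup>+x. \<integral>\<^sup>+z. ennreal (pos_sq (f x - f (x(j := z)))) \<partial>\<mu> \<partial>?Q)" .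
  qed
  also have "\<dots> = (\<Sum>j\<in>insert i I. \<integral>\<^sup>+x. \<integral>\<^sup>+z. ennreal (pos_sq (f x - f (x(j := z)))) \<partial>\<mu> \<partial>?Q)"
    using insert.hyps by simp
  finally show ?case .
qed

section \<open>Concentration of the free energy\<close>

text \<open>
  The Gibbs average of \<open>\<sigma>\<^sub>i \<sigma>\<^sub>j\<close>, which is the gradient of the free energy in the couplings up to
  the factor \<open>t / sqrt N\<close>.
\<close>

definition gibbs :: "nat \<Rightarrow> real \<Rightarrow> (nat \<times> nat \<Rightarrow> real) \<Rightarrow> nat \<times> nat \<Rightarrow> real" where
  "gibbs N t x p = (\<integral>\<sigma>. \<sigma> (fst p) * \<sigma> (snd p) * exp (exponent (couplings x) N t (\<lambda>_. 0) \<sigma>) \<partial>uniform_sphere N) / partition_function (couplings x) N t (\<lambda>_. 0)"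

lemma sphere_coordinate_le:
  assumes "rdot N \<sigma> \<sigma> = 1" "i \<in> {1..N}" shows "\<bar>\<sigma> i\<bar> \<le> 1"
proof -
  have "\<bar>\<sigma> i\<bar> \<le> L2_set (\<lambda>i. \<bar>\<sigma> i\<bar>) {1..N}" using assms(2) by (intro member_le_L2_set) auto
  also have "\<dots> = rnorm N \<sigma>" by (simp add: rnorm_def L2_set_def)
  finally show ?thesis using assms(1) by (simp add: rnorm_eq_sqrt)
qed

lemma gibbs_weight_integrable:
  assumes N: "N \<ge> 1" and \<phi>: "\<phi> \<in> borel_measurable (uniform_sphere N)" and B: "\<And>\<sigma>. rdot N \<sigma> \<sigma> = 1 \<Longrightarrow> \<bar>\<phi> \<sigma>\<bar> \<le> 1"
  shows "integrable (uniform_sphere N) (\<lambda>\<sigma>. \<phi> \<sigma> * exp (exponent g N t h \<sigma>))"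
proof -
  have i: "integrable (uniform_sphere N) (\<lambda>\<sigma>. exp (exponent g N t h \<sigma>))"
    by (rule sphere_exp_integrable(1)[OF N exponent_measurable(3) exponent_bound[OF quad_le_sum]])
  show ?thesis
  proof (rule Bochner_Integration.integrable_bound[OF i])
    show "(\<lambda>\<sigma>. \<phi> \<sigma> * exp (exponent g N t h \<sigma>)) \<in> borel_measurable (uniform_sphere N)" using \<phi> by measurable
    show "AE \<sigma> in uniform_sphere N. norm (\<phi> \<sigma> * exp (exponent g N t h \<sigma>)) \<le> norm (exp (exponent g N t h \<sigma>))"
      using AE_uniform_sphere_rdot[OF N]
    proof eventually_elim
      fix \<sigma> assume "rdot N \<sigma> \<sigma> = 1"
      then show "norm (\<phi> \<sigma> * exp (exponent g N t h \<sigma>)) \<le> norm (exp (exponent g N t h \<sigma>))" using B[of \<sigma>] by (simp add: abs_mult mult_left_le_one_le)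
    qed
  qed
qed

lemma pair_bound: "rdot N \<sigma> \<sigma> = 1 \<Longrightarrow> p \<in> index_pairs N \<Longrightarrow> \<bar>\<sigma> (fst p) * \<sigma> (snd p)\<bar> \<le> 1"
  unfolding abs_mult by (intro mult_le_one sphere_coordinate_le) auto

lemma pair_measurable: "p \<in> index_pairs N \<Longrightarrow> (\<lambda>\<sigma>. \<sigma> (fst p) * \<sigma> (snd p)) \<in> borel_measurable (uniform_sphere N)"
  by (cases p) auto

lemma pair_square_measurable: "p \<in> index_pairs N \<Longrightarrow> (\<lambda>\<sigma>. (\<sigma> (fst p) * \<sigma> (snd p))\<^sup>2) \<in> borel_measurable (uniform_sphere N)"
  using pair_measurable by measurable

text \<open>
  By Jensen's inequality the sum is at most the Gibbs average of \<open>|\<sigma>|\<^sup>4\<close>.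
\<close>

lemma sum_gibbs_squares:
  assumes N: "N \<ge> 1"
  shows "(\<Sum>p\<in>index_pairs N. (gibbs N t x p)\<^sup>2) \<le> 1"
proof -
  let ?w = "\<lambda>\<sigma>. exp (exponent (couplings x) N t (\<lambda>_. 0) \<sigma>)" and ?Z = "partition_function (couplings x) N t (\<lambda>_. 0)"
  have Z: "?Z > 0" by (rule partition_function_pos[OF N])
  have Zi: "?Z = (\<integral>\<sigma>. ?w \<sigma> \<partial>uniform_sphere N)" by (rule partition_function_exponent[OF N])
  have sq1: "\<bar>(\<sigma> (fst p) * \<sigma> (snd p))\<^sup>2\<bar> \<le> 1" if "rdot N \<sigma> \<sigma> = 1" "p \<in> index_pairs N" for \<sigma> p
    using pair_bound[OF that] power_mono[of "\<bar>\<sigma> (fst p) * \<sigma> (snd p)\<bar>" 1 2] by simp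
  have i0: "integrable (uniform_sphere N) ?w"
    by (rule sphere_exp_integrable(1)[OF N exponent_measurable(3) exponent_bound[OF quad_le_sum]])
  have i1: "integrable (uniform_sphere N) (\<lambda>\<sigma>. \<sigma> (fst p) * \<sigma> (snd p) * ?w \<sigma>)" if "p \<in> index_pairs N" for p
    using gibbs_weight_integrable[OF N pair_measurable[OF that] pair_bound[OF _ that]] by simp
  have i2: "integrable (uniform_sphere N) (\<lambda>\<sigma>. (\<sigma> (fst p) * \<sigma> (snd p))\<^sup>2 * ?w \<sigma>)" if "p \<in> index_pairs N" for p
    by (rule gibbs_weight_integrable[OF N pair_square_measurable[OF that] sq1[OF _ that]])
  have one: "(gibbs N t x p)\<^sup>2 * ?Z \<le> (\<integral>\<sigma>. (\<sigma> (fst p) * \<sigma> (snd p))\<^sup>2 * ?w \<sigma> \<partial>uniform_sphere N)" if p: "p \<in> index_pairs N" for p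
  proof -
    define a where "a = gibbs N t x p"
    have aZ: "(\<integral>\<sigma>. \<sigma> (fst p) * \<sigma> (snd p) * ?w \<sigma> \<partial>uniform_sphere N) = a * ?Z" using Z by (simp add: a_def gibbs_def)
    have eq: "(\<sigma> (fst p) * \<sigma> (snd p) - a)\<^sup>2 * ?w \<sigma> = ((\<sigma> (fst p) * \<sigma> (snd p))\<^sup>2 * ?w \<sigma> - 2 * a * (\<sigma> (fst p) * \<sigma> (snd p) * ?w \<sigma>)) + a\<^sup>2 * ?w \<sigma>" for \<sigma>
      by (simp add: power2_diff algebra_simps)
    have "0 \<le> (\<integral>\<sigma>. (\<sigma> (fst p) * \<sigma> (snd p) - a)\<^sup>2 * ?w \<sigma> \<partial>uniform_sphere N)" by (rule Bochner_Integration.integral_nonneg) simp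
    also have "\<dots> = ((\<integral>\<sigma>. (\<sigma> (fst p) * \<sigma> (snd p))\<^sup>2 * ?w \<sigma> \<partial>uniform_sphere N) - 2 * a * (\<integral>\<sigma>. \<sigma> (fst p) * \<sigma> (snd p) * ?w \<sigma> \<partial>uniform_sphere N)) + a\<^sup>2 * (\<integral>\<sigma>. ?w \<sigma> \<partial>uniform_sphere N)"
      unfolding eq using i0 i1[OF p] i2[OF p] by simp
    also have "\<dots> = ((\<integral>\<sigma>. (\<sigma> (fst p) * \<sigma> (snd p))\<^sup>2 * ?w \<sigma> \<partial>uniform_sphere N) - 2 * a * (a * ?Z)) + a\<^sup>2 * ?Z"
      by (simp only: aZ Zi[symmetric])
    finally show ?thesis by (simp add: a_def power2_eq_square algebra_simps)
  qed
  have "(\<Sum>p\<in>index_pairs N. (gibbs N t x p)\<^sup>2) * ?Z = (\<Sum>p\<in>index_pairs N. (gibbs N t x p)\<^sup>2 * ?Z)" by (rule sum_distrib_right)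
  also have "\<dots> \<le> (\<Sum>p\<in>index_pairs N. \<integral>\<sigma>. (\<sigma> (fst p) * \<sigma> (snd p))\<^sup>2 * ?w \<sigma> \<partial>uniform_sphere N)" by (rule sum_mono) (rule one)
  also have "\<dots> = (\<integral>\<sigma>. (\<Sum>p\<in>index_pairs N. (\<sigma> (fst p) * \<sigma> (snd p))\<^sup>2 * ?w \<sigma>) \<partial>uniform_sphere N)"
    by (rule Bochner_Integration.integral_sum[symmetric]) (rule i2)
  also have "\<dots> = (\<integral>\<sigma>. ?w \<sigma> \<partial>uniform_sphere N)"
  proof (rule integral_cong_AE)
    show "(\<lambda>\<sigma>. \<Sum>p\<in>index_pairs N. (\<sigma> (fst p) * \<sigma> (snd p))\<^sup>2 * ?w \<sigma>) \<in> borel_measurable (uniform_sphere N)"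
      by (intro borel_measurable_sum borel_measurable_integrable i2)
    show "?w \<in> borel_measurable (uniform_sphere N)" using i0 by auto
    show "AE \<sigma> in uniform_sphere N. (\<Sum>p\<in>index_pairs N. (\<sigma> (fst p) * \<sigma> (snd p))\<^sup>2 * ?w \<sigma>) = ?w \<sigma>"
      using AE_uniform_sphere_rdot[OF N]
    proof eventually_elim
      fix \<sigma> assume s: "rdot N \<sigma> \<sigma> = 1"
      have "(\<Sum>p\<in>index_pairs N. (\<sigma> (fst p) * \<sigma> (snd p))\<^sup>2) = (\<Sum>p\<in>index_pairs N. (\<sigma> (fst p))\<^sup>2 * (\<sigma> (snd p))\<^sup>2)" by (simp add: power_mult_distrib)
      also have "\<dots> = rdot N \<sigma> \<sigma> * rdot N \<sigma> \<sigma>"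
        unfolding sum_index_pairs_prod[where a="\<lambda>i. (\<sigma> i)\<^sup>2" and b="\<lambda>i. (\<sigma> i)\<^sup>2"] by (simp add: rdot_def power2_eq_square)
      finally show "(\<Sum>p\<in>index_pairs N. (\<sigma> (fst p) * \<sigma> (snd p))\<^sup>2 * ?w \<sigma>) = ?w \<sigma>" using s by (simp add: sum_distrib_right[symmetric])
    qed
  qed
  finally have "(\<Sum>p\<in>index_pairs N. (gibbs N t x p)\<^sup>2) * ?Z \<le> 1 * ?Z" unfolding Zi by simp
  then show ?thesis using Z by (simp only: mult_le_cancel_right_pos)
qed

text \<open>
  The free energy is convex in each coupling, with derivative \<open>t / sqrt N\<close> times \<open>gibbs\<close>.
\<close>

lemma free_energy_convex_bound:
  assumes N: "N \<ge> 1" and p: "p \<in> index_pairs N"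
  shows "free0 (couplings x) N t - free0 (couplings (x(p := z))) N t \<le> t / sqrt (real N) * (x p - z) * gibbs N t x p"
proof -
  have N0: "real N > 0" using N by simp
  let ?w = "\<lambda>\<sigma>. exp (exponent (couplings x) N t (\<lambda>_. 0) \<sigma>)" and ?Z = "partition_function (couplings x) N t (\<lambda>_. 0)"
  let ?\<phi> = "\<lambda>\<sigma> :: nat \<Rightarrow> real. \<sigma> (fst p) * \<sigma> (snd p)"
  have Z: "?Z > 0" by (rule partition_function_pos[OF N])
  have Zi: "?Z = (\<integral>\<sigma>. ?w \<sigma> \<partial>uniform_sphere N)" by (rule partition_function_exponent[OF N])
  define a where "a = gibbs N t x p"
  define b where "b = sqrt (real N) * t * (z - x p)"
  have aZ: "(\<integral>\<sigma>. ?\<phi> \<sigma> * ?w \<sigma> \<partial>uniform_sphere N) = a * ?Z" using Z by (simp add: a_def gibbs_def)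
  have i0: "integrable (uniform_sphere N) ?w"
    by (rule sphere_exp_integrable(1)[OF N exponent_measurable(3) exponent_bound[OF quad_le_sum]])
  have i1: "integrable (uniform_sphere N) (\<lambda>\<sigma>. ?\<phi> \<sigma> * ?w \<sigma>)"
    using gibbs_weight_integrable[OF N pair_measurable[OF p] pair_bound[OF _ p]] by simp
  have iz: "integrable (uniform_sphere N) (\<lambda>\<sigma>. exp (exponent (couplings (x(p := z))) N t (\<lambda>_. 0) \<sigma>))"
    by (rule sphere_exp_integrable(1)[OF N exponent_measurable(3) exponent_bound[OF quad_le_sum]])
  have upd: "exponent (couplings (x(p := z))) N t (\<lambda>_. 0) \<sigma> = exponent (couplings x) N t (\<lambda>_. 0) \<sigma> + b * ?\<phi> \<sigma>" for \<sigma>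
  proof -
    have "(\<Sum>q\<in>index_pairs N. coupling_coeff N t \<sigma> q * (x(p := z)) q) = (\<Sum>q\<in>index_pairs N. coupling_coeff N t \<sigma> q * x q + (if q = p then coupling_coeff N t \<sigma> p * (z - x p) else 0))"
      by (intro sum.cong refl) (simp add: algebra_simps)
    also have "\<dots> = (\<Sum>q\<in>index_pairs N. coupling_coeff N t \<sigma> q * x q) + coupling_coeff N t \<sigma> p * (z - x p)"
      using p by (simp add: sum.distrib)
    finally show ?thesis unfolding exponent_couplings[OF N] by (simp add: coupling_coeff_def b_def mult_ac)
  qed
  have "exp (b * a) * ?Z = exp (b * a) * (((1 - b * a) * ?Z) + b * (a * ?Z))" by (simp add: algebra_simps)
  also have "\<dots> = exp (b * a) * (((1 - b * a) * (\<integral>\<sigma>. ?w \<sigma> \<partial>uniform_sphere N)) + b * (\<integral>\<sigma>. ?\<phi> \<sigma> * ?w \<sigma> \<partial>uniform_sphere N))"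
    by (simp only: aZ Zi[symmetric])
  also have "\<dots> = (\<integral>\<sigma>. exp (b * a) * ((1 - b * a) * ?w \<sigma> + b * (?\<phi> \<sigma> * ?w \<sigma>)) \<partial>uniform_sphere N)"
    using i0 i1 by simp
  also have "\<dots> \<le> (\<integral>\<sigma>. exp (exponent (couplings (x(p := z))) N t (\<lambda>_. 0) \<sigma>) \<partial>uniform_sphere N)"
  proof (rule integral_mono)
    show "integrable (uniform_sphere N) (\<lambda>\<sigma>. exp (b * a) * ((1 - b * a) * ?w \<sigma> + b * (?\<phi> \<sigma> * ?w \<sigma>)))"
      using i0 i1 by (intro integrable_mult_right Bochner_Integration.integrable_add) auto
    show "integrable (uniform_sphere N) (\<lambda>\<sigma>. exp (exponent (couplings (x(p := z))) N t (\<lambda>_. 0) \<sigma>))" by (rule iz)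
    fix \<sigma>
    have "exp (b * a) * ((1 - b * a) * ?w \<sigma> + b * (?\<phi> \<sigma> * ?w \<sigma>)) = (exp (b * a) * (1 + (b * ?\<phi> \<sigma> - b * a))) * ?w \<sigma>" by (simp add: algebra_simps)
    also have "\<dots> \<le> (exp (b * a) * exp (b * ?\<phi> \<sigma> - b * a)) * ?w \<sigma>"
      by (intro mult_right_mono mult_left_mono exp_ge_add_one_self) auto
    also have "\<dots> = exp (exponent (couplings (x(p := z))) N t (\<lambda>_. 0) \<sigma>)" unfolding upd exp_add[symmetric] by simp
    finally show "exp (b * a) * ((1 - b * a) * ?w \<sigma> + b * (?\<phi> \<sigma> * ?w \<sigma>)) \<le> exp (exponent (couplings (x(p := z))) N t (\<lambda>_. 0) \<sigma>)" .
  qed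
  also have "\<dots> = exp (real N * free0 (couplings (x(p := z))) N t)"
    unfolding partition_function_exponent[OF N, symmetric] by (rule partition_function_eq[OF N])
  finally have "b * a + real N * free0 (couplings x) N t \<le> real N * free0 (couplings (x(p := z))) N t"
    unfolding partition_function_eq[OF N] exp_add[symmetric] by simp
  then have "real N * (free0 (couplings x) N t - free0 (couplings (x(p := z))) N t) \<le> - (b * a)" by (simp add: algebra_simps)
  also have "- (b * a) = real N * (t / sqrt (real N) * (x p - z) * a)"
  proof -
    have "real N * (t / sqrt (real N)) = sqrt (real N) * t" using N0 by (simp add: real_div_sqrt field_simps)
    then have "real N * (t / sqrt (real N)) * ((x p - z) * a) = sqrt (real N) * t * ((x p - z) * a)" by (simp only:)
    then show ?thesis unfolding b_def by (simp only: mult.assoc) (simp add: algebra_simps)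
  qed
  finally show ?thesis using N0 unfolding a_def by (subst (asm) mult_le_cancel_left_pos) auto
qed

text \<open>
  Truncation makes the free energy bounded without increasing its increments.
\<close>

definition clip :: "real \<Rightarrow> real" where "clip a = max (-1) (min 1 a)"

lemma pos_sq_clip_le: "pos_sq (clip a - clip b) \<le> pos_sq (a - b)"
  unfolding pos_sq_def clip_def by (intro power_mono) auto

lemma pos_sq_le_square: "a \<le> b \<Longrightarrow> pos_sq a \<le> b\<^sup>2"
  unfolding pos_sq_def by (cases "a \<le> 0") (auto simp: max_def intro: power_mono)

lemma std_gauss_second_moment: "(\<integral>\<^sup>+y. ennreal (y\<^sup>2) \<partial>std_gauss) = 1"
proof -
  have i: "has_bochner_integral lborel (\<lambda>x. std_normal_density x * x\<^sup>2) 1"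
    using std_normal_moment_even[of 1] by (simp add: fact_numeral)
  have "(\<integral>\<^sup>+y. ennreal (y\<^sup>2) \<partial>std_gauss) = (\<integral>\<^sup>+y. ennreal (std_normal_density y * y\<^sup>2) \<partial>lborel)"
    unfolding std_gauss_def by (subst nn_integral_density) (auto simp: ennreal_mult)
  also have "\<dots> = ennreal 1"
    by (subst nn_integral_eq_integral) (use i in \<open>auto simp: has_bochner_integral_iff\<close>)
  finally show ?thesis by simp
qed

lemma std_gauss_moment16: obtains m :: real where "m \<ge> 0" "(\<integral>\<^sup>+y. ennreal (y ^ 16) \<partial>std_gauss) = ennreal m"
proof -
  define m :: real where "m = fact 16 / (2 ^ 8 * fact 8)"
  have i: "has_bochner_integral lborel (\<lambda>x. std_normal_density x * x ^ 16) m"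
    using std_normal_moment_even[of 8] by (simp add: m_def)
  have "(\<integral>\<^sup>+y. ennreal (y ^ 16) \<partial>std_gauss) = (\<integral>\<^sup>+y. ennreal (std_normal_density y * y ^ 16) \<partial>lborel)"
    unfolding std_gauss_def by (subst nn_integral_density) (auto simp: ennreal_mult)
  also have "\<dots> = ennreal m"
    by (subst nn_integral_eq_integral) (use i in \<open>auto simp: has_bochner_integral_iff\<close>)
  finally show ?thesis using that[of m] by (simp add: m_def)
qed

lemma coupling_law_marginal:
  assumes p: "p \<in> index_pairs N" and u: "u \<in> borel_measurable borel"
  shows "(\<integral>\<^sup>+x. u (x p) \<partial>coupling_law N) = (\<integral>\<^sup>+y. u y \<partial>std_gauss)"
proof -
  have "distr (coupling_law N) std_gauss (\<lambda>x. x p) = std_gauss"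
    unfolding coupling_law_def by (rule distr_PiM_component[OF prob_space_std_gauss p])
  then have "(\<integral>\<^sup>+y. u y \<partial>std_gauss) = (\<integral>\<^sup>+y. u y \<partial>distr (coupling_law N) std_gauss (\<lambda>x. x p))" by simp
  also have "\<dots> = (\<integral>\<^sup>+x. u (x p) \<partial>coupling_law N)"
  proof (rule nn_integral_distr)
    show "(\<lambda>x. x p) \<in> coupling_law N \<rightarrow>\<^sub>M std_gauss" unfolding coupling_law_def by (rule measurable_component_singleton[OF p])
    show "u \<in> borel_measurable (distr (coupling_law N) std_gauss (\<lambda>x. x p))"
      using u by (subst measurable_cong_sets[OF _ refl, of _ borel]) simp_all
  qed
  finally show ?thesis ..
qed

text \<open>
  The increment in coupling \<open>p\<close> is at most \<open>t / sqrt N * (x p - z) * gibbs p\<close>.  Since the squares of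
  \<open>gibbs\<close> sum to at most 1, the variance is at most of order \<open>1 / N\<close> times the expectation of the
  largest \<open>(x p)\<^sup>2\<close>, which a high moment bounds by a small power of \<open>N\<close>.
\<close>

lemma free_energy_variance:
  obtains A :: real where "A \<ge> 0" "\<And>N t. N \<ge> 1 \<Longrightarrow> \<bar>t\<bar> \<le> 1 \<Longrightarrow>
    (\<integral>x. (clip (free0 (couplings x) N t))\<^sup>2 \<partial>coupling_law N) - (\<integral>x. clip (free0 (couplings x) N t) \<partial>coupling_law N)\<^sup>2 \<le> A * real N powr (- 3 / 4)"
proof -
  obtain m :: real where m: "m \<ge> 0" "(\<integral>\<^sup>+y. ennreal (y ^ 16) \<partial>std_gauss) = ennreal m" using std_gauss_moment16 by blast
  show ?thesis
  proof (rule that)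
    show "2 * (2 + m) \<ge> 0" using m by simp
    fix N :: nat and t :: real assume N: "N \<ge> 1" and t: "\<bar>t\<bar> \<le> 1"
    have N0: "real N > 0" using N by simp
    interpret G: prob_space "coupling_law N" by (rule prob_space_coupling_law)
    interpret g: prob_space std_gauss by (rule prob_space_std_gauss)
    define f where "f x = clip (free0 (couplings x) N t)" for x
    have fm: "f \<in> borel_measurable (coupling_law N)" unfolding f_def[abs_def] clip_def using N by measurable
    have fm': "f \<in> borel_measurable (\<Pi>\<^sub>M p\<in>index_pairs N. std_gauss)" using fm by (simp add: coupling_law_def)
    have fB: "\<bar>f x\<bar> \<le> 1" for x by (auto simp: f_def clip_def)
    define R where "R p x = (\<integral>\<^sup>+z. ennreal (pos_sq (f x - f (x(p := z)))) \<partial>std_gauss)" for p x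
    have Rm: "R p \<in> borel_measurable (coupling_law N)" if "p \<in> index_pairs N" for p
      unfolding R_def[abs_def] coupling_law_def by (rule resample_measurable[OF prob_space_std_gauss fm' that])
    \<comment> \<open>This \<open>c\<close> balances the two terms of \<open>c + N\<^sup>2 / c\<^sup>7\<close>, the bound on the largest squared coupling by its 16th moments.\<close>
    define c where "c = real N powr (1 / 4)"
    have c: "c \<ge> 1" "c > 0" using N by (auto simp: c_def ge_one_powr_ge_zero)
    let ?C = "2 * t\<^sup>2 / real N"
    have C0: "?C \<ge> 0" using N0 by simp
    have Rb: "R p x \<le> ennreal (?C * (gibbs N t x p)\<^sup>2 * ((x p)\<^sup>2 + 1))" if p: "p \<in> index_pairs N" for p x
    proof -
      have "R p x \<le> (\<integral>\<^sup>+z. ennreal (?C * (gibbs N t x p)\<^sup>2) * (ennreal ((x p)\<^sup>2) + ennreal (z\<^sup>2)) \<partial>std_gauss)"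
        unfolding R_def
      proof (intro nn_integral_mono)
        fix z
        have "pos_sq (f x - f (x(p := z))) \<le> pos_sq (free0 (couplings x) N t - free0 (couplings (x(p := z))) N t)" unfolding f_def by (rule pos_sq_clip_le)
        also have "\<dots> \<le> (t / sqrt (real N) * (x p - z) * gibbs N t x p)\<^sup>2"
          by (rule pos_sq_le_square[OF free_energy_convex_bound[OF N p]])
        also have "\<dots> = (t\<^sup>2 / real N) * (gibbs N t x p)\<^sup>2 * (x p - z)\<^sup>2" using N0 by (simp add: power_mult_distrib power_divide)
        also have "\<dots> \<le> (t\<^sup>2 / real N) * (gibbs N t x p)\<^sup>2 * (2 * ((x p)\<^sup>2 + z\<^sup>2))"
        proof (intro mult_left_mono)
          have "0 \<le> (x p + z)\<^sup>2" by simp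
          then show "(x p - z)\<^sup>2 \<le> 2 * ((x p)\<^sup>2 + z\<^sup>2)" by (simp add: power2_sum power2_diff)
        qed (use N0 in auto)
        also have "\<dots> = ?C * (gibbs N t x p)\<^sup>2 * ((x p)\<^sup>2 + z\<^sup>2)" by simp
        finally have le: "ennreal (pos_sq (f x - f (x(p := z)))) \<le> ennreal (?C * (gibbs N t x p)\<^sup>2 * ((x p)\<^sup>2 + z\<^sup>2))" by (rule ennreal_leI)
        show "ennreal (pos_sq (f x - f (x(p := z)))) \<le> ennreal (?C * (gibbs N t x p)\<^sup>2) * (ennreal ((x p)\<^sup>2) + ennreal (z\<^sup>2))"
        proof -
          have "ennreal ((x p)\<^sup>2) + ennreal (z\<^sup>2) = ennreal ((x p)\<^sup>2 + z\<^sup>2)" by (simp add: ennreal_plus)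
          moreover have "0 \<le> ?C * (gibbs N t x p)\<^sup>2" using C0 by simp
          ultimately show "ennreal (pos_sq (f x - f (x(p := z)))) \<le> ennreal (?C * (gibbs N t x p)\<^sup>2) * (ennreal ((x p)\<^sup>2) + ennreal (z\<^sup>2))"
            using le by (simp only: ennreal_mult[symmetric] add_nonneg_nonneg zero_le_power2)
        qed
      qed
      also have "\<dots> = ennreal (?C * (gibbs N t x p)\<^sup>2) * (\<integral>\<^sup>+z. ennreal ((x p)\<^sup>2) + ennreal (z\<^sup>2) \<partial>std_gauss)"
        by (rule nn_integral_cmult) (subst measurable_cong_sets[OF sets_std_gauss refl], measurable)
      also have "(\<integral>\<^sup>+z. ennreal ((x p)\<^sup>2) + ennreal (z\<^sup>2) \<partial>std_gauss) = ennreal ((x p)\<^sup>2) + 1"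
      proof -
        have mean_sq: "(\<lambda>z. ennreal (z\<^sup>2)) \<in> borel_measurable std_gauss" by (subst measurable_cong_sets[OF sets_std_gauss refl]) measurable
        show ?thesis by (subst nn_integral_add) (use mean_sq in \<open>auto simp: std_gauss_second_moment g.emeasure_space_1[simplified]\<close>)
      qed
      also have "ennreal ((x p)\<^sup>2) + 1 = ennreal ((x p)\<^sup>2 + 1)" by (simp add: ennreal_plus)
      also have "ennreal (?C * (gibbs N t x p)\<^sup>2) * ennreal ((x p)\<^sup>2 + 1) = ennreal (?C * (gibbs N t x p)\<^sup>2 * ((x p)\<^sup>2 + 1))"
        using C0 by (intro ennreal_mult[symmetric]) auto
      finally show ?thesis .
    qed
    have pw: "y\<^sup>2 \<le> c + y ^ 16 / c ^ 7" for y :: real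
    proof (cases "y\<^sup>2 \<le> c")
      case True
      have "0 \<le> y ^ 16 / c ^ 7" using c by simp
      then show ?thesis using True by linarith
    next
      case False
      then have "1 \<le> y\<^sup>2 / c" using c by simp
      then have "1 \<le> (y\<^sup>2 / c) ^ 7" by (rule one_le_power)
      then have "y\<^sup>2 * 1 \<le> y\<^sup>2 * (y\<^sup>2 / c) ^ 7" by (intro mult_left_mono) auto
      also have "\<dots> = y ^ 16 / c ^ 7" by (simp add: power_divide power_mult[symmetric] power_add[symmetric])
      finally show ?thesis using c by simp
    qed
    have sumR: "(\<Sum>p\<in>index_pairs N. R p x) \<le> ennreal (?C * (c + 1)) + (\<Sum>p\<in>index_pairs N. ennreal (?C / c ^ 7) * ennreal ((x p) ^ 16))" for x
    proof -
      have g1: "(gibbs N t x p)\<^sup>2 \<le> 1" if "p \<in> index_pairs N" for p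
        using sum_gibbs_squares[OF N, of t x] member_le_sum[OF that, of "\<lambda>p. (gibbs N t x p)\<^sup>2"] by auto
      have "(\<Sum>p\<in>index_pairs N. R p x) \<le> (\<Sum>p\<in>index_pairs N. ennreal (?C * (gibbs N t x p)\<^sup>2 * ((x p)\<^sup>2 + 1)))" by (rule sum_mono) (rule Rb)
      also have "\<dots> = ennreal (\<Sum>p\<in>index_pairs N. ?C * (gibbs N t x p)\<^sup>2 * ((x p)\<^sup>2 + 1))" by (rule sum_ennreal) (use C0 in auto)
      also have "\<dots> \<le> ennreal (\<Sum>p\<in>index_pairs N. ?C * (c + 1) * (gibbs N t x p)\<^sup>2 + ?C / c ^ 7 * (x p) ^ 16)"
      proof (intro ennreal_leI sum_mono)
        have arrange: "D * G * (X + 1) \<le> D * (c + 1) * G + D / k * Y"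
          if "D * (G * (X + 1)) \<le> D * ((c + 1) * G + 1 * (Y / k))" for D G X Y k :: real
          using that by (simp add: algebra_simps)
        fix p assume p: "p \<in> index_pairs N"
        have "(gibbs N t x p)\<^sup>2 * ((x p)\<^sup>2 + 1) \<le> (gibbs N t x p)\<^sup>2 * ((c + 1) + (x p) ^ 16 / c ^ 7)" using pw[of "x p"] by (intro mult_left_mono) auto
        also have "\<dots> = (c + 1) * (gibbs N t x p)\<^sup>2 + (gibbs N t x p)\<^sup>2 * ((x p) ^ 16 / c ^ 7)" by (simp add: algebra_simps)
        also have "\<dots> \<le> (c + 1) * (gibbs N t x p)\<^sup>2 + 1 * ((x p) ^ 16 / c ^ 7)" using g1[OF p] c by (intro add_left_mono mult_right_mono) auto
        finally have "?C * ((gibbs N t x p)\<^sup>2 * ((x p)\<^sup>2 + 1)) \<le> ?C * ((c + 1) * (gibbs N t x p)\<^sup>2 + 1 * ((x p) ^ 16 / c ^ 7))" using C0 by (rule mult_left_mono)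
        then show "?C * (gibbs N t x p)\<^sup>2 * ((x p)\<^sup>2 + 1) \<le> ?C * (c + 1) * (gibbs N t x p)\<^sup>2 + ?C / c ^ 7 * (x p) ^ 16" by (rule arrange)
      qed
      also have "(\<Sum>p\<in>index_pairs N. ?C * (c + 1) * (gibbs N t x p)\<^sup>2 + ?C / c ^ 7 * (x p) ^ 16) = ?C * (c + 1) * (\<Sum>p\<in>index_pairs N. (gibbs N t x p)\<^sup>2) + (\<Sum>p\<in>index_pairs N. ?C / c ^ 7 * (x p) ^ 16)"
        unfolding sum.distrib sum_distrib_left ..
      also have "ennreal \<dots> \<le> ennreal (?C * (c + 1) * 1 + (\<Sum>p\<in>index_pairs N. ?C / c ^ 7 * (x p) ^ 16))"
        using sum_gibbs_squares[OF N, of t x] C0 c by (intro ennreal_leI add_right_mono mult_left_mono mult_nonneg_nonneg) auto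
      also have "\<dots> = ennreal (?C * (c + 1)) + (\<Sum>p\<in>index_pairs N. ennreal (?C / c ^ 7 * (x p) ^ 16))"
        using C0 c by (subst ennreal_plus) (auto intro!: sum_nonneg)
      also have "\<dots> = ennreal (?C * (c + 1)) + (\<Sum>p\<in>index_pairs N. ennreal (?C / c ^ 7) * ennreal ((x p) ^ 16))"
        using C0 c by (intro arg_cong2[where f="(+)"] refl sum.cong ennreal_mult) auto
      finally show ?thesis .
    qed
    have "ennreal ((\<integral>x. (f x)\<^sup>2 \<partial>coupling_law N) - (\<integral>x. f x \<partial>coupling_law N)\<^sup>2) \<le> (\<Sum>p\<in>index_pairs N. \<integral>\<^sup>+x. R p x \<partial>coupling_law N)"
      unfolding R_def coupling_law_def by (rule efron_stein[OF prob_space_std_gauss _ fm' fB]) simp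
    also have "\<dots> = (\<integral>\<^sup>+x. (\<Sum>p\<in>index_pairs N. R p x) \<partial>coupling_law N)" by (rule nn_integral_sum[symmetric]) (rule Rm)
    also have "\<dots> \<le> (\<integral>\<^sup>+x. ennreal (?C * (c + 1)) + (\<Sum>p\<in>index_pairs N. ennreal (?C / c ^ 7) * ennreal ((x p) ^ 16)) \<partial>coupling_law N)"
      by (intro nn_integral_mono sumR)
    also have "\<dots> = (\<integral>\<^sup>+x. ennreal (?C * (c + 1)) \<partial>coupling_law N) + (\<integral>\<^sup>+x. (\<Sum>p\<in>index_pairs N. ennreal (?C / c ^ 7) * ennreal ((x p) ^ 16)) \<partial>coupling_law N)"
      by (rule nn_integral_add) (auto intro!: borel_measurable_sum borel_measurable_times_ennreal measurable_compose[OF coupling_law_component])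
    also have "(\<integral>\<^sup>+x. (\<Sum>p\<in>index_pairs N. ennreal (?C / c ^ 7) * ennreal ((x p) ^ 16)) \<partial>coupling_law N) = (\<Sum>p\<in>index_pairs N. \<integral>\<^sup>+x. ennreal (?C / c ^ 7) * ennreal ((x p) ^ 16) \<partial>coupling_law N)"
      by (rule nn_integral_sum) measurable
    also have "\<dots> = (\<Sum>p\<in>index_pairs N. ennreal (?C / c ^ 7) * ennreal m)"
    proof (rule sum.cong[OF refl])
      fix p assume p: "p \<in> index_pairs N"
      have "(\<integral>\<^sup>+x. ennreal (?C / c ^ 7) * ennreal ((x p) ^ 16) \<partial>coupling_law N) = ennreal (?C / c ^ 7) * (\<integral>\<^sup>+x. ennreal ((x p) ^ 16) \<partial>coupling_law N)"
        using p by (intro nn_integral_cmult) measurable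
      also have "(\<integral>\<^sup>+x. ennreal ((x p) ^ 16) \<partial>coupling_law N) = ennreal m" unfolding m(2)[symmetric] by (rule coupling_law_marginal[OF p]) measurable
      finally show "(\<integral>\<^sup>+x. ennreal (?C / c ^ 7) * ennreal ((x p) ^ 16) \<partial>coupling_law N) = ennreal (?C / c ^ 7) * ennreal m" .
    qed
    also have "\<dots> = ennreal ((real N)\<^sup>2 * (?C / c ^ 7 * m))"
    proof -
      have "0 \<le> ?C / c ^ 7" using C0 c by simp
      then have "(\<Sum>p\<in>index_pairs N. ennreal (?C / c ^ 7) * ennreal m) = (\<Sum>p\<in>index_pairs N. ennreal (?C / c ^ 7 * m))" by (simp only: ennreal_mult[OF _ m(1)])
      also have "\<dots> = ennreal (\<Sum>p\<in>index_pairs N. ?C / c ^ 7 * m)" by (intro sum_ennreal mult_nonneg_nonneg[OF \<open>0 \<le> ?C / c ^ 7\<close> m(1)])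
      finally show ?thesis by (simp add: power2_eq_square)
    qed
    also have "(\<integral>\<^sup>+x. ennreal (?C * (c + 1)) \<partial>coupling_law N) = ennreal (?C * (c + 1))" by (simp add: G.emeasure_space_1)
    finally have "ennreal ((\<integral>x. (f x)\<^sup>2 \<partial>coupling_law N) - (\<integral>x. f x \<partial>coupling_law N)\<^sup>2) \<le> ennreal (?C * (c + 1) + (real N)\<^sup>2 * (?C / c ^ 7 * m))"
      using C0 c m by (subst ennreal_plus) auto
    then have "(\<integral>x. (f x)\<^sup>2 \<partial>coupling_law N) - (\<integral>x. f x \<partial>coupling_law N)\<^sup>2 \<le> ?C * (c + 1) + (real N)\<^sup>2 * (?C / c ^ 7 * m)"
      using C0 c m by (subst (asm) ennreal_le_iff) auto
    also have "\<dots> = ?C * ((c + 1) + ((real N)\<^sup>2 / c ^ 7) * m)"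
    proof -
      have "D * (c + 1) + k * (D / l * m) = D * ((c + 1) + (k / l) * m)" for D k l :: real by (simp add: algebra_simps)
      then show ?thesis .
    qed
    also have "(real N)\<^sup>2 / c ^ 7 = c"
    proof -
      have "c ^ 8 = (real N)\<^sup>2" using N0 by (simp add: c_def powr_power powr_numeral)
      moreover have "c ^ 8 = c * c ^ 7" using power_Suc[of c 7] by simp
      ultimately show ?thesis using c by (simp add: field_simps)
    qed
    also have "?C * ((c + 1) + c * m) \<le> (2 * 1 / real N) * ((2 + m) * c)"
    proof (intro mult_mono divide_right_mono mult_left_mono)
      show "t\<^sup>2 \<le> 1" using t by (simp add: abs_square_le_1)
      show "c + 1 + c * m \<le> (2 + m) * c" using c by (simp add: algebra_simps)
    qed (use N0 c m in auto)
    also have "\<dots> = 2 * (2 + m) * (c / real N)" by simp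
    also have "c / real N = real N powr (- 3 / 4)"
      using N0 powr_diff[of "real N" "1/4" 1] by (simp add: c_def)
    finally show "(\<integral>x. (clip (free0 (couplings x) N t))\<^sup>2 \<partial>coupling_law N) - (\<integral>x. clip (free0 (couplings x) N t) \<partial>coupling_law N)\<^sup>2 \<le> 2 * (2 + m) * real N powr (- 3 / 4)"
      unfolding f_def .
  qed
qed

text \<open>
  By \<open>free_energy_large_probability\<close> the free energy is near \<open>t\<^sup>2 / 2\<close> or above with probability of
  order \<open>1 / sqrt N\<close> at least, while by Chebyshev it deviates from its mean with probability
  \<open>O(N\<^sup>-\<^sup>3\<^sup>/\<^sup>4)\<close>.  For large \<open>N\<close> both events cannot exclude each other, so the mean is at least
  \<open>t\<^sup>2 / 2\<close> up to a small error, and a second use of Chebyshev gives the tail.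
\<close>

lemma free_energy_lower_tail:
  assumes t: "0 < t" "t < beta_crit" and eta: "0 < \<eta>" "\<eta> \<le> 1"
  shows "(\<lambda>N. measure (coupling_law N) {x \<in> space (coupling_law N). free0 (couplings x) N t < t\<^sup>2 / 2 - \<eta>}) \<longlonglongrightarrow> 0"
proof -
  obtain A :: real where A: "A \<ge> 0" "\<And>N t. N \<ge> 1 \<Longrightarrow> \<bar>t\<bar> \<le> 1 \<Longrightarrow>
    (\<integral>x. (clip (free0 (couplings x) N t))\<^sup>2 \<partial>coupling_law N) - (\<integral>x. clip (free0 (couplings x) N t) \<partial>coupling_law N)\<^sup>2 \<le> A * real N powr (- 3 / 4)"
    using free_energy_variance by blast
  obtain c :: real where c: "c > 0" "\<And>N. N \<ge> 1 \<Longrightarrow>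
    c / sqrt (real N) \<le> measure (coupling_law N) {x \<in> space (coupling_law N). free0 (couplings x) N t > t\<^sup>2 / 2 - 1 / real N}"
    using free_energy_large_probability[OF t] by blast
  define V where "V N = A * real N powr (- 3 / 4) / (\<eta> / 3)\<^sup>2" for N
  have V0: "V \<longlonglongrightarrow> 0" unfolding V_def[abs_def] using eta by real_asymp
  have "(\<lambda>N. V N * sqrt (real N)) \<longlonglongrightarrow> 0" unfolding V_def[abs_def] using eta by real_asymp
  then have ev1: "\<forall>\<^sub>F N in sequentially. V N * sqrt (real N) < c" by (rule order_tendstoD) (rule c)
  have ev2: "\<forall>\<^sub>F N in sequentially. 1 / real N < \<eta> / 3" using order_tendstoD(2)[OF lim_1_over_n[where 'a=real], of "\<eta> / 3"] eta by simp
  have "t\<^sup>2 < beta_crit\<^sup>2" using t by (intro power_strict_mono) auto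
  then have t2: "t\<^sup>2 < 1 / 2" using beta_crit(3) by (simp add: power2_eq_square)
  have t2p: "0 < t\<^sup>2" using t by simp
  have t1: "\<bar>t\<bar> \<le> 1" using t beta_crit by simp
  show ?thesis
  proof (rule tendsto_sandwich[OF _ _ tendsto_const V0])
    show "\<forall>\<^sub>F N in sequentially. measure (coupling_law N) {x \<in> space (coupling_law N). free0 (couplings x) N t < t\<^sup>2 / 2 - \<eta>} \<le> V N"
      using ev1 ev2 eventually_ge_at_top[of 1]
    proof eventually_elim
      case (elim N)
      note N = elim(3)
      have N0: "real N > 0" using N by simp
      interpret G: prob_space "coupling_law N" by (rule prob_space_coupling_law)
      let ?f = "\<lambda>x. clip (free0 (couplings x) N t)"
      have fem [measurable]: "(\<lambda>x. free0 (couplings x) N t) \<in> borel_measurable (coupling_law N)" using N by measurable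
      have fm [measurable]: "?f \<in> borel_measurable (coupling_law N)" unfolding clip_def by measurable
      have fB: "\<bar>?f x\<bar> \<le> 1" for x by (auto simp: clip_def)
      have i1: "integrable (coupling_law N) ?f" by (rule G.bounded_integrable[OF fm fB])
      have i2: "integrable (coupling_law N) (\<lambda>x. (?f x)\<^sup>2)"
      proof (rule G.bounded_integrable)
        show "\<bar>(?f x)\<^sup>2\<bar> \<le> 1" for x using power_mono[OF fB[of x], of 2] by simp
      qed measurable
      let ?m = "G.expectation ?f"
      have "G.prob {x \<in> space (coupling_law N). \<eta> / 3 \<le> \<bar>?f x - ?m\<bar>} \<le> G.variance ?f / (\<eta> / 3)\<^sup>2"
        using eta by (intro G.Chebyshev_inequality fm i2) auto
      also have "\<dots> \<le> V N" unfolding V_def using A(2)[OF N t1] eta G.variance_eq[OF i1 i2] by (intro divide_right_mono) auto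
      finally have cheb: "G.prob {x \<in> space (coupling_law N). \<eta> / 3 \<le> \<bar>?f x - ?m\<bar>} \<le> V N" .
      have "V N < c / sqrt (real N)" using elim(1) N0 by (simp add: pos_less_divide_eq)
      then have less: "G.prob {x \<in> space (coupling_law N). \<eta> / 3 \<le> \<bar>?f x - ?m\<bar>} < G.prob {x \<in> space (coupling_law N). free0 (couplings x) N t > t\<^sup>2 / 2 - 1 / real N}"
        using cheb c(2)[OF N] by linarith
      have "\<not> {x \<in> space (coupling_law N). free0 (couplings x) N t > t\<^sup>2 / 2 - 1 / real N} \<subseteq> {x \<in> space (coupling_law N). \<eta> / 3 \<le> \<bar>?f x - ?m\<bar>}"
      proof
        assume sub: "{x \<in> space (coupling_law N). free0 (couplings x) N t > t\<^sup>2 / 2 - 1 / real N} \<subseteq> {x \<in> space (coupling_law N). \<eta> / 3 \<le> \<bar>?f x - ?m\<bar>}"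
        have "G.prob {x \<in> space (coupling_law N). free0 (couplings x) N t > t\<^sup>2 / 2 - 1 / real N} \<le> G.prob {x \<in> space (coupling_law N). \<eta> / 3 \<le> \<bar>?f x - ?m\<bar>}"
          by (rule G.finite_measure_mono[OF sub]) measurable
        then show False using less by linarith
      qed
      then obtain x where x: "free0 (couplings x) N t > t\<^sup>2 / 2 - 1 / real N" "\<bar>?f x - ?m\<bar> < \<eta> / 3" unfolding subset_eq by (auto simp: not_le)
      have "0 \<le> 1 / real N" by simp
      then have "t\<^sup>2 / 2 - 1 / real N \<le> 1" using t2 by linarith
      then have "?f x \<ge> t\<^sup>2 / 2 - 1 / real N" using x(1) by (auto simp: clip_def max_def min_def)
      then have mlow: "?m > t\<^sup>2 / 2 - 1 / real N - \<eta> / 3" using x(2) by linarith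
      have "G.prob {x \<in> space (coupling_law N). free0 (couplings x) N t < t\<^sup>2 / 2 - \<eta>} \<le> G.prob {x \<in> space (coupling_law N). \<eta> / 3 \<le> \<bar>?f x - ?m\<bar>}"
      proof (rule G.finite_measure_mono)
        show "{x \<in> space (coupling_law N). free0 (couplings x) N t < t\<^sup>2 / 2 - \<eta>} \<subseteq> {x \<in> space (coupling_law N). \<eta> / 3 \<le> \<bar>?f x - ?m\<bar>}"
        proof safe
          fix x assume x: "free0 (couplings x) N t < t\<^sup>2 / 2 - \<eta>"
          have "- 1 \<le> t\<^sup>2 / 2 - \<eta>" using eta t2p by linarith
          then have "?f x \<le> t\<^sup>2 / 2 - \<eta>" using x by (auto simp: clip_def max_def min_def)
          then show "\<eta> / 3 \<le> \<bar>?f x - ?m\<bar>" using mlow elim(2) by linarith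
        qed
      qed measurable
      then show ?case using cheb by linarith
    qed
  qed (auto intro!: always_eventually)
qed

section \<open>Convergence in probability\<close>

lemma free_energy_deviation:
  assumes t: "0 < t" "t < beta_crit" and eta: "0 < \<eta>" "\<eta> \<le> 1"
  shows "(\<lambda>N. measure (coupling_law N) {x \<in> space (coupling_law N). \<bar>free0 (couplings x) N t - t\<^sup>2 / 2\<bar> > \<eta>}) \<longlonglongrightarrow> 0"
proof -
  let ?u = "\<lambda>N. exp (- (real N * \<eta>)) + measure (coupling_law N) {x \<in> space (coupling_law N). free0 (couplings x) N t < t\<^sup>2 / 2 - \<eta>}"
  have "(\<lambda>N. exp (- (real N * \<eta>))) \<longlonglongrightarrow> 0" using eta by real_asymp
  then have u0: "?u \<longlonglongrightarrow> 0 + 0" by (intro tendsto_add free_energy_lower_tail[OF t eta])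
  show ?thesis
  proof (rule tendsto_sandwich[OF _ _ tendsto_const u0[simplified]])
    show "\<forall>\<^sub>F N in sequentially. measure (coupling_law N) {x \<in> space (coupling_law N). \<bar>free0 (couplings x) N t - t\<^sup>2 / 2\<bar> > \<eta>} \<le> ?u N"
      using eventually_ge_at_top[of 1]
    proof eventually_elim
      case (elim N)
      interpret G: prob_space "coupling_law N" by (rule prob_space_coupling_law)
      have [measurable]: "(\<lambda>x. free0 (couplings x) N t) \<in> borel_measurable (coupling_law N)" using elim by measurable
      have "G.prob {x \<in> space (coupling_law N). \<bar>free0 (couplings x) N t - t\<^sup>2 / 2\<bar> > \<eta>}
        \<le> G.prob ({x \<in> space (coupling_law N). free0 (couplings x) N t > t\<^sup>2 / 2 + \<eta>} \<union> {x \<in> space (coupling_law N). free0 (couplings x) N t < t\<^sup>2 / 2 - \<eta>})"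
        by (rule G.finite_measure_mono) (auto simp: abs_if split: if_splits)
      also have "\<dots> \<le> G.prob {x \<in> space (coupling_law N). free0 (couplings x) N t > t\<^sup>2 / 2 + \<eta>} + G.prob {x \<in> space (coupling_law N). free0 (couplings x) N t < t\<^sup>2 / 2 - \<eta>}"
        by (rule measure_Un_le) measurable
      also have "\<dots> \<le> ?u N" using free_energy_upper_tail[OF elim, of t \<eta>] by simp
      finally show ?case .
    qed
    show "\<forall>\<^sub>F N in sequentially. 0 \<le> measure (coupling_law N) {x \<in> space (coupling_law N). \<bar>free0 (couplings x) N t - t\<^sup>2 / 2\<bar> > \<eta>}"
      by (intro always_eventually allI measure_nonneg)
  qed
qed

text \<open>
  The free energy is Lipschitz in the temperature because the energy is bounded, so finitely many
  temperatures control all of them.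
\<close>

lemma typical_of_grid:
  assumes N: "N \<ge> 1" and n: "n \<ge> 1" "22 / \<eta> \<le> real n" and eta: "\<eta> > 0"
    and b: "free0 g N 1 \<le> 1" "free0 g N (-1) \<le> 1"
    and grid: "\<And>k. k \<in> {1..<n} \<Longrightarrow> \<bar>free0 g N (beta_crit * real k / real n) - (beta_crit * real k / real n)\<^sup>2 / 2\<bar> \<le> \<eta> / 2"
  shows "typical g N 10 \<eta>"
proof -
  have qb: "quad_bounded N (scaled g N) 10" by (rule quad_bounded_of_free_energy[OF N b])
  have n0: "real n > 0" using n by simp
  show ?thesis unfolding typical_def
  proof (intro conjI allI impI qb)
    \<comment> \<open>The grid point to the left of \<open>t\<close>; for \<open>k = 0\<close> it is 0, where the free energy vanishes.\<close>
    fix t assume t: "0 < t \<and> t \<le> beta_crit"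
    define k where "k = nat (\<lceil>t * real n / beta_crit\<rceil> - 1)"
    define s where "s = beta_crit * real k / real n"
    have "0 < t * real n / beta_crit" using t n0 beta_crit by simp
    then have c1: "1 \<le> \<lceil>t * real n / beta_crit\<rceil>" by (simp add: one_le_ceiling)
    have "t * real n / beta_crit \<le> real n" using t beta_crit n0 by (simp add: divide_le_eq mult.commute)
    then have "\<lceil>t * real n / beta_crit\<rceil> \<le> int n" by (simp add: ceiling_le_iff)
    then have kn: "k < n" using c1 n unfolding k_def by linarith
    have rk: "real k = of_int \<lceil>t * real n / beta_crit\<rceil> - 1" using c1 by (simp add: k_def)
    have "real k < t * real n / beta_crit" "t * real n / beta_crit \<le> real k + 1" unfolding rk by linarith+
    then have "s < t" "t \<le> s + beta_crit / real n" using beta_crit n0 by (auto simp: s_def field_simps)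
    moreover have "beta_crit / real n \<le> 1 / real n" using beta_crit n0 by (intro divide_right_mono) auto
    ultimately have st: "s < t" "t - s \<le> 1 / real n" by linarith+
    have s0: "0 \<le> s" using beta_crit by (simp add: s_def)
    have "1 / real n \<le> \<eta> / 22"
    proof -
      have "22 \<le> real n * \<eta>" using n eta by (simp add: divide_le_eq)
      then show ?thesis using n0 by (simp add: field_simps)
    qed
    then have d: "t - s \<le> \<eta> / 22" using st by linarith
    have gs: "\<bar>free0 g N s - s\<^sup>2 / 2\<bar> \<le> \<eta> / 2"
    proof (cases "k = 0")
      case True
      then show ?thesis using eta by (simp add: s_def free_energy_0)
    next
      case False
      then show ?thesis using grid[of k] kn by (simp add: s_def)
    qed
    have "free0 g N t \<le> free0 g N s + 10 * \<bar>t - s\<bar>" "free0 g N s \<le> free0 g N t + 10 * \<bar>s - t\<bar>"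
      by (rule free_energy_lipschitz[OF N quad_boundedD[OF qb]])+
    then have l: "\<bar>free0 g N t - free0 g N s\<bar> \<le> 10 * (t - s)" using st by (simp add: abs_le_iff)
    have "t\<^sup>2 / 2 - s\<^sup>2 / 2 = (t - s) * ((t + s) / 2)" by (simp add: power2_eq_square field_simps)
    moreover have "(t - s) * ((t + s) / 2) \<le> (t - s) * 1" using st t beta_crit by (intro mult_left_mono) auto
    moreover have "0 \<le> (t - s) * ((t + s) / 2)" using st s0 t by (intro mult_nonneg_nonneg) auto
    ultimately have "\<bar>t\<^sup>2 / 2 - s\<^sup>2 / 2\<bar> \<le> t - s" by simp
    moreover have "\<bar>f - T\<bar> \<le> \<eta>" if "\<bar>T - S\<bar> \<le> d" "\<bar>f - f'\<bar> \<le> 10 * d" "\<bar>f' - S\<bar> \<le> \<eta> / 2" "d \<le> \<eta> / 22" for f f' T S d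
      using that by linarith
    ultimately show "\<bar>free0 g N t - t\<^sup>2 / 2\<bar> \<le> \<eta>" using l gs d by blast
  qed
qed

lemma tap_energy_continuous_on: "continuous_on (plefka_region N \<beta>) (tap_energy g N \<beta> h)"
proof -
  have "1 - (\<Sum>i\<in>{1..N}. m i * m i) > 0" if "m \<in> plefka_region N \<beta>" for m
  proof -
    have "rnorm N m < 1" using that by (simp add: plefka_region_def)
    then have "(rnorm N m)\<^sup>2 < 1" by (simp add: abs_square_less_1)
    then show ?thesis by (simp add: rdot_self[symmetric] rdot_def)
  qed
  then have ne: "\<forall>m\<in>plefka_region N \<beta>. 1 - (\<Sum>i\<in>{1..N}. m i * m i) \<noteq> 0" by fastforce
  show ?thesis
    unfolding tap_energy_def[abs_def] hamiltonian_def rdot_self[symmetric] rdot_def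
    using ne by (intro continuous_intros continuous_on_product_then_coordinatewise[OF continuous_on_id, unfolded id_def]) auto
qed

text \<open>
  This gives measurability of the TAP supremum, as a supremum over countably many points.
\<close>

lemma SUP_dense_subset:
  fixes f :: "'a::metric_space \<Rightarrow> real"
  assumes D: "D \<subseteq> S" "S \<subseteq> closure D" and f: "continuous_on S f" and bdd: "bdd_above (f ` S)" and ne: "S \<noteq> {}"
  shows "(SUP x\<in>S. f x) = (SUP x\<in>D. f x)"
proof (rule antisym)
  have neD: "D \<noteq> {}" using D ne by auto
  have bddD: "bdd_above (f ` D)" using bdd D(1) by (meson bdd_above_mono image_mono)
  show "(SUP x\<in>D. f x) \<le> (SUP x\<in>S. f x)" by (rule cSUP_subset_mono[OF neD bdd D(1)]) simp
  show "(SUP x\<in>S. f x) \<le> (SUP x\<in>D. f x)"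
  proof (rule cSUP_least[OF ne])
    fix x assume x: "x \<in> S"
    then obtain u where u: "\<And>n. u n \<in> D" "u \<longlonglongrightarrow> x" using D(2) by (meson closure_sequential subsetD)
    have "(\<lambda>n. f (u n)) \<longlonglongrightarrow> f x"
      using f u x D(1) unfolding continuous_on_sequentially by (auto simp: comp_def)
    then show "f x \<le> (SUP x\<in>D. f x)"
      by (rule LIMSEQ_le_const2) (use cSUP_upper[OF u(1) bddD] in blast)
  qed
qed

lemma hamiltonian_cong:
  "(\<And>i j. i \<in> {1..N} \<Longrightarrow> j \<in> {1..N} \<Longrightarrow> g i j = g' i j) \<Longrightarrow> hamiltonian g N x = hamiltonian g' N x"
  unfolding hamiltonian_def by (intro arg_cong2[where f="(*)"] refl sum.cong) auto

lemma free_energy_cong: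
  assumes "\<And>i j. i \<in> {1..N} \<Longrightarrow> j \<in> {1..N} \<Longrightarrow> g i j = g' i j"
  shows "free_energy g N \<beta> h = free_energy g' N \<beta> h"
proof -
  have "hamiltonian g N = hamiltonian g' N" by (rule ext) (rule hamiltonian_cong[OF assms])
  then show ?thesis unfolding free_energy_def partition_function_def by simp
qed

lemma typical_cong:
  assumes eq: "\<And>i j. i \<in> {1..N} \<Longrightarrow> j \<in> {1..N} \<Longrightarrow> g i j = g' i j" and g: "typical g N K \<eta>"
  shows "typical g' N K \<eta>"
proof -
  have "quad N (scaled g N) x = quad N (scaled g' N) x" for x unfolding quad_def scaled_def by (intro sum.cong refl) (simp add: eq)
  moreover have "free0 g N t = free0 g' N t" for t by (rule free_energy_cong) (rule eq)
  ultimately show ?thesis using g by (simp add: typical_def quad_bounded_def)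
qed

lemma couplings_distr:
  assumes M: "prob_space M" and N: "N \<ge> 1"
    and J: "\<And>i j. i \<ge> 1 \<Longrightarrow> j \<ge> 1 \<Longrightarrow> distributed M lborel (J i j) std_normal_density"
    and ind: "prob_space.indep_vars M (\<lambda>_. borel) (\<lambda>(i, j). J i j) ({1..} \<times> {1..})"
  shows "(\<lambda>\<omega>. \<lambda>p\<in>index_pairs N. J (fst p) (snd p) \<omega>) \<in> M \<rightarrow>\<^sub>M coupling_law N"
    and "distr M (coupling_law N) (\<lambda>\<omega>. \<lambda>p\<in>index_pairs N. J (fst p) (snd p) \<omega>) = coupling_law N"
proof -
  interpret prob_space M by (rule M)
  let ?X = "\<lambda>p. J (fst p) (snd p)"
  have rv: "?X p \<in> borel_measurable M" if "p \<in> index_pairs N" for p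
    using distributed_measurable[OF J, of "fst p" "snd p"] that by (auto simp: measurable_lborel1)
  have "indep_vars (\<lambda>_. borel) ?X (index_pairs N)"
  proof (rule indep_vars_subset)
    show "indep_vars (\<lambda>_. borel) ?X ({1..} \<times> {1..})" using ind by (simp add: case_prod_beta')
  qed auto
  then have d: "distr M (\<Pi>\<^sub>M p\<in>index_pairs N. borel) (\<lambda>\<omega>. \<lambda>p\<in>index_pairs N. ?X p \<omega>) = (\<Pi>\<^sub>M p\<in>index_pairs N. distr M borel (?X p))"
    using N rv by (subst (asm) indep_vars_iff_distr_eq_PiM') auto
  have marg: "distr M borel (?X p) = std_gauss" if "p \<in> index_pairs N" for p
  proof -
    have "distr M lborel (?X p) = density lborel (\<lambda>x. ennreal (std_normal_density x))"
      using distributed_distr_eq_density[OF J, of "fst p" "snd p"] that by auto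
    moreover have "distr M borel (?X p) = distr M lborel (?X p)" by (rule distr_cong) simp_all
    ultimately show ?thesis unfolding std_gauss_def by (rule trans[rotated])
  qed
  have e: "(\<Pi>\<^sub>M p\<in>index_pairs N. distr M borel (?X p)) = coupling_law N" unfolding coupling_law_def by (rule PiM_cong) (auto simp: marg)
  have s: "sets (coupling_law N) = sets (\<Pi>\<^sub>M p\<in>index_pairs N. borel)" unfolding coupling_law_def by (rule sets_PiM_cong) simp_all
  have m: "(\<lambda>\<omega>. \<lambda>p\<in>index_pairs N. ?X p \<omega>) \<in> M \<rightarrow>\<^sub>M (\<Pi>\<^sub>M p\<in>index_pairs N. borel)" by (rule measurable_restrict) (rule rv)
  show "(\<lambda>\<omega>. \<lambda>p\<in>index_pairs N. ?X p \<omega>) \<in> M \<rightarrow>\<^sub>M coupling_law N" using m by (subst measurable_cong_sets[OF refl s])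
  show "distr M (coupling_law N) (\<lambda>\<omega>. \<lambda>p\<in>index_pairs N. ?X p \<omega>) = coupling_law N"
    using distr_cong[OF refl s refl, of M "\<lambda>\<omega>. \<lambda>p\<in>index_pairs N. ?X p \<omega>"] unfolding d e .
qed

lemma tap_energy_measurable: "(\<lambda>x. tap_energy (couplings x) N \<beta> h m) \<in> borel_measurable (coupling_law N)"
  unfolding tap_energy_def hamiltonian_def couplings_def by measurable

theorem theorem1:
  fixes M :: "'a measure"
    and J :: "nat \<Rightarrow> nat \<Rightarrow> 'a \<Rightarrow> real"
    and \<beta> h :: real
    and hv :: "nat \<Rightarrow> nat \<Rightarrow> real"
  assumes "prob_space M"
    and "\<And>i j. i \<ge> 1 \<Longrightarrow> j \<ge> 1 \<Longrightarrow> distributed M lborel (J i j) std_normal_density"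
    and "prob_space.indep_vars M (\<lambda>_. borel) (\<lambda>(i, j). J i j) ({1..} \<times> {1..})"
    and "\<beta> > 0" and "h \<ge> 0"
    and "\<And>N. N \<ge> 1 \<Longrightarrow> hv N \<in> rvec N"
    and "\<And>N. N \<ge> 1 \<Longrightarrow> rnorm N (hv N) = h"
  shows "converges_in_probability M
           (\<lambda>N \<omega>. \<bar>free_energy (\<lambda>i j. J i j \<omega>) N \<beta> (hv N)
                  - 1 / real N * (SUP m\<in>plefka_region N \<beta>. tap_energy (\<lambda>i j. J i j \<omega>) N \<beta> (hv N) m)\<bar>)
           (\<lambda>_. 0)"
proof -
  interpret prob_space M by fact
  define \<Phi> where "\<Phi> N \<omega> = (\<lambda>p\<in>index_pairs N. J (fst p) (snd p) \<omega>)" for N \<omega>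
  have \<Phi>m: "\<Phi> N \<in> M \<rightarrow>\<^sub>M coupling_law N" if "N \<ge> 1" for N
    unfolding \<Phi>_def[abs_def] by (rule couplings_distr(1)[OF assms(1) that assms(2,3)])
  have \<Phi>d: "distr M (coupling_law N) (\<Phi> N) = coupling_law N" if "N \<ge> 1" for N
    unfolding \<Phi>_def[abs_def] by (rule couplings_distr(2)[OF assms(1) that assms(2,3)])
  have F\<Phi>: "free_energy (\<lambda>i j. J i j \<omega>) N t k = free_energy (couplings (\<Phi> N \<omega>)) N t k" for N \<omega> t k
    by (rule free_energy_cong) (simp add: couplings_def \<Phi>_def)
  have T\<Phi>: "tap_energy (\<lambda>i j. J i j \<omega>) N \<beta> k m = tap_energy (couplings (\<Phi> N \<omega>)) N \<beta> k m" for N \<omega> k m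
  proof -
    have "hamiltonian (\<lambda>i j. J i j \<omega>) N m = hamiltonian (couplings (\<Phi> N \<omega>)) N m"
      by (rule hamiltonian_cong) (simp add: couplings_def \<Phi>_def)
    then show ?thesis unfolding tap_energy_def by simp
  qed
  let ?X = "\<lambda>N \<omega>. \<bar>free_energy (\<lambda>i j. J i j \<omega>) N \<beta> (hv N) - 1 / real N * (SUP m\<in>plefka_region N \<beta>. tap_energy (\<lambda>i j. J i j \<omega>) N \<beta> (hv N) m)\<bar>"
  have fem: "(\<lambda>\<omega>. free_energy (\<lambda>i j. J i j \<omega>) N t k) \<in> borel_measurable M" if N: "N \<ge> 1" for N t k
    unfolding F\<Phi> by (rule measurable_compose[OF \<Phi>m[OF N] free_energy_measurable[OF N]])
  have Xm: "?X N \<in> borel_measurable M" for N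
  proof (cases "N \<ge> 1")
    case False
    \<comment> \<open>Here \<open>1 / real N = 0\<close>, so the random variable is constant.\<close>
    then have "N = 0" by simp
    then show ?thesis by (simp add: free_energy_def)
  next
    case True
    note N = True
    obtain D where D: "countable D" "D \<subseteq> plefka_region N \<beta>" "plefka_region N \<beta> \<subseteq> closure D"
      by (rule separable)
    have sup: "(SUP m\<in>plefka_region N \<beta>. tap_energy g N \<beta> (hv N) m) = (SUP m\<in>D. tap_energy g N \<beta> (hv N) m)" for g
      by (rule SUP_dense_subset[OF D(2,3) tap_energy_continuous_on tap_energy_bdd_above plefka_region_nonempty[OF N assms(4)]])
    have "(\<lambda>\<omega>. SUP m\<in>D. tap_energy (\<lambda>i j. J i j \<omega>) N \<beta> (hv N) m) \<in> borel_measurable M"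
    proof (rule borel_measurable_cSUP[OF D(1)])
      show "(\<lambda>\<omega>. tap_energy (\<lambda>i j. J i j \<omega>) N \<beta> (hv N) m) \<in> borel_measurable M" for m
        unfolding T\<Phi> by (rule measurable_compose[OF \<Phi>m[OF N] tap_energy_measurable])
      show "bdd_above ((\<lambda>m. tap_energy (\<lambda>i j. J i j \<omega>) N \<beta> (hv N) m) ` D)" for \<omega>
        using tap_energy_bdd_above[of "\<lambda>i j. J i j \<omega>" N \<beta> "hv N"] D(2) by (meson bdd_above_mono image_mono)
    qed
    then show ?thesis unfolding sup using fem[OF N, of \<beta> "hv N"] by measurable
  qed
  have conv: "(\<lambda>N. measure M {\<omega> \<in> space M. \<bar>?X N \<omega> - 0\<bar> > \<epsilon>}) \<longlonglongrightarrow> 0" if e: "\<epsilon> > 0" for \<epsilon>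
  proof -
    obtain \<eta>0 where eta0: "\<eta>0 > 0" and det0: "\<forall>\<^sub>F N in sequentially. \<forall>g k. typical g N 10 \<eta>0 \<longrightarrow> rnorm N k = h \<longrightarrow>
       \<bar>free_energy g N \<beta> k - 1 / real N * (SUP m\<in>plefka_region N \<beta>. tap_energy g N \<beta> k m)\<bar> \<le> \<epsilon>"
      using free_energy_tap_typical[OF assms(4,5) _ e, of 10] by auto
    define \<eta> where "\<eta> = min 1 \<eta>0"
    have eta: "0 < \<eta>" "\<eta> \<le> 1" "\<eta> \<le> \<eta>0" using eta0 by (auto simp: \<eta>_def)
    obtain n :: nat where n': "22 / \<eta> < real n" using reals_Archimedean2 by blast
    have "0 < 22 / \<eta>" using eta by simp
    then have "0 < real n" using n' by linarith
    then have n: "n \<ge> 1" "22 / \<eta> \<le> real n" using n' by auto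
    let ?t = "\<lambda>k. beta_crit * real k / real n"
    let ?Bk = "\<lambda>N k. {x \<in> space (coupling_law N). \<bar>free0 (couplings x) N (?t k) - (?t k)\<^sup>2 / 2\<bar> > \<eta> / 2}"
    let ?P = "\<lambda>N t. {x \<in> space (coupling_law N). free0 (couplings x) N t > t\<^sup>2 / 2 + 1 / 2}"
    define u where "u N = exp (- (real N * (1 / 2))) + exp (- (real N * (1 / 2))) + (\<Sum>k\<in>{1..<n}. measure (coupling_law N) (?Bk N k))" for N
    have "(\<lambda>N. exp (- (real N * (1 / 2)))) \<longlonglongrightarrow> 0" by real_asymp
    moreover have "(\<lambda>N. measure (coupling_law N) (?Bk N k)) \<longlonglongrightarrow> 0" if k: "k \<in> {1..<n}" for k
    proof (rule free_energy_deviation)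
      show "0 < ?t k" using k beta_crit by simp
      show "?t k < beta_crit" using k beta_crit by (simp add: divide_less_eq)
    qed (use eta in auto)
    ultimately have "u \<longlonglongrightarrow> 0 + 0 + (\<Sum>k\<in>{1..<n}. 0)" unfolding u_def[abs_def] by (intro tendsto_add tendsto_sum)
    then have u0: "u \<longlonglongrightarrow> 0" by simp
    show ?thesis
    proof (rule tendsto_sandwich[OF _ _ tendsto_const u0])
      show "\<forall>\<^sub>F N in sequentially. measure M {\<omega> \<in> space M. \<bar>?X N \<omega> - 0\<bar> > \<epsilon>} \<le> u N"
        using det0 eventually_ge_at_top[of 1]
      proof eventually_elim
        case (elim N)
        note N = elim(2)
        interpret G: prob_space "coupling_law N" by (rule prob_space_coupling_law)
        have fm [measurable]: "(\<lambda>x. free0 (couplings x) N t) \<in> borel_measurable (coupling_law N)" for t using N by measurable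
        define Bad where "Bad = ?P N 1 \<union> ?P N (-1) \<union> (\<Union>k\<in>{1..<n}. ?Bk N k)"
        have BadS [measurable]: "Bad \<in> sets (coupling_law N)" unfolding Bad_def by measurable
        have "measure M {\<omega> \<in> space M. \<bar>?X N \<omega> - 0\<bar> > \<epsilon>} \<le> measure M (\<Phi> N -` Bad \<inter> space M)"
        proof (rule finite_measure_mono)
          show "\<Phi> N -` Bad \<inter> space M \<in> sets M" by (rule measurable_sets[OF \<Phi>m[OF N] BadS])
          show "{\<omega> \<in> space M. \<bar>?X N \<omega> - 0\<bar> > \<epsilon>} \<subseteq> \<Phi> N -` Bad \<inter> space M"
          proof (rule subsetI, rule ccontr)
            fix \<omega> assume "\<omega> \<in> {\<omega> \<in> space M. \<bar>?X N \<omega> - 0\<bar> > \<epsilon>}" and "\<omega> \<notin> \<Phi> N -` Bad \<inter> space M"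
            then have w: "\<omega> \<in> space M" and big: "\<epsilon> < \<bar>?X N \<omega> - 0\<bar>" and nb: "\<Phi> N \<omega> \<notin> Bad" by auto
            let ?x = "\<Phi> N \<omega>"
            have xs: "?x \<in> space (coupling_law N)" using measurable_space[OF \<Phi>m[OF N] w] .
            have "typical (couplings ?x) N 10 \<eta>"
            proof (rule typical_of_grid[OF N n eta(1)])
              show "free0 (couplings ?x) N 1 \<le> 1" "free0 (couplings ?x) N (-1) \<le> 1" using nb xs by (auto simp: Bad_def)
              show "\<bar>free0 (couplings ?x) N (?t k) - (?t k)\<^sup>2 / 2\<bar> \<le> \<eta> / 2" if "k \<in> {1..<n}" for k
                using nb xs that by (force simp: Bad_def not_less)
            qed
            then have "typical (\<lambda>i j. J i j \<omega>) N 10 \<eta>"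
              by (rule typical_cong[rotated]) (simp add: couplings_def \<Phi>_def)
            then have "typical (\<lambda>i j. J i j \<omega>) N 10 \<eta>0" using eta(3) by (rule typical_mono)
            then have "?X N \<omega> \<le> \<epsilon>" using elim(1) assms(7)[OF N] by blast
            then show False using big by simp
          qed
        qed
        also have "\<dots> = measure (distr M (coupling_law N) (\<Phi> N)) Bad" by (rule measure_distr[symmetric, OF \<Phi>m[OF N] BadS])
        also have "\<dots> = G.prob Bad" by (simp only: \<Phi>d[OF N])
        also have "\<dots> \<le> G.prob (?P N 1 \<union> ?P N (-1)) + G.prob (\<Union>k\<in>{1..<n}. ?Bk N k)"
          unfolding Bad_def by (rule measure_Un_le) measurable
        also have "\<dots> \<le> (G.prob (?P N 1) + G.prob (?P N (-1))) + (\<Sum>k\<in>{1..<n}. G.prob (?Bk N k))"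
          by (intro add_mono measure_Un_le measure_UNION_le) auto
        also have "\<dots> \<le> u N" unfolding u_def by (intro add_mono free_energy_upper_tail[OF N] order_refl)
        finally show ?case .
      qed
      show "\<forall>\<^sub>F N in sequentially. 0 \<le> measure M {\<omega> \<in> space M. \<bar>?X N \<omega> - 0\<bar> > \<epsilon>}"
        by (intro always_eventually allI measure_nonneg)
    qed
  qed
  show ?thesis
    unfolding converges_in_probability_def using Xm conv by auto
qed

end
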